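(* Let $(X_0,X_1)$ be a regular compatible couple of complex Banach spaces on the unit strip $\mathbb S$, with sum $\Sigma$ and intersection $\Delta$, and let $0<a<b<1$. For every $n\ge1$ the Rochberg spaces $X^{(n)}_a$ and $X^{(n)}_b$ form a compatible couple on the strip $\mathbb S_{a,b}$, as subspaces of $\Sigma^n$, and for every $a<c<b$ the formal inclusion $X^{(n)}_c\to[X^{(n)}_a,X^{(n)}_b]_c$ is an isomorphic embedding. If, in addition, $\Delta^n$ is dense in $X^{(n)}_a\cap X^{(n)}_b$, which is always the case when $X_1$ contains $X_0$, then $[X^{(n)}_a,X^{(n)}_b]_c=X^{(n)}_c$, with equivalent norms.
   Context: For real $a<b$, $\mathbb S_{a,b}=\{z\in\mathbb C:a<\Re z<b\}$ and $\mathbb S=\mathbb S_{0,1}$. A compatible couple $(X_a,X_b)$ consists of two Banach spaces continuously and linearly embedded in a third Banach space. For a couple placed on $\mathbb S_{a,b}$ with ambient space $\Sigma$, the Calderón space $\mathscr C(X_a,X_b)$ is the space of bounded analytic functions $f:\mathbb S_{a,b}\to\Sigma$ that extend continuously to the closure of $\mathbb S_{a,b}$ and such that for $j=a,b$ the map $t\in\mathbb R\mapsto f(j+it)\in X_j$ is continuous and bounded, with norm $\|f\|=\sup\{\|f(j+it)\|_{X_j}:t\in\mathbb R,\ j=a,b\}$. For $c\in\mathbb S_{a,b}$, $[X_a,X_b]_c=\{f(c):f\in\mathscr C(X_a,X_b)\}$ with the quotient norm. A couple $(X_0,X_1)$ with sum $\Sigma=X_0+X_1$ is regular if $\Delta=X_0\cap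 X_1$ (normed by $\max(\|\cdot\|_0,\|\cdot\|_1)$) is dense in both $X_0$ and $X_1$. For $z\in\mathbb S$ and $n\ge1$ the Rochberg space is $$X^{(n)}_z=\left\{\left(\tfrac{f^{(n-1)}(z)}{(n-1)!},\dots,f'(z),f(z)\right): f\in\mathscr C(X_0,X_1)\right\}\subset\Sigma^n$$ with the quotient norm (infimum of $\|f\|$ over all $f\in\mathscr C(X_0,X_1)$ producing the given array). *)

theory Defs
  imports "HOL-Analysis.Analysis" "HOL-Library.Function_Algebras"
begin

text \<open>
  All spaces below are linear subspaces of some ambient complex vector space, each carrying its own
  norm. The class only supplies the linear structure; no topology is attached to the type.
\<close>

class complex_vector = ab_group_add +
  fixes scaleC :: "complex \<Rightarrow> 'a \<Rightarrow> 'a"  (infixr "*\<^sub>C" 75)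
  assumes scaleC_add_right: "c *\<^sub>C (x + y) = c *\<^sub>C x + c *\<^sub>C y"
    and scaleC_add_left: "(c + d) *\<^sub>C x = c *\<^sub>C x + d *\<^sub>C x"
    and scaleC_scaleC: "c *\<^sub>C d *\<^sub>C x = (c * d) *\<^sub>C x"
    and scaleC_one: "1 *\<^sub>C x = x"

lemma vector_space_scaleC: "vector_space (scaleC :: complex \<Rightarrow> 'a::complex_vector \<Rightarrow> 'a)"
  by unfold_locales (simp_all add: scaleC_add_right scaleC_add_left scaleC_scaleC scaleC_one)

instantiation "fun" :: (type, complex_vector) complex_vector
begin

definition scaleC_fun :: "complex \<Rightarrow> ('a \<Rightarrow> 'b) \<Rightarrow> 'a \<Rightarrow> 'b"
  where "scaleC_fun c f = (\<lambda>i. c *\<^sub>C f i)"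

instance
  by standard
    (simp_all add: scaleC_fun_def plus_fun_def fun_eq_iff scaleC_add_right scaleC_add_left
      scaleC_scaleC scaleC_one)

end

record 'v nspace =
  pts :: "'v set"
  nrm :: "'v \<Rightarrow> real"

definition normed_space :: "'v::complex_vector nspace \<Rightarrow> bool"
  where "normed_space X \<longleftrightarrow>
    module.subspace scaleC (pts X) \<and>
    (\<forall>x\<in>pts X. 0 \<le> nrm X x) \<and>
    (\<forall>x\<in>pts X. nrm X x = 0 \<longleftrightarrow> x = 0) \<and>
    (\<forall>c. \<forall>x\<in>pts X. nrm X (c *\<^sub>C x) = cmod c * nrm X x) \<and>
    (\<forall>x\<in>pts X. \<forall>y\<in>pts X. nrm X (x + y) \<le> nrm X x + nrm X y)"

text \<open>
  The library requires a metric to be symmetric and nonnegative on the whole type, whereas the value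
  of \<^term>\<open>nrm X\<close> off \<^term>\<open>pts X\<close> is irrelevant; hence the distance is set to 0 there.
\<close>

definition nmetric :: "'v::complex_vector nspace \<Rightarrow> 'v metric"
  where "nmetric X = metric (pts X, \<lambda>x y. if x \<in> pts X \<and> y \<in> pts X then nrm X (x - y) else 0)"

abbreviation ntop :: "'v::complex_vector nspace \<Rightarrow> 'v topology"
  where "ntop X \<equiv> mtopology_of (nmetric X)"

lemma Metric_space_nspace:
  fixes X :: "'v::complex_vector nspace"
  assumes "normed_space X"
  shows "Metric_space (pts X) (\<lambda>x y. if x \<in> pts X \<and> y \<in> pts X then nrm X (x - y) else 0)"
proof -
  interpret vector_space "scaleC :: complex \<Rightarrow> 'v \<Rightarrow> 'v"
    by (rule vector_space_scaleC)
  have sub: "subspace (pts X)"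
    and nonneg: "\<And>x. x \<in> pts X \<Longrightarrow> 0 \<le> nrm X x"
    and zero: "\<And>x. x \<in> pts X \<Longrightarrow> nrm X x = 0 \<longleftrightarrow> x = 0"
    and hom: "\<And>c x. x \<in> pts X \<Longrightarrow> nrm X (c *\<^sub>C x) = cmod c * nrm X x"
    and tri: "\<And>x y. x \<in> pts X \<Longrightarrow> y \<in> pts X \<Longrightarrow> nrm X (x + y) \<le> nrm X x + nrm X y"
    using assms by (auto simp: normed_space_def)
  have diff: "x - y \<in> pts X" if "x \<in> pts X" "y \<in> pts X" for x y
    using subspace_diff[OF sub that] .
  show ?thesis
  proof
    show "0 \<le> (if x \<in> pts X \<and> y \<in> pts X then nrm X (x - y) else 0)" for x y
      by (simp add: nonneg diff)
    show "(if x \<in> pts X \<and> y \<in> pts X then nrm X (x - y) else 0) =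
        (if y \<in> pts X \<and> x \<in> pts X then nrm X (y - x) else 0)" for x y
      using hom[of "x - y" "-1"] diff by auto
    show "((if x \<in> pts X \<and> y \<in> pts X then nrm X (x - y) else 0) = 0) = (x = y)"
      if "x \<in> pts X" "y \<in> pts X" for x y
      using that by (simp add: zero diff)
    show "(if x \<in> pts X \<and> z \<in> pts X then nrm X (x - z) else 0) \<le>
        (if x \<in> pts X \<and> y \<in> pts X then nrm X (x - y) else 0) +
        (if y \<in> pts X \<and> z \<in> pts X then nrm X (y - z) else 0)"
      if "x \<in> pts X" "y \<in> pts X" "z \<in> pts X" for x y z
      using that tri[of "x - y" "y - z"] diff by simp
  qed
qed

lemma mspace_nmetric: "normed_space X \<Longrightarrow> mspace (nmetric X) = pts X"
  by (simp add: nmetric_def mspace_def metric_inverse Metric_space_nspace)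

lemma mdist_nmetric:
  "normed_space X \<Longrightarrow> x \<in> pts X \<Longrightarrow> y \<in> pts X \<Longrightarrow> mdist (nmetric X) x y = nrm X (x - y)"
  by (simp add: nmetric_def mdist_def metric_inverse Metric_space_nspace)

definition banach_space :: "'v::complex_vector nspace \<Rightarrow> bool"
  where "banach_space X \<longleftrightarrow> normed_space X \<and> mcomplete_of (nmetric X)"

definition dense_in :: "'v::complex_vector set \<Rightarrow> 'v nspace \<Rightarrow> bool"
  where "dense_in S X \<longleftrightarrow> S \<subseteq> pts X \<and> ntop X closure_of S = pts X"

definition continuously_included :: "'v::complex_vector nspace \<Rightarrow> 'v nspace \<Rightarrow> bool"
  where "continuously_included X Y \<longleftrightarrow> pts X \<subseteq> pts Y \<and> continuous_map (ntop X) (ntop Y) (\<lambda>x. x)"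

definition isomorphically_included :: "'v nspace \<Rightarrow> 'v nspace \<Rightarrow> bool"
  where "isomorphically_included X Y \<longleftrightarrow> pts X \<subseteq> pts Y \<and>
    (\<exists>m>0. \<exists>M>0. \<forall>x\<in>pts X. m * nrm X x \<le> nrm Y x \<and> nrm Y x \<le> M * nrm X x)"

definition equal_with_equivalent_norms :: "'v nspace \<Rightarrow> 'v nspace \<Rightarrow> bool"
  where "equal_with_equivalent_norms X Y \<longleftrightarrow> pts X = pts Y \<and>
    (\<exists>m>0. \<exists>M>0. \<forall>x\<in>pts X. m * nrm X x \<le> nrm Y x \<and> nrm Y x \<le> M * nrm X x)"

definition sum_space :: "'v::complex_vector nspace \<Rightarrow> 'v nspace \<Rightarrow> 'v nspace"
  where "sum_space X Y =
    \<lparr>pts = {x + y | x y. x \<in> pts X \<and> y \<in> pts Y},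
     nrm = (\<lambda>v. Inf {nrm X x + nrm Y y | x y. x \<in> pts X \<and> y \<in> pts Y \<and> v = x + y})\<rparr>"

definition inter_space :: "'v nspace \<Rightarrow> 'v nspace \<Rightarrow> 'v nspace"
  where "inter_space X Y = \<lparr>pts = pts X \<inter> pts Y, nrm = (\<lambda>v. max (nrm X v) (nrm Y v))\<rparr>"

text \<open>
  \<open>X\<^sup>n\<close> with the maximum norm. Arrays are functions on \<^typ>\<open>nat\<close> vanishing from \<open>n\<close> on, so that
  equality of arrays is equality of functions.
\<close>

definition power_space :: "nat \<Rightarrow> 'v::zero nspace \<Rightarrow> (nat \<Rightarrow> 'v) nspace"
  where "power_space n X =
    \<lparr>pts = {x. (\<forall>i<n. x i \<in> pts X) \<and> (\<forall>i\<ge>n. x i = 0)},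
     nrm = (\<lambda>x. Max ((\<lambda>i. nrm X (x i)) ` {..<n}))\<rparr>"

definition quotient_space :: "('u \<Rightarrow> 'v) \<Rightarrow> 'u nspace \<Rightarrow> 'v nspace"
  where "quotient_space T X =
    \<lparr>pts = T ` pts X, nrm = (\<lambda>y. Inf {nrm X x | x. x \<in> pts X \<and> T x = y})\<rparr>"

definition compatible_couple ::
    "'v::complex_vector nspace \<Rightarrow> 'v nspace \<Rightarrow> 'v nspace \<Rightarrow> bool"
  where "compatible_couple W X Y \<longleftrightarrow>
    banach_space W \<and> banach_space X \<and> banach_space Y \<and>
    continuously_included X W \<and> continuously_included Y W"

definition regular_couple :: "'v::complex_vector nspace \<Rightarrow> 'v nspace \<Rightarrow> bool"
  where "regular_couple X Y \<longleftrightarrow>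
    dense_in (pts (inter_space X Y)) X \<and> dense_in (pts (inter_space X Y)) Y"

definition has_cderiv ::
    "'v::complex_vector nspace \<Rightarrow> (complex \<Rightarrow> 'v) \<Rightarrow> 'v \<Rightarrow> complex \<Rightarrow> bool"
  where "has_cderiv W f D z \<longleftrightarrow>
    limitin (ntop W) (\<lambda>w. inverse (w - z) *\<^sub>C (f w - f z)) D (at z)"

definition cderiv :: "'v::complex_vector nspace \<Rightarrow> (complex \<Rightarrow> 'v) \<Rightarrow> complex \<Rightarrow> 'v"
  where "cderiv W f z = (THE D. has_cderiv W f D z)"

text \<open>Complex differentiability at each point amounts to analyticity because \<open>S\<close> is always an open strip.\<close>

definition analytic_into :: "'v::complex_vector nspace \<Rightarrow> (complex \<Rightarrow> 'v) \<Rightarrow> complex set \<Rightarrow> bool"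
  where "analytic_into W f S \<longleftrightarrow> f ` S \<subseteq> pts W \<and> (\<forall>z\<in>S. \<exists>D. has_cderiv W f D z)"

definition bounded_into :: "'v nspace \<Rightarrow> ('t \<Rightarrow> 'v) \<Rightarrow> 't set \<Rightarrow> bool"
  where "bounded_into X f S \<longleftrightarrow> f ` S \<subseteq> pts X \<and> (\<exists>B. \<forall>t\<in>S. nrm X (f t) \<le> B)"

definition strip :: "real \<Rightarrow> real \<Rightarrow> complex set"
  where "strip a b = {z. a < Re z \<and> Re z < b}"

text \<open>
  A function on the open strip is identified with its (unique) continuous extension to the closed
  strip; it is set to 0 elsewhere, so that the functions form a linear subspace of
  \<^typ>\<open>complex \<Rightarrow> 'v\<close>.
\<close>

definition calderon_space ::
    "'v::complex_vector nspace \<Rightarrow> 'v nspace \<Rightarrow> 'v nspace \<Rightarrow> real \<Rightarrow> real \<Rightarrow> (complex \<Rightarrow> 'v) nspace"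
  where "calderon_space W X Y a b =
    \<lparr>pts = {f. analytic_into W f (strip a b) \<and> bounded_into W f (strip a b) \<and>
         continuous_map (top_of_set (closure (strip a b))) (ntop W) f \<and>
         continuous_map euclideanreal (ntop X) (\<lambda>t. f (Complex a t)) \<and>
         bounded_into X (\<lambda>t. f (Complex a t)) UNIV \<and>
         continuous_map euclideanreal (ntop Y) (\<lambda>t. f (Complex b t)) \<and>
         bounded_into Y (\<lambda>t. f (Complex b t)) UNIV \<and>
         (\<forall>z. z \<notin> closure (strip a b) \<longrightarrow> f z = 0)},
     nrm = (\<lambda>f. Sup (range (\<lambda>t. nrm X (f (Complex a t))) \<union> range (\<lambda>t. nrm Y (f (Complex b t)))))\<rparr>"

definition interpolation_space ::
    "'v::complex_vector nspace \<Rightarrow> 'v nspace \<Rightarrow> 'v nspace \<Rightarrow> real \<Rightarrow> real \<Rightarrow> complex \<Rightarrow> 'v nspace"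
  where "interpolation_space W X Y a b c = quotient_space (\<lambda>f. f c) (calderon_space W X Y a b)"

text \<open>Entry \<open>i\<close> of the array (counting from 0) is the Taylor coefficient of order \<open>n - 1 - i\<close>.\<close>

definition taylor_array ::
    "'v::complex_vector nspace \<Rightarrow> nat \<Rightarrow> complex \<Rightarrow> (complex \<Rightarrow> 'v) \<Rightarrow> nat \<Rightarrow> 'v"
  where "taylor_array W n z f =
    (\<lambda>i. if i < n then inverse (fact (n - 1 - i)) *\<^sub>C (cderiv W ^^ (n - 1 - i)) f z else 0)"

definition rochberg_space ::
    "'v::complex_vector nspace \<Rightarrow> 'v nspace \<Rightarrow> nat \<Rightarrow> complex \<Rightarrow> (nat \<Rightarrow> 'v) nspace"
  where "rochberg_space X0 X1 n z =
    quotient_space (taylor_array (sum_space X0 X1) n z)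
      (calderon_space (sum_space X0 X1) X0 X1 0 1)"

end

theory Submission
  imports Defs "HOL-Complex_Analysis.Complex_Analysis"
begin

text \<open>Write \<open>F\<close> for the Calderon space of \<open>(X0, X1)\<close> on the unit
  strip. The array space at \<open>c\<close> consists of the Taylor arrays at \<open>c\<close> of
  the functions of \<open>F\<close>, the interpolation space of the values at \<open>c\<close> of
  functions in the Calderon space of the two array spaces on the inner strip. Two inclusions, each
  with a norm bound, are proved and combined in \<open>reiteration\<close>.

  One inclusion is direct. For \<open>f\<close> in \<open>F\<close> the function sending
  \<open>z\<close> to the Taylor array of \<open>f\<close> at \<open>z\<close> is analytic with
  values in the power of \<open>\<Sigma>\<close>. The array at \<open>a + it\<close> is the array at
  \<open>a\<close> of a vertical translate of \<open>f\<close>, so its quotient norm is at most the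
  norm of \<open>f\<close>; the same holds at \<open>b\<close>. This is
  \<open>taylor_in_calderon\<close>.

  For the other inclusion let \<open>g\<close> lie in the inner Calderon space. For \<open>w\<close>
  on one of the lines \<open>Re w = a\<close>, \<open>Re w = b\<close>, read the array
  \<open>g w\<close> as a polynomial \<open>p_w\<close> in powers of \<open>z - w\<close>. After a
  damping in \<open>w\<close>, the boundary arrays are lifted continuously to functions of
  \<open>F\<close> (\<open>continuous_lift\<close>, \<open>lift_line\<close>); translating a lift
  gives \<open>h_w\<close> with Taylor polynomial \<open>p_w\<close> at \<open>w\<close>. The
  expression \<open>p_w + ((z - c)/(z - w))^n (h_w - p_w)\<close> is integrated over both lines
  against a damped Cauchy kernel at \<open>c\<close>. The resulting function \<open>J\<close> of
  \<open>z\<close> has three properties. It is analytic on the whole unit strip, because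
  \<open>h_w - p_w\<close> vanishes to order \<open>n\<close> at \<open>w\<close>
  (\<open>extension\<close>). Its Taylor array at \<open>c\<close> is \<open>g c\<close>, because
  the second summand is of order \<open>n\<close> at \<open>c\<close> and Cauchy's formula evaluates
  the integral of \<open>p_w\<close> (\<open>order_at_c\<close>). On \<open>Re z = 0\<close> and
  \<open>Re z = 1\<close> the terms containing \<open>p_w\<close> form a Cauchy integral with the
  factor \<open>1 - ((z - c)/(z - w))^n\<close>, which is 0 at \<open>w = c\<close>; they cancel,
  and what remains is an integral of boundary values of functions of \<open>F\<close>, which lie in
  \<open>X0\<close> or \<open>X1\<close> (\<open>boundary\<close>, \<open>two_lines\<close>).
  Multiplying by an entire function with Gaussian decay that equals 1 to order \<open>n\<close> at
  \<open>c\<close> puts \<open>J\<close> into \<open>F\<close> (\<open>glue\<close>). This gives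
  \<open>reiteration_upper\<close>.

  For the density statement with \<open>X0\<close> contained in \<open>X1\<close>, an array in the
  intersection is the array at \<open>a\<close> of some \<open>f\<close> in \<open>F\<close>. A
  Gaussian average of damped translates of \<open>f\<close> is close to a function of
  \<open>F\<close> with the same array, and moving the contour to \<open>Re z = 0\<close> shows that
  the array of the average has entries in \<open>X0\<close> (\<open>gaussian_average\<close>,
  \<open>rochberg_approx\<close>). The integral operator above, used on the half-plane to the right
  of \<open>a\<close> with a constant array, maps the array space at \<open>a\<close> boundedly into
  the one at \<open>b\<close> (\<open>rochberg_mono\<close>); hence the approximation holds in both
  norms (\<open>dense_inter_power\<close>).

  Vector-valued analysis is reduced to scalar analysis by Hahn-Banach: a locally bounded, weakly
  holomorphic function is analytic (\<open>weakly_analytic\<close>), and a weak expansion of order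
  \<open>n\<close> determines the Taylor array (\<open>taylor_array_eqI\<close>).\<close>

interpretation scaleC: vector_space "scaleC :: complex \<Rightarrow> 'a::complex_vector \<Rightarrow> 'a"
  by (rule vector_space_scaleC)

section \<open>Normed spaces as records: limits, continuity and bounded inclusions\<close>

text \<open>Continuity is phrased through real-valued limits, to which the calculus of filters
  applies; \<open>continuous_map_iff\<close> identifies it with the topological notion used for the
  Calderon space.\<close>

definition ncont :: "'v::complex_vector nspace \<Rightarrow> 'a::topological_space set \<Rightarrow> ('a \<Rightarrow> 'v) \<Rightarrow> bool"
  where "ncont X A f \<longleftrightarrow>
    (\<forall>a\<in>A. f a \<in> pts X \<and> ((\<lambda>x. nrm X (f x - f a)) \<longlongrightarrow> 0) (at a within A))"

definition nlim :: "'v::complex_vector nspace \<Rightarrow> (nat \<Rightarrow> 'v) \<Rightarrow> 'v \<Rightarrow> bool"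
  where "nlim X s x \<longleftrightarrow> (\<forall>k. s k \<in> pts X) \<and> x \<in> pts X \<and> (\<lambda>k. nrm X (s k - x)) \<longlonglongrightarrow> 0"

definition ncauchy :: "'v::complex_vector nspace \<Rightarrow> (nat \<Rightarrow> 'v) \<Rightarrow> bool"
  where "ncauchy X s \<longleftrightarrow> (\<forall>k. s k \<in> pts X) \<and>
    (\<forall>e>0. \<exists>N. \<forall>m\<ge>N. \<forall>n\<ge>N. nrm X (s m - s n) < e)"

locale nsp =
  fixes X :: "'v::complex_vector nspace"
  assumes normed: "normed_space X"
begin

lemma subspace: "scaleC.subspace (pts X)"
  using normed by (simp add: normed_space_def)

lemma zero_mem [simp]: "0 \<in> pts X"
  using subspace scaleC.subspace_0 by blast

lemma add_mem: "x \<in> pts X \<Longrightarrow> y \<in> pts X \<Longrightarrow> x + y \<in> pts X"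
  using subspace scaleC.subspace_add by blast

lemma diff_mem: "x \<in> pts X \<Longrightarrow> y \<in> pts X \<Longrightarrow> x - y \<in> pts X"
  using subspace scaleC.subspace_diff by blast

lemma scale_mem: "x \<in> pts X \<Longrightarrow> c *\<^sub>C x \<in> pts X"
  using subspace scaleC.subspace_scale by blast

lemma minus_mem: "x \<in> pts X \<Longrightarrow> - x \<in> pts X"
  using subspace scaleC.subspace_neg by blast

lemma sum_mem: "(\<And>i. i \<in> I \<Longrightarrow> f i \<in> pts X) \<Longrightarrow> (\<Sum>i\<in>I. f i) \<in> pts X"
  using subspace scaleC.subspace_sum by blast

lemma nrm_ge0: "x \<in> pts X \<Longrightarrow> 0 \<le> nrm X x"
  using normed by (simp add: normed_space_def)

lemma nrm_eq0: "x \<in> pts X \<Longrightarrow> nrm X x = 0 \<longleftrightarrow> x = 0"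
  using normed by (simp add: normed_space_def)

lemma nrm_0 [simp]: "nrm X 0 = 0"
  using nrm_eq0 by simp

lemma nrm_scale: "x \<in> pts X \<Longrightarrow> nrm X (c *\<^sub>C x) = cmod c * nrm X x"
  using normed by (simp add: normed_space_def)

lemma nrm_add: "x \<in> pts X \<Longrightarrow> y \<in> pts X \<Longrightarrow> nrm X (x + y) \<le> nrm X x + nrm X y"
  using normed by (simp add: normed_space_def)

lemma nrm_minus: "x \<in> pts X \<Longrightarrow> nrm X (- x) = nrm X x"
  using nrm_scale[of x "-1"] by simp

lemma nrm_commute: "x \<in> pts X \<Longrightarrow> y \<in> pts X \<Longrightarrow> nrm X (x - y) = nrm X (y - x)"
  using nrm_minus[of "x - y"] diff_mem by simp

lemma nrm_diff: "x \<in> pts X \<Longrightarrow> y \<in> pts X \<Longrightarrow> nrm X (x - y) \<le> nrm X x + nrm X y"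
  using nrm_add[of x "- y"] by (simp add: nrm_minus minus_mem)

lemma nrm_tri:
  "x \<in> pts X \<Longrightarrow> y \<in> pts X \<Longrightarrow> z \<in> pts X \<Longrightarrow> nrm X (x - z) \<le> nrm X (x - y) + nrm X (y - z)"
  using nrm_add[of "x - y" "y - z"] diff_mem by simp

lemma nrm_abs_diff: "x \<in> pts X \<Longrightarrow> y \<in> pts X \<Longrightarrow> \<bar>nrm X x - nrm X y\<bar> \<le> nrm X (x - y)"
  using nrm_tri[of x y 0] nrm_tri[of y x 0] nrm_commute[of x y] by simp

lemma nrm_le_diff: "x \<in> pts X \<Longrightarrow> y \<in> pts X \<Longrightarrow> nrm X x \<le> nrm X (x - y) + nrm X y"
  using nrm_tri[of x y 0] by simp

lemma nrm_sum: "(\<And>i. i \<in> I \<Longrightarrow> f i \<in> pts X) \<Longrightarrow> nrm X (\<Sum>i\<in>I. f i) \<le> (\<Sum>i\<in>I. nrm X (f i))"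
proof (induction I rule: infinite_finite_induct)
  case (insert i I)
  thus ?case using nrm_add[of "f i" "\<Sum>i\<in>I. f i"] sum_mem[of I f] by fastforce
qed auto

lemma mtop:
  "Metric_space (pts X) (\<lambda>x y. if x \<in> pts X \<and> y \<in> pts X then nrm X (x - y) else 0)"
  "ntop X = Metric_space.mtopology (pts X) (\<lambda>x y. if x \<in> pts X \<and> y \<in> pts X then nrm X (x - y) else 0)"
  using Metric_space_nspace[OF normed] by (auto simp: nmetric_def Metric_space.mtopology_of)

lemma topspace: "topspace (ntop X) = pts X"
  by (simp add: mspace_nmetric normed)

lemma limitin_iff:
  "limitin (ntop X) f D F \<longleftrightarrow>
    D \<in> pts X \<and> (\<forall>\<^sub>F x in F. f x \<in> pts X) \<and> ((\<lambda>x. nrm X (f x - D)) \<longlongrightarrow> 0) F"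
proof (cases "D \<in> pts X \<and> (\<forall>\<^sub>F x in F. f x \<in> pts X)")
  case True
  hence e: "\<forall>\<^sub>F x in F. (if f x \<in> pts X \<and> D \<in> pts X then nrm X (f x - D) else 0) = nrm X (f x - D)"
    by (auto elim!: eventually_mono)
  show ?thesis
    unfolding mtop(2) Metric_space.limitin_metric_dist_null[OF mtop(1)]
    using tendsto_cong[OF e] True by auto
next
  case False
  thus ?thesis
    unfolding mtop(2) Metric_space.limitin_metric_dist_null[OF mtop(1)] by auto
qed

lemma closure_iff:
  "x \<in> ntop X closure_of S \<longleftrightarrow> x \<in> pts X \<and> (\<forall>e>0. \<exists>y\<in>S \<inter> pts X. nrm X (x - y) < e)"
  unfolding mtop(2) Metric_space.metric_closure_of[OF mtop(1)] Metric_space.in_mball[OF mtop(1)]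
  by auto

lemma continuous_map_metric:
  "continuous_map T (ntop X) f \<longleftrightarrow> (\<forall>x\<in>topspace T. f x \<in> pts X \<and>
    (\<forall>e>0. \<exists>U. openin T U \<and> x \<in> U \<and> (\<forall>y\<in>U. f y \<in> pts X \<and> nrm X (f x - f y) < e)))"
proof -
  have "continuous_map T (ntop X) f \<longleftrightarrow>
    (\<forall>x\<in>topspace T. \<forall>e>0. \<exists>U. openin T U \<and> x \<in> U \<and> (\<forall>y\<in>U. f x \<in> pts X \<and> f y \<in> pts X \<and> nrm X (f x - f y) < e))"
    unfolding mtop(2) Metric_space.continuous_map_to_metric[OF mtop(1)] Metric_space.in_mball[OF mtop(1)]
    by (intro ball_cong all_cong imp_cong ex_cong conj_cong refl) auto
  thus ?thesis
    by (meson zero_less_one)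
qed

lemma openin_iff:
  "openin (ntop X) U \<longleftrightarrow> U \<subseteq> pts X \<and> (\<forall>x\<in>U. \<exists>r>0. \<forall>y\<in>pts X. nrm X (x - y) < r \<longrightarrow> y \<in> U)"
proof -
  have "(Metric_space.mball (pts X) (\<lambda>x y. if x \<in> pts X \<and> y \<in> pts X then nrm X (x - y) else 0) x r \<subseteq> U)
      \<longleftrightarrow> (\<forall>y\<in>pts X. nrm X (x - y) < r \<longrightarrow> y \<in> U)" if "x \<in> pts X" for x r
    using that by (auto simp: subset_iff Metric_space.in_mball[OF mtop(1)])
  thus ?thesis
    unfolding mtop(2) Metric_space.openin_mtopology[OF mtop(1)] by (meson subset_iff)
qed

lemma openin_ball: "x \<in> pts X \<Longrightarrow> openin (ntop X) {y\<in>pts X. nrm X (x - y) < r}"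
  unfolding openin_iff
proof (intro conjI ballI)
  fix y assume x: "x \<in> pts X" and "y \<in> {y\<in>pts X. nrm X (x - y) < r}"
  hence y: "y \<in> pts X" "nrm X (x - y) < r" by auto
  show "\<exists>d>0. \<forall>z\<in>pts X. nrm X (y - z) < d \<longrightarrow> z \<in> {y\<in>pts X. nrm X (x - y) < r}"
  proof (intro exI[of _ "r - nrm X (x - y)"] conjI ballI impI)
    fix z assume "z \<in> pts X" "nrm X (y - z) < r - nrm X (x - y)"
    thus "z \<in> {y\<in>pts X. nrm X (x - y) < r}" using nrm_tri[of x y z] x y by simp
  qed (use y in simp)
qed auto

lemma continuous_map_iff:
  fixes A :: "'a::topological_space set"
  shows "continuous_map (top_of_set A) (ntop X) f \<longleftrightarrow> ncont X A f"
proof -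
  have "(\<forall>e>0. \<exists>U. openin (top_of_set A) U \<and> a \<in> U \<and> (\<forall>y\<in>U. f y \<in> pts X \<and> nrm X (f a - f y) < e))
      \<longleftrightarrow> ((\<lambda>x. nrm X (f x - f a)) \<longlongrightarrow> 0) (at a within A)" (is "?L \<longleftrightarrow> ?R")
    if a: "a \<in> A" and m: "\<And>x. x \<in> A \<Longrightarrow> f x \<in> pts X" for a
  proof
    assume L: ?L
    show ?R
    proof (rule tendstoI)
      fix e :: real assume "e > 0"
      then obtain U where U: "openin (top_of_set A) U" "a \<in> U" "\<And>y. y \<in> U \<Longrightarrow> nrm X (f a - f y) < e"
        using L by meson
      obtain T where T: "open T" "U = A \<inter> T"
        using U(1) by (meson openin_open)
      have "\<forall>\<^sub>F x in at a within A. x \<in> T \<and> x \<in> A"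
        using T U(2) unfolding eventually_at_topological by blast
      thus "\<forall>\<^sub>F x in at a within A. dist (nrm X (f x - f a)) 0 < e"
      proof eventually_elim
        case (elim x)
        thus ?case using U(3)[of x] T nrm_commute[OF m[OF a] m] nrm_ge0[OF diff_mem[OF m m[OF a]]] by simp
      qed
    qed
  next
    assume R: ?R
    show ?L
    proof (intro allI impI)
      fix e :: real assume e: "e > 0"
      hence "\<forall>\<^sub>F x in at a within A. dist (nrm X (f x - f a)) 0 < e"
        using R unfolding tendsto_iff by blast
      then obtain T where T: "open T" "a \<in> T"
        "\<And>x. x \<in> T \<Longrightarrow> x \<noteq> a \<Longrightarrow> x \<in> A \<Longrightarrow> dist (nrm X (f x - f a)) 0 < e"
        unfolding eventually_at_topological by blast
      have "nrm X (f a - f y) < e" if y: "y \<in> A \<inter> T" for y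
        using T(3)[of y] e y nrm_commute[OF m[OF a] m[of y]] by (cases "y = a") auto
      moreover have "openin (top_of_set A) (A \<inter> T)" using T(1) by (simp add: openin_open_Int)
      ultimately show "\<exists>U. openin (top_of_set A) U \<and> a \<in> U \<and> (\<forall>y\<in>U. f y \<in> pts X \<and> nrm X (f a - f y) < e)"
        using a T(2) m by (intro exI[of _ "A \<inter> T"]) blast
    qed
  qed
  note eq = this
  show ?thesis
  proof (cases "\<forall>x\<in>A. f x \<in> pts X")
    case True
    thus ?thesis
      unfolding continuous_map_metric ncont_def topspace_euclidean_subtopology
      by (intro ball_cong refl conj_cong eq) auto
  next
    case False
    thus ?thesis
      unfolding continuous_map_metric ncont_def topspace_euclidean_subtopology by blast
  qed
qed

lemma continuous_map_real_iff: "continuous_map euclideanreal (ntop X) f \<longleftrightarrow> ncont X UNIV f"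
  using continuous_map_iff[of UNIV f] by simp

lemma MCauchy_iff:
  "Metric_space.MCauchy (pts X) (\<lambda>x y. if x \<in> pts X \<and> y \<in> pts X then nrm X (x - y) else 0) s
    \<longleftrightarrow> ncauchy X s"
  unfolding Metric_space.MCauchy_def[OF mtop(1)] ncauchy_def by (auto simp: image_subset_iff)

lemma mcomplete_iff: "mcomplete_of (nmetric X) \<longleftrightarrow> (\<forall>s. ncauchy X s \<longrightarrow> (\<exists>x. nlim X s x))"
proof -
  have "mcomplete_of (nmetric X) \<longleftrightarrow>
      (\<forall>s. ncauchy X s \<longrightarrow> (\<exists>x. limitin (ntop X) s x sequentially))"
    unfolding mcomplete_of_def mtop(2)
    by (simp add: nmetric_def mspace_def mdist_def metric_inverse mtop(1) Metric_space.mcomplete_def MCauchy_iff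
        del: Metric_space.mtopology_of)
  also have "\<dots> \<longleftrightarrow> (\<forall>s. ncauchy X s \<longrightarrow> (\<exists>x. nlim X s x))"
    by (auto simp: limitin_iff nlim_def ncauchy_def)
  finally show ?thesis .
qed

lemma has_cderiv_iff:
  "has_cderiv X f D z \<longleftrightarrow> D \<in> pts X \<and> (\<forall>\<^sub>F w in at z. inverse (w - z) *\<^sub>C (f w - f z) \<in> pts X) \<and>
    ((\<lambda>w. nrm X (inverse (w - z) *\<^sub>C (f w - f z) - D)) \<longlongrightarrow> 0) (at z)"
  unfolding has_cderiv_def limitin_iff ..

lemma has_cderiv_unique: "has_cderiv X f D z \<Longrightarrow> has_cderiv X f E z \<Longrightarrow> D = E"
  unfolding has_cderiv_def mtop(2)
  by (rule Metric_space.limitin_metric_unique[OF mtop(1)]) auto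

lemma cderiv_eqI: "has_cderiv X f D z \<Longrightarrow> cderiv X f z = D"
  unfolding cderiv_def using has_cderiv_unique by blast

lemma nlim_unique: "nlim X s x \<Longrightarrow> nlim X s y \<Longrightarrow> x = y"
proof -
  assume a: "nlim X s x" "nlim X s y"
  hence xy: "x \<in> pts X" "y \<in> pts X" "\<And>k. s k \<in> pts X" by (auto simp: nlim_def)
  have "(\<lambda>k. nrm X (s k - x) + nrm X (s k - y)) \<longlonglongrightarrow> 0 + 0"
    using a by (intro tendsto_add) (auto simp: nlim_def)
  moreover have "nrm X (x - y) \<le> nrm X (s k - x) + nrm X (s k - y)" for k
    using nrm_tri[of x "s k" y] xy nrm_commute[of x "s k"] by simp
  ultimately have "nrm X (x - y) \<le> 0 + 0"
    by (intro LIMSEQ_le_const) auto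
  thus "x = y"
    using nrm_eq0[of "x - y"] nrm_ge0[of "x - y"] diff_mem xy by simp
qed

lemma nlim_nrm: "nlim X s x \<Longrightarrow> (\<lambda>k. nrm X (s k)) \<longlonglongrightarrow> nrm X x"
proof -
  assume a: "nlim X s x"
  have "(\<lambda>k. nrm X (s k) - nrm X x) \<longlonglongrightarrow> 0"
    by (rule Lim_null_comparison[where g = "\<lambda>k. nrm X (s k - x)"])
      (use a nrm_abs_diff in \<open>auto simp: nlim_def\<close>)
  thus ?thesis using LIM_zero_iff by blast
qed

lemma nlim_nrm_le: "nlim X s x \<Longrightarrow> (\<And>k. nrm X (s k) \<le> B) \<Longrightarrow> nrm X x \<le> B"
  using nlim_nrm[of s x] by (intro LIMSEQ_le_const2[of "\<lambda>k. nrm X (s k)"]) auto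

lemma ncont_mono: "ncont X A f \<Longrightarrow> B \<subseteq> A \<Longrightarrow> ncont X B f"
  unfolding ncont_def by (meson subset_iff tendsto_within_subset)

lemma ncont_mem: "ncont X A f \<Longrightarrow> a \<in> A \<Longrightarrow> f a \<in> pts X"
  by (simp add: ncont_def)

lemma ncont_uniform_limit:
  assumes "\<And>x. x \<in> A \<Longrightarrow> f x \<in> pts X"
    and "\<And>e. e > 0 \<Longrightarrow> \<exists>g. ncont X A g \<and> (\<forall>x\<in>A. nrm X (f x - g x) \<le> e)"
  shows "ncont X A f"
  unfolding ncont_def
proof (intro ballI conjI assms(1))
  fix a assume a: "a \<in> A"
  show "((\<lambda>x. nrm X (f x - f a)) \<longlongrightarrow> 0) (at a within A)"
  proof (rule tendstoI)
    fix e :: real assume e: "e > 0"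
    obtain g where g: "ncont X A g" "\<And>x. x \<in> A \<Longrightarrow> nrm X (f x - g x) \<le> e/4"
      using assms(2)[of "e/4"] e by auto
    have "\<forall>\<^sub>F x in at a within A. dist (nrm X (g x - g a)) 0 < e/4"
      using g(1) a e unfolding ncont_def tendsto_iff by (meson zero_less_divide_iff zero_less_numeral)
    moreover have "\<forall>\<^sub>F x in at a within A. x \<in> A"
      unfolding eventually_at_filter by simp
    ultimately show "\<forall>\<^sub>F x in at a within A. dist (nrm X (f x - f a)) 0 < e"
    proof eventually_elim
      case (elim x)
      have m: "f x \<in> pts X" "f a \<in> pts X" "g x \<in> pts X" "g a \<in> pts X"
        using assms(1) ncont_mem[OF g(1)] a elim by auto
      have "nrm X (f x - f a) \<le> nrm X (f x - g x) + (nrm X (g x - g a) + nrm X (g a - f a))"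
        using nrm_tri[of "f x" "g x" "f a"] nrm_tri[of "g x" "g a" "f a"] m by simp
      thus ?case
        using g(2)[of x] g(2)[of a] a elim nrm_commute[of "g a" "f a"] m
          nrm_ge0[of "f x - f a"] diff_mem[of "f x" "f a"] e by simp
    qed
  qed
qed

lemma ncont_continuous_nrm: "ncont X A f \<Longrightarrow> continuous_on A (\<lambda>x. nrm X (f x))"
  unfolding continuous_on_def
proof
  fix a assume f: "ncont X A f" and a: "a \<in> A"
  have "((\<lambda>x. nrm X (f x) - nrm X (f a)) \<longlongrightarrow> 0) (at a within A)"
  proof (rule Lim_null_comparison)
    show "\<forall>\<^sub>F x in at a within A. norm (nrm X (f x) - nrm X (f a)) \<le> nrm X (f x - f a)"
      unfolding eventually_at_filter using f a nrm_abs_diff by (auto simp: ncont_def)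
    show "((\<lambda>x. nrm X (f x - f a)) \<longlongrightarrow> 0) (at a within A)"
      using f a by (simp add: ncont_def)
  qed
  thus "((\<lambda>x. nrm X (f x)) \<longlongrightarrow> nrm X (f a)) (at a within A)"
    using LIM_zero_iff by blast
qed

lemma ncont_const: "x \<in> pts X \<Longrightarrow> ncont X A (\<lambda>_. x)"
  by (simp add: ncont_def)

lemma ncont_add: "ncont X A f \<Longrightarrow> ncont X A g \<Longrightarrow> ncont X A (\<lambda>x. f x + g x)"
  unfolding ncont_def
proof (intro ballI conjI)
  fix a assume f: "\<forall>a\<in>A. f a \<in> pts X \<and> ((\<lambda>x. nrm X (f x - f a)) \<longlongrightarrow> 0) (at a within A)"
    and g: "\<forall>a\<in>A. g a \<in> pts X \<and> ((\<lambda>x. nrm X (g x - g a)) \<longlongrightarrow> 0) (at a within A)"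
    and a: "a \<in> A"
  show "f a + g a \<in> pts X" using f g a add_mem by blast
  show "((\<lambda>x. nrm X (f x + g x - (f a + g a))) \<longlongrightarrow> 0) (at a within A)"
  proof (rule Lim_null_comparison)
    show "\<forall>\<^sub>F x in at a within A. norm (nrm X (f x + g x - (f a + g a))) \<le> nrm X (f x - f a) + nrm X (g x - g a)"
      unfolding eventually_at_filter
    proof (rule always_eventually, intro allI impI)
      fix x assume "x \<in> A"
      hence "f x - f a \<in> pts X" "g x - g a \<in> pts X" using f g a diff_mem by auto
      thus "norm (nrm X (f x + g x - (f a + g a))) \<le> nrm X (f x - f a) + nrm X (g x - g a)"
        using nrm_add[of "f x - f a" "g x - g a"] nrm_ge0[OF add_mem[of "f x - f a" "g x - g a"]]
        by (simp add: algebra_simps)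
    qed
    have "((\<lambda>x. nrm X (f x - f a)) \<longlongrightarrow> 0) (at a within A)" "((\<lambda>x. nrm X (g x - g a)) \<longlongrightarrow> 0) (at a within A)"
      using f g a by auto
    from tendsto_add[OF this]
    show "((\<lambda>x. nrm X (f x - f a) + nrm X (g x - g a)) \<longlongrightarrow> 0) (at a within A)" by simp
  qed
qed

lemma ncont_scale:
  assumes c: "continuous_on A c" and f: "ncont X A f"
  shows "ncont X A (\<lambda>x. c x *\<^sub>C f x)"
  unfolding ncont_def
proof (intro ballI conjI)
  fix a assume a: "a \<in> A"
  have m: "f x \<in> pts X" if "x \<in> A" for x using f that by (simp add: ncont_def)
  show "c a *\<^sub>C f a \<in> pts X" using m a scale_mem by blast
  show "((\<lambda>x. nrm X (c x *\<^sub>C f x - c a *\<^sub>C f a)) \<longlongrightarrow> 0) (at a within A)"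
  proof (rule Lim_null_comparison)
    show "\<forall>\<^sub>F x in at a within A. norm (nrm X (c x *\<^sub>C f x - c a *\<^sub>C f a)) \<le>
        cmod (c x) * nrm X (f x - f a) + cmod (c x - c a) * nrm X (f a)"
      unfolding eventually_at_filter
    proof (rule always_eventually, intro allI impI)
      fix x assume x: "x \<in> A"
      have e: "c x *\<^sub>C f x - c a *\<^sub>C f a = c x *\<^sub>C (f x - f a) + (c x - c a) *\<^sub>C f a"
        by (simp add: scaleC.scale_right_diff_distrib scaleC.scale_left_diff_distrib)
      show "norm (nrm X (c x *\<^sub>C f x - c a *\<^sub>C f a)) \<le> cmod (c x) * nrm X (f x - f a) + cmod (c x - c a) * nrm X (f a)"
        unfolding e
        using nrm_add[of "c x *\<^sub>C (f x - f a)" "(c x - c a) *\<^sub>C f a"] m[OF x] m[OF a]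
          nrm_ge0[of "c x *\<^sub>C (f x - f a) + (c x - c a) *\<^sub>C f a"]
        by (simp add: nrm_scale scale_mem diff_mem add_mem)
    qed
    have c0: "(c \<longlongrightarrow> c a) (at a within A)" using c a by (simp add: continuous_on_def)
    have f0: "((\<lambda>x. nrm X (f x - f a)) \<longlongrightarrow> 0) (at a within A)" using f a by (simp add: ncont_def)
    have "((\<lambda>x. cmod (c x) * nrm X (f x - f a) + cmod (c x - c a) * nrm X (f a)) \<longlongrightarrow>
        cmod (c a) * 0 + cmod (c a - c a) * nrm X (f a)) (at a within A)"
      by (intro tendsto_intros c0 f0)
    thus "((\<lambda>x. cmod (c x) * nrm X (f x - f a) + cmod (c x - c a) * nrm X (f a)) \<longlongrightarrow> 0) (at a within A)"
      by simp
  qed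
qed

lemma ncont_sum:
  "finite I \<Longrightarrow> (\<And>i. i \<in> I \<Longrightarrow> ncont X A (f i)) \<Longrightarrow> ncont X A (\<lambda>x. \<Sum>i\<in>I. f i x)"
  by (induction I rule: finite_induct) (auto intro!: ncont_add ncont_const)

lemma ncont_compose:
  fixes A :: "'a::t2_space set" and B :: "'b::t2_space set"
  assumes f: "ncont X A f" and h: "continuous_on B h" "h ` B \<subseteq> A"
  shows "ncont X B (\<lambda>x. f (h x))"
  unfolding ncont_def
proof (intro ballI conjI)
  fix b assume b: "b \<in> B"
  thus "f (h b) \<in> pts X" using f h by (auto simp: ncont_def)
  let ?g = "\<lambda>y. nrm X (f y - f (h b))"
  have "(?g \<longlongrightarrow> ?g (h b)) (at (h b) within A)"
    using f h b by (auto simp: ncont_def)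
  hence "continuous (at (h b) within h ` B) ?g"
    unfolding continuous_within using h(2) tendsto_within_subset by blast
  hence "continuous (at b within B) (?g \<circ> h)"
    using h(1) b by (intro continuous_within_compose) (auto simp: continuous_on_eq_continuous_within)
  thus "((\<lambda>x. nrm X (f (h x) - f (h b))) \<longlongrightarrow> 0) (at b within B)"
    by (simp add: continuous_within o_def)
qed

end

lemma nsp_banach: "banach_space X \<Longrightarrow> nsp X"
  by (simp add: banach_space_def nsp_def)

locale bsp = fixes X :: "'v::complex_vector nspace"
  assumes banach: "banach_space X"

sublocale bsp \<subseteq> nsp
  using banach by (simp add: banach_space_def nsp_def)

lemma (in bsp) complete: "ncauchy X s \<Longrightarrow> \<exists>x. nlim X s x"
  using banach mcomplete_iff by (auto simp: banach_space_def)

lemma (in nsp) bspI: "(\<And>s. ncauchy X s \<Longrightarrow> \<exists>x. nlim X s x) \<Longrightarrow> banach_space X"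
  using normed mcomplete_iff by (auto simp: banach_space_def)

lemma nlim_mono:
  assumes "nsp X" "nsp Y" "pts X \<subseteq> pts Y" "\<And>x. x \<in> pts X \<Longrightarrow> nrm Y x \<le> C * nrm X x" "nlim X s x"
  shows "nlim Y s x"
proof -
  interpret X: nsp X by fact
  interpret Y: nsp Y by fact
  have m: "s k \<in> pts X" "x \<in> pts X" for k using assms(5) by (auto simp: nlim_def)
  have "(\<lambda>k. nrm Y (s k - x)) \<longlonglongrightarrow> 0"
  proof (rule Lim_null_comparison)
    show "\<forall>\<^sub>F k in sequentially. norm (nrm Y (s k - x)) \<le> C * nrm X (s k - x)"
    proof (intro always_eventually allI)
      fix k
      have "s k - x \<in> pts X" using X.diff_mem m by blast
      thus "norm (nrm Y (s k - x)) \<le> C * nrm X (s k - x)"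
        using assms(4)[of "s k - x"] Y.nrm_ge0[of "s k - x"] assms(3) by auto
    qed
    show "(\<lambda>k. C * nrm X (s k - x)) \<longlonglongrightarrow> 0"
      using assms(5) tendsto_mult_right_zero by (auto simp: nlim_def)
  qed
  thus ?thesis using m assms(3) by (auto simp: nlim_def)
qed

text \<open>A linear map continuous at 0 is bounded: a nonzero vector is rescaled to norm
  \<open>d / 2\<close>, inside the ball on which the larger space has norm below 1.\<close>

lemma continuously_included_iff:
  assumes "nsp X" "nsp Y"
  shows "continuously_included X Y \<longleftrightarrow>
    pts X \<subseteq> pts Y \<and> (\<exists>C>0. \<forall>x\<in>pts X. nrm Y x \<le> C * nrm X x)"
proof -
  interpret X: nsp X by fact
  interpret Y: nsp Y by fact
  show ?thesis
  proof
    assume c: "continuously_included X Y"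
    hence sub: "pts X \<subseteq> pts Y" and ct: "continuous_map (ntop X) (ntop Y) (\<lambda>x. x)"
      by (auto simp: continuously_included_def)
    have "\<exists>d>0. \<forall>x\<in>pts X. nrm X x < d \<longrightarrow> nrm Y x < 1"
    proof -
      from ct obtain U where U: "openin (ntop X) U" "0 \<in> U" "\<And>y. y \<in> U \<Longrightarrow> nrm Y (0 - y) < 1"
        unfolding Y.continuous_map_metric X.topspace by (metis X.zero_mem zero_less_one)
      then obtain d where d: "d > 0" "\<And>y. y \<in> pts X \<Longrightarrow> nrm X (0 - y) < d \<Longrightarrow> y \<in> U"
        unfolding X.openin_iff by meson
      have "nrm Y x < 1" if x: "x \<in> pts X" "nrm X x < d" for x
        using U(3)[OF d(2)[OF x(1)]] x sub X.nrm_minus Y.nrm_minus by (auto simp: subset_iff)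
      thus ?thesis using d by blast
    qed
    then obtain d where d: "d > 0" "\<And>x. x \<in> pts X \<Longrightarrow> nrm X x < d \<Longrightarrow> nrm Y x < 1" by blast
    have "nrm Y x \<le> (2/d) * nrm X x" if x: "x \<in> pts X" for x
    proof (cases "x = 0")
      case False
      hence p: "nrm X x > 0" using X.nrm_eq0[OF x] X.nrm_ge0[OF x] by linarith
      let ?t = "d / (2 * nrm X x)"
      have t: "?t > 0" using p d by simp
      have "nrm X (of_real ?t *\<^sub>C x) < d"
        using X.nrm_scale[OF x, of "of_real ?t"] t p d(1) by (simp add: norm_divide norm_mult)
      hence "nrm Y (of_real ?t *\<^sub>C x) < 1" using d(2) X.scale_mem[OF x] by blast
      moreover have "nrm Y (of_real ?t *\<^sub>C x) = ?t * nrm Y x"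
      proof -
        have "nrm Y (of_real ?t *\<^sub>C x) = \<bar>?t\<bar> * nrm Y x"
          using Y.nrm_scale[of x "of_real ?t"] x sub unfolding norm_of_real by blast
        thus ?thesis using t by (simp only: abs_of_pos)
      qed
      ultimately have "?t * nrm Y x < 1" by simp
      thus ?thesis using p d by (simp add: field_simps)
    qed (simp)
    thus "pts X \<subseteq> pts Y \<and> (\<exists>C>0. \<forall>x\<in>pts X. nrm Y x \<le> C * nrm X x)"
      using sub d(1) by (intro conjI exI[of _ "2/d"]) auto
  next
    assume a: "pts X \<subseteq> pts Y \<and> (\<exists>C>0. \<forall>x\<in>pts X. nrm Y x \<le> C * nrm X x)"
    then obtain C where sub: "pts X \<subseteq> pts Y" and C: "C > 0" "\<And>x. x \<in> pts X \<Longrightarrow> nrm Y x \<le> C * nrm X x" by blast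
    have "continuous_map (ntop X) (ntop Y) (\<lambda>x. x)"
      unfolding Y.continuous_map_metric X.topspace
    proof (intro ballI conjI allI impI)
      fix x assume x: "x \<in> pts X"
      thus "x \<in> pts Y" using sub by blast
      fix e :: real assume e: "0 < e"
      show "\<exists>U. openin (ntop X) U \<and> x \<in> U \<and> (\<forall>y\<in>U. y \<in> pts Y \<and> nrm Y (x - y) < e)"
      proof (intro exI[of _ "{y\<in>pts X. nrm X (x - y) < e/C}"] conjI ballI)
        show "openin (ntop X) {y\<in>pts X. nrm X (x - y) < e/C}" using X.openin_ball x by blast
        fix y assume "y \<in> {y\<in>pts X. nrm X (x - y) < e/C}"
        hence y: "y \<in> pts X" "nrm X (x - y) < e/C" by auto
        have "nrm Y (x - y) \<le> C * nrm X (x - y)" using C(2) X.diff_mem x y by blast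
        also have "\<dots> < e" using y(2) C(1) by (simp add: field_simps)
        finally show "nrm Y (x - y) < e" .
        show "y \<in> pts Y" using y sub by blast
      qed (use x e C in simp_all)
    qed
    thus "continuously_included X Y" using sub by (simp add: continuously_included_def)
  qed
qed

section \<open>Hahn-Banach by minimal sublinear functionals\<close>

text \<open>Only the restriction to \<open>pts X\<close> matters. The unit ball is enough for all
  purposes because Hahn-Banach norms each vector by functionals of norm at most 1.\<close>

definition dual_ball :: "'v::complex_vector nspace \<Rightarrow> ('v \<Rightarrow> complex) set"
  where "dual_ball X = {l. (\<forall>x\<in>pts X. \<forall>y\<in>pts X. l (x + y) = l x + l y) \<and>
    (\<forall>c. \<forall>x\<in>pts X. l (c *\<^sub>C x) = c * l x) \<and> (\<forall>x\<in>pts X. cmod (l x) \<le> nrm X x)}"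

context nsp
begin

text \<open>The value 0 off \<open>pts X\<close> lets functionals be compared as functions, so that
  minimality can be stated with plain equality.\<close>

definition sublinear :: "('v \<Rightarrow> real) \<Rightarrow> bool"
  where "sublinear q \<longleftrightarrow> (\<forall>x. x \<notin> pts X \<longrightarrow> q x = 0) \<and>
    (\<forall>x\<in>pts X. \<forall>y\<in>pts X. q (x + y) \<le> q x + q y) \<and>
    (\<forall>t\<ge>0. \<forall>x\<in>pts X. q (of_real t *\<^sub>C x) = t * q x)"

text \<open>The sublinear functional below \<open>q\<close> whose value at \<open>- y\<close> is at
  most \<open>- q y\<close> (take \<open>t = 1\<close>); it pushes \<open>q\<close> towards
  linearity in the direction \<open>y\<close>.\<close>

definition directional :: "('v \<Rightarrow> real) \<Rightarrow> 'v \<Rightarrow> 'v \<Rightarrow> real"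
  where "directional q y x =
    (if x \<in> pts X then INF t\<in>{0..}. q (x + of_real t *\<^sub>C y) - t * q y else 0)"

lemma sublinearD:
  assumes "sublinear q"
  shows "x \<notin> pts X \<Longrightarrow> q x = 0"
    and "x \<in> pts X \<Longrightarrow> y \<in> pts X \<Longrightarrow> q (x + y) \<le> q x + q y"
    and "t \<ge> 0 \<Longrightarrow> x \<in> pts X \<Longrightarrow> q (of_real t *\<^sub>C x) = t * q x"
    and "q 0 = 0"
    and "x \<in> pts X \<Longrightarrow> - q (- x) \<le> q x"
proof -
  show "x \<notin> pts X \<Longrightarrow> q x = 0" "x \<in> pts X \<Longrightarrow> y \<in> pts X \<Longrightarrow> q (x + y) \<le> q x + q y"
    "t \<ge> 0 \<Longrightarrow> x \<in> pts X \<Longrightarrow> q (of_real t *\<^sub>C x) = t * q x" for x y t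
    using assms by (auto simp: sublinear_def)
  have "q (of_real 0 *\<^sub>C 0) = 0 * q 0"
    using assms unfolding sublinear_def by (metis order_refl zero_mem)
  thus z: "q 0 = 0" by simp
  have "q (x + - x) \<le> q x + q (- x)" if "x \<in> pts X"
    using assms that minus_mem unfolding sublinear_def by blast
  thus "x \<in> pts X \<Longrightarrow> - q (- x) \<le> q x" using z by simp
qed

lemma
  assumes q: "sublinear q" and y: "y \<in> pts X"
  shows directional_le: "x \<in> pts X \<Longrightarrow> t \<ge> 0 \<Longrightarrow> directional q y x \<le> q (x + of_real t *\<^sub>C y) - t * q y"
    and sublinear_directional: "sublinear (directional q y)"
    and directional_le_self: "directional q y \<le> q"
proof -
  note Q = sublinearD[OF q]
  have bdd: "bdd_below ((\<lambda>t. q (x + of_real t *\<^sub>C y) - t * q y) ` {0..})" if x: "x \<in> pts X" for x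
  proof (rule bdd_belowI2[of _ "- q (- x)"])
    fix t :: real assume "t \<in> {0..}"
    hence t: "t \<ge> 0" by simp
    have "q ((x + of_real t *\<^sub>C y) + - x) \<le> q (x + of_real t *\<^sub>C y) + q (- x)"
      by (rule Q(2)[OF add_mem[OF x scale_mem[OF y]] minus_mem[OF x]])
    thus "- q (- x) \<le> q (x + of_real t *\<^sub>C y) - t * q y"
      by (simp add: Q(3)[OF t y])
  qed
  show le: "directional q y x \<le> q (x + of_real t *\<^sub>C y) - t * q y" if "x \<in> pts X" "t \<ge> 0" for x t
    using cINF_lower[OF bdd[OF that(1)], of t] that by (simp add: directional_def)
  have ge: "B \<le> directional q y x"
    if "x \<in> pts X" "\<And>t. t \<ge> 0 \<Longrightarrow> B \<le> q (x + of_real t *\<^sub>C y) - t * q y" for B x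
    unfolding directional_def using that by (auto intro!: cINF_greatest)
  show "directional q y \<le> q"
  proof (rule le_funI)
    fix x show "directional q y x \<le> q x"
      using le[of x 0] Q(1)[of x] by (cases "x \<in> pts X") (auto simp: directional_def)
  qed
  have hom: "directional q y (of_real t *\<^sub>C x) \<le> t * directional q y x" if t: "t > 0" and x: "x \<in> pts X" for t x
  proof -
    have "directional q y (of_real t *\<^sub>C x) / t \<le> directional q y x"
    proof (rule ge[OF x])
      fix s :: real assume s: "s \<ge> 0"
      have "directional q y (of_real t *\<^sub>C x) \<le> q (of_real t *\<^sub>C x + of_real (t * s) *\<^sub>C y) - (t * s) * q y"
        using le[of "of_real t *\<^sub>C x" "t * s"] x s t scale_mem by simp
      also have "of_real t *\<^sub>C x + of_real (t * s) *\<^sub>C y = of_real t *\<^sub>C (x + of_real s *\<^sub>C y)"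
        by (simp add: scaleC.scale_right_distrib)
      also have "q \<dots> = t * q (x + of_real s *\<^sub>C y)"
        using Q(3) t x y add_mem scale_mem by simp
      finally show "directional q y (of_real t *\<^sub>C x) / t \<le> q (x + of_real s *\<^sub>C y) - s * q y"
        using t by (simp add: field_simps)
    qed
    thus ?thesis using t by (simp add: field_simps)
  qed
  show "sublinear (directional q y)"
    unfolding sublinear_def
  proof (intro conjI allI ballI impI)
    fix x assume "x \<notin> pts X" thus "directional q y x = 0" by (simp add: directional_def)
  next
    fix x x' assume x: "x \<in> pts X" and x': "x' \<in> pts X"
    \<comment> \<open>Two infima have to be added: the inequality is shown for fixed parameters
      \<open>s\<close> and \<open>t\<close>, with \<open>s + t\<close> inserted on the left, and the
      infima are taken one after the other.\<close>
    have "directional q y (x + x') - directional q y x' \<le> directional q y x"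
    proof (rule ge[OF x])
      fix s :: real assume s: "s \<ge> 0"
      have "directional q y (x + x') - (q (x + of_real s *\<^sub>C y) - s * q y) \<le> directional q y x'"
      proof (rule ge[OF x'])
        fix t :: real assume t: "t \<ge> 0"
        have "directional q y (x + x') \<le> q (x + x' + of_real (s + t) *\<^sub>C y) - (s + t) * q y"
          using le[of "x + x'" "s + t"] x x' s t add_mem by simp
        also have "x + x' + of_real (s + t) *\<^sub>C y = (x + of_real s *\<^sub>C y) + (x' + of_real t *\<^sub>C y)"
          by (simp add: scaleC.scale_left_distrib algebra_simps)
        also have "q \<dots> \<le> q (x + of_real s *\<^sub>C y) + q (x' + of_real t *\<^sub>C y)"
          using Q(2) x x' y add_mem scale_mem by simp
        finally show "directional q y (x + x') - (q (x + of_real s *\<^sub>C y) - s * q y) \<le> q (x' + of_real t *\<^sub>C y) - t * q y"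
          by (simp add: algebra_simps)
      qed
      thus "directional q y (x + x') - directional q y x' \<le> q (x + of_real s *\<^sub>C y) - s * q y" by simp
    qed
    thus "directional q y (x + x') \<le> directional q y x + directional q y x'" by simp
  next
    fix t :: real and x assume t: "0 \<le> t" and x: "x \<in> pts X"
    show "directional q y (of_real t *\<^sub>C x) = t * directional q y x"
    proof (cases "t = 0")
      case True
      have "directional q y 0 \<le> 0" using le[of 0 0] Q(4) by simp
      moreover have "0 \<le> directional q y 0" using ge[of 0 0] Q(3)[of _ y] y by simp
      ultimately show ?thesis using True by simp
    next
      case False
      hence t: "t > 0" using t by simp
      have "directional q y (of_real (1/t) *\<^sub>C of_real t *\<^sub>C x) \<le> (1/t) * directional q y (of_real t *\<^sub>C x)"
        using hom[of "1/t" "of_real t *\<^sub>C x"] t x scale_mem by simp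
      moreover have "of_real (1/t) *\<^sub>C of_real t *\<^sub>C x = x" using t by simp
      ultimately have "t * directional q y x \<le> directional q y (of_real t *\<^sub>C x)"
        using t by (simp add: field_simps)
      thus ?thesis using hom[OF t x] by simp
    qed
  qed
qed

text \<open>Zorn's lemma for the reversed pointwise order: the pointwise infimum of a chain is again
  sublinear.\<close>

lemma minimal_sublinear:
  assumes p: "sublinear p"
  shows "\<exists>q. sublinear q \<and> q \<le> p \<and> (\<forall>r. sublinear r \<longrightarrow> r \<le> q \<longrightarrow> r = q)"
proof -
  let ?A = "{q. sublinear q \<and> q \<le> p}"
  let ?P = "\<lambda>a b :: 'v \<Rightarrow> real. b \<le> a"
  have "\<exists>m\<in>?A. \<forall>a\<in>?A. ?P m a \<longrightarrow> a = m"
  proof (rule predicate_Zorn)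
    show "partial_order_on ?A (relation_of ?P ?A)"
      by (rule partial_order_on_relation_ofI) auto
    fix C assume C: "C \<in> Chains (relation_of ?P ?A)"
    hence CA: "\<And>q. q \<in> C \<Longrightarrow> sublinear q \<and> q \<le> p"
      and ch: "\<And>q r. q \<in> C \<Longrightarrow> r \<in> C \<Longrightarrow> q \<le> r \<or> r \<le> q"
      unfolding Chains_def relation_of_def by auto
    show "\<exists>u\<in>?A. \<forall>a\<in>C. ?P a u"
    proof (cases "C = {}")
      case True thus ?thesis using p by auto
    next
      case False
      define u where "u x = (INF q\<in>C. q x)" for x
      have bdd: "bdd_below ((\<lambda>q. q x) ` C)" for x
      \<comment> \<open>On the carrier \<open>- p (- x) \<le> - q (- x) \<le> q x\<close>; off the
        carrier the value is 0, which accounts for the minimum.\<close>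
      proof (rule bdd_belowI2[of _ "min 0 (- p (- x))"])
        fix q assume q: "q \<in> C"
        show "min 0 (- p (- x)) \<le> q x"
        proof (cases "x \<in> pts X")
          case True
          thus ?thesis using sublinearD(5)[of q x] CA[OF q] le_funD[of q p "- x"] by auto
        next
          case False
          thus ?thesis using sublinearD(1)[of q x] CA[OF q] by auto
        qed
      qed
      have le: "u x \<le> q x" if "q \<in> C" for q x
        unfolding u_def using cINF_lower[OF bdd that] .
      have ge: "B \<le> u x" if "\<And>q. q \<in> C \<Longrightarrow> B \<le> q x" for B x
        unfolding u_def using that False by (intro cINF_greatest) auto
      have "sublinear u"
        unfolding sublinear_def
      proof (intro conjI allI ballI impI)
        fix x assume "x \<notin> pts X"
        hence z: "q x = 0" if "q \<in> C" for q using CA[OF that] sublinearD(1) by blast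
        obtain q where "q \<in> C" using False by blast
        thus "u x = 0" using le[of q x] ge[of 0 x] z by fastforce
      next
        fix x y assume x: "x \<in> pts X" and y: "y \<in> pts X"
        have "u (x + y) - u y \<le> u x"
        proof (rule ge)
          fix q assume q: "q \<in> C"
          have "u (x + y) - q x \<le> u y"
          proof (rule ge)
            fix r assume r: "r \<in> C"
            \<comment> \<open>Of two members of the chain the smaller one bounds both evaluations at
              once; this is where the chain property enters.\<close>
            obtain m where m: "m \<in> C" "m \<le> q" "m \<le> r" using ch[OF q r] q r by auto
            have "u (x + y) \<le> m x + m y"
              using le[OF m(1), of "x + y"] sublinearD(2)[of m x y] CA[OF m(1)] x y by force
            also have "\<dots> \<le> q x + r y" using m by (intro add_mono) (auto simp: le_fun_def)
            finally show "u (x + y) - q x \<le> r y" by simp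
          qed
          thus "u (x + y) - u y \<le> q x" by simp
        qed
        thus "u (x + y) \<le> u x + u y" by simp
      next
        fix t :: real and x assume t: "0 \<le> t" and x: "x \<in> pts X"
        have h: "q (of_real t *\<^sub>C x) = t * q x" if "q \<in> C" for q
          using CA[OF that] sublinearD(3) t x by blast
        show "u (of_real t *\<^sub>C x) = t * u x"
        proof (cases "t = 0")
          case True
          have z: "q 0 = 0" if "q \<in> C" for q using CA[OF that] sublinearD(4) by blast
          obtain q where "q \<in> C" using False by blast
          hence "u 0 = 0" using le[of q 0] ge[of 0 0] z by fastforce
          thus ?thesis using True by simp
        next
          case nz: False
          hence t: "t > 0" using t by simp
          have "u (of_real t *\<^sub>C x) / t \<le> u x"
          proof (rule ge)
            fix q assume q: "q \<in> C"
            show "u (of_real t *\<^sub>C x) / t \<le> q x" using le[OF q, of "of_real t *\<^sub>C x"] h[OF q] t by (simp add: field_simps)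
          qed
          moreover have "t * u x \<le> u (of_real t *\<^sub>C x)"
          proof (rule ge)
            fix q assume q: "q \<in> C"
            show "t * u x \<le> q (of_real t *\<^sub>C x)" using le[OF q, of x] h[OF q] t by simp
          qed
          ultimately show ?thesis using t by (simp add: field_simps)
        qed
      qed
      moreover have "u \<le> p"
      proof (rule le_funI)
        fix x
        obtain q where "q \<in> C" using False by blast
        thus "u x \<le> p x" using le[of q x] CA[of q] by (meson le_funD order_trans)
      qed
      ultimately show ?thesis using le by (intro bexI[of _ u]) (auto simp: le_fun_def)
    qed
  qed
  then obtain m where m: "sublinear m" "m \<le> p" "\<And>a. sublinear a \<Longrightarrow> a \<le> p \<Longrightarrow> a \<le> m \<Longrightarrow> a = m" by blast
  thus ?thesis by (meson order_trans)
qed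

text \<open>Minimality forces \<open>directional q y = q\<close> for every \<open>y\<close>.
  Evaluated at \<open>t = 1\<close> this is \<open>q x \<le> q (x + y) - q y\<close>, the reverse of
  subadditivity.\<close>

lemma minimal_sublinear_linear:
  assumes q: "sublinear q" and min: "\<And>r. sublinear r \<Longrightarrow> r \<le> q \<Longrightarrow> r = q"
  shows "x \<in> pts X \<Longrightarrow> y \<in> pts X \<Longrightarrow> q (x + y) = q x + q y"
    and "x \<in> pts X \<Longrightarrow> q (of_real t *\<^sub>C x) = t * q x"
proof -
  note Q = sublinearD[OF q]
  show add: "q (x + y) = q x + q y" if "x \<in> pts X" "y \<in> pts X" for x y
  proof -
    have "directional q y = q"
      using min sublinear_directional[OF q that(2)] directional_le_self[OF q that(2)] by blast
    hence "q x \<le> q (x + y) - q y"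
      using directional_le[OF q that(2) that(1), of 1] by simp
    thus ?thesis using Q(2)[OF that] by simp
  qed
  assume x: "x \<in> pts X"
  show "q (of_real t *\<^sub>C x) = t * q x"
  proof (cases "t \<ge> 0")
    case True thus ?thesis using Q(3) x by blast
  next
    case False
    have m: "of_real (- t) *\<^sub>C x \<in> pts X" using scale_mem x by blast
    have "q (of_real t *\<^sub>C x + of_real (- t) *\<^sub>C x) = q (of_real t *\<^sub>C x) + q (of_real (- t) *\<^sub>C x)"
      using add scale_mem x by blast
    moreover have "of_real t *\<^sub>C x + of_real (- t) *\<^sub>C x = (0::'v)"
      by (simp flip: scaleC.scale_left_distrib)
    moreover have "q (of_real (- t) *\<^sub>C x) = - t * q x" using Q(3)[of "- t" x] x False by linarith
    ultimately show ?thesis using Q(4) by simp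
  qed
qed

text \<open>A minimal sublinear functional below \<open>directional p x0\<close>, with
  \<open>p\<close> the norm, is real linear, dominated by the norm, and at most minus the norm of
  \<open>x0\<close> at \<open>- x0\<close>. It is complexified by the usual formula
  \<open>q x - i q (i x)\<close>.\<close>

theorem hahn_banach:
  assumes x0: "x0 \<in> pts X"
  shows "\<exists>l\<in>dual_ball X. nrm X x0 \<le> cmod (l x0)"
proof -
  define p where "p x = (if x \<in> pts X then nrm X x else 0)" for x
  have p: "sublinear p"
    unfolding sublinear_def p_def by (auto simp: nrm_add nrm_scale add_mem scale_mem)
  obtain q where q: "sublinear q" "q \<le> directional p x0" "\<And>r. sublinear r \<Longrightarrow> r \<le> q \<Longrightarrow> r = q"
    using minimal_sublinear[OF sublinear_directional[OF p x0]] by blast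
  have add: "q (x + y) = q x + q y" if "x \<in> pts X" "y \<in> pts X" for x y
    by (rule minimal_sublinear_linear(1)[OF q(1)]) (use q(3) that in blast)+
  have hom: "q (of_real t *\<^sub>C x) = t * q x" if "x \<in> pts X" for t x
    by (rule minimal_sublinear_linear(2)[OF q(1)]) (use q(3) that in blast)+
  have qp: "q x \<le> nrm X x" if "x \<in> pts X" for x
    using le_funD[OF q(2), of x] le_funD[OF directional_le_self[OF p x0], of x] that by (simp add: p_def)
  have q0: "q x0 \<ge> nrm X x0"
  proof -
    have "q (- x0) \<le> - nrm X x0"
      using le_funD[OF q(2), of "- x0"] directional_le[OF p x0, of "- x0" 1] minus_mem x0 by (simp add: p_def)
    moreover have "q (- x0) = - q x0" using hom[OF x0, of "-1"] by simp
    ultimately show ?thesis by simp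
  qed
  define l where "l x = Complex (q x) (- q (\<i> *\<^sub>C x))" for x
  have ladd: "l (x + y) = l x + l y" if "x \<in> pts X" "y \<in> pts X" for x y
    unfolding l_def using that add scale_mem by (simp add: complex_eq_iff scaleC.scale_right_distrib)
  have lhom: "l (c *\<^sub>C x) = c * l x" if x: "x \<in> pts X" for c x
  proof -
    have cx: "c *\<^sub>C x = of_real (Re c) *\<^sub>C x + of_real (Im c) *\<^sub>C \<i> *\<^sub>C x" for x :: 'v
      by (simp add: scaleC.scale_left_distrib[symmetric] complex_eq mult.commute)
    have icx: "\<i> *\<^sub>C c *\<^sub>C x = of_real (Re c) *\<^sub>C \<i> *\<^sub>C x + of_real (- Im c) *\<^sub>C x"
    proof -
      have "\<i> * c = of_real (Re c) * \<i> + of_real (- Im c)" by (simp add: complex_eq_iff)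
      thus ?thesis by (simp only: scaleC.scale_scale scaleC.scale_left_distrib)
    qed
    have "q (c *\<^sub>C x) = Re c * q x + Im c * q (\<i> *\<^sub>C x)"
      by (subst cx) (simp add: add hom scale_mem x del: scaleC.scale_scale)
    moreover have "q (\<i> *\<^sub>C c *\<^sub>C x) = Re c * q (\<i> *\<^sub>C x) - Im c * q x"
      by (subst icx) (simp add: add hom scale_mem x del: scaleC.scale_scale of_real_minus)
    ultimately show ?thesis
      by (simp add: l_def complex_eq_iff del: scaleC.scale_scale)
  qed
  have "cmod (l x) \<le> nrm X x" if x: "x \<in> pts X" for x
  proof (cases "l x = 0")
    case True thus ?thesis using nrm_ge0 x by simp
  next
    case False
    \<comment> \<open>A unimodular factor making \<open>l (w x)\<close> real and nonnegative, so
      that the modulus of \<open>l x\<close> is a value of \<open>q\<close>.\<close>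
    define w where "w = of_real (cmod (l x)) / l x"
    have w: "cmod w = 1" using False by (simp add: w_def norm_divide)
    have "l (w *\<^sub>C x) = of_real (cmod (l x))" using lhom[OF x] False by (simp add: w_def)
    hence "cmod (l x) = q (w *\<^sub>C x)" by (simp add: l_def complex_eq_iff)
    also have "\<dots> \<le> nrm X (w *\<^sub>C x)" using qp scale_mem x by blast
    also have "\<dots> = nrm X x" using nrm_scale x w by simp
    finally show ?thesis .
  qed
  hence "l \<in> dual_ball X" using ladd lhom by (simp add: dual_ball_def)
  moreover have "nrm X x0 \<le> cmod (l x0)"
    using q0 abs_Re_le_cmod[of "l x0"] by (simp add: l_def)
  ultimately show ?thesis by blast
qed

lemma dual_add: "l \<in> dual_ball X \<Longrightarrow> x \<in> pts X \<Longrightarrow> y \<in> pts X \<Longrightarrow> l (x + y) = l x + l y"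
  by (simp add: dual_ball_def)

lemma dual_scale: "l \<in> dual_ball X \<Longrightarrow> x \<in> pts X \<Longrightarrow> l (c *\<^sub>C x) = c * l x"
  by (simp add: dual_ball_def)

lemma dual_le: "l \<in> dual_ball X \<Longrightarrow> x \<in> pts X \<Longrightarrow> cmod (l x) \<le> nrm X x"
  by (simp add: dual_ball_def)

lemma dual_0: "l \<in> dual_ball X \<Longrightarrow> l 0 = 0"
  using dual_scale[of l 0 0] by simp

lemma dual_diff: "l \<in> dual_ball X \<Longrightarrow> x \<in> pts X \<Longrightarrow> y \<in> pts X \<Longrightarrow> l (x - y) = l x - l y"
  using dual_add[of l "x - y" y] diff_mem by simp

lemma dual_sum:
  "l \<in> dual_ball X \<Longrightarrow> (\<And>i. i \<in> I \<Longrightarrow> f i \<in> pts X) \<Longrightarrow> l (\<Sum>i\<in>I. f i) = (\<Sum>i\<in>I. l (f i))"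
proof (induction I rule: infinite_finite_induct)
  case (insert i I)
  thus ?case using dual_add[of l "f i" "\<Sum>i\<in>I. f i"] sum_mem[of I f] by fastforce
qed (auto simp: dual_0)

text \<open>Together with \<open>dual_eqI\<close>, this is how scalar estimates and identities
  become vector-valued ones below.\<close>

lemma nrm_le_dual: "x \<in> pts X \<Longrightarrow> (\<And>l. l \<in> dual_ball X \<Longrightarrow> cmod (l x) \<le> B) \<Longrightarrow> nrm X x \<le> B"
  using hahn_banach by (meson order_trans)

lemma dual_eqI:
  "x \<in> pts X \<Longrightarrow> y \<in> pts X \<Longrightarrow> (\<And>l. l \<in> dual_ball X \<Longrightarrow> l x = l y) \<Longrightarrow> x = y"
  using nrm_le_dual[of "x - y" 0] nrm_eq0[of "x - y"] nrm_ge0[of "x - y"] diff_mem dual_diff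
  by (metis eq_iff_diff_eq_0 norm_zero order_refl order_antisym)

lemma dual_nlim:
  assumes l: "l \<in> dual_ball X" and s: "nlim X s x"
  shows "(\<lambda>k. l (s k)) \<longlonglongrightarrow> l x"
proof -
  have m: "s k \<in> pts X" "x \<in> pts X" for k using s by (auto simp: nlim_def)
  have "(\<lambda>k. l (s k) - l x) \<longlonglongrightarrow> 0"
  proof (rule Lim_null_comparison)
    show "\<forall>\<^sub>F k in sequentially. norm (l (s k) - l x) \<le> nrm X (s k - x)"
      using dual_le[OF l diff_mem[OF m]] dual_diff[OF l m] by (simp add: always_eventually)
    show "(\<lambda>k. nrm X (s k - x)) \<longlonglongrightarrow> 0" using s by (simp add: nlim_def)
  qed
  thus ?thesis by (rule LIM_zero_cancel)
qed

lemma dual_continuous_on: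
  assumes l: "l \<in> dual_ball X" and f: "ncont X A f"
  shows "continuous_on A (\<lambda>x. l (f x))"
  unfolding continuous_on_def
proof
  fix a assume a: "a \<in> A"
  have "((\<lambda>x. l (f x) - l (f a)) \<longlongrightarrow> 0) (at a within A)"
  proof (rule Lim_null_comparison)
    show "\<forall>\<^sub>F x in at a within A. norm (l (f x) - l (f a)) \<le> nrm X (f x - f a)"
      unfolding eventually_at_filter
      using dual_le[OF l diff_mem] dual_diff[OF l] ncont_mem[OF f] a by (auto intro!: always_eventually)
    show "((\<lambda>x. nrm X (f x - f a)) \<longlongrightarrow> 0) (at a within A)" using f a by (simp add: ncont_def)
  qed
  thus "((\<lambda>x. l (f x)) \<longlongrightarrow> l (f a)) (at a within A)" by (rule LIM_zero_cancel)
qed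

end

section \<open>Scalar Taylor estimates; vector-valued analyticity by duality\<close>

text \<open>Cauchy's inequalities on the circle of radius \<open>3 r / 4\<close>, strictly inside
  the open ball, bound the terms by \<open>M q^k\<close>. For \<open>z\<close> within
  \<open>r / 2\<close> of the centre \<open>q \<le> 2/3\<close>, and the factor 3 is the bound for
  \<open>1 / (1 - q)\<close> in the geometric tail.\<close>

lemma taylor_remainder_bound:
  assumes f: "f holomorphic_on ball c r" and M: "\<And>z. z \<in> ball c r \<Longrightarrow> cmod (f z) \<le> M"
    and z: "z \<in> ball c (r/2)"
  shows "cmod (f z - (\<Sum>k<n. (deriv ^^ k) f c / fact k * (z - c) ^ k)) \<le> 3 * M * (2 * cmod (z - c) / r) ^ n"
proof -
  have r: "r > 0" using z by (metis ball_eq_empty empty_iff half_gt_zero_iff not_le)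
  define R where "R = 3 * r / 4"
  have R: "0 < R" "R < r" using r by (auto simp: R_def)
  have M0: "M \<ge> 0" using M[of c] r norm_ge_zero order_trans by (metis centre_in_ball)
  define q where "q = cmod (z - c) / R"
  have zr: "cmod (z - c) < r/2" using z by (simp add: dist_norm norm_minus_commute)
  have q0: "q \<ge> 0" using R by (simp add: q_def)
  have q1: "q \<le> 2/3" using zr R by (simp add: q_def R_def field_simps)
  have ql: "q \<le> 2 * cmod (z - c) / r" using r by (simp add: q_def R_def field_simps)
  define a where "a k = (deriv ^^ k) f c / fact k * (z - c) ^ k" for k
  have zb: "z \<in> ball c r" using zr r by (simp add: dist_norm norm_minus_commute)
  have s: "a sums f z"
    unfolding a_def using holomorphic_power_series[OF f zb] .
  have ab: "cmod (a k) \<le> M * q ^ k" for k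
  proof -
    have "cmod ((deriv ^^ k) f c) \<le> fact k * M / R ^ k"
    proof (rule Cauchy_inequality)
      show "f holomorphic_on ball c R" "continuous_on (cball c R) f"
        using f R by (auto intro!: holomorphic_on_subset[OF f] holomorphic_on_imp_continuous_on)
      show "cmod (f x) \<le> M" if "cmod (c - x) = R" for x
        using that R by (intro M) (simp add: dist_norm)
    qed (use R in auto)
    hence "cmod ((deriv ^^ k) f c) / fact k * cmod (z - c) ^ k \<le> M / R ^ k * cmod (z - c) ^ k"
      by (intro mult_right_mono) (auto simp: field_simps)
    thus ?thesis
      by (simp add: a_def norm_mult norm_divide norm_power q_def power_divide)
  qed
  have sm: "summable (\<lambda>k. M * q ^ (k + n))"
    using q0 q1 by (intro summable_mult summable_ignore_initial_segment summable_geometric) auto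
  have "f z - (\<Sum>k<n. a k) = (\<Sum>k. a (k + n))"
    using s suminf_minus_initial_segment[of a n] sums_unique sums_summable by metis
  also have "cmod \<dots> \<le> (\<Sum>k. M * q ^ (k + n))"
    using ab sm by (intro norm_suminf_le) auto
  also have "\<dots> = M * q ^ n * (\<Sum>k. q ^ k)"
    using q0 q1 by (subst suminf_mult[symmetric]) (auto simp: power_add mult_ac intro!: summable_geometric)
  also have "(\<Sum>k. q ^ k) = 1 / (1 - q)"
    using q0 q1 by (intro suminf_geometric) auto
  also have "M * q ^ n * (1 / (1 - q)) \<le> M * q ^ n * 3"
    using q0 q1 M0 by (intro mult_left_mono) (auto simp: field_simps)
  also have "\<dots> \<le> 3 * M * (2 * cmod (z - c) / r) ^ n"
    using power_mono[OF ql q0, of n] M0 by (simp add: mult_left_mono mult_ac)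
  finally show ?thesis unfolding a_def .
qed

lemma deriv_power_bound:
  assumes f: "f holomorphic_on ball c r" and M: "\<And>z. z \<in> ball c r \<Longrightarrow> cmod (f z) \<le> M" and r: "r > 0"
  shows "cmod ((deriv ^^ k) f c / fact k) \<le> M * (2 / r) ^ k"
proof -
  have "cmod ((deriv ^^ k) f c) \<le> fact k * M / (r/2) ^ k"
  proof (rule Cauchy_inequality)
    show "f holomorphic_on ball c (r/2)" "continuous_on (cball c (r/2)) f"
      using f r by (auto intro!: holomorphic_on_subset[OF f] holomorphic_on_imp_continuous_on)
    show "cmod (f x) \<le> M" if "cmod (c - x) = r/2" for x
      using that r by (intro M) (simp add: dist_norm)
  qed (use r in auto)
  thus ?thesis by (simp add: norm_divide field_simps power_divide)
qed

text \<open>The constant coefficient is the limit at 0, hence 0; dividing by \<open>h\<close> lowers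
  the degree and the order of smallness together.\<close>

lemma poly_small_imp_zero:
  fixes b :: "nat \<Rightarrow> complex"
  assumes "r > 0" "\<And>h. h \<noteq> 0 \<Longrightarrow> cmod h < r \<Longrightarrow> cmod (\<Sum>k<n. b k * h ^ k) \<le> C * cmod h ^ n" "k < n"
  shows "b k = 0"
  using assms(2,3)
proof (induction n arbitrary: b k)
  case (Suc n)
  have ev: "\<forall>\<^sub>F h in at (0::complex). h \<noteq> 0 \<and> cmod h < r"
    using assms(1) by (auto simp: eventually_at intro!: exI[of _ r])
  have b0: "b 0 = 0"
  proof -
    have "((\<lambda>h. \<Sum>k<Suc n. b k * h ^ k) \<longlongrightarrow> (\<Sum>k<Suc n. b k * 0 ^ k)) (at 0)"
      by (intro tendsto_intros)
    moreover have "((\<lambda>h. \<Sum>k<Suc n. b k * h ^ k) \<longlongrightarrow> 0) (at 0)"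
    proof (rule Lim_null_comparison)
      show "\<forall>\<^sub>F h in at 0. norm (\<Sum>k<Suc n. b k * h ^ k) \<le> C * cmod h ^ Suc n"
        using ev by eventually_elim (use Suc.prems in auto)
      have "((\<lambda>h::complex. C * cmod h ^ Suc n) \<longlongrightarrow> C * cmod 0 ^ Suc n) (at 0)"
        by (intro tendsto_intros)
      thus "((\<lambda>h::complex. C * cmod h ^ Suc n) \<longlongrightarrow> 0) (at 0)" by simp
    qed
    ultimately have "(\<Sum>k<Suc n. b k * 0 ^ k) = 0"
      using tendsto_unique[of "at (0::complex)"] by auto
    thus ?thesis by (subst (asm) sum.lessThan_Suc_shift) simp
  qed
  have "b (Suc k) = 0" if k: "k < n" for k
  proof (rule Suc.IH[of "\<lambda>k. b (Suc k)", OF _ k])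
    fix h :: complex assume h: "h \<noteq> 0" "cmod h < r"
    have "cmod h * cmod (\<Sum>k<n. b (Suc k) * h ^ k) = cmod (\<Sum>k<Suc n. b k * h ^ k)"
      by (subst sum.lessThan_Suc_shift)
        (simp add: b0 norm_mult[symmetric] sum_distrib_left mult_ac)
    also have "\<dots> \<le> C * cmod h ^ Suc n" by (rule Suc.prems(1)[OF h])
    finally show "cmod (\<Sum>k<n. b (Suc k) * h ^ k) \<le> C * cmod h ^ n"
      using h by (simp add: mult_ac)
  qed
  thus ?case using b0 Suc.prems(2) by (cases k) auto
qed simp

lemma analytic_into_subset: "analytic_into X f U \<Longrightarrow> V \<subseteq> U \<Longrightarrow> analytic_into X f V"
  unfolding analytic_into_def by blast

lemma growth_locally_bounded:
  assumes h: "\<And>w. w \<in> A \<Longrightarrow> h w \<le> C * (2 + cmod w) ^ n" and C: "C \<ge> 0"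
  shows "\<exists>r>0. \<exists>B. \<forall>w\<in>ball z r \<inter> A. h w \<le> (B::real)"
proof -
  have "h w \<le> C * (3 + cmod z) ^ n" if w: "w \<in> ball z 1 \<inter> A" for w
  proof -
    have "cmod w \<le> 1 + cmod z" using w norm_triangle_ineq2[of w z] by (simp add: dist_norm norm_minus_commute)
    thus ?thesis using w C by (intro order_trans[OF h] mult_left_mono power_mono) auto
  qed
  thus ?thesis using zero_less_one by blast
qed

context nsp
begin

lemma analytic_mem: "analytic_into X f U \<Longrightarrow> z \<in> U \<Longrightarrow> f z \<in> pts X"
  by (auto simp: analytic_into_def)

lemma analytic_has_cderiv: "analytic_into X f U \<Longrightarrow> z \<in> U \<Longrightarrow> has_cderiv X f (cderiv X f z) z"
  using cderiv_eqI by (fastforce simp: analytic_into_def)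

lemma has_cderiv_dual:
  assumes l: "l \<in> dual_ball X" and U: "open U" "f ` U \<subseteq> pts X" "z \<in> U" and d: "has_cderiv X f D z"
  shows "((\<lambda>w. l (f w)) has_field_derivative l D) (at z)"
  unfolding has_field_derivative_iff
proof -
  have D: "D \<in> pts X" and lim: "((\<lambda>w. nrm X (inverse (w - z) *\<^sub>C (f w - f z) - D)) \<longlongrightarrow> 0) (at z)"
    using d by (auto simp: has_cderiv_iff)
  have "((\<lambda>w. (l (f w) - l (f z)) / (w - z) - l D) \<longlongrightarrow> 0) (at z)"
  proof (rule Lim_null_comparison[OF _ lim])
    have "\<forall>\<^sub>F w in at z. w \<in> U" using U eventually_at_in_open' by blast
    thus "\<forall>\<^sub>F w in at z. norm ((l (f w) - l (f z)) / (w - z) - l D) \<le> nrm X (inverse (w - z) *\<^sub>C (f w - f z) - D)"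
    proof eventually_elim
      case (elim w)
      hence m: "f w \<in> pts X" "f z \<in> pts X" "f w - f z \<in> pts X" "inverse (w - z) *\<^sub>C (f w - f z) \<in> pts X"
        using U by (auto intro!: diff_mem scale_mem)
      have "l (inverse (w - z) *\<^sub>C (f w - f z) - D) = (l (f w) - l (f z)) / (w - z) - l D"
        by (simp add: dual_diff[OF l m(4) D] dual_scale[OF l m(3)] dual_diff[OF l m(1,2)] divide_inverse mult.commute
            del: scaleC.scale_right_diff_distrib)
      thus ?case using dual_le[OF l diff_mem[OF m(4) D]] by simp
    qed
  qed
  thus "((\<lambda>w. (l (f w) - l (f z)) / (w - z)) \<longlongrightarrow> l D) (at z)" by (rule LIM_zero_cancel)
qed

lemma analytic_dual:
  assumes U: "open U" and f: "analytic_into X f U" and l: "l \<in> dual_ball X"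
  shows "(\<lambda>z. l (f z)) holomorphic_on U"
    and "z \<in> U \<Longrightarrow> deriv (\<lambda>z. l (f z)) z = l (cderiv X f z)"
proof -
  have sub: "f ` U \<subseteq> pts X" using f by (simp add: analytic_into_def)
  have d: "((\<lambda>w. l (f w)) has_field_derivative l (cderiv X f z)) (at z)" if "z \<in> U" for z
    using has_cderiv_dual[OF l U sub that analytic_has_cderiv[OF f that]] .
  thus "(\<lambda>z. l (f z)) holomorphic_on U"
    unfolding holomorphic_on_def field_differentiable_def
    using has_field_derivative_at_within by blast
  show "z \<in> U \<Longrightarrow> deriv (\<lambda>z. l (f z)) z = l (cderiv X f z)" using d DERIV_imp_deriv by blast
qed

lemma analytic_ncont:
  assumes U: "open U" and f: "analytic_into X f U"
  shows "ncont X U f"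
  unfolding ncont_def
proof (intro ballI conjI)
  fix z assume z: "z \<in> U"
  thus fz: "f z \<in> pts X" using analytic_mem f by blast
  let ?q = "\<lambda>w. inverse (w - z) *\<^sub>C (f w - f z)"
  obtain D where D: "D \<in> pts X" and lim: "((\<lambda>w. nrm X (?q w - D)) \<longlongrightarrow> 0) (at z)"
    using analytic_has_cderiv[OF f z] by (auto simp: has_cderiv_iff)
  show "((\<lambda>w. nrm X (f w - f z)) \<longlongrightarrow> 0) (at z within U)"
  proof (rule Lim_null_comparison)
    have "\<forall>\<^sub>F w in at z. w \<in> U" using U z eventually_at_in_open' by blast
    hence "\<forall>\<^sub>F w in at z. norm (nrm X (f w - f z)) \<le> cmod (w - z) * (nrm X (?q w - D) + nrm X D)"
      using eventually_neq_at_within[of z z UNIV]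
    proof eventually_elim
      case (elim w)
      hence m: "f w \<in> pts X" "f w - f z \<in> pts X" "?q w \<in> pts X"
        using f fz analytic_mem diff_mem scale_mem by auto
      have "f w - f z = (w - z) *\<^sub>C ?q w" using elim by simp
      hence "nrm X (f w - f z) = cmod (w - z) * nrm X (?q w)" using nrm_scale[OF m(3)] by metis
      also have "\<dots> \<le> cmod (w - z) * (nrm X (?q w - D) + nrm X D)"
        using nrm_le_diff[OF m(3) D] by (simp add: mult_left_mono)
      finally show ?case using nrm_ge0[OF m(2)] by simp
    qed
    thus "\<forall>\<^sub>F w in at z within U. norm (nrm X (f w - f z)) \<le> cmod (w - z) * (nrm X (?q w - D) + nrm X D)"
      by (rule filter_leD[OF at_le[OF subset_UNIV]])
    have "((\<lambda>w. cmod (w - z) * (nrm X (?q w - D) + nrm X D)) \<longlongrightarrow> cmod (z - z) * (0 + nrm X D)) (at z)"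
      by (intro tendsto_intros lim)
    thus "((\<lambda>w. cmod (w - z) * (nrm X (?q w - D) + nrm X D)) \<longlongrightarrow> 0) (at z within U)"
      using tendsto_within_subset[of _ _ z UNIV U] by simp
  qed
qed

lemma analytic_into_cong:
  assumes U: "open U" and f: "analytic_into X f U" and eq: "\<And>z. z \<in> U \<Longrightarrow> g z = f z"
  shows "analytic_into X g U"
  unfolding analytic_into_def
proof (intro conjI ballI)
  show "g ` U \<subseteq> pts X" using f eq by (auto simp: analytic_into_def)
  fix z assume z: "z \<in> U"
  then obtain D where D: "has_cderiv X f D z" using f by (auto simp: analytic_into_def)
  have "\<forall>\<^sub>F w in at z. f w = g w" using U z eq unfolding eventually_at_topological by metis
  hence "\<forall>\<^sub>F w in at z. inverse (w - z) *\<^sub>C (f w - f z) = inverse (w - z) *\<^sub>C (g w - g z)"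
    by (rule eventually_mono) (simp add: eq[OF z])
  hence "has_cderiv X g D z" using D unfolding has_cderiv_def by (rule limitin_transform_eventually)
  thus "\<exists>D. has_cderiv X g D z" by blast
qed

lemma analytic_locally_bounded:
  assumes U: "open U" and f: "analytic_into X f U" and z: "z \<in> U"
  shows "\<exists>r>0. \<exists>B. ball z r \<subseteq> U \<and> (\<forall>w\<in>ball z r. nrm X (f w) \<le> B)"
proof -
  have c: "continuous_on U (\<lambda>w. nrm X (f w))" by (rule ncont_continuous_nrm[OF analytic_ncont[OF U f]])
  obtain r where r: "r > 0" "cball z r \<subseteq> U" using U z open_contains_cball by blast
  have "compact ((\<lambda>w. nrm X (f w)) ` cball z r)"
    by (rule compact_continuous_image[OF continuous_on_subset[OF c r(2)] compact_cball])
  hence "bounded ((\<lambda>w. nrm X (f w)) ` cball z r)" by (rule compact_imp_bounded)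
  then obtain B where B: "\<forall>y\<in>(\<lambda>w. nrm X (f w)) ` cball z r. norm y \<le> B"
    unfolding bounded_iff by blast
  have "\<forall>w\<in>ball z r. nrm X (f w) \<le> B"
  proof
    fix w assume "w \<in> ball z r"
    hence "norm (nrm X (f w)) \<le> B" using B by simp
    thus "nrm X (f w) \<le> B" by simp
  qed
  moreover have "ball z r \<subseteq> U" using r(2) ball_subset_cball by (rule order_trans[rotated])
  ultimately show ?thesis using r(1) by blast
qed

end

context bsp
begin

text \<open>Convergence of \<open>l (x k)\<close> that is uniform over the dual ball is norm
  Cauchyness by Hahn-Banach, and completeness supplies a vector representing the scalar
  limits.\<close>

lemma weak_limit:
  assumes x: "\<And>k. x k \<in> pts X" and L: "\<And>l k. l \<in> dual_ball X \<Longrightarrow> cmod (l (x k) - L l) \<le> e k" and e: "e \<longlonglongrightarrow> 0"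
  obtains D where "D \<in> pts X" "\<And>l. l \<in> dual_ball X \<Longrightarrow> l D = L l"
proof -
  have "ncauchy X x"
    unfolding ncauchy_def
  proof (intro conjI allI impI x)
    fix d :: real assume "d > 0"
    then obtain N where N: "\<And>k. k \<ge> N \<Longrightarrow> e k < d/3"
      using order_tendstoD(2)[OF e, of "d/3"] unfolding eventually_sequentially by auto
    have "nrm X (x m - x n) < d" if "m \<ge> N" "n \<ge> N" for m n
    proof -
      have "nrm X (x m - x n) \<le> e m + e n"
      proof (rule nrm_le_dual[OF diff_mem[OF x x]])
        fix l assume l: "l \<in> dual_ball X"
        show "cmod (l (x m - x n)) \<le> e m + e n"
          using L[OF l, of m] L[OF l, of n] norm_triangle_ineq4[of "l (x m) - L l" "l (x n) - L l"]
          unfolding dual_diff[OF l x x] by simp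
      qed
      thus ?thesis using N[OF that(1)] N[OF that(2)] \<open>d > 0\<close> by simp
    qed
    thus "\<exists>N. \<forall>i\<ge>N. \<forall>j\<ge>N. nrm X (x i - x j) < d" by blast
  qed
  then obtain D where D: "nlim X x D" using complete by blast
  have "l D = L l" if l: "l \<in> dual_ball X" for l
  proof -
    have "(\<lambda>k. l (x k) - L l) \<longlonglongrightarrow> 0"
      using L[OF l] by (intro Lim_null_comparison[OF _ e]) (auto intro!: always_eventually)
    from LIM_zero_cancel[OF this] show ?thesis by (rule LIMSEQ_unique[OF dual_nlim[OF l D]])
  qed
  thus ?thesis using that D by (auto simp: nlim_def)
qed

text \<open>A local norm bound makes the second-order Taylor estimate for \<open>l (f w)\<close>
  uniform in \<open>l\<close>. The scalar derivatives are therefore approached uniformly over the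
  dual ball, and \<open>weak_limit\<close> turns them into a norm derivative.\<close>

lemma weakly_analytic:
  assumes U: "open U" and m: "f ` U \<subseteq> pts X"
    and hol: "\<And>l. l \<in> dual_ball X \<Longrightarrow> (\<lambda>z. l (f z)) holomorphic_on U"
    and bd: "\<And>z. z \<in> U \<Longrightarrow> \<exists>r>0. \<exists>B. \<forall>w\<in>ball z r \<inter> U. nrm X (f w) \<le> B"
  shows "analytic_into X f U"
  unfolding analytic_into_def
proof (intro conjI ballI m)
  fix z assume z: "z \<in> U"
  have mem: "f w \<in> pts X" if "w \<in> U" for w using m that by blast
  obtain r1 B where r1: "r1 > 0" "\<And>w. w \<in> ball z r1 \<inter> U \<Longrightarrow> nrm X (f w) \<le> B" using bd[OF z] by blast
  obtain r2 where r2: "r2 > 0" "ball z r2 \<subseteq> U" using U z open_contains_ball by blast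
  define r where "r = min r1 r2"
  have r: "r > 0" "ball z r \<subseteq> U" "\<And>w. w \<in> ball z r \<Longrightarrow> nrm X (f w) \<le> B"
    using r1 r2 by (auto simp: r_def subset_iff)
  define q where "q w = inverse (w - z) *\<^sub>C (f w - f z)" for w
  have qm: "q w \<in> pts X" if "w \<in> U" for w
    unfolding q_def using that z mem by (simp add: diff_mem scale_mem)
  define C where "C = 3 * B * (2/r)^2"
  have key: "cmod (l (q w) - deriv (\<lambda>z. l (f z)) z) \<le> C * cmod (w - z)"
    if l: "l \<in> dual_ball X" and w: "w \<in> ball z (r/2)" "w \<noteq> z" for l w
  proof -
    let ?f = "\<lambda>z. l (f z)"
    have h: "?f holomorphic_on ball z r" using hol[OF l] r(2) holomorphic_on_subset by blast
    have b: "cmod (?f w) \<le> B" if "w \<in> ball z r" for w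
      using dual_le[OF l mem] r that by (meson order_trans subset_iff)
    have wU: "w \<in> U" using w r by (auto simp: subset_iff)
    have "cmod (?f w - (\<Sum>k<2. (deriv ^^ k) ?f z / fact k * (w - z) ^ k)) \<le> 3 * B * (2 * cmod (w - z) / r)^2"
      by (rule taylor_remainder_bound[OF h b w(1)])
    moreover have "?f w - (\<Sum>k<2. (deriv ^^ k) ?f z / fact k * (w - z) ^ k) = (w - z) * (l (q w) - deriv ?f z)"
    proof -
      have "l (q w) = inverse (w - z) * (l (f w) - l (f z))"
        unfolding q_def by (simp only: dual_scale[OF l diff_mem[OF mem mem]] dual_diff[OF l mem mem] wU z)
      thus ?thesis using w(2) by (simp add: numeral_2_eq_2 field_simps)
    qed
    ultimately have "cmod (w - z) * cmod (l (q w) - deriv ?f z) \<le> 3 * B * (2 * cmod (w - z) / r)^2"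
      by (simp only: norm_mult)
    also have "\<dots> = cmod (w - z) * (C * cmod (w - z))"
      by (simp add: C_def power2_eq_square)
    finally have "cmod (w - z) * cmod (l (q w) - deriv ?f z) \<le> cmod (w - z) * (C * cmod (w - z))" .
    thus ?thesis using w(2) by simp
  qed
  have C0: "C \<ge> 0" using r(3)[of z] r(1) nrm_ge0[OF mem[OF z]] by (simp add: C_def)
  \<comment> \<open>Any sequence tending to \<open>z\<close> inside the half ball serves to produce
    the derivative; convergence of the quotients along all \<open>w\<close> then follows from
    \<open>key\<close> again.\<close>
  define h where "h k = z + of_real (r / (4 * (real k + 1)))" for k
  have hz: "cmod (h k - z) = r / (4 * (real k + 1))" for k
    using r(1) by (simp add: h_def del: of_real_divide of_real_mult)
  have hb: "h k \<in> ball z (r/2)" "h k \<noteq> z" for k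
  proof -
    have "r / (4 * (real k + 1)) \<le> r / 4" using r(1) by (intro divide_left_mono) auto
    also have "\<dots> < r/2" using r(1) by simp
    finally show "h k \<in> ball z (r/2)" using hz[of k] by (simp add: dist_norm norm_minus_commute)
    show "h k \<noteq> z" using hz[of k] r(1) by auto
  qed
  have hU: "h k \<in> U" for k using hb[of k] r by (auto simp: subset_iff)
  have lim0: "(\<lambda>k. r / (4 * (real k + 1))) \<longlonglongrightarrow> 0"
    by real_asymp
  obtain D where Dm: "D \<in> pts X" and lD: "\<And>l. l \<in> dual_ball X \<Longrightarrow> l D = deriv (\<lambda>z. l (f z)) z"
  proof (rule weak_limit)
    show "q (h k) \<in> pts X" for k using qm hU by blast
    show "cmod (l (q (h k)) - deriv (\<lambda>z. l (f z)) z) \<le> C * (r / (4 * (real k + 1)))" if "l \<in> dual_ball X" for l k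
      using key[OF that hb] hz by simp
    show "(\<lambda>k. C * (r / (4 * (real k + 1)))) \<longlonglongrightarrow> 0" using tendsto_mult_right_zero[OF lim0] by simp
  qed (rule that)
  have nb: "nrm X (q w - D) \<le> C * cmod (w - z)" if w: "w \<in> ball z (r/2)" "w \<noteq> z" for w
  proof (rule nrm_le_dual)
    have wU: "w \<in> U" using w r by (auto simp: subset_iff)
    thus "q w - D \<in> pts X" using qm Dm diff_mem by blast
    fix l assume l: "l \<in> dual_ball X"
    thus "cmod (l (q w - D)) \<le> C * cmod (w - z)"
      using key[OF l w] lD[OF l] dual_diff[OF l qm[OF wU] Dm] by simp
  qed
  have ev: "\<forall>\<^sub>F w in at z. w \<in> ball z (r/2) \<and> w \<noteq> z"
    using r(1) by (intro eventually_conj eventually_at_in_open' eventually_neq_at_within) auto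
  have "has_cderiv X f D z"
    unfolding has_cderiv_iff q_def[symmetric]
  proof (intro conjI Dm)
    show "\<forall>\<^sub>F w in at z. q w \<in> pts X"
      using ev by eventually_elim (use qm r in \<open>auto simp: subset_iff\<close>)
    show "((\<lambda>w. nrm X (q w - D)) \<longlongrightarrow> 0) (at z)"
    proof (rule Lim_null_comparison)
      show "\<forall>\<^sub>F w in at z. norm (nrm X (q w - D)) \<le> C * cmod (w - z)"
        using ev
      proof eventually_elim
        case (elim w)
        hence "q w - D \<in> pts X" using qm Dm diff_mem r by (auto simp: subset_iff)
        thus ?case using nb[of w] elim nrm_ge0[of "q w - D"] by simp
      qed
      have "((\<lambda>w. C * cmod (w - z)) \<longlongrightarrow> C * cmod (z - z)) (at z)" by (intro tendsto_intros)
      thus "((\<lambda>w. C * cmod (w - z)) \<longlongrightarrow> 0) (at z)" by simp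
    qed
  qed
  thus "\<exists>D. has_cderiv X f D z" by blast
qed

text \<open>
  Scalar extensions of \<open>l \<circ> f\<close> across a set with empty interior assemble to a vector-valued
  one: the uniform local bound makes them equicontinuous, so \<open>f\<close> is Cauchy along sequences in \<open>D\<close>.
\<close>

lemma weak_extension:
  assumes U: "open U" and D: "D \<subseteq> U" "U \<subseteq> closure D" and m: "f ` D \<subseteq> pts X"
    and hol: "\<And>l. l \<in> dual_ball X \<Longrightarrow> F l holomorphic_on U"
    and eq: "\<And>l z. l \<in> dual_ball X \<Longrightarrow> z \<in> D \<Longrightarrow> F l z = l (f z)"
    and bd: "\<And>z. z \<in> U \<Longrightarrow> \<exists>r>0. \<exists>B. \<forall>l\<in>dual_ball X. \<forall>w\<in>ball z r \<inter> U. cmod (F l w) \<le> B"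
  shows "\<exists>g. analytic_into X g U \<and> (\<forall>z\<in>D. g z = f z) \<and> (\<forall>l\<in>dual_ball X. \<forall>z\<in>U. l (g z) = F l z)"
proof -
  have ex: "\<exists>x\<in>pts X. \<forall>l\<in>dual_ball X. l x = F l z" if z: "z \<in> U" for z
  proof -
    obtain r1 B where r1: "r1 > 0" "\<And>l w. l \<in> dual_ball X \<Longrightarrow> w \<in> ball z r1 \<inter> U \<Longrightarrow> cmod (F l w) \<le> B"
      using bd[OF z] by metis
    obtain r2 where r2: "r2 > 0" "ball z r2 \<subseteq> U" using U z open_contains_ball by blast
    define r where "r = min r1 r2"
    have r: "r > 0" "ball z r \<subseteq> U" "\<And>l w. l \<in> dual_ball X \<Longrightarrow> w \<in> ball z r \<Longrightarrow> cmod (F l w) \<le> B"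
      using r1 r2 by (auto simp: r_def subset_iff)
    define C where "C = 3 * B * (2 / r)"
    have key: "cmod (F l w - F l z) \<le> C * cmod (w - z)" if l: "l \<in> dual_ball X" and w: "w \<in> ball z (r/2)" for l w
    proof -
      have "F l holomorphic_on ball z r" using hol[OF l] r(2) holomorphic_on_subset by blast
      from taylor_remainder_bound[OF this r(3)[OF l] w, of 1]
      show ?thesis by (simp add: C_def field_simps)
    qed
    have "z \<in> closure D" using z D by blast
    then obtain s0 where s0: "\<And>k. s0 k \<in> D" "s0 \<longlonglongrightarrow> z" unfolding closure_sequential by blast
    have "\<forall>\<^sub>F k in sequentially. dist (s0 k) z < r/2" using s0(2) r(1) tendstoD half_gt_zero by blast
    then obtain N0 where N0: "\<And>k. k \<ge> N0 \<Longrightarrow> dist (s0 k) z < r/2" unfolding eventually_sequentially by blast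
    define s where "s k = s0 (k + N0)" for k
    have s: "s k \<in> D" "s k \<in> ball z (r/2)" for k
      using s0(1) N0[of "k + N0"] by (auto simp: s_def dist_commute)
    have slim: "s \<longlonglongrightarrow> z" unfolding s_def using LIMSEQ_ignore_initial_segment[OF s0(2)] .
    have cl: "(\<lambda>k. C * cmod (s k - z)) \<longlonglongrightarrow> 0"
      using tendsto_mult_right_zero[OF tendsto_norm_zero[OF LIM_zero[OF slim]]] by simp
    show ?thesis
    proof (rule weak_limit[of "\<lambda>k. f (s k)" "\<lambda>l. F l z"])
      show "f (s k) \<in> pts X" for k using m s by blast
      show "cmod (l (f (s k)) - F l z) \<le> C * cmod (s k - z)" if "l \<in> dual_ball X" for l k
        using key[OF that s(2)] eq[OF that s(1)] by simp
    qed (rule cl, blast)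
  qed
  define g where "g z = (SOME x. x \<in> pts X \<and> (\<forall>l\<in>dual_ball X. l x = F l z))" for z
  have g: "g z \<in> pts X" "\<And>l. l \<in> dual_ball X \<Longrightarrow> l (g z) = F l z" if "z \<in> U" for z
    using someI_ex[OF ex[OF that, unfolded Bex_def]] unfolding g_def by auto
  have "g z = f z" if "z \<in> D" for z
    using g[of z] eq[OF _ that] m D(1) that by (intro dual_eqI) auto
  moreover have "analytic_into X g U"
  proof (rule weakly_analytic[OF U])
    show "g ` U \<subseteq> pts X" using g by blast
    show "(\<lambda>z. l (g z)) holomorphic_on U" if "l \<in> dual_ball X" for l
      using hol[OF that] g(2)[OF _ that] by (simp cong: holomorphic_cong)
    fix z assume "z \<in> U"
    then obtain r B where rB: "r > 0" "\<forall>l\<in>dual_ball X. \<forall>w\<in>ball z r \<inter> U. cmod (F l w) \<le> B" using bd by blast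
    hence "\<forall>w\<in>ball z r \<inter> U. nrm X (g w) \<le> B" using g by (auto intro!: nrm_le_dual)
    thus "\<exists>r>0. \<exists>B. \<forall>w\<in>ball z r \<inter> U. nrm X (g w) \<le> B" using rB(1) by blast
  qed
  ultimately show ?thesis using g by blast
qed

text \<open>The derivative is weakly holomorphic, and Cauchy's inequality on balls of half the
  radius bounds it locally, so \<open>weakly_analytic\<close> applies to it.\<close>

lemma analytic_cderiv:
  assumes U: "open U" and f: "analytic_into X f U"
  shows "analytic_into X (cderiv X f) U"
proof (rule weakly_analytic[OF U])
  have mem: "cderiv X f z \<in> pts X" if "z \<in> U" for z
    using analytic_has_cderiv[OF f that] by (simp add: has_cderiv_iff)
  thus "cderiv X f ` U \<subseteq> pts X" by blast
  show "(\<lambda>z. l (cderiv X f z)) holomorphic_on U" if "l \<in> dual_ball X" for l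
    using holomorphic_deriv[OF analytic_dual(1)[OF U f that] U] analytic_dual(2)[OF U f that]
    by (simp cong: holomorphic_cong)
  fix z assume z: "z \<in> U"
  obtain r B where r: "r > 0" "ball z r \<subseteq> U" "\<And>w. w \<in> ball z r \<Longrightarrow> nrm X (f w) \<le> B"
    using analytic_locally_bounded[OF U f z] by blast
  have "nrm X (cderiv X f w) \<le> B * (2 / (r/2)) ^ 1" if w: "w \<in> ball z (r/2) \<inter> U" for w
  proof (rule nrm_le_dual)
    show "cderiv X f w \<in> pts X" using mem w by blast
    fix l assume l: "l \<in> dual_ball X"
    have sub: "ball w (r/2) \<subseteq> ball z r" 
    proof
      fix x assume "x \<in> ball w (r/2)"
      thus "x \<in> ball z r" using dist_triangle[of z x w] w by simp
    qed
    have "cmod ((deriv ^^ 1) (\<lambda>z. l (f z)) w / fact 1) \<le> B * (2 / (r/2)) ^ 1"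
    proof (rule deriv_power_bound)
      show "(\<lambda>z. l (f z)) holomorphic_on ball w (r/2)"
        using analytic_dual(1)[OF U f l] sub r(2) by (meson holomorphic_on_subset)
      show "cmod (l (f x)) \<le> B" if "x \<in> ball w (r/2)" for x
        using that sub r(2,3) dual_le[OF l analytic_mem[OF f]] by (meson order_trans subset_iff)
    qed (use r in auto)
    thus "cmod (l (cderiv X f w)) \<le> B * (2 / (r/2)) ^ 1"
      using analytic_dual(2)[OF U f l] w by simp
  qed
  thus "\<exists>r>0. \<exists>B. \<forall>w\<in>ball z r \<inter> U. nrm X (cderiv X f w) \<le> B"
    using r(1) half_gt_zero by blast
qed

lemma analytic_higher_cderiv:
  assumes U: "open U" and f: "analytic_into X f U"
  shows "analytic_into X ((cderiv X ^^ k) f) U"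
    and "l \<in> dual_ball X \<Longrightarrow> z \<in> U \<Longrightarrow> l ((cderiv X ^^ k) f z) = (deriv ^^ k) (\<lambda>z. l (f z)) z"
proof -
  show a: "analytic_into X ((cderiv X ^^ k) f) U" for k
    by (induction k) (auto intro: f analytic_cderiv[OF U])
  show "l \<in> dual_ball X \<Longrightarrow> z \<in> U \<Longrightarrow> l ((cderiv X ^^ k) f z) = (deriv ^^ k) (\<lambda>z. l (f z)) z"
  proof (induction k arbitrary: z)
    case (Suc k)
    have "l ((cderiv X ^^ Suc k) f z) = deriv (\<lambda>z. l ((cderiv X ^^ k) f z)) z"
      using analytic_dual(2)[OF U a Suc.prems] by simp
    also have "\<dots> = deriv ((deriv ^^ k) (\<lambda>z. l (f z))) z"
    proof (rule deriv_cong_ev)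
      show "\<forall>\<^sub>F w in nhds z. l ((cderiv X ^^ k) f w) = (deriv ^^ k) (\<lambda>z. l (f z)) w"
        using Suc U by (auto simp: eventually_nhds intro!: exI[of _ U])
    qed simp
    finally show ?case by simp
  qed simp
qed

lemma taylor_array_mem:
  assumes "open U" "analytic_into X f U" "z \<in> U"
  shows "taylor_array X n z f i \<in> pts X"
  using analytic_mem[OF analytic_higher_cderiv(1)[OF assms(1,2)] assms(3)]
  by (simp add: taylor_array_def scale_mem)

lemma dual_taylor_array:
  assumes "open U" "analytic_into X f U" "z \<in> U" "l \<in> dual_ball X" "i < n"
  shows "l (taylor_array X n z f i) = (deriv ^^ (n - 1 - i)) (\<lambda>z. l (f z)) z / fact (n - 1 - i)"
  using analytic_mem[OF analytic_higher_cderiv(1)[OF assms(1,2)] assms(3)]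
    analytic_higher_cderiv(2)[OF assms(1,2,4,3)] assms(4,5)
  by (simp add: taylor_array_def dual_scale field_simps)

lemma sum_taylor_array:
  assumes "open U" "analytic_into X f U" "z \<in> U" "l \<in> dual_ball X"
  shows "(\<Sum>i<n. l (taylor_array X n z f i) * (w - z) ^ (n - 1 - i)) =
    (\<Sum>k<n. (deriv ^^ k) (\<lambda>z. l (f z)) z / fact k * (w - z) ^ k)"
  using dual_taylor_array[OF assms] 
  by (subst sum.nat_diff_reindex[symmetric]) (auto intro!: sum.cong)

lemma taylor_array_remainder:
  assumes f: "analytic_into X f (ball z r)" and l: "l \<in> dual_ball X"
    and M: "\<And>w. w \<in> ball z r \<Longrightarrow> nrm X (f w) \<le> M" and w: "w \<in> ball z (r/2)"
  shows "cmod (l (f w) - (\<Sum>i<n. l (taylor_array X n z f i) * (w - z) ^ (n - 1 - i)))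
    \<le> 3 * M * (2 * cmod (w - z) / r) ^ n"
proof -
  have r: "z \<in> ball z r" using w by (metis ball_eq_empty centre_in_ball empty_iff half_gt_zero_iff not_le)
  show ?thesis
    unfolding sum_taylor_array[OF open_ball f r l]
    by (rule taylor_remainder_bound[OF analytic_dual(1)[OF open_ball f l] _ w])
      (meson M analytic_mem dual_le f l order_trans)
qed

lemma taylor_array_nrm_le:
  assumes f: "analytic_into X f (ball z r)" and M: "\<And>w. w \<in> ball z r \<Longrightarrow> nrm X (f w) \<le> M"
    and r: "r > 0" and i: "i < n"
  shows "nrm X (taylor_array X n z f i) \<le> M * (2 / r) ^ (n - 1 - i)"
proof (rule nrm_le_dual)
  have z: "z \<in> ball z r" using r by simp
  show "taylor_array X n z f i \<in> pts X" by (rule taylor_array_mem[OF open_ball f z])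
  fix l assume l: "l \<in> dual_ball X"
  show "cmod (l (taylor_array X n z f i)) \<le> M * (2 / r) ^ (n - 1 - i)"
    unfolding dual_taylor_array[OF open_ball f z l i]
    by (rule deriv_power_bound[OF analytic_dual(1)[OF open_ball f l] _ r])
      (meson M analytic_mem dual_le f l order_trans)
qed

text \<open>A weak Taylor expansion to order \<open>n\<close>, in which constant and radius may
  depend on the functional. Entry \<open>i\<close> carries the power \<open>n - 1 - i\<close>,
  matching the reversed order of arrays. It allows arrays to be computed without
  differentiating.\<close>

definition jet :: "nat \<Rightarrow> complex \<Rightarrow> (complex \<Rightarrow> 'v) \<Rightarrow> (nat \<Rightarrow> 'v) \<Rightarrow> bool"
  where "jet n z f x \<longleftrightarrow> (\<forall>l\<in>dual_ball X. \<exists>C. \<exists>r>0. \<forall>w\<in>ball z r.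
    cmod (l (f w) - (\<Sum>i<n. l (x i) * (w - z) ^ (n - 1 - i))) \<le> C * cmod (w - z) ^ n)"

lemma taylor_array_jet:
  assumes U: "open U" "analytic_into X f U" "z \<in> U"
  shows "jet n z f (taylor_array X n z f)"
proof -
  obtain r B where r: "r > 0" "ball z r \<subseteq> U" "\<And>w. w \<in> ball z r \<Longrightarrow> nrm X (f w) \<le> B"
    using analytic_locally_bounded[OF U] by blast
  have f: "analytic_into X f (ball z r)" using U(2) r(2) by (auto simp: analytic_into_def)
  show ?thesis
    unfolding jet_def
  proof
    fix l assume l: "l \<in> dual_ball X"
    have "cmod (l (f w) - (\<Sum>i<n. l (taylor_array X n z f i) * (w - z) ^ (n - 1 - i)))
        \<le> (3 * B * (2 / r) ^ n) * cmod (w - z) ^ n" if w: "w \<in> ball z (r/2)" for w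
      using taylor_array_remainder[OF f l r(3) w] by (simp add: power_mult_distrib power_divide mult_ac)
    thus "\<exists>C. \<exists>r>0. \<forall>w\<in>ball z r.
        cmod (l (f w) - (\<Sum>i<n. l (taylor_array X n z f i) * (w - z) ^ (n - 1 - i))) \<le> C * cmod (w - z) ^ n"
      using half_gt_zero[OF r(1)] by blast
  qed
qed

text \<open>The difference of the two expansions is a polynomial of degree below \<open>n\<close>
  that is of order \<open>n\<close> at the origin, hence zero by
  \<open>poly_small_imp_zero\<close>.\<close>

lemma jet_unique:
  assumes "jet n z f x" "jet n z f y" "\<And>i. i < n \<Longrightarrow> x i \<in> pts X" "\<And>i. i < n \<Longrightarrow> y i \<in> pts X" "i < n"
  shows "x i = y i"
proof (rule dual_eqI[OF assms(3,4)[OF assms(5)]])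
  fix l assume l: "l \<in> dual_ball X"
  obtain C r where C: "r > 0" "\<And>w. w \<in> ball z r \<Longrightarrow>
      cmod (l (f w) - (\<Sum>i<n. l (x i) * (w - z) ^ (n - 1 - i))) \<le> C * cmod (w - z) ^ n"
    using assms(1) l unfolding jet_def by metis
  obtain C' r' where C': "r' > 0" "\<And>w. w \<in> ball z r' \<Longrightarrow>
      cmod (l (f w) - (\<Sum>i<n. l (y i) * (w - z) ^ (n - 1 - i))) \<le> C' * cmod (w - z) ^ n"
    using assms(2) l unfolding jet_def by metis
  define b where "b k = l (x (n - 1 - k)) - l (y (n - 1 - k))" for k
  have "b (n - 1 - i) = 0"
  proof (rule poly_small_imp_zero[where r = "min r r'" and n = n and b = b and C = "C + C'"])
    fix h :: complex assume h: "cmod h < min r r'"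
    have "(\<Sum>k<n. b k * h ^ k) = (\<Sum>i<n. (l (x i) - l (y i)) * h ^ (n - 1 - i))"
      by (subst sum.nat_diff_reindex[symmetric]) (auto simp: b_def intro!: sum.cong)
    also have "\<dots> = (\<Sum>i<n. l (x i) * h ^ (n - 1 - i)) - (\<Sum>i<n. l (y i) * h ^ (n - 1 - i))"
      by (simp add: sum_subtractf left_diff_distrib)
    finally have e: "(\<Sum>k<n. b k * h ^ k) =
      (l (f (z + h)) - (\<Sum>i<n. l (y i) * h ^ (n - 1 - i))) - (l (f (z + h)) - (\<Sum>i<n. l (x i) * h ^ (n - 1 - i)))"
      by simp
    show "cmod (\<Sum>k<n. b k * h ^ k) \<le> (C + C') * cmod h ^ n"
      unfolding e using C(2)[of "z + h"] C'(2)[of "z + h"] h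
      by (intro norm_triangle_le_diff) (simp add: dist_norm algebra_simps)
  qed (use C C' assms(5) in auto)
  thus "l (x i) = l (y i)" using assms(5) by (simp add: b_def)
qed

lemma taylor_array_eqI:
  assumes U: "open U" "analytic_into X f U" "z \<in> U"
    and x: "\<And>i. i < n \<Longrightarrow> x i \<in> pts X" "\<And>i. i \<ge> n \<Longrightarrow> x i = 0" and j: "jet n z f x"
  shows "taylor_array X n z f = x"
proof
  fix i show "taylor_array X n z f i = x i"
    using jet_unique[OF taylor_array_jet[OF U] j taylor_array_mem[OF U] x(1)] x(2)
    by (cases "i < n") (auto simp: taylor_array_def)
qed

end

section \<open>Completeness of powers and quotients\<close>

context nsp
begin

text \<open>The right-hand side is the exact partial sum of the geometric series; keeping the
  subtracted term lets the induction close.\<close>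

lemma fast_telescope:
  assumes s: "\<And>k. s k \<in> pts X" "\<And>k. nrm X (s (Suc k) - s k) \<le> C * (1/2) ^ k" and mn: "m \<le> n"
  shows "nrm X (s n - s m) \<le> 2 * C * (1/2) ^ m - 2 * C * (1/2) ^ n"
  using mn
proof (induction n rule: dec_induct)
  case (step n)
  have "nrm X (s (Suc n) - s m) \<le> nrm X (s (Suc n) - s n) + nrm X (s n - s m)"
    using nrm_tri s(1) by blast
  thus ?case using s(2)[of n] step.IH by simp
qed simp

lemma fast_ncauchy:
  assumes s: "\<And>k. s k \<in> pts X" "\<And>k. nrm X (s (Suc k) - s k) \<le> C * (1/2) ^ k"
  shows "ncauchy X s"
  unfolding ncauchy_def
proof (intro conjI allI impI s(1))
  fix e :: real assume e: "e > 0"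
  have C: "C \<ge> 0" using s(2)[of 0] nrm_ge0[OF diff_mem[OF s(1)[of "Suc 0"] s(1)[of 0]]] by simp
  have "(\<lambda>k. 2 * C * (1/2::real) ^ k) \<longlonglongrightarrow> 2 * C * 0" by (intro tendsto_intros LIMSEQ_power_zero) simp
  hence "\<forall>\<^sub>F k in sequentially. 2 * C * (1/2::real) ^ k < e" using e order_tendstoD(2) by force
  then obtain N where N: "\<And>k. k \<ge> N \<Longrightarrow> 2 * C * (1/2::real) ^ k < e" unfolding eventually_sequentially by blast
  have le: "nrm X (s n - s m) < e" if "m \<le> n" "m \<ge> N" for m n
  proof -
    have "nrm X (s n - s m) \<le> 2 * C * (1/2) ^ m - 2 * C * (1/2) ^ n"
      by (rule fast_telescope[OF s that(1)])
    moreover have "2 * C * (1/2::real) ^ n \<ge> 0" using C by simp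
    ultimately show ?thesis using N[OF that(2)] by linarith
  qed
  have "nrm X (s m - s n) < e" if "m \<ge> N" "n \<ge> N" for m n
    using le[of m n] le[of n m] nrm_commute[OF s(1) s(1), of m n] that by (cases "m \<le> n") auto
  thus "\<exists>N. \<forall>m\<ge>N. \<forall>n\<ge>N. nrm X (s m - s n) < e" by blast
qed

text \<open>Completeness need only be tested on sequences with geometrically small steps. In
  quotients and sums these are the ones whose increments can be lifted or split with summable
  norms.\<close>

lemma banach_spaceI_fast:
  assumes "\<And>s. (\<And>k. s k \<in> pts X) \<Longrightarrow> (\<And>k. nrm X (s (Suc k) - s k) < (1/2) ^ k) \<Longrightarrow> \<exists>x. nlim X s x"
  shows "banach_space X"
proof (rule bspI)
  fix s assume c: "ncauchy X s"
  hence m: "\<And>k. s k \<in> pts X" and c': "\<And>e. e > 0 \<Longrightarrow> \<exists>N. \<forall>i\<ge>N. \<forall>j\<ge>N. nrm X (s i - s j) < e"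
    by (auto simp: ncauchy_def)
  obtain N where N: "\<And>k i j. i \<ge> N k \<Longrightarrow> j \<ge> N k \<Longrightarrow> nrm X (s i - s j) < (1/2) ^ k"
    using c'[of "(1/2) ^ k" for k] by (metis zero_less_power half_gt_zero zero_less_one)
  \<comment> \<open>Partial sums make the indices nondecreasing, so that both \<open>r k\<close> and
    \<open>r (Suc k)\<close> lie beyond \<open>N k\<close>.\<close>
  define r where "r k = (\<Sum>i\<le>k. N i)" for k
  have r1: "r k \<ge> N k" for k unfolding r_def by (rule member_le_sum) auto
  have r: "r k \<ge> N k" "r (Suc k) \<ge> N k" for k using r1[of k] by (auto simp: r_def)
  obtain x where x: "nlim X (\<lambda>k. s (r k)) x"
    using assms[of "\<lambda>k. s (r k)"] m N[OF r(2) r(1)] by blast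
  hence xm: "x \<in> pts X" and lx: "(\<lambda>k. nrm X (s (r k) - x)) \<longlonglongrightarrow> 0" by (auto simp: nlim_def)
  have "(\<lambda>k. nrm X (s k - x)) \<longlonglongrightarrow> 0"
  proof (rule LIMSEQ_I)
    fix e :: real assume e: "e > 0"
    have "\<forall>\<^sub>F k in sequentially. nrm X (s (r k) - x) < e/2" using lx e order_tendstoD(2) half_gt_zero by blast
    moreover have "\<forall>\<^sub>F k in sequentially. (1/2::real) ^ k < e/2"
      using LIMSEQ_power_zero[of "1/2::real"] e order_tendstoD(2)[of _ 0 _ "e/2"] by force
    ultimately have "\<forall>\<^sub>F k in sequentially. nrm X (s (r k) - x) < e/2 \<and> (1/2::real) ^ k < e/2"
      by (rule eventually_conj)
    then obtain k where k: "nrm X (s (r k) - x) < e/2" "(1/2::real) ^ k < e/2"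
      using eventually_happens'[OF sequentially_bot] by blast
    have "norm (nrm X (s n - x) - 0) < e" if "n \<ge> N k" for n
      using nrm_tri[OF m m xm, of n "r k"] N[OF that r(1)] k nrm_ge0[OF diff_mem[OF m xm], of n] by simp
    thus "\<exists>no. \<forall>n\<ge>no. norm (nrm X (s n - x) - 0) < e" by blast
  qed
  thus "\<exists>x. nlim X s x" using m xm by (auto simp: nlim_def)
qed

end

lemma (in bsp) fast_limit:
  assumes s: "\<And>k. s k \<in> pts X" "\<And>k. nrm X (s (Suc k) - s k) \<le> C * (1/2) ^ k"
  obtains x where "nlim X s x" "nrm X (x - s 0) \<le> 2 * C"
proof -
  obtain x where x: "nlim X s x" using complete[OF fast_ncauchy[OF s]] by blast
  have C: "C \<ge> 0" using s(2)[of 0] nrm_ge0[OF diff_mem[OF s(1)[of "Suc 0"] s(1)[of 0]]] by simp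
  have "nlim X (\<lambda>k. s k - s 0) (x - s 0)"
    using x s(1) diff_mem by (simp add: nlim_def)
  moreover have "nrm X (s k - s 0) \<le> 2 * C" for k
  proof -
    have "nrm X (s k - s 0) \<le> 2 * C * (1/2) ^ 0 - 2 * C * (1/2) ^ k"
      by (rule fast_telescope[OF s]) simp
    moreover have "2 * C * (1/2::real) ^ k \<ge> 0" using C by simp
    ultimately show ?thesis by simp
  qed
  ultimately show ?thesis using that x nlim_nrm_le by blast
qed

lemma nsp_powerspace_nrm:
  assumes "n \<ge> 1"
  shows "i < n \<Longrightarrow> nrm X (x i) \<le> nrm (power_space n X) x"
    and "(\<And>i. i < n \<Longrightarrow> nrm X (x i) \<le> B) \<Longrightarrow> nrm (power_space n X) x \<le> B"
    and "\<exists>i<n. nrm (power_space n X) x = nrm X (x i)"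
proof -
  have f: "finite ((\<lambda>i. nrm X (x i)) ` {..<n})" "(\<lambda>i. nrm X (x i)) ` {..<n} \<noteq> {}" using assms by (auto simp: lessThan_empty_iff)
  show "i < n \<Longrightarrow> nrm X (x i) \<le> nrm (power_space n X) x" using f by (simp add: power_space_def)
  show "(\<And>i. i < n \<Longrightarrow> nrm X (x i) \<le> B) \<Longrightarrow> nrm (power_space n X) x \<le> B" using f by (auto simp: power_space_def)
  show "\<exists>i<n. nrm (power_space n X) x = nrm X (x i)" using Max_in[OF f] by (auto simp: power_space_def)
qed

lemma power_space_pts: "x \<in> pts (power_space n X) \<longleftrightarrow> (\<forall>i<n. x i \<in> pts X) \<and> (\<forall>i\<ge>n. x i = 0)"
  by (simp add: power_space_def)

lemma normed_power_space:
  assumes "normed_space X" "n \<ge> 1"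
  shows "normed_space (power_space n X)"
proof -
  interpret nsp X by unfold_locales fact
  let ?P = "power_space n X"
  note N = nsp_powerspace_nrm[OF assms(2)]
  show ?thesis
    unfolding normed_space_def
  proof (intro conjI ballI allI)
    show "module.subspace (*\<^sub>C) (pts ?P)"
      unfolding scaleC.subspace_def by (auto simp: power_space_pts add_mem scale_mem scaleC_fun_def)
    fix x :: "nat \<Rightarrow> 'a" assume x: "x \<in> pts ?P"
    hence xm: "\<And>i. i < n \<Longrightarrow> x i \<in> pts X" "\<And>i. i \<ge> n \<Longrightarrow> x i = 0" by (auto simp: power_space_pts)
    show "0 \<le> nrm ?P x" using N(3)[of X x] nrm_ge0 xm(1) by metis
    show "nrm ?P x = 0 \<longleftrightarrow> x = 0"
    proof
      assume z: "nrm ?P x = 0"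
      have "x i = 0" for i
      proof (cases "i < n")
        case True
        thus ?thesis using N(1)[OF True, of X x] nrm_eq0[OF xm(1)] nrm_ge0[OF xm(1)] z by fastforce
      qed (use xm in auto)
      thus "x = 0" by auto
    next
      assume "x = 0" thus "nrm ?P x = 0" using N(3)[of X x] by auto
    qed
    have le: "nrm ?P (c *\<^sub>C x) \<le> cmod c * nrm ?P x" for c
      by (rule N(2)) (use N(1)[of _ X x] in \<open>simp add: scaleC_fun_def nrm_scale xm mult_left_mono\<close>)
    show "nrm ?P (c *\<^sub>C x) = cmod c * nrm ?P x" for c
    proof (rule antisym[OF le])
      obtain i where i: "i < n" "nrm ?P x = nrm X (x i)" using N(3)[of X x] by blast
      show "cmod c * nrm ?P x \<le> nrm ?P (c *\<^sub>C x)"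
        using N(1)[OF i(1), of X "c *\<^sub>C x"] i xm by (simp add: scaleC_fun_def nrm_scale)
    qed
    fix y :: "nat \<Rightarrow> 'a" assume y: "y \<in> pts ?P"
    hence ym: "\<And>i. i < n \<Longrightarrow> y i \<in> pts X" by (auto simp: power_space_pts)
    show "nrm ?P (x + y) \<le> nrm ?P x + nrm ?P y"
    proof (rule N(2))
      fix i assume i: "i < n"
      show "nrm X ((x + y) i) \<le> nrm ?P x + nrm ?P y"
        using nrm_add[OF xm(1)[OF i] ym[OF i]] N(1)[OF i, of X x] N(1)[OF i, of X y] by simp
    qed
  qed
qed

lemma banach_power_space:
  assumes "banach_space X" "n \<ge> 1"
  shows "banach_space (power_space n X)"
proof -
  interpret bsp X by unfold_locales fact
  interpret P: nsp "power_space n X" by unfold_locales (rule normed_power_space[OF normed assms(2)])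
  note N = nsp_powerspace_nrm[OF assms(2)]
  show ?thesis
  proof (rule P.bspI)
    fix s assume c: "ncauchy (power_space n X) s"
    hence sm: "\<And>k i. i < n \<Longrightarrow> s k i \<in> pts X" "\<And>k i. i \<ge> n \<Longrightarrow> s k i = 0" and sP: "\<And>k. s k \<in> pts (power_space n X)"
      by (auto simp: ncauchy_def power_space_pts)
    have "ncauchy X (\<lambda>k. s k i)" if i: "i < n" for i
      unfolding ncauchy_def
    proof (intro conjI allI impI sm(1) i)
      fix e :: real assume "e > 0"
      then obtain K where K: "\<And>j k. j \<ge> K \<Longrightarrow> k \<ge> K \<Longrightarrow> nrm (power_space n X) (s j - s k) < e"
        using c unfolding ncauchy_def by blast
      have "nrm X (s j i - s k i) < e" if "j \<ge> K" "k \<ge> K" for j k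
        using N(1)[OF i, of X "s j - s k"] K[OF that] by simp
      thus "\<exists>N. \<forall>m\<ge>N. \<forall>n\<ge>N. nrm X (s m i - s n i) < e" by blast
    qed
    hence "\<forall>i. \<exists>y. i < n \<longrightarrow> nlim X (\<lambda>k. s k i) y" using complete by blast
    then obtain y where y: "\<And>i. i < n \<Longrightarrow> nlim X (\<lambda>k. s k i) (y i)" by metis
    define x where "x i = (if i < n then y i else 0)" for i
    have x: "i < n \<Longrightarrow> nlim X (\<lambda>k. s k i) (x i)" for i using y by (simp add: x_def)
    have xP: "x \<in> pts (power_space n X)" using x by (auto simp: power_space_pts nlim_def x_def)
    have "(\<lambda>k. nrm (power_space n X) (s k - x)) \<longlonglongrightarrow> 0"
    proof (rule Lim_null_comparison)
      have le: "nrm (power_space n X) (s k - x) \<le> (\<Sum>i<n. nrm X (s k i - x i))" for k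
      proof (rule N(2))
        fix i assume i: "i < n"
        have "nrm X (s k j - x j) \<ge> 0" if "j < n" for j
          using nrm_ge0 diff_mem sm(1)[OF that] xP that by (auto simp: power_space_pts)
        thus "nrm X ((s k - x) i) \<le> (\<Sum>i<n. nrm X (s k i - x i))"
          using i by (auto intro!: member_le_sum[where f = "\<lambda>i. nrm X (s k i - x i)", simplified])
      qed
      show "\<forall>\<^sub>F k in sequentially. norm (nrm (power_space n X) (s k - x)) \<le> (\<Sum>i<n. nrm X (s k i - x i))"
        using le P.nrm_ge0[OF P.diff_mem[OF sP xP]] by (auto intro!: always_eventually)
      have "(\<lambda>k. \<Sum>i<n. nrm X (s k i - x i)) \<longlonglongrightarrow> (\<Sum>i<n. 0)"
        by (rule tendsto_sum) (use x in \<open>auto simp: nlim_def\<close>)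
      thus "(\<lambda>k. \<Sum>i<n. nrm X (s k i - x i)) \<longlonglongrightarrow> 0" by simp
    qed
    thus "\<exists>x. nlim (power_space n X) s x" using sP xP by (auto simp: nlim_def)
  qed
qed

text \<open>The range of a bounded operator with the quotient norm. Rochberg spaces are the case
  where \<open>T\<close> forms Taylor arrays; boundedness into \<open>Y\<close> makes the quotient
  norm vanish only at 0.\<close>

locale quotient_map = F: bsp F + Y: bsp Y
  for F :: "'u::complex_vector nspace" and Y :: "'w::complex_vector nspace" and T :: "'u \<Rightarrow> 'w" and C :: real +
  assumes T_add: "\<And>x y. x \<in> pts F \<Longrightarrow> y \<in> pts F \<Longrightarrow> T (x + y) = T x + T y"
    and T_scale: "\<And>c x. x \<in> pts F \<Longrightarrow> T (c *\<^sub>C x) = c *\<^sub>C T x"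
    and T_mem: "\<And>x. x \<in> pts F \<Longrightarrow> T x \<in> pts Y"
    and T_le: "\<And>x. x \<in> pts F \<Longrightarrow> nrm Y (T x) \<le> C * nrm F x" and C: "C > 0"
begin

abbreviation Q where "Q \<equiv> quotient_space T F"

lemma Q_pts: "y \<in> pts Q \<longleftrightarrow> (\<exists>x\<in>pts F. y = T x)"
  by (auto simp: quotient_space_def)

lemma T_0: "T 0 = 0"
  using T_scale[of 0 0] by simp

lemma T_diff: "x \<in> pts F \<Longrightarrow> y \<in> pts F \<Longrightarrow> T (x - y) = T x - T y"
  using T_add[of "x - y" y] F.diff_mem by simp

lemma Q_nrm_le: "x \<in> pts F \<Longrightarrow> nrm Q (T x) \<le> nrm F x"
proof -
  assume x: "x \<in> pts F"
  have "bdd_below {nrm F x' |x'. x' \<in> pts F \<and> T x' = T x}"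
    by (rule bdd_belowI[of _ 0]) (auto simp: F.nrm_ge0)
  thus ?thesis using x by (auto simp: quotient_space_def intro!: cInf_lower)
qed

lemma Q_nrm_ge: "y \<in> pts Q \<Longrightarrow> (\<And>x. x \<in> pts F \<Longrightarrow> T x = y \<Longrightarrow> B \<le> nrm F x) \<Longrightarrow> B \<le> nrm Q y"
  by (auto simp: quotient_space_def intro!: cInf_greatest)

lemma Q_lift: "y \<in> pts Q \<Longrightarrow> nrm Q y < r \<Longrightarrow> \<exists>x\<in>pts F. T x = y \<and> nrm F x < r"
  using Q_nrm_ge[of y r] by fastforce

lemma nrm_Y_le: "y \<in> pts Q \<Longrightarrow> nrm Y y \<le> C * nrm Q y"
proof -
  assume y: "y \<in> pts Q"
  have "nrm Y y / C \<le> nrm Q y"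
    by (rule Q_nrm_ge[OF y]) (use T_le C in \<open>auto simp: field_simps\<close>)
  thus ?thesis using C by (simp add: field_simps)
qed

lemma Q_sub: "pts Q \<subseteq> pts Y"
  using T_mem by (auto simp: Q_pts)

lemma normed_Q: "normed_space Q"
  unfolding normed_space_def
proof (intro conjI ballI allI)
  show "module.subspace (*\<^sub>C) (pts Q)"
    unfolding scaleC.subspace_def
  proof (intro conjI ballI allI)
    show "0 \<in> pts Q" using T_0 F.zero_mem by (metis Q_pts)
    show "x + y \<in> pts Q" if "x \<in> pts Q" "y \<in> pts Q" for x y
      using that T_add F.add_mem unfolding Q_pts by metis
    show "c *\<^sub>C x \<in> pts Q" if "x \<in> pts Q" for c x
      using that T_scale F.scale_mem unfolding Q_pts by metis
  qed
  fix y assume y: "y \<in> pts Q"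
  show ge0: "0 \<le> nrm Q y" by (rule Q_nrm_ge[OF y]) (simp add: F.nrm_ge0)
  have z: "nrm Q 0 \<le> 0" using Q_nrm_le[OF F.zero_mem] T_0 by simp
  show "nrm Q y = 0 \<longleftrightarrow> y = 0"
  proof
    assume "nrm Q y = 0"
    thus "y = 0" using nrm_Y_le[OF y] Y.nrm_eq0[of y] Y.nrm_ge0[of y] y Q_sub by auto
  qed (use z ge0 in auto)
  have le: "nrm Q (c *\<^sub>C y) \<le> cmod c * nrm Q y" if "c \<noteq> 0" "y \<in> pts Q" for c y
  proof -
    have "nrm Q (c *\<^sub>C y) / cmod c \<le> nrm Q y"
    proof (rule Q_nrm_ge[OF that(2)])
      fix x assume x: "x \<in> pts F" "T x = y"
      thus "nrm Q (c *\<^sub>C y) / cmod c \<le> nrm F x"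
        using Q_nrm_le[OF F.scale_mem[OF x(1), of c]] that by (simp add: T_scale F.nrm_scale field_simps)
    qed
    thus ?thesis using that by (simp add: field_simps)
  qed
  show "nrm Q (c *\<^sub>C y) = cmod c * nrm Q y" for c
  proof (cases "c = 0")
    case True
    thus ?thesis using z Q_nrm_ge[of 0 0] F.nrm_ge0 T_0 F.zero_mem by (fastforce simp: Q_pts)
  next
    case False
    have "c *\<^sub>C y \<in> pts Q" using y T_scale F.scale_mem unfolding Q_pts by metis
    from le[of "inverse c", OF _ this] le[OF False y] False show ?thesis by (simp add: norm_divide field_simps)
  qed
  fix y' assume y': "y' \<in> pts Q"
  have "nrm Q (y + y') - nrm Q y' \<le> nrm Q y"
  proof (rule Q_nrm_ge[OF y])
    fix x assume x: "x \<in> pts F" "T x = y"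
    have "nrm Q (y + y') - nrm F x \<le> nrm Q y'"
    proof (rule Q_nrm_ge[OF y'])
      fix x' assume x': "x' \<in> pts F" "T x' = y'"
      show "nrm Q (y + y') - nrm F x \<le> nrm F x'"
        using Q_nrm_le[OF F.add_mem[OF x(1) x'(1)]] F.nrm_add[OF x(1) x'(1)] T_add[OF x(1) x'(1)] x x' by simp
    qed
    thus "nrm Q (y + y') - nrm Q y' \<le> nrm F x" by simp
  qed
  thus "nrm Q (y + y') \<le> nrm Q y + nrm Q y'" by simp
qed

text \<open>The increments of a fast sequence are lifted to \<open>F\<close> with norms below
  \<open>(1/2)^k\<close> and summed there; the limit is pushed forward by \<open>T\<close>.\<close>

lemma banach_Q: "banach_space Q"
proof -
  interpret Q: nsp Q by unfold_locales (rule normed_Q)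
  show ?thesis
  proof (rule Q.banach_spaceI_fast)
    fix s assume s: "\<And>k. s k \<in> pts Q" "\<And>k. nrm Q (s (Suc k) - s k) < (1/2) ^ k"
    obtain d where d: "\<And>k. d k \<in> pts F" "\<And>k. T (d k) = s (Suc k) - s k" "\<And>k. nrm F (d k) < (1/2) ^ k"
      using Q_lift[OF Q.diff_mem[OF s(1) s(1)] s(2)] by metis
    obtain u0 where u0: "u0 \<in> pts F" "T u0 = s 0" using s(1) Q_pts by metis
    define u where "u k = u0 + (\<Sum>i<k. d i)" for k
    have um: "u k \<in> pts F" for k unfolding u_def using u0 d by (intro F.add_mem F.sum_mem) auto
    have Tu: "T (u k) = s k" for k
    proof (induction k)
      case (Suc k)
      have "u (Suc k) = u k + d k" by (simp add: u_def add.assoc)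
      thus ?case using Suc T_add[OF um d(1)] d(2) by simp
    qed (simp add: u_def u0)
    have "nrm F (u (Suc k) - u k) \<le> 1 * (1/2) ^ k" for k
      using d(3)[of k] by (simp add: u_def)
    from F.fast_limit[OF um this] obtain x where x: "nlim F u x" by blast
    have xm: "x \<in> pts F" using x by (simp add: nlim_def)
    have "nrm Q (s k - T x) \<le> nrm F (u k - x)" for k
      using Q_nrm_le[OF F.diff_mem[OF um xm]] T_diff[OF um xm] Tu by simp
    moreover have "s k - T x \<in> pts Q" for k
      using T_diff[OF um xm] Tu F.diff_mem[OF um xm] unfolding Q_pts by metis
    ultimately have "norm (nrm Q (s k - T x)) \<le> nrm F (u k - x)" for k
      using Q.nrm_ge0[of "s k - T x"] by (metis abs_of_nonneg real_norm_def)
    moreover have "(\<lambda>k. nrm F (u k - x)) \<longlonglongrightarrow> 0" using x by (simp add: nlim_def)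
    ultimately have "(\<lambda>k. nrm Q (s k - T x)) \<longlonglongrightarrow> 0"
      using Lim_null_comparison[of "\<lambda>k. nrm Q (s k - T x)" "\<lambda>k. nrm F (u k - x)"] by simp
    thus "\<exists>y. nlim Q s y" using s(1) xm by (auto simp: nlim_def Q_pts)
  qed
qed

lemma continuously_included_Q: "continuously_included Q Y"
proof -
  have "nsp Q" by unfold_locales (rule normed_Q)
  thus ?thesis
    using continuously_included_iff[OF _ Y.nsp_axioms, of Q] Q_sub nrm_Y_le C by blast
qed

end

section \<open>Three lines theorem, the sum space and the Calderon space\<close>

lemma open_strip: "open (strip a b)"
proof -
  have "strip a b = {z. Re z > a} \<inter> {z. Re z < b}" by (auto simp: strip_def)
  thus ?thesis by (simp add: open_Int open_halfspace_Re_gt open_halfspace_Re_lt)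
qed

lemma closure_strip:
  assumes "a < b"
  shows "closure (strip a b) = {z. a \<le> Re z \<and> Re z \<le> b}"
proof
  have "closed {z. a \<le> Re z \<and> Re z \<le> b}"
    by (intro closed_Collect_conj closed_Collect_le continuous_intros)
  thus "closure (strip a b) \<subseteq> {z. a \<le> Re z \<and> Re z \<le> b}"
    by (intro closure_minimal) (auto simp: strip_def)
  show "{z. a \<le> Re z \<and> Re z \<le> b} \<subseteq> closure (strip a b)"
  proof
    fix z assume "z \<in> {z. a \<le> Re z \<and> Re z \<le> b}"
    hence z: "a \<le> Re z" "Re z \<le> b" by auto
    show "z \<in> closure (strip a b)"
      unfolding closure_approachable
    proof (intro allI impI)
      fix e :: real assume e: "e > 0"
      define t where "t = min (1/2) (e / (2 * (b - a)))"
      have t: "t > 0" "t < 1" "t \<le> e / (2 * (b - a))"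
        using e assms by (auto simp: t_def)
      hence t3: "t * (b - a) < e" using e assms by (simp add: field_simps)
      define m where "m = (a + b) / 2"
      \<comment> \<open>The point \<open>z\<close> moved by the fraction \<open>t\<close> of its way
        to the centre line \<open>Re = m\<close>.\<close>
      define y where "y = z + of_real (t * (m - Re z))"
      have "(1 - t) * a \<le> (1 - t) * Re z" "(1 - t) * Re z \<le> (1 - t) * b" "t * a < t * m" "t * m < t * b"
        using z t assms by (auto simp: m_def)
      moreover have "Re y = (1 - t) * Re z + t * m" by (simp add: y_def algebra_simps)
      ultimately have "y \<in> strip a b" by (simp add: strip_def algebra_simps)
      hence yS: "y \<in> strip a b" .
      have "\<bar>m - Re z\<bar> \<le> b - a" using z assms by (auto simp: m_def abs_le_iff field_simps)
      hence "t * \<bar>m - Re z\<bar> \<le> t * (b - a)" using t by simp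
      moreover have "dist y z = t * \<bar>m - Re z\<bar>" using t by (simp add: y_def dist_norm abs_mult del: of_real_mult)
      ultimately have "dist y z < e" using t3 by linarith
      thus "\<exists>y\<in>strip a b. dist y z < e" using yS by blast
    qed
  qed
qed

text \<open>Phragmen-Lindelof: \<open>g w * exp (e w^2)\<close> decays at the ends of the strip, so
  the maximum principle on a tall rectangle bounds it by its values on the vertical sides; then
  \<open>e\<close> tends to 0. The bound \<open>K\<close> enters only on the horizontal sides and
  disappears from the conclusion.\<close>

lemma three_lines:
  assumes ab: "a < b" and c: "continuous_on {z. a \<le> Re z \<and> Re z \<le> b} g" and h: "g holomorphic_on strip a b"
    and K: "\<And>z. a \<le> Re z \<Longrightarrow> Re z \<le> b \<Longrightarrow> cmod (g z) \<le> K"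
    and M: "\<And>t. cmod (g (Complex a t)) \<le> M" "\<And>t. cmod (g (Complex b t)) \<le> M"
    and z: "a \<le> Re z" "Re z \<le> b"
  shows "cmod (g z) \<le> M"
proof -
  define m where "m = max \<bar>a\<bar> \<bar>b\<bar>"
  have m: "x^2 \<le> m^2" if "a \<le> x" "x \<le> b" for x
    by (rule power2_le_iff_abs_le[THEN iffD2]) (use that in \<open>auto simp: m_def\<close>)
  have M0: "M \<ge> 0" using M(1)[of 0] norm_ge_zero order_trans by blast
  \<comment> \<open>Working with some \<open>M' > M\<close> leaves room for the horizontal sides
    even if \<open>M = 0\<close>.\<close>
  have step: "cmod (g z) * exp (e * ((Re z)^2 - (Im z)^2)) \<le> M' * exp (e * m^2)" if e: "e > 0" and M': "M' > M" for e M'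
  proof -
    have "((\<lambda>R. K * exp (e * (m^2 - R^2))) \<longlongrightarrow> 0) at_top"
      using e by real_asymp
    hence "\<forall>\<^sub>F R in at_top. K * exp (e * (m^2 - R^2)) < M'"
      by (rule order_tendstoD(2)) (use M' M0 in simp)
    moreover have "\<forall>\<^sub>F R in at_top. R > \<bar>Im z\<bar>" by (rule eventually_gt_at_top)
    ultimately have "\<forall>\<^sub>F R in at_top. K * exp (e * (m^2 - R^2)) < M' \<and> R > \<bar>Im z\<bar>" by (rule eventually_conj)
    then obtain R where R: "K * exp (e * (m^2 - R^2)) < M'" "R > \<bar>Im z\<bar>"
      using eventually_happens'[OF trivial_limit_at_top_linorder] by fastforce
    define S where "S = cbox (Complex a (- R)) (Complex b R)"
    define f where "f w = g w * exp (of_real e * w^2)" for w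
    have nf: "cmod (f w) = cmod (g w) * exp (e * ((Re w)^2 - (Im w)^2))" for w
      by (simp add: f_def norm_mult power2_eq_square)
    have S: "w \<in> S \<longleftrightarrow> a \<le> Re w \<and> Re w \<le> b \<and> - R \<le> Im w \<and> Im w \<le> R" for w
      by (auto simp: S_def in_cbox_complex_iff)
    have iS: "w \<in> interior S \<longleftrightarrow> a < Re w \<and> Re w < b \<and> - R < Im w \<and> Im w < R" for w
      by (auto simp: S_def interior_cbox in_box_complex_iff)
    have "cmod (f z) \<le> M' * exp (e * m^2)"
    proof (rule maximum_modulus_frontier[of f S])
      have "interior S \<subseteq> strip a b" by (auto simp: iS strip_def)
      thus "f holomorphic_on interior S"
        unfolding f_def by (intro holomorphic_intros holomorphic_on_subset[OF h])
      have "S \<subseteq> {z. a \<le> Re z \<and> Re z \<le> b}" by (auto simp: S)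
      thus "continuous_on (closure S) f"
        unfolding f_def by (intro continuous_intros continuous_on_subset[OF c]) (simp add: S_def)
      show "bounded S" by (simp add: S_def bounded_cbox)
      show "z \<in> S" using z R(2) by (auto simp: S)
      fix w assume "w \<in> frontier S"
      hence w: "w \<in> S" "w \<notin> interior S" by (auto simp: frontier_def S_def)
      have wm: "(Re w)^2 \<le> m^2" using m w(1) by (simp add: S)
      consider "Re w = a" | "Re w = b" | "\<bar>Im w\<bar> = R" using w by (auto simp: S iS)
      thus "cmod (f w) \<le> M' * exp (e * m^2)"
      proof cases
        case 3
        hence "(Im w)^2 = R^2" by (metis power2_abs)
        hence "cmod (f w) \<le> K * exp (e * (m^2 - R^2))"
          unfolding nf using K[of w] w(1) wm e order_trans[OF norm_ge_zero K[of w]]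
          by (intro mult_mono) (auto simp: S order_trans)
        also have "\<dots> \<le> M' * 1" using R by simp
        also have "\<dots> \<le> M' * exp (e * m^2)" using M' M0 e by (intro mult_left_mono) auto
        finally show ?thesis .
      next
        case 1
        hence "w = Complex a (Im w)" by (simp add: complex_eq_iff)
        hence "cmod (g w) \<le> M'" using M(1)[of "Im w"] M' by simp
        moreover have "(Re w)^2 - (Im w)^2 \<le> m^2" using wm zero_le_power2[of "Im w"] by linarith
        ultimately show ?thesis unfolding nf using M' M0 e by (intro mult_mono) auto
      next
        case 2
        hence "w = Complex b (Im w)" by (simp add: complex_eq_iff)
        hence "cmod (g w) \<le> M'" using M(2)[of "Im w"] M' by simp
        moreover have "(Re w)^2 - (Im w)^2 \<le> m^2" using wm zero_le_power2[of "Im w"] by linarith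
        ultimately show ?thesis unfolding nf using M' M0 e by (intro mult_mono) auto
      qed
    qed
    thus ?thesis unfolding nf .
  qed
  have "cmod (g z) \<le> M'" if M': "M' > M" for M'
  proof (rule tendsto_le[OF trivial_limit_at_right_real])
    have "((\<lambda>e. M' * exp (e * m^2)) \<longlongrightarrow> M' * exp (0 * m^2)) (at_right 0)" by (intro tendsto_intros)
    thus "((\<lambda>e. M' * exp (e * m^2)) \<longlongrightarrow> M') (at_right 0)" by simp
    have "((\<lambda>e. cmod (g z) * exp (e * ((Re z)^2 - (Im z)^2))) \<longlongrightarrow> cmod (g z) * exp (0 * ((Re z)^2 - (Im z)^2))) (at_right 0)"
      by (intro tendsto_intros)
    thus "((\<lambda>e. cmod (g z) * exp (e * ((Re z)^2 - (Im z)^2))) \<longlongrightarrow> cmod (g z)) (at_right 0)" by simp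
    show "\<forall>\<^sub>F e in at_right 0. cmod (g z) * exp (e * ((Re z)^2 - (Im z)^2)) \<le> M' * exp (e * m^2)"
      by (rule eventually_mono[OF eventually_at_right_less[of 0]]) (use step M' in blast)
  qed
  thus ?thesis by (rule dense_ge)
qed

lemma calderon_mem:
  assumes "nsp W" "nsp X" "nsp Y"
  shows "f \<in> pts (calderon_space W X Y a b) \<longleftrightarrow>
    analytic_into W f (strip a b) \<and> bounded_into W f (strip a b) \<and> ncont W (closure (strip a b)) f \<and>
    ncont X UNIV (\<lambda>t. f (Complex a t)) \<and> bounded_into X (\<lambda>t. f (Complex a t)) UNIV \<and>
    ncont Y UNIV (\<lambda>t. f (Complex b t)) \<and> bounded_into Y (\<lambda>t. f (Complex b t)) UNIV \<and>
    (\<forall>z. z \<notin> closure (strip a b) \<longrightarrow> f z = 0)"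
  by (simp add: calderon_space_def nsp.continuous_map_iff[OF assms(1)]
      nsp.continuous_map_real_iff[OF assms(2)] nsp.continuous_map_real_iff[OF assms(3)])

lemma calderon_nrm_le:
  assumes "\<And>t. nrm X (f (Complex a t)) \<le> B" "\<And>t. nrm Y (f (Complex b t)) \<le> B"
  shows "nrm (calderon_space W X Y a b) f \<le> B"
  unfolding calderon_space_def nspace.simps by (rule cSup_least) (use assms in auto)

lemma calderon_le_nrm:
  assumes "f \<in> pts (calderon_space W X Y a b)"
  shows "nrm X (f (Complex a t)) \<le> nrm (calderon_space W X Y a b) f"
    and "nrm Y (f (Complex b t)) \<le> nrm (calderon_space W X Y a b) f"
proof -
  obtain B1 B2 where B: "\<And>t. nrm X (f (Complex a t)) \<le> B1" "\<And>t. nrm Y (f (Complex b t)) \<le> B2"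
    using assms by (auto simp: calderon_space_def bounded_into_def)
  have "bdd_above (range (\<lambda>t. nrm X (f (Complex a t))) \<union> range (\<lambda>t. nrm Y (f (Complex b t))))"
    using B by (intro bdd_aboveI[of _ "max B1 B2"]) (auto simp: le_max_iff_disj)
  thus "nrm X (f (Complex a t)) \<le> nrm (calderon_space W X Y a b) f"
    "nrm Y (f (Complex b t)) \<le> nrm (calderon_space W X Y a b) f"
    by (auto simp: calderon_space_def intro!: cSup_upper)
qed

locale couple =
  fixes W X0 X1 :: "'v::complex_vector nspace"
  assumes compatible: "compatible_couple W X0 X1"

sublocale couple \<subseteq> W: bsp W
  using compatible by unfold_locales (simp add: compatible_couple_def)
sublocale couple \<subseteq> X0: bsp X0
  using compatible by unfold_locales (simp add: compatible_couple_def)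
sublocale couple \<subseteq> X1: bsp X1
  using compatible by unfold_locales (simp add: compatible_couple_def)

context couple
begin

abbreviation \<Sigma> :: "'v nspace" where "\<Sigma> \<equiv> sum_space X0 X1"

abbreviation \<S> :: "complex set" where "\<S> \<equiv> strip 0 1"

abbreviation \<D> :: "('v \<Rightarrow> complex) set" where "\<D> \<equiv> dual_ball \<Sigma>"

abbreviation \<T> :: "nat \<Rightarrow> complex \<Rightarrow> (complex \<Rightarrow> 'v) \<Rightarrow> nat \<Rightarrow> 'v" where "\<T> \<equiv> taylor_array \<Sigma>"

abbreviation \<P> :: "nat \<Rightarrow> (nat \<Rightarrow> 'v) nspace" where "\<P> n \<equiv> power_space n \<Sigma>"

abbreviation \<R> :: "nat \<Rightarrow> real \<Rightarrow> (nat \<Rightarrow> 'v) nspace" where "\<R> n c \<equiv> rochberg_space X0 X1 n (of_real c)"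

lemma W_bounds:
  obtains C where "C > 0" "\<And>x. x \<in> pts X0 \<Longrightarrow> nrm W x \<le> C * nrm X0 x"
    "\<And>x. x \<in> pts X1 \<Longrightarrow> nrm W x \<le> C * nrm X1 x"
proof -
  obtain C0 C1 where C: "C0 > 0" "C1 > 0" "\<And>x. x \<in> pts X0 \<Longrightarrow> nrm W x \<le> C0 * nrm X0 x"
    "\<And>x. x \<in> pts X1 \<Longrightarrow> nrm W x \<le> C1 * nrm X1 x"
    using compatible continuously_included_iff[OF X0.nsp_axioms W.nsp_axioms]
      continuously_included_iff[OF X1.nsp_axioms W.nsp_axioms]
    unfolding compatible_couple_def by blast
  show ?thesis
  proof (rule that[of "C0 + C1"])
    show "nrm W x \<le> (C0 + C1) * nrm X0 x" if "x \<in> pts X0" for x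
      using C(3)[OF that] mult_right_mono[of C0 "C0 + C1" "nrm X0 x"] X0.nrm_ge0[OF that] C(2) by simp
    show "nrm W x \<le> (C0 + C1) * nrm X1 x" if "x \<in> pts X1" for x
      using C(4)[OF that] mult_right_mono[of C1 "C0 + C1" "nrm X1 x"] X1.nrm_ge0[OF that] C(1) by simp
  qed (use C in simp)
qed

lemma W_sub: "pts X0 \<subseteq> pts W" "pts X1 \<subseteq> pts W"
  using compatible by (auto simp: compatible_couple_def continuously_included_def)

lemma \<Sigma>_pts: "v \<in> pts \<Sigma> \<longleftrightarrow> (\<exists>x\<in>pts X0. \<exists>y\<in>pts X1. v = x + y)"
  by (auto simp: sum_space_def)

lemma \<Sigma>_nrm_le: "x \<in> pts X0 \<Longrightarrow> y \<in> pts X1 \<Longrightarrow> nrm \<Sigma> (x + y) \<le> nrm X0 x + nrm X1 y"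
proof -
  assume xy: "x \<in> pts X0" "y \<in> pts X1"
  have "bdd_below {nrm X0 x' + nrm X1 y' |x' y'. x' \<in> pts X0 \<and> y' \<in> pts X1 \<and> x + y = x' + y'}"
    by (rule bdd_belowI[of _ 0]) (auto simp: X0.nrm_ge0 X1.nrm_ge0 add_nonneg_nonneg)
  thus ?thesis using xy by (auto simp: sum_space_def intro!: cInf_lower)
qed

lemma \<Sigma>_nrm_ge:
  "v \<in> pts \<Sigma> \<Longrightarrow> (\<And>x y. x \<in> pts X0 \<Longrightarrow> y \<in> pts X1 \<Longrightarrow> v = x + y \<Longrightarrow> B \<le> nrm X0 x + nrm X1 y) \<Longrightarrow> B \<le> nrm \<Sigma> v"
proof -
  assume v: "v \<in> pts \<Sigma>" and B: "\<And>x y. x \<in> pts X0 \<Longrightarrow> y \<in> pts X1 \<Longrightarrow> v = x + y \<Longrightarrow> B \<le> nrm X0 x + nrm X1 y"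
  have "{nrm X0 x + nrm X1 y |x y. x \<in> pts X0 \<and> y \<in> pts X1 \<and> v = x + y} \<noteq> {}"
    using v unfolding \<Sigma>_pts by blast
  thus ?thesis
    unfolding sum_space_def nspace.simps by (rule cInf_greatest) (use B in blast)
qed

lemma \<Sigma>_decompose:
  "v \<in> pts \<Sigma> \<Longrightarrow> nrm \<Sigma> v < r \<Longrightarrow> \<exists>x\<in>pts X0. \<exists>y\<in>pts X1. v = x + y \<and> nrm X0 x + nrm X1 y < r"
  using \<Sigma>_nrm_ge[of v r] by fastforce

lemma \<Sigma>_sub: "pts X0 \<subseteq> pts \<Sigma>" "pts X1 \<subseteq> pts \<Sigma>"
proof
  show "x \<in> pts \<Sigma>" if "x \<in> pts X0" for x using that X1.zero_mem \<Sigma>_pts by (metis add.right_neutral)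
  show "pts X1 \<subseteq> pts \<Sigma>" using X0.zero_mem \<Sigma>_pts by (metis add.left_neutral subsetI)
qed

lemma \<Sigma>_le: "x \<in> pts X0 \<Longrightarrow> nrm \<Sigma> x \<le> nrm X0 x" "x \<in> pts X1 \<Longrightarrow> nrm \<Sigma> x \<le> nrm X1 x"
  using \<Sigma>_nrm_le[of x 0] \<Sigma>_nrm_le[of 0 x] by auto

lemma normed_\<Sigma>: "normed_space \<Sigma>"
  unfolding normed_space_def
proof (intro conjI ballI allI)
  show "module.subspace (*\<^sub>C) (pts \<Sigma>)"
    unfolding scaleC.subspace_def
  proof (intro conjI ballI allI)
    show "0 \<in> pts \<Sigma>" using \<Sigma>_sub by auto
    fix u v assume "u \<in> pts \<Sigma>" "v \<in> pts \<Sigma>"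
    then obtain x y x' y' where "x \<in> pts X0" "x' \<in> pts X0" "y \<in> pts X1" "y' \<in> pts X1" "u = x + y" "v = x' + y'"
      unfolding \<Sigma>_pts by blast
    thus "u + v \<in> pts \<Sigma>" unfolding \<Sigma>_pts
      by (intro bexI[of _ "x + x'"] bexI[of _ "y + y'"]) (auto simp: X0.add_mem X1.add_mem algebra_simps)
  next
    fix c v assume "v \<in> pts \<Sigma>"
    thus "c *\<^sub>C v \<in> pts \<Sigma>" unfolding \<Sigma>_pts using X0.scale_mem X1.scale_mem scaleC.scale_right_distrib by metis
  qed
  fix v assume v: "v \<in> pts \<Sigma>"
  show ge0: "0 \<le> nrm \<Sigma> v" by (rule \<Sigma>_nrm_ge[OF v]) (simp add: X0.nrm_ge0 X1.nrm_ge0)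
  have z: "nrm \<Sigma> 0 \<le> 0" using \<Sigma>_nrm_le[OF X0.zero_mem X1.zero_mem] by simp
  show "nrm \<Sigma> v = 0 \<longleftrightarrow> v = 0"
  proof
    assume z: "nrm \<Sigma> v = 0"
    obtain C where C: "C > 0" "\<And>x. x \<in> pts X0 \<Longrightarrow> nrm W x \<le> C * nrm X0 x"
      "\<And>x. x \<in> pts X1 \<Longrightarrow> nrm W x \<le> C * nrm X1 x" using W_bounds by blast
    \<comment> \<open>The ambient space separates points: the sum norm dominates a multiple of the
      norm of \<open>W\<close>.\<close>
    have "nrm W v / C \<le> nrm \<Sigma> v"
    proof (rule \<Sigma>_nrm_ge[OF v])
      fix x y assume xy: "x \<in> pts X0" "y \<in> pts X1" "v = x + y"
      have "nrm W v \<le> nrm W x + nrm W y" using W.nrm_add xy W_sub by blast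
      also have "\<dots> \<le> C * (nrm X0 x + nrm X1 y)" using C xy by (simp add: distrib_left add_mono)
      finally show "nrm W v / C \<le> nrm X0 x + nrm X1 y" using C(1) by (simp add: field_simps)
    qed
    moreover have vW: "v \<in> pts W" using v W_sub W.add_mem unfolding \<Sigma>_pts by blast
    ultimately show "v = 0" using z C(1) W.nrm_eq0[OF vW] W.nrm_ge0[OF vW] by (simp add: field_simps)
  qed (use z ge0 in auto)
  have le: "nrm \<Sigma> (c *\<^sub>C v) \<le> cmod c * nrm \<Sigma> v" if "c \<noteq> 0" "v \<in> pts \<Sigma>" for c v
  proof -
    have "nrm \<Sigma> (c *\<^sub>C v) / cmod c \<le> nrm \<Sigma> v"
    proof (rule \<Sigma>_nrm_ge[OF that(2)])
      fix x y assume xy: "x \<in> pts X0" "y \<in> pts X1" "v = x + y"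
      thus "nrm \<Sigma> (c *\<^sub>C v) / cmod c \<le> nrm X0 x + nrm X1 y"
        using \<Sigma>_nrm_le[OF X0.scale_mem[OF xy(1), of c] X1.scale_mem[OF xy(2), of c]] that
        by (simp add: X0.nrm_scale X1.nrm_scale scaleC.scale_right_distrib field_simps)
    qed
    thus ?thesis using that by (simp add: field_simps)
  qed
  show "nrm \<Sigma> (c *\<^sub>C v) = cmod c * nrm \<Sigma> v" for c
  proof (cases "c = 0")
    case True
    have "0 \<le> nrm \<Sigma> 0" by (rule \<Sigma>_nrm_ge) (use \<Sigma>_sub in \<open>auto simp: X0.nrm_ge0 X1.nrm_ge0 add_nonneg_nonneg\<close>)
    thus ?thesis using z True by simp
  next
    case False
    have "c *\<^sub>C v \<in> pts \<Sigma>" using v X0.scale_mem X1.scale_mem scaleC.scale_right_distrib unfolding \<Sigma>_pts by metis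
    from le[of "inverse c", OF _ this] le[OF False v] False show ?thesis by (simp add: norm_divide field_simps)
  qed
  fix v' assume v': "v' \<in> pts \<Sigma>"
  have "nrm \<Sigma> (v + v') - nrm \<Sigma> v' \<le> nrm \<Sigma> v"
  proof (rule \<Sigma>_nrm_ge[OF v])
    fix x y assume x: "x \<in> pts X0" "y \<in> pts X1" "v = x + y"
    have "nrm \<Sigma> (v + v') - (nrm X0 x + nrm X1 y) \<le> nrm \<Sigma> v'"
    proof (rule \<Sigma>_nrm_ge[OF v'])
      fix x' y' assume x': "x' \<in> pts X0" "y' \<in> pts X1" "v' = x' + y'"
      have e: "v + v' = (x + x') + (y + y')" using x x' by (simp add: algebra_simps)
      show "nrm \<Sigma> (v + v') - (nrm X0 x + nrm X1 y) \<le> nrm X0 x' + nrm X1 y'"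
        unfolding e using \<Sigma>_nrm_le[OF X0.add_mem[OF x(1) x'(1)] X1.add_mem[OF x(2) x'(2)]]
          X0.nrm_add[OF x(1) x'(1)] X1.nrm_add[OF x(2) x'(2)] by simp
    qed
    thus "nrm \<Sigma> (v + v') - nrm \<Sigma> v' \<le> nrm X0 x + nrm X1 y" by simp
  qed
  thus "nrm \<Sigma> (v + v') \<le> nrm \<Sigma> v + nrm \<Sigma> v'" by simp
qed

text \<open>Increments of a fast sequence are decomposed into parts in \<open>X0\<close> and
  \<open>X1\<close> with geometrically small norms, and the two series are summed
  separately.\<close>

lemma banach_\<Sigma>: "banach_space \<Sigma>"
proof -
  interpret S: nsp \<Sigma> by unfold_locales (rule normed_\<Sigma>)
  show ?thesis
  proof (rule S.banach_spaceI_fast)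
    fix s assume s: "\<And>k. s k \<in> pts \<Sigma>" "\<And>k. nrm \<Sigma> (s (Suc k) - s k) < (1/2) ^ k"
    have "\<forall>k. \<exists>x y. x \<in> pts X0 \<and> y \<in> pts X1 \<and> s (Suc k) - s k = x + y \<and> nrm X0 x + nrm X1 y < (1/2) ^ k"
      using \<Sigma>_decompose[OF S.diff_mem[OF s(1) s(1)] s(2)] by blast
    then obtain d e where de: "\<And>k. d k \<in> pts X0" "\<And>k. e k \<in> pts X1" "\<And>k. s (Suc k) - s k = d k + e k"
      "\<And>k. nrm X0 (d k) + nrm X1 (e k) < (1/2) ^ k" by metis
    obtain u0 w0 where u0: "u0 \<in> pts X0" "w0 \<in> pts X1" "s 0 = u0 + w0" using s(1) \<Sigma>_pts by metis
    define u where "u k = u0 + (\<Sum>i<k. d i)" for k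
    define w where "w k = w0 + (\<Sum>i<k. e i)" for k
    have um: "u k \<in> pts X0" "w k \<in> pts X1" for k
      unfolding u_def w_def using u0 de by (auto intro!: X0.add_mem X0.sum_mem X1.add_mem X1.sum_mem)
    have su: "s k = u k + w k" for k
    proof (induction k)
      case (Suc k)
      have "s (Suc k) = s k + (d k + e k)" using de(3)[of k] by (simp add: algebra_simps)
      thus ?case using Suc by (simp add: u_def w_def algebra_simps)
    qed (simp add: u_def w_def u0)
    have "nrm X0 (u (Suc k) - u k) \<le> 1 * (1/2) ^ k" for k
      using de(4)[of k] X1.nrm_ge0[OF de(2)[of k]] by (simp add: u_def)
    from X0.fast_limit[OF um(1) this] obtain x where x: "nlim X0 u x" by blast
    have "nrm X1 (w (Suc k) - w k) \<le> 1 * (1/2) ^ k" for k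
      using de(4)[of k] X0.nrm_ge0[OF de(1)[of k]] by (simp add: w_def)
    from X1.fast_limit[OF um(2) this] obtain y where y: "nlim X1 w y" by blast
    have xm: "x \<in> pts X0" "y \<in> pts X1" using x y by (auto simp: nlim_def)
    have xy: "x + y \<in> pts \<Sigma>" using xm \<Sigma>_pts by blast
    have le: "nrm \<Sigma> (s k - (x + y)) \<le> nrm X0 (u k - x) + nrm X1 (w k - y)" for k
      using \<Sigma>_nrm_le[OF X0.diff_mem[OF um(1) xm(1)] X1.diff_mem[OF um(2) xm(2)], of k k] su
      by (simp add: algebra_simps)
    have "(\<lambda>k. nrm \<Sigma> (s k - (x + y))) \<longlonglongrightarrow> 0"
    proof (rule Lim_null_comparison)
      show "\<forall>\<^sub>F k in sequentially. norm (nrm \<Sigma> (s k - (x + y))) \<le> nrm X0 (u k - x) + nrm X1 (w k - y)"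
        using le S.nrm_ge0[OF S.diff_mem[OF s(1) xy]] by (intro always_eventually) auto
      show "(\<lambda>k. nrm X0 (u k - x) + nrm X1 (w k - y)) \<longlonglongrightarrow> 0"
        using tendsto_add[of "\<lambda>k. nrm X0 (u k - x)" 0 _ "\<lambda>k. nrm X1 (w k - y)" 0] x y by (auto simp: nlim_def)
    qed
    thus "\<exists>v. nlim \<Sigma> s v" using s(1) xy by (auto simp: nlim_def)
  qed
qed

end

sublocale couple \<subseteq> S: bsp \<Sigma>
  by unfold_locales (rule banach_\<Sigma>)

context couple
begin

abbreviation F :: "(complex \<Rightarrow> 'v) nspace" where "F \<equiv> calderon_space \<Sigma> X0 X1 0 1"

abbreviation cstrip :: "complex set" where "cstrip \<equiv> {z. 0 \<le> Re z \<and> Re z \<le> 1}"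

lemmas F_mem_iff = calderon_mem[OF S.nsp_axioms X0.nsp_axioms X1.nsp_axioms, of _ 0 1,
  unfolded closure_strip[OF zero_less_one]]

lemma F_D:
  assumes "f \<in> pts F"
  shows "analytic_into \<Sigma> f \<S>" "ncont \<Sigma> cstrip f"
    "ncont X0 UNIV (\<lambda>t. f (Complex 0 t))" "ncont X1 UNIV (\<lambda>t. f (Complex 1 t))"
    "\<And>t. f (Complex 0 t) \<in> pts X0" "\<And>t. f (Complex 1 t) \<in> pts X1"
    "\<And>z. z \<notin> cstrip \<Longrightarrow> f z = 0" "\<And>z. z \<in> cstrip \<Longrightarrow> f z \<in> pts \<Sigma>"
    "\<And>t. nrm X0 (f (Complex 0 t)) \<le> nrm F f" "\<And>t. nrm X1 (f (Complex 1 t)) \<le> nrm F f"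
  using assms calderon_le_nrm[OF assms] unfolding F_mem_iff
  by (auto simp: ncont_def)

text \<open>Membership is tested weakly: the bound \<open>K\<close> in \<open>\<Sigma>\<close>
  upgrades holomorphy of all \<open>l (f z)\<close> to analyticity, and the norm is read off the two
  boundary lines.\<close>

lemma F_I:
  assumes hol: "\<And>l. l \<in> \<D> \<Longrightarrow> (\<lambda>z. l (f z)) holomorphic_on \<S>"
    and K: "\<And>z. z \<in> cstrip \<Longrightarrow> nrm \<Sigma> (f z) \<le> K" and c: "ncont \<Sigma> cstrip f"
    and c0: "ncont X0 UNIV (\<lambda>t. f (Complex 0 t))" and c1: "ncont X1 UNIV (\<lambda>t. f (Complex 1 t))"
    and B: "\<And>t. nrm X0 (f (Complex 0 t)) \<le> B" "\<And>t. nrm X1 (f (Complex 1 t)) \<le> B"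
    and z: "\<And>z. z \<notin> cstrip \<Longrightarrow> f z = 0"
  shows "f \<in> pts F \<and> nrm F f \<le> B"
proof
  have m: "f z \<in> pts \<Sigma>" if "z \<in> cstrip" for z using c that by (simp add: ncont_def)
  have sub: "\<S> \<subseteq> cstrip" by (auto simp: strip_def)
  have "analytic_into \<Sigma> f \<S>"
  proof (rule S.weakly_analytic[OF open_strip _ hol])
    show "f ` \<S> \<subseteq> pts \<Sigma>" using m sub by blast
    show "\<exists>r>0. \<exists>B. \<forall>w\<in>ball z r \<inter> \<S>. nrm \<Sigma> (f w) \<le> B" for z
      using K sub by (intro exI[of _ 1] conjI exI[of _ K]) auto
  qed
  moreover have "bounded_into \<Sigma> f \<S>" using K sub m unfolding bounded_into_def by blast
  moreover have "bounded_into X0 (\<lambda>t. f (Complex 0 t)) UNIV" "bounded_into X1 (\<lambda>t. f (Complex 1 t)) UNIV"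
    using B c0 c1 unfolding bounded_into_def by (auto simp: ncont_def)
  ultimately show "f \<in> pts F" using c c0 c1 z by (simp add: F_mem_iff)
  show "nrm F f \<le> B" by (rule calderon_nrm_le[OF B])
qed

lemma F_holomorphic: "f \<in> pts F \<Longrightarrow> l \<in> \<D> \<Longrightarrow> (\<lambda>z. l (f z)) holomorphic_on \<S>"
  using S.analytic_dual(1)[OF open_strip] F_D(1) by blast

text \<open>The three lines theorem for \<open>l (f z)\<close>; on the boundary lines the norms of
  \<open>X0\<close> and \<open>X1\<close> dominate that of \<open>\<Sigma>\<close>. Completeness of
  \<open>F\<close> and all Taylor estimates rest on it.\<close>

lemma F_\<Sigma>_le:
  assumes f: "f \<in> pts F" and z: "z \<in> cstrip"
  shows "nrm \<Sigma> (f z) \<le> nrm F f"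
proof (rule S.nrm_le_dual[OF F_D(8)[OF f z]])
  fix l assume l: "l \<in> \<D>"
  have "bounded_into \<Sigma> f \<S>" using f by (simp add: F_mem_iff)
  then obtain K where K: "\<And>z. z \<in> \<S> \<Longrightarrow> nrm \<Sigma> (f z) \<le> K" by (auto simp: bounded_into_def)
  have b0: "cmod (l (f (Complex 0 t))) \<le> nrm F f" for t
    using S.dual_le[OF l, of "f (Complex 0 t)"] \<Sigma>_sub \<Sigma>_le(1)[of "f (Complex 0 t)"] F_D(5,9)[OF f, of t] by force
  have b1: "cmod (l (f (Complex 1 t))) \<le> nrm F f" for t
    using S.dual_le[OF l, of "f (Complex 1 t)"] \<Sigma>_sub \<Sigma>_le(2)[of "f (Complex 1 t)"] F_D(6,10)[OF f, of t] by force
  show "cmod (l (f z)) \<le> nrm F f"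
  proof (rule three_lines[of 0 1 "\<lambda>z. l (f z)" "max K (nrm F f)"])
    show "continuous_on {z. 0 \<le> Re z \<and> Re z \<le> 1} (\<lambda>z. l (f z))"
      by (rule S.dual_continuous_on[OF l F_D(2)[OF f]])
    show "(\<lambda>z. l (f z)) holomorphic_on \<S>" by (rule F_holomorphic[OF f l])
    fix w :: complex assume w: "0 \<le> Re w" "Re w \<le> 1"
    consider "w \<in> \<S>" | "w = Complex 0 (Im w)" | "w = Complex 1 (Im w)"
      using w by (force simp: strip_def complex_eq_iff)
    thus "cmod (l (f w)) \<le> max K (nrm F f)"
    proof cases
      case 1 thus ?thesis
        using K[OF 1] S.dual_le[OF l F_D(8)[OF f], of w] w by (simp add: le_max_iff_disj)
    next
      case 2 thus ?thesis using b0[of "Im w"] by (simp add: le_max_iff_disj)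
    next
      case 3 thus ?thesis using b1[of "Im w"] by (simp add: le_max_iff_disj)
    qed
  qed (use b0 b1 z in auto)
qed

lemma F_nrm_ge0: "f \<in> pts F \<Longrightarrow> 0 \<le> nrm F f"
  using F_D(9)[of f 0] X0.nrm_ge0[OF F_D(5)[of f 0]] by simp

lemma F_add: "f \<in> pts F \<Longrightarrow> g \<in> pts F \<Longrightarrow> f + g \<in> pts F \<and> nrm F (f + g) \<le> nrm F f + nrm F g"
proof -
  assume f: "f \<in> pts F" and g: "g \<in> pts F"
  show "f + g \<in> pts F \<and> nrm F (f + g) \<le> nrm F f + nrm F g"
  proof (rule F_I[where K = "nrm F f + nrm F g"])
    show "(\<lambda>z. l ((f + g) z)) holomorphic_on \<S>" if l: "l \<in> \<D>" for l
    proof (rule holomorphic_transform)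
      show "(\<lambda>z. l (f z) + l (g z)) holomorphic_on \<S>"
        by (intro holomorphic_on_add F_holomorphic f g l)
      show "l (f z) + l (g z) = l ((f + g) z)" if "z \<in> \<S>" for z
        using S.dual_add[OF l F_D(8)[OF f] F_D(8)[OF g], of z z] that by (simp add: strip_def)
    qed
    show "nrm \<Sigma> ((f + g) z) \<le> nrm F f + nrm F g" if "z \<in> cstrip" for z
      using S.nrm_add[OF F_D(8)[OF f that] F_D(8)[OF g that]] F_\<Sigma>_le[OF f that] F_\<Sigma>_le[OF g that] by simp
    show "ncont \<Sigma> cstrip (f + g)" using S.ncont_add[OF F_D(2)[OF f] F_D(2)[OF g]] by (simp add: plus_fun_def)
    show "ncont X0 UNIV (\<lambda>t. (f + g) (Complex 0 t))" using X0.ncont_add[OF F_D(3)[OF f] F_D(3)[OF g]] by simp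
    show "ncont X1 UNIV (\<lambda>t. (f + g) (Complex 1 t))" using X1.ncont_add[OF F_D(4)[OF f] F_D(4)[OF g]] by simp
    show "nrm X0 ((f + g) (Complex 0 t)) \<le> nrm F f + nrm F g" for t
      using X0.nrm_add[OF F_D(5)[OF f, of t] F_D(5)[OF g, of t]] F_D(9)[OF f, of t] F_D(9)[OF g, of t] by simp
    show "nrm X1 ((f + g) (Complex 1 t)) \<le> nrm F f + nrm F g" for t
      using X1.nrm_add[OF F_D(6)[OF f, of t] F_D(6)[OF g, of t]] F_D(10)[OF f, of t] F_D(10)[OF g, of t] by simp
    show "(f + g) z = 0" if "z \<notin> cstrip" for z using F_D(7)[OF f that] F_D(7)[OF g that] by simp
  qed
qed

lemma F_mult:
  assumes f: "f \<in> pts F" and hol: "u holomorphic_on \<S>" and c: "continuous_on cstrip u"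
    and K: "\<And>z. z \<in> cstrip \<Longrightarrow> cmod (u z) \<le> K"
    and B: "\<And>t. cmod (u (Complex 0 t)) * nrm X0 (f (Complex 0 t)) \<le> B"
      "\<And>t. cmod (u (Complex 1 t)) * nrm X1 (f (Complex 1 t)) \<le> B"
  shows "(\<lambda>z. u z *\<^sub>C f z) \<in> pts F \<and> nrm F (\<lambda>z. u z *\<^sub>C f z) \<le> B"
proof (rule F_I[where K = "K * nrm F f"])
  show "(\<lambda>z. l (u z *\<^sub>C f z)) holomorphic_on \<S>" if l: "l \<in> \<D>" for l
  proof (rule holomorphic_transform)
    show "(\<lambda>z. u z * l (f z)) holomorphic_on \<S>"
      by (intro holomorphic_on_mult F_holomorphic f l hol)
    show "u z * l (f z) = l (u z *\<^sub>C f z)" if "z \<in> \<S>" for z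
      using S.dual_scale[OF l F_D(8)[OF f], of z] that by (simp add: strip_def)
  qed
  show "nrm \<Sigma> (u z *\<^sub>C f z) \<le> K * nrm F f" if "z \<in> cstrip" for z
    unfolding S.nrm_scale[OF F_D(8)[OF f that]]
    by (rule mult_mono[OF K[OF that] F_\<Sigma>_le[OF f that] order_trans[OF norm_ge_zero K[OF that]] S.nrm_ge0[OF F_D(8)[OF f that]]])
  show "ncont \<Sigma> cstrip (\<lambda>z. u z *\<^sub>C f z)" by (rule S.ncont_scale[OF c F_D(2)[OF f]])
  have c': "continuous_on UNIV (\<lambda>t. u (Complex j t))" if "0 \<le> j" "j \<le> 1" for j
    by (rule continuous_on_compose2[OF c, of UNIV "Complex j"])
      (use that in \<open>auto simp: Complex_eq intro!: continuous_intros\<close>)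
  show "ncont X0 UNIV (\<lambda>t. u (Complex 0 t) *\<^sub>C f (Complex 0 t))" by (rule X0.ncont_scale[OF c' F_D(3)[OF f]]) auto
  show "ncont X1 UNIV (\<lambda>t. u (Complex 1 t) *\<^sub>C f (Complex 1 t))" by (rule X1.ncont_scale[OF c' F_D(4)[OF f]]) auto
  show "nrm X0 (u (Complex 0 t) *\<^sub>C f (Complex 0 t)) \<le> B" for t
    using B(1)[of t] by (simp add: X0.nrm_scale[OF F_D(5)[OF f]])
  show "nrm X1 (u (Complex 1 t) *\<^sub>C f (Complex 1 t)) \<le> B" for t
    using B(2)[of t] by (simp add: X1.nrm_scale[OF F_D(6)[OF f]])
  show "u z *\<^sub>C f z = 0" if "z \<notin> cstrip" for z using F_D(7)[OF f that] by simp
qed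

lemma F_scale: "f \<in> pts F \<Longrightarrow> c *\<^sub>C f \<in> pts F \<and> nrm F (c *\<^sub>C f) \<le> cmod c * nrm F f"
  unfolding scaleC_fun_def
  using F_mult[of f "\<lambda>_. c" "cmod c" "cmod c * nrm F f"] F_D(9,10)[of f]
  by (simp add: mult_left_mono holomorphic_on_const)

lemma normed_F: "normed_space F"
  unfolding normed_space_def
proof (intro conjI ballI allI)
  have z: "(0 :: complex \<Rightarrow> 'v) \<in> pts F \<and> nrm F (0 :: complex \<Rightarrow> 'v) \<le> 0"
    by (rule F_I[where K = 0]) (auto simp: S.dual_0 S.ncont_const X0.ncont_const X1.ncont_const zero_fun_def)
  thus "module.subspace (*\<^sub>C) (pts F)"
    unfolding scaleC.subspace_def using F_add F_scale by blast
  fix f assume f: "f \<in> pts F"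
  show "0 \<le> nrm F f" by (rule F_nrm_ge0[OF f])
  show "nrm F f = 0 \<longleftrightarrow> f = 0"
  proof
    assume n: "nrm F f = 0"
    have "f w = 0" for w
    proof (cases "w \<in> cstrip")
      case True
      thus ?thesis using F_\<Sigma>_le[OF f True] S.nrm_ge0[OF F_D(8)[OF f True]] S.nrm_eq0[OF F_D(8)[OF f True]] n by simp
    qed (use F_D(7)[OF f] in simp)
    thus "f = 0" by auto
  qed (use z F_nrm_ge0 in force)
  show "nrm F (c *\<^sub>C f) = cmod c * nrm F f" for c
  proof (cases "c = 0")
    case True
    thus ?thesis using z F_nrm_ge0 by (auto intro: antisym)
  next
    case False
    have "nrm F (inverse c *\<^sub>C c *\<^sub>C f) \<le> cmod (inverse c) * nrm F (c *\<^sub>C f)"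
      using F_scale F_scale f by blast
    hence "cmod c * nrm F f \<le> nrm F (c *\<^sub>C f)" using False by (simp add: norm_inverse norm_divide field_simps)
    thus ?thesis using F_scale[OF f, of c] by simp
  qed
  show "nrm F (f + g) \<le> nrm F f + nrm F g" if "g \<in> pts F" for g using F_add f that by blast
qed

end

sublocale couple \<subseteq> F: nsp F
  by unfold_locales (rule normed_F)

section \<open>Completeness of the Calderon space; Rochberg spaces as quotients\<close>

context couple
begin

lemma banach_F: "banach_space F"
proof (rule F.bspI)
  fix s assume "ncauchy F s"
  hence sm: "\<And>k. s k \<in> pts F" and cau: "\<And>e. e > 0 \<Longrightarrow> \<exists>N. \<forall>m\<ge>N. \<forall>n\<ge>N. nrm F (s m - s n) < e"
    by (auto simp: ncauchy_def)
  have dm: "s m - s n \<in> pts F" for m n using sm F.diff_mem by blast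
  have "ncauchy \<Sigma> (\<lambda>k. s k z)" if z: "z \<in> cstrip" for z
    unfolding ncauchy_def
    using F_D(8)[OF sm z] cau F_\<Sigma>_le[OF dm z] by (auto simp: fun_diff_def) (meson le_less_trans)
  hence "\<forall>z. \<exists>x. z \<in> cstrip \<longrightarrow> nlim \<Sigma> (\<lambda>k. s k z) x" using S.complete by blast
  then obtain g where g: "\<And>z. z \<in> cstrip \<Longrightarrow> nlim \<Sigma> (\<lambda>k. s k z) (g z)" by metis
  define f where "f z = (if z \<in> cstrip then g z else 0)" for z
  have f: "nlim \<Sigma> (\<lambda>k. s k z) (f z)" if "z \<in> cstrip" for z using g[OF that] that by (simp add: f_def)
  \<comment> \<open>One predicate covers the closed strip with values in \<open>\<Sigma>\<close> and
    the two boundary lines with values in \<open>X0\<close> and \<open>X1\<close>, so that a single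
    uniform-limit argument handles all three norms.\<close>
  define good where "good X z \<longleftrightarrow> z \<in> cstrip \<and> bsp X \<and> pts X \<subseteq> pts \<Sigma> \<and> (\<forall>x\<in>pts X. nrm \<Sigma> x \<le> nrm X x) \<and>
    (\<forall>h\<in>pts F. h z \<in> pts X \<and> nrm X (h z) \<le> nrm F h)" for X z
  have good: "z \<in> cstrip \<Longrightarrow> good \<Sigma> z" "good X0 (Complex 0 t)" "good X1 (Complex 1 t)" for z t
    using S.bsp_axioms X0.bsp_axioms X1.bsp_axioms \<Sigma>_sub \<Sigma>_le F_D(5,6,8-10) F_\<Sigma>_le by (auto simp: good_def)
  \<comment> \<open>The limit taken in \<open>X\<close> equals \<open>f z\<close>, since both are
    limits in \<open>\<Sigma>\<close>.\<close>
  have lim: "nlim X (\<lambda>k. s k z) (f z)" if X: "good X z" for X z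
  proof -
    interpret X: bsp X using X by (simp add: good_def)
    have e: "s k z \<in> pts X" "nrm X (s m z - s n z) \<le> nrm F (s m - s n)" for k m n
      using X sm[of k] bspec[OF _ dm[of m n], of "\<lambda>h. h z \<in> pts X \<and> nrm X (h z) \<le> nrm F h"] by (auto simp: good_def)
    hence "ncauchy X (\<lambda>k. s k z)"
      unfolding ncauchy_def using cau by (meson le_less_trans)
    then obtain x where x: "nlim X (\<lambda>k. s k z) x" using X.complete by blast
    hence "nlim \<Sigma> (\<lambda>k. s k z) x"
      by (rule nlim_mono[OF X.nsp_axioms S.nsp_axioms, of 1, rotated 2]) (use X in \<open>auto simp: good_def\<close>)
    thus ?thesis using S.nlim_unique[OF f] x X by (auto simp: good_def)
  qed
  have fm: "f z \<in> pts X" "s k z \<in> pts X" if "good X z" for X z k using lim[OF that] by (auto simp: nlim_def)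
  have unif: "\<exists>N. \<forall>k\<ge>N. \<forall>X z. good X z \<longrightarrow> nrm X (f z - s k z) \<le> e" if e: "e > 0" for e
  proof -
    obtain N where N: "\<And>m n. m \<ge> N \<Longrightarrow> n \<ge> N \<Longrightarrow> nrm F (s m - s n) < e" using cau[OF e] by blast
    have "nrm X (f z - s k z) \<le> e" if X: "good X z" and k: "k \<ge> N" for X z k
    proof -
      interpret X: bsp X using X by (simp add: good_def)
      have "nlim X (\<lambda>j. s (j + N) z - s k z) (f z - s k z)"
        using lim[OF X] fm[OF X] LIMSEQ_ignore_initial_segment[of "\<lambda>j. nrm X (s j z - f z)" 0 N] X.diff_mem by (simp add: nlim_def)
      thus ?thesis
      proof (rule X.nlim_nrm_le)
        show "nrm X (s (j + N) z - s k z) \<le> e" for j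
          using X dm[of "j + N" k] N[OF _ k, of "j + N"] by (force simp: good_def)
      qed
    qed
    thus ?thesis by blast
  qed
  obtain N1 where N1: "\<And>X z. good X z \<Longrightarrow> nrm X (f z - s N1 z) \<le> 1" using unif[of 1] zero_less_one by blast
  have K: "nrm X (f z) \<le> 1 + nrm F (s N1)" if X: "good X z" for X z
  proof -
    interpret X: bsp X using X by (simp add: good_def)
    show ?thesis using X.nrm_le_diff[OF fm[OF X], of N1] N1[OF X] X sm[of N1] by (force simp: good_def)
  qed
  have cont: "ncont X A (\<lambda>t. f (j t))" if X: "\<And>t. t \<in> A \<Longrightarrow> good X (j t)" and c: "\<And>h. h \<in> pts F \<Longrightarrow> ncont X A (\<lambda>t. h (j t))" and "nsp X"
    for X j and A :: "'b::t2_space set"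
  proof (rule nsp.ncont_uniform_limit[OF \<open>nsp X\<close> fm(1)[OF X]])
    fix e :: real assume "e > 0"
    then obtain N where "\<And>X z. good X z \<Longrightarrow> nrm X (f z - s N z) \<le> e" using unif by blast
    thus "\<exists>g. ncont X A g \<and> (\<forall>x\<in>A. nrm X (f (j x) - g x) \<le> e)" using c[OF sm] X by blast
  qed
  have "f \<in> pts F \<and> nrm F f \<le> 1 + nrm F (s N1)"
  proof (rule F_I[where K = "1 + nrm F (s N1)"])
    show "f z = 0" if "z \<notin> cstrip" for z using that unfolding f_def by (rule if_not_P)
    fix l assume l: "l \<in> \<D>"
    show "(\<lambda>z. l (f z)) holomorphic_on \<S>"
    proof (rule holomorphic_uniform_sequence[OF open_strip F_holomorphic[OF sm l]])
      fix z assume "z \<in> \<S>"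
      then obtain d where d: "d > 0" "cball z d \<subseteq> \<S>" using open_strip open_contains_cball by metis
      have "uniform_limit (cball z d) (\<lambda>n z. l (s n z)) (\<lambda>z. l (f z)) sequentially"
        unfolding uniform_limit_iff
      proof (intro allI impI)
        fix e :: real assume e: "e > 0"
        then obtain N where N: "\<And>k z. k \<ge> N \<Longrightarrow> good \<Sigma> z \<Longrightarrow> nrm \<Sigma> (f z - s k z) \<le> e/2"
          using unif[of "e/2"] half_gt_zero by blast
        have "dist (l (s k w)) (l (f w)) < e" if "k \<ge> N" "w \<in> cball z d" for k w
        proof -
          have w: "good \<Sigma> w" using that d by (auto simp: strip_def subset_iff less_imp_le intro!: good)
          have "cmod (l (f w) - l (s k w)) \<le> nrm \<Sigma> (f w - s k w)"
            using S.dual_le[OF l S.diff_mem[OF fm[OF w]], of k] S.dual_diff[OF l fm[OF w], of k] by simp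
          thus ?thesis using N[OF that(1) w] e by (simp add: dist_norm norm_minus_commute)
        qed
        thus "\<forall>\<^sub>F n in sequentially. \<forall>x\<in>cball z d. dist (l (s n x)) (l (f x)) < e"
          unfolding eventually_sequentially by blast
      qed
      thus "\<exists>d>0. cball z d \<subseteq> \<S> \<and> uniform_limit (cball z d) (\<lambda>n z. l (s n z)) (\<lambda>z. l (f z)) sequentially"
        using d by blast
    qed
  qed (use good K F_D(2-4) in \<open>auto intro!: cont S.nsp_axioms X0.nsp_axioms X1.nsp_axioms\<close>)
  hence fF: "f \<in> pts F" by blast
  have "(\<lambda>k. nrm F (s k - f)) \<longlonglongrightarrow> 0"
  proof (rule LIMSEQ_I)
    fix e :: real assume e: "e > 0"
    then obtain N where N: "\<And>k X z. k \<ge> N \<Longrightarrow> good X z \<Longrightarrow> nrm X (f z - s k z) \<le> e/2" using unif[of "e/2"] half_gt_zero by blast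
    have "nrm F (f - s k) \<le> e/2" if "k \<ge> N" for k
      by (rule calderon_nrm_le) (use N that good in auto)
    thus "\<exists>no. \<forall>n\<ge>no. norm (nrm F (s n - f) - 0) < e"
      using e F.nrm_commute[OF fF sm] F_nrm_ge0[OF F.diff_mem[OF fF sm]] by (intro exI[of _ N]) fastforce
  qed
  thus "\<exists>x. nlim F s x" using sm fF by (auto simp: nlim_def)
qed

lemma taylor_bound:
  assumes f: "f \<in> pts F" and r: "ball z r \<subseteq> \<S>" "r > 0" "r \<le> 1" and n: "n \<ge> 1"
  shows "nrm (\<P> n) (\<T> n z f) \<le> (2 / r) ^ n * nrm F f"
proof (rule nsp_powerspace_nrm(2)[OF n])
  fix i assume i: "i < n"
  have sub: "w \<in> cstrip" if "w \<in> ball z r" for w using r(1) that by (auto simp: strip_def subset_iff less_imp_le)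
  have "analytic_into \<Sigma> f (ball z r)" using F_D(1)[OF f] r(1) by (auto simp: analytic_into_def)
  hence "nrm \<Sigma> (\<T> n z f i) \<le> nrm F f * (2/r) ^ (n - 1 - i)"
    by (rule S.taylor_array_nrm_le) (use F_\<Sigma>_le[OF f] sub r i in auto)
  also have "\<dots> \<le> nrm F f * (2/r) ^ n"
    using r F_nrm_ge0[OF f] by (intro mult_left_mono power_increasing) (auto simp: field_simps)
  finally show "nrm \<Sigma> (\<T> n z f i) \<le> (2/r) ^ n * nrm F f" by (simp add: mult.commute)
qed

text \<open>Boundedness is Cauchy's inequality on a disc inside the strip. Linearity is tested by
  functionals, where it becomes the linearity of higher derivatives of holomorphic
  functions.\<close>

lemma taylor_F:
  assumes z: "z \<in> \<S>" and n: "n \<ge> 1"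
  shows "\<exists>C>0. quotient_map F (\<P> n) (\<T> n z) C"
proof -
  let ?T = "\<T> n z"
  note U = open_strip[of 0 1]
  obtain r where r: "r > 0" "r \<le> 1" "ball z r \<subseteq> \<S>"
  proof -
    obtain r where r: "r > 0" "ball z r \<subseteq> \<S>" using U z open_contains_ball by blast
    have "ball z (min r 1) \<subseteq> ball z r" by auto
    thus ?thesis using that[of "min r 1"] r by auto
  qed
  have i0: "?T f i = 0" if "i \<ge> n" for f i using that by (simp add: taylor_array_def)
  have mem: "?T f i \<in> pts \<Sigma>" if "f \<in> pts F" for f i
    by (rule S.taylor_array_mem[OF U F_D(1)[OF that] z])
  have "quotient_map F (\<P> n) ?T ((2/r) ^ n)"
  proof
    show "banach_space F" by (rule banach_F)
    show "banach_space (\<P> n)" by (rule banach_power_space[OF banach_\<Sigma> n])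
    show "0 < (2/r) ^ n" using r by simp
    fix f assume f: "f \<in> pts F"
    show "?T f \<in> pts (\<P> n)" using mem[OF f] i0 by (simp add: power_space_pts)
    show "nrm (\<P> n) (?T f) \<le> (2/r) ^ n * nrm F f"
      by (rule taylor_bound[OF f r(3,1,2) n])
    show "?T (c *\<^sub>C f) = c *\<^sub>C ?T f" for c
    proof
      fix i show "?T (c *\<^sub>C f) i = (c *\<^sub>C ?T f) i"
      proof (cases "i < n")
        case True
        show ?thesis
        proof (rule S.dual_eqI)
          have cf: "c *\<^sub>C f \<in> pts F" by (rule F.scale_mem[OF f])
          show "?T (c *\<^sub>C f) i \<in> pts \<Sigma>" "(c *\<^sub>C ?T f) i \<in> pts \<Sigma>"
            using mem[OF f] mem[OF cf] by (auto simp: scaleC_fun_def S.scale_mem)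
          fix l assume l: "l \<in> \<D>"
          have "(deriv ^^ (n - 1 - i)) (\<lambda>w. l ((c *\<^sub>C f) w)) z = (deriv ^^ (n - 1 - i)) (\<lambda>w. c * l (f w)) z"
          proof (rule higher_deriv_cong_ev)
            show "\<forall>\<^sub>F w in nhds z. l ((c *\<^sub>C f) w) = c * l (f w)"
              using U z F_D(8)[OF f] S.dual_scale[OF l] unfolding eventually_nhds
              by (intro exI[of _ "\<S>"]) (auto simp: strip_def scaleC_fun_def)
          qed simp
          also have "\<dots> = c * (deriv ^^ (n - 1 - i)) (\<lambda>w. l (f w)) z"
            by (rule higher_deriv_cmult[OF F_holomorphic[OF f l] z U])
          finally show "l (?T (c *\<^sub>C f) i) = l ((c *\<^sub>C ?T f) i)"
            using S.dual_taylor_array[OF U F_D(1)[OF f] z l True] S.dual_taylor_array[OF U F_D(1)[OF cf] z l True]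
              S.dual_scale[OF l mem[OF f]] by (simp add: scaleC_fun_def)
        qed
      qed (simp add: i0 scaleC_fun_def)
    qed
    fix g assume g: "g \<in> pts F"
    show "?T (f + g) = ?T f + ?T g"
    proof
      fix i show "?T (f + g) i = (?T f + ?T g) i"
      proof (cases "i < n")
        case True
        show ?thesis
        proof (rule S.dual_eqI)
          have fg: "f + g \<in> pts F" by (rule F.add_mem[OF f g])
          show "?T (f + g) i \<in> pts \<Sigma>" "(?T f + ?T g) i \<in> pts \<Sigma>"
            using mem[OF f] mem[OF g] mem[OF fg] by (auto simp: S.add_mem)
          fix l assume l: "l \<in> \<D>"
          have "(deriv ^^ (n - 1 - i)) (\<lambda>w. l ((f + g) w)) z = (deriv ^^ (n - 1 - i)) (\<lambda>w. l (f w) + l (g w)) z"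
          proof (rule higher_deriv_cong_ev)
            show "\<forall>\<^sub>F w in nhds z. l ((f + g) w) = l (f w) + l (g w)"
              using U z F_D(8)[OF f] F_D(8)[OF g] S.dual_add[OF l] unfolding eventually_nhds
              by (intro exI[of _ "\<S>"]) (auto simp: strip_def)
          qed simp
          also have "\<dots> = (deriv ^^ (n - 1 - i)) (\<lambda>w. l (f w)) z + (deriv ^^ (n - 1 - i)) (\<lambda>w. l (g w)) z"
            by (rule higher_deriv_add[OF F_holomorphic[OF f l] F_holomorphic[OF g l] U z])
          finally show "l (?T (f + g) i) = l ((?T f + ?T g) i)"
            using S.dual_taylor_array[OF U F_D(1)[OF f] z l True] S.dual_taylor_array[OF U F_D(1)[OF g] z l True]
              S.dual_taylor_array[OF U F_D(1)[OF fg] z l True] S.dual_add[OF l mem[OF f] mem[OF g]]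
            by (simp add: add_divide_distrib)
        qed
      qed (simp add: i0)
    qed
  qed
  thus ?thesis using r by (intro exI[of _ "(2/r)^n"]) auto
qed

lemma rochberg_compatible:
  assumes n: "n \<ge> 1" and z: "z \<in> \<S>" "w \<in> \<S>"
  shows "compatible_couple (\<P> n) (rochberg_space X0 X1 n z) (rochberg_space X0 X1 n w)"
proof -
  obtain C where "quotient_map F (\<P> n) (\<T> n z) C" using taylor_F[OF z(1) n] by blast
  then interpret z: quotient_map F "\<P> n" "\<T> n z" C .
  obtain C' where "quotient_map F (\<P> n) (\<T> n w) C'" using taylor_F[OF z(2) n] by blast
  then interpret w: quotient_map F "\<P> n" "\<T> n w" C' .
  show ?thesis
    unfolding compatible_couple_def rochberg_space_def
    using z.banach_Q w.banach_Q z.continuously_included_Q w.continuously_included_Q z.Y.banach by blast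
qed

end

section \<open>A Riemann integral over the unit interval with values in a record space\<close>

definition dyadic_sum :: "nat \<Rightarrow> (real \<Rightarrow> 'v::complex_vector) \<Rightarrow> 'v"
  where "dyadic_sum N \<phi> = of_real (1 / 2 ^ N) *\<^sub>C (\<Sum>k<2 ^ N. \<phi> (real k / 2 ^ N))"

text \<open>The Riemann integral of a norm-continuous function, as the limit of left sums over
  dyadic partitions; its existence is \<open>nlim_interval_int\<close>.\<close>

definition interval_int :: "'v::complex_vector nspace \<Rightarrow> (real \<Rightarrow> 'v) \<Rightarrow> 'v"
  where "interval_int X \<phi> = (THE x. nlim X (\<lambda>N. dyadic_sum N \<phi>) x)"

lemma dyadic_point: "k < 2 ^ N \<Longrightarrow> real k / 2 ^ N \<in> {0..1}"
  by (simp add: field_simps of_nat_less_two_power less_imp_le)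

text \<open>Uniform continuity makes each subinterval cost at most \<open>e / 2\<close> times its
  length; the errors are added by induction on the number \<open>m\<close> of subintervals
  covered.\<close>

lemma continuous_dyadic_sum_limit:
  fixes \<psi> :: "real \<Rightarrow> complex"
  assumes c: "continuous_on {0..1} \<psi>"
  shows "(\<lambda>N. of_real (1 / 2 ^ N) * (\<Sum>k<2 ^ N. \<psi> (real k / 2 ^ N))) \<longlonglongrightarrow> integral {0..1} \<psi>"
proof (rule LIMSEQ_I)
  fix e :: real assume e: "e > 0"
  have "uniformly_continuous_on {0..1} \<psi>" by (rule compact_uniformly_continuous[OF c]) simp
  then obtain d where d: "d > 0" "\<And>s s'. s \<in> {0..1} \<Longrightarrow> s' \<in> {0..1} \<Longrightarrow> dist s' s < d \<Longrightarrow> dist (\<psi> s') (\<psi> s) < e/2"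
    unfolding uniformly_continuous_on_def using e by (meson half_gt_zero)
  obtain N0 where N0: "(1/2::real) ^ N0 < d" using real_arch_pow_inv[OF d(1), of "1/2"] by auto
  have "norm (of_real (1 / 2 ^ N) * (\<Sum>k<2 ^ N. \<psi> (real k / 2 ^ N)) - integral {0..1} \<psi>) < e" if N: "N \<ge> N0" for N
  proof -
    define h where "h = 1 / (2::real) ^ N"
    have h: "h > 0" by (simp add: h_def)
    have "h = (1/2) ^ N" by (simp add: h_def power_divide)
    also have "\<dots> \<le> (1/2) ^ N0" using N by (intro power_decreasing) auto
    finally have hd: "h < d" using N0 by simp
    have "norm (of_real h * (\<Sum>k<m. \<psi> (real k * h)) - integral {0..real m * h} \<psi>) \<le> e/2 * (real m * h)"
      if "m \<le> 2 ^ N" for m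
      using that
    proof (induction m)
      case (Suc m)
      have mh: "real (Suc m) * h \<le> 1"
      proof -
        have "real (Suc m) \<le> 2 ^ N" using Suc.prems by (metis of_nat_le_iff of_nat_numeral of_nat_power)
        thus ?thesis by (simp add: h_def field_simps)
      qed
      have i: "\<psi> integrable_on {u..v}" if "0 \<le> u" "v \<le> 1" for u v
        using that by (intro integrable_continuous_interval continuous_on_subset[OF c]) auto
      have le: "0 \<le> real m * h" "real m * h \<le> real (Suc m) * h" using h by (auto simp: algebra_simps)
      have split: "integral {0..real (Suc m) * h} \<psi> = integral {0..real m * h} \<psi> + integral {real m * h..real (Suc m) * h} \<psi>"
        using Henstock_Kurzweil_Integration.integral_combine[OF le i] mh by simp
      have "norm (integral {real m * h..real (Suc m) * h} (\<lambda>s. \<psi> (real m * h) - \<psi> s)) \<le> e/2 * (real (Suc m) * h - real m * h)"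
      proof (rule integral_bound[OF le(2)])
        show "continuous_on {real m * h..real (Suc m) * h} (\<lambda>s. \<psi> (real m * h) - \<psi> s)"
          using mh le by (intro continuous_intros continuous_on_subset[OF c]) auto
        fix s assume s: "s \<in> {real m * h..real (Suc m) * h}"
        have "dist (\<psi> (real m * h)) (\<psi> s) < e/2"
        proof (rule d(2))
          show "s \<in> {0..1}" using s mh order_trans[OF le(1), of s] by simp
          show "real m * h \<in> {0..1}" using mh le by simp
          show "dist (real m * h) s < d" using s hd by (simp add: dist_real_def algebra_simps)
        qed
        thus "norm (\<psi> (real m * h) - \<psi> s) \<le> e/2" by (simp add: dist_norm)
      qed
      moreover have "integral {real m * h..real (Suc m) * h} (\<lambda>s. \<psi> (real m * h) - \<psi> s) =
          of_real h * \<psi> (real m * h) - integral {real m * h..real (Suc m) * h} \<psi>"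
        using i[of "real m * h" "real (Suc m) * h"] le mh
        by (subst integral_diff) (auto simp: algebra_simps scaleR_conv_of_real)
      ultimately have "norm (of_real h * \<psi> (real m * h) - integral {real m * h..real (Suc m) * h} \<psi>)
          \<le> e/2 * (real (Suc m) * h - real m * h)"
        by (simp only:)
      also have "\<dots> = e/2 * h" by (simp add: algebra_simps)
      finally have "norm (of_real h * \<psi> (real m * h) - integral {real m * h..real (Suc m) * h} \<psi>) \<le> e/2 * h" .
      moreover have "norm (of_real h * (\<Sum>k<m. \<psi> (real k * h)) - integral {0..real m * h} \<psi>) \<le> e/2 * (real m * h)"
        using Suc by simp
      moreover have "of_real h * (\<Sum>k<Suc m. \<psi> (real k * h)) - integral {0..real (Suc m) * h} \<psi> =
        (of_real h * (\<Sum>k<m. \<psi> (real k * h)) - integral {0..real m * h} \<psi>) +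
        (of_real h * \<psi> (real m * h) - integral {real m * h..real (Suc m) * h} \<psi>)"
        unfolding split by (simp add: algebra_simps)
      ultimately have "norm (of_real h * (\<Sum>k<Suc m. \<psi> (real k * h)) - integral {0..real (Suc m) * h} \<psi>)
          \<le> e/2 * (real m * h) + e/2 * h"
        using norm_triangle_mono by metis
      also have "\<dots> = e/2 * (real (Suc m) * h)" by (simp add: algebra_simps)
      finally show ?case .
    qed simp
    from this[of "2 ^ N"] show ?thesis using e by (simp add: h_def)
  qed
  thus "\<exists>no. \<forall>N\<ge>no. norm (of_real (1 / 2 ^ N) * (\<Sum>k<2 ^ N. \<psi> (real k / 2 ^ N)) - integral {0..1} \<psi>) < e" by blast
qed

context nsp
begin

lemma ncont_diff: "ncont X A f \<Longrightarrow> ncont X A g \<Longrightarrow> ncont X A (\<lambda>x. f x - g x)"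
  using ncont_add[of A f "\<lambda>x. (-1) *\<^sub>C g x"] ncont_scale[of A "\<lambda>_. -1" g] by simp

text \<open>Uniform continuity of the real function sending \<open>(x, y)\<close> to the norm of
  \<open>f x - f y\<close> on the compact square, compared with its value 0 on the diagonal.\<close>

lemma ncont_uniform:
  fixes K :: "'a::metric_space set"
  assumes f: "ncont X K f" and K: "compact K" and e: "e > 0"
  shows "\<exists>d>0. \<forall>x\<in>K. \<forall>y\<in>K. dist x y < d \<longrightarrow> nrm X (f x - f y) < e"
proof -
  let ?N = "\<lambda>p. nrm X (f (fst p) - f (snd p))"
  have "ncont X (K \<times> K) (\<lambda>p. f (fst p) - f (snd p))"
    by (intro ncont_diff ncont_compose[OF f] continuous_intros) auto
  hence "continuous_on (K \<times> K) ?N" by (rule ncont_continuous_nrm)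
  hence "uniformly_continuous_on (K \<times> K) ?N"
    by (rule compact_uniformly_continuous) (rule compact_Times[OF K K])
  then obtain d where d: "d > 0" "\<And>p q. p \<in> K \<times> K \<Longrightarrow> q \<in> K \<times> K \<Longrightarrow> dist q p < d \<Longrightarrow> dist (?N q) (?N p) < e"
    unfolding uniformly_continuous_on_def using e by meson
  have "nrm X (f x - f y) < e" if "x \<in> K" "y \<in> K" "dist x y < d" for x y
    using d(2)[of "(x, x)" "(x, y)"] that nrm_ge0[OF diff_mem[OF ncont_mem[OF f that(1)] ncont_mem[OF f that(2)]]]
    by (simp add: dist_Pair_Pair dist_commute dist_real_def)
  thus ?thesis using d(1) by blast
qed

lemma dyadic_sum_mem: "(\<And>s. s \<in> {0..1} \<Longrightarrow> \<phi> s \<in> pts X) \<Longrightarrow> dyadic_sum N \<phi> \<in> pts X"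
  unfolding dyadic_sum_def by (intro scale_mem sum_mem) (use dyadic_point in blast)

lemma dyadic_sum_le:
  assumes "\<And>s. s \<in> {0..1} \<Longrightarrow> \<phi> s \<in> pts X" "\<And>s. s \<in> {0..1} \<Longrightarrow> nrm X (\<phi> s) \<le> B"
  shows "nrm X (dyadic_sum N \<phi>) \<le> B"
proof -
  have m: "\<phi> (real k / 2 ^ N) \<in> pts X" if "k < 2 ^ N" for k using assms(1) dyadic_point that by blast
  have "nrm X (\<Sum>k<2 ^ N. \<phi> (real k / 2 ^ N)) \<le> (\<Sum>k<2 ^ N. nrm X (\<phi> (real k / 2 ^ N)))"
    by (rule nrm_sum) (use m in simp)
  also have "\<dots> \<le> (\<Sum>k<(2::nat) ^ N. B)"
    using assms(2) dyadic_point by (intro sum_mono) (simp del: atLeastAtMost_iff)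
  also have "\<dots> = 2 ^ N * B" by simp
  finally have "1 / 2 ^ N * nrm X (\<Sum>k<2 ^ N. \<phi> (real k / 2 ^ N)) \<le> B" by (simp add: field_simps)
  moreover have "nrm X (dyadic_sum N \<phi>) = 1 / 2 ^ N * nrm X (\<Sum>k<2 ^ N. \<phi> (real k / 2 ^ N))"
    unfolding dyadic_sum_def using m by (subst nrm_scale) (auto intro!: sum_mem simp: norm_divide norm_power)
  ultimately show ?thesis by simp
qed

text \<open>The coarse sum is rewritten over the fine grid by repeating each coarse node
  \<open>k\<close> times; nodes then differ by less than the coarse mesh.\<close>

lemma dyadic_sum_refine:
  assumes m: "\<And>s. s \<in> {0..1} \<Longrightarrow> \<phi> s \<in> pts X" and MN: "N \<le> M"
    and e: "\<And>x y. x \<in> {0..1} \<Longrightarrow> y \<in> {0..1} \<Longrightarrow> dist x y < d \<Longrightarrow> nrm X (\<phi> x - \<phi> y) \<le> e"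
    and d: "(1/2) ^ N \<le> d"
  shows "nrm X (dyadic_sum M \<phi> - dyadic_sum N \<phi>) \<le> e"
proof -
  define k :: nat where "k = 2 ^ (M - N)"
  have k: "k > 0" "(2::nat) ^ M = 2 ^ N * k" using MN by (auto simp: k_def simp flip: power_add)
  have kr: "(2::real) ^ M = 2 ^ N * real k" using MN by (simp add: k_def flip: power_add)
  \<comment> \<open>\<open>J j\<close> is the index of the coarse subinterval that contains the fine
    node \<open>j\<close>.\<close>
  define J where "J j = j div k" for j
  have J: "J j < 2 ^ N" if "j < 2 ^ M" for j
    using that k unfolding J_def by (simp add: less_mult_imp_div_less)
  have "dyadic_sum N \<phi> = of_real (1 / 2 ^ M) *\<^sub>C (\<Sum>i<2 ^ N. of_real (real k) *\<^sub>C \<phi> (real i / 2 ^ N))"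
    using k unfolding dyadic_sum_def kr by (simp add: scaleC.scale_sum_right)
  also have "(\<Sum>i<2 ^ N. of_real (real k) *\<^sub>C \<phi> (real i / 2 ^ N)) =
      (\<Sum>i<2 ^ N. sum (\<lambda>j. \<phi> (real (J j) / 2 ^ N)) {i * k..<i * k + k})"
  proof (rule sum.cong[OF refl])
    fix i
    have "J j = i" if "j \<in> {i * k..<i * k + k}" for j
      using that k unfolding J_def by (auto intro!: div_nat_eqI simp: algebra_simps)
    hence "sum (\<lambda>j. \<phi> (real (J j) / 2 ^ N)) {i * k..<i * k + k} = sum (\<lambda>j. \<phi> (real i / 2 ^ N)) {i * k..<i * k + k}"
      by (intro sum.cong) auto
    also have "\<dots> = of_real (real k) *\<^sub>C \<phi> (real i / 2 ^ N)"
      by (simp add: scaleC.sum_constant_scale)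
    finally show "of_real (real k) *\<^sub>C \<phi> (real i / 2 ^ N) = sum (\<lambda>j. \<phi> (real (J j) / 2 ^ N)) {i * k..<i * k + k}" by simp
  qed
  also have "\<dots> = (\<Sum>j<2 ^ M. \<phi> (real (J j) / 2 ^ N))" unfolding k(2) by (rule sum.nat_group)
  finally have N: "dyadic_sum N \<phi> = of_real (1 / 2 ^ M) *\<^sub>C (\<Sum>j<2 ^ M. \<phi> (real (J j) / 2 ^ N))" .
  define D where "D j = \<phi> (real j / 2 ^ M) - \<phi> (real (J j) / 2 ^ N)" for j
  have Dm: "D j \<in> pts X" and De: "nrm X (D j) \<le> e" if j: "j < 2 ^ M" for j
  proof -
    have p: "real j / 2 ^ M \<in> {0..1}" "real (J j) / 2 ^ N \<in> {0..1}" using dyadic_point J j by blast+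
    show "D j \<in> pts X" unfolding D_def by (intro diff_mem m p)
    have j2: "real j = real (J j) * real k + real (j mod k)"
      unfolding J_def by (metis div_mult_mod_eq of_nat_add of_nat_mult)
    have "real j / 2 ^ M - real (J j) / 2 ^ N = real (j mod k) / 2 ^ M"
      unfolding j2 kr using k(1) by (simp add: field_simps)
    moreover have "real (j mod k) / 2 ^ M < (1/2) ^ N"
      unfolding kr using k(1) by (simp add: field_simps power_divide)
    ultimately have "dist (real j / 2 ^ M) (real (J j) / 2 ^ N) < d" using d by (simp add: dist_real_def)
    thus "nrm X (D j) \<le> e" unfolding D_def by (rule e[OF p])
  qed
  have "dyadic_sum M \<phi> - dyadic_sum N \<phi> = of_real (1 / 2 ^ M) *\<^sub>C (\<Sum>j<2 ^ M. D j)"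
    unfolding N dyadic_sum_def[of M] D_def by (simp add: sum_subtractf scaleC.scale_right_diff_distrib)
  moreover have "nrm X (\<Sum>j<2 ^ M. D j) \<le> 2 ^ M * e"
    using nrm_sum[of "{..<2 ^ M}" D] sum_mono[of "{..<(2::nat) ^ M}" "\<lambda>j. nrm X (D j)" "\<lambda>_. e"] Dm De by simp
  moreover have "(\<Sum>j<2 ^ M. D j) \<in> pts X" using Dm by (intro sum_mem) simp
  ultimately show ?thesis by (simp add: nrm_scale norm_divide norm_power field_simps)
qed

lemma dual_dyadic_sum:
  assumes l: "l \<in> dual_ball X" and m: "\<And>s. s \<in> {0..1} \<Longrightarrow> \<phi> s \<in> pts X"
  shows "l (dyadic_sum N \<phi>) = of_real (1 / 2 ^ N) * (\<Sum>k<2 ^ N. l (\<phi> (real k / 2 ^ N)))"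
proof -
  have mm: "\<phi> (real k / 2 ^ N) \<in> pts X" if "k < 2 ^ N" for k using m dyadic_point that by blast
  have "l (\<Sum>k<2 ^ N. \<phi> (real k / 2 ^ N)) = (\<Sum>k<2 ^ N. l (\<phi> (real k / 2 ^ N)))"
    by (rule dual_sum[OF l]) (use mm in simp)
  thus ?thesis unfolding dyadic_sum_def
    by (subst dual_scale[OF l]) (use mm in \<open>auto intro!: sum_mem\<close>)
qed

end

context bsp
begin

lemma nlim_interval_int:
  assumes f: "ncont X {0..1} \<phi>"
  shows "nlim X (\<lambda>N. dyadic_sum N \<phi>) (interval_int X \<phi>)"
proof -
  have m: "\<And>s. s \<in> {0..1} \<Longrightarrow> \<phi> s \<in> pts X" using ncont_mem[OF f] by blast
  have "ncauchy X (\<lambda>N. dyadic_sum N \<phi>)"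
    unfolding ncauchy_def
  proof (intro conjI allI impI dyadic_sum_mem m)
    fix e :: real assume e: "e > 0"
    obtain d where d: "d > 0" "\<And>x y. x \<in> {0..1} \<Longrightarrow> y \<in> {0..1} \<Longrightarrow> dist x y < d \<Longrightarrow> nrm X (\<phi> x - \<phi> y) < e/2"
      using ncont_uniform[OF f, of "e/2"] e by (metis compact_Icc half_gt_zero)
    obtain N0 where N0: "(1/2::real) ^ N0 < d" using real_arch_pow_inv[OF d(1), of "1/2"] by auto
    have le: "nrm X (dyadic_sum M \<phi> - dyadic_sum N \<phi>) \<le> e/2" if "N0 \<le> N" "N \<le> M" for M N
    proof (rule dyadic_sum_refine[OF m that(2)])
      have "(1/2::real) ^ N \<le> (1/2) ^ N0" using that by (intro power_decreasing) auto
      thus "(1/2) ^ N \<le> d" using N0 by linarith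
    qed (use d in \<open>auto simp: less_imp_le\<close>)
    have "nrm X (dyadic_sum M \<phi> - dyadic_sum N \<phi>) < e" if "N0 \<le> N" "N0 \<le> M" for M N
      using le[of N M] le[of M N] that e nrm_commute[OF dyadic_sum_mem[of \<phi>, OF m] dyadic_sum_mem[of \<phi>, OF m], of M N]
      by (cases "N \<le> M") auto
    thus "\<exists>N0. \<forall>M\<ge>N0. \<forall>N\<ge>N0. nrm X (dyadic_sum M \<phi> - dyadic_sum N \<phi>) < e" by blast
  qed
  then obtain x where x: "nlim X (\<lambda>N. dyadic_sum N \<phi>) x" using complete by blast
  hence "interval_int X \<phi> = x"
    unfolding interval_int_def using nlim_unique by (intro the_equality) auto
  thus ?thesis using x by simp
qed

lemma interval_int_mem: "ncont X {0..1} \<phi> \<Longrightarrow> interval_int X \<phi> \<in> pts X"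
  using nlim_interval_int by (simp add: nlim_def)

lemma interval_int_nrm_le:
  "ncont X {0..1} \<phi> \<Longrightarrow> (\<And>s. s \<in> {0..1} \<Longrightarrow> nrm X (\<phi> s) \<le> B) \<Longrightarrow> nrm X (interval_int X \<phi>) \<le> B"
  by (rule nlim_nrm_le[OF nlim_interval_int dyadic_sum_le]) (auto simp: ncont_def)

lemma dual_interval_int:
  assumes l: "l \<in> dual_ball X" and f: "ncont X {0..1} \<phi>"
  shows "l (interval_int X \<phi>) = integral {0..1} (\<lambda>s. l (\<phi> s))"
proof -
  have "(\<lambda>N. l (dyadic_sum N \<phi>)) \<longlonglongrightarrow> l (interval_int X \<phi>)"
    by (rule dual_nlim[OF l nlim_interval_int[OF f]])
  moreover have "(\<lambda>N. l (dyadic_sum N \<phi>)) \<longlonglongrightarrow> integral {0..1} (\<lambda>s. l (\<phi> s))"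
    using continuous_dyadic_sum_limit[OF dual_continuous_on[OF l f]] dual_dyadic_sum[OF l ncont_mem[OF f]] by simp
  ultimately show ?thesis by (rule LIMSEQ_unique)
qed

end

text \<open>The integral does not depend on which of two nested spaces it is formed in. In this way
  a boundary integral computed in \<open>X0\<close> or \<open>X1\<close> agrees with the one in
  \<open>\<Sigma>\<close>.\<close>

lemma interval_int_mono:
  assumes "bsp X" "bsp Y" "pts X \<subseteq> pts Y" "\<And>x. x \<in> pts X \<Longrightarrow> nrm Y x \<le> C * nrm X x" "ncont X {0..1} \<phi>"
  shows "interval_int Y \<phi> = interval_int X \<phi>"
proof -
  interpret X: bsp X by fact
  interpret Y: bsp Y by fact
  have "nlim Y (\<lambda>N. dyadic_sum N \<phi>) (interval_int X \<phi>)"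
    by (rule nlim_mono[OF X.nsp_axioms Y.nsp_axioms assms(3,4) X.nlim_interval_int[OF assms(5)]])
  thus ?thesis
    unfolding interval_int_def[of Y] using Y.nlim_unique by (intro the_equality) auto
qed

section \<open>Integrals over the real line\<close>

text \<open>
  Integrals over the real line are taken over \<open>(0, 1)\<close> after the substitution \<open>t = tan (\<pi> (s - 1/2))\<close>;
  integrands of order \<open>|t|\<^sup>-\<^sup>3\<close> then extend continuously by 0 to the end points.
\<close>

definition line_param :: "real \<Rightarrow> real"
  where "line_param s = tan (pi * (s - 1/2))"

definition compactify :: "(real \<Rightarrow> 'v::complex_vector) \<Rightarrow> real \<Rightarrow> 'v"
  where "compactify \<phi> s = (if 0 < s \<and> s < 1
    then of_real (pi * (1 + (line_param s)\<^sup>2)) *\<^sub>C \<phi> (line_param s) else 0)"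

definition line_int :: "'v::complex_vector nspace \<Rightarrow> (real \<Rightarrow> 'v) \<Rightarrow> 'v"
  where "line_int X \<phi> = interval_int X (compactify \<phi>)"

definition cline_int :: "(real \<Rightarrow> complex) \<Rightarrow> complex"
  where "cline_int \<psi> = integral {0..1} (\<lambda>s. if 0 < s \<and> s < 1
    then of_real (pi * (1 + (line_param s)\<^sup>2)) * \<psi> (line_param s) else 0)"

text \<open>The factor \<open>1 + t^2\<close> offsets the Jacobian of the substitution; the further
  \<open>1 + |t|\<close> makes the substituted integrand vanish at the end points and is the reserve
  used for continuity in parameters.\<close>

definition weight :: "real \<Rightarrow> real"
  where "weight t = (1 + t\<^sup>2) * (1 + \<bar>t\<bar>)"

definition rapid :: "'v::complex_vector nspace \<Rightarrow> real \<Rightarrow> (real \<Rightarrow> 'v) \<Rightarrow> bool"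
  where "rapid X M \<phi> \<longleftrightarrow> ncont X UNIV \<phi> \<and> (\<forall>t. weight t * nrm X (\<phi> t) \<le> M)"

lemma weight_ge: "weight t \<ge> 1" "weight t \<ge> 1 + t\<^sup>2" "weight t \<ge> 1 + \<bar>t\<bar>" "weight t > 0"
proof -
  show w: "weight t \<ge> 1 + t\<^sup>2" "weight t \<ge> 1 + \<bar>t\<bar>"
    using mult_left_mono[of 1 "1 + \<bar>t\<bar>" "1 + t\<^sup>2"] mult_right_mono[of 1 "1 + t\<^sup>2" "1 + \<bar>t\<bar>"]
    by (auto simp: weight_def)
  thus "weight t \<ge> 1" "weight t > 0" by (smt (verit) zero_le_power2)+
qed

lemma line_param_cos:
  assumes "0 < s" "s < 1" shows "cos (pi * (s - 1/2)) > 0"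
proof (rule cos_gt_zero_pi)
  have "- (1/2) < s - 1/2" "s - 1/2 < 1/2" using assms by auto
  thus "- (pi/2) < pi * (s - 1/2)" "pi * (s - 1/2) < pi/2"
    using mult_strict_left_mono[of "-(1/2)" "s - 1/2" pi] mult_strict_left_mono[of "s - 1/2" "1/2" pi] by auto
qed

lemma line_param_deriv:
  assumes "0 < s" "s < 1"
  shows "(line_param has_field_derivative pi * (1 + (line_param s)\<^sup>2)) (at s within S)"
proof -
  have c: "cos (pi * (s - 1/2)) \<noteq> 0" using line_param_cos[OF assms] by simp
  have "1 + (tan (pi * (s - 1/2)))\<^sup>2 = inverse ((cos (pi * (s - 1/2)))\<^sup>2)"
    using tan_sec[OF c] by (simp add: power_inverse)
  thus ?thesis
    unfolding line_param_def using c by (auto intro!: derivative_eq_intros)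
qed

lemma line_param_continuous: "continuous_on {0<..<1} line_param"
  using line_param_deriv by (intro DERIV_continuous_on) auto

text \<open>Since \<open>|cos x| + |sin x| \<ge> 1\<close>, dividing by the positive cosine gives
  \<open>cos x * (1 + |tan x|) \<ge> 1\<close>; with \<open>x = pi (s - 1/2)\<close> the cosine is
  \<open>sin (pi s)\<close>.\<close>

lemma line_param_decay:
  assumes "0 < s" "s < 1"
  shows "1 / (1 + \<bar>line_param s\<bar>) \<le> sin (pi * s)"
proof -
  let ?x = "pi * (s - 1/2)"
  have c: "cos ?x > 0" by (rule line_param_cos[OF assms])
  have "(\<bar>cos ?x\<bar> + \<bar>sin ?x\<bar>)\<^sup>2 \<ge> 1"
    using sin_cos_squared_add[of ?x] by (simp add: power2_sum)
  hence "\<bar>cos ?x\<bar> + \<bar>sin ?x\<bar> \<ge> 1"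
    by (smt (verit) abs_ge_zero one_power2 power2_le_imp_le power_mono)
  hence "cos ?x * (1 + \<bar>line_param s\<bar>) \<ge> 1"
    using c by (simp add: line_param_def tan_def distrib_left abs_divide)
  hence "1 / (1 + \<bar>line_param s\<bar>) \<le> cos ?x"
    by (simp add: divide_le_eq add_pos_nonneg)
  also have "cos ?x = sin (pi * s)"
    by (simp add: right_diff_distrib cos_diff)
  finally show ?thesis .
qed

lemma compactify_decay:
  assumes M: "\<And>t. weight t * N t \<le> M" "\<And>t. N t \<ge> 0" and s: "0 < s" "s < 1"
  shows "pi * (1 + (line_param s)\<^sup>2) * N (line_param s) \<le> pi * M * sin (pi * s)"
proof -
  let ?t = "line_param s"
  have M0: "M \<ge> 0" using M[of 0] weight_ge(4)[of 0] by (smt (verit) mult_nonneg_nonneg)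
  have "(1 + ?t\<^sup>2) * N ?t = (weight ?t * N ?t) * (1 / (1 + \<bar>?t\<bar>))"
    by (simp add: weight_def add_pos_nonneg)
  also have "\<dots> \<le> M * sin (pi * s)"
    using M(1)[of ?t] line_param_decay[OF s] M0 by (intro mult_mono) auto
  finally show ?thesis by (simp add: mult.assoc)
qed

lemma (in nsp) ncont_compactify:
  assumes r: "rapid X M \<phi>"
  shows "ncont X {0..1} (compactify \<phi>)"
proof -
  have c: "ncont X UNIV \<phi>" and w: "\<And>t. weight t * nrm X (\<phi> t) \<le> M" using r by (auto simp: rapid_def)
  have pm: "\<phi> t \<in> pts X" for t using c by (simp add: ncont_def)
  have m: "compactify \<phi> s \<in> pts X" for s unfolding compactify_def using pm by (auto intro: scale_mem)
  have M0: "M \<ge> 0" using w[of 0] weight_ge(4)[of 0] nrm_ge0[OF pm[of 0]] by (smt (verit) mult_nonneg_nonneg)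
  have bd: "nrm X (compactify \<phi> s) \<le> pi * M * \<bar>sin (pi * s)\<bar>" for s
  proof (cases "0 < s \<and> s < 1")
    case True
    have "nrm X (compactify \<phi> s) = pi * (1 + (line_param s)\<^sup>2) * nrm X (\<phi> (line_param s))"
      using True by (simp add: compactify_def nrm_scale[OF pm] abs_mult norm_mult del: of_real_mult of_real_add)
    also have "\<dots> \<le> pi * M * sin (pi * s)"
      using True by (intro compactify_decay w nrm_ge0 pm) auto
    also have "\<dots> \<le> pi * M * \<bar>sin (pi * s)\<bar>" using M0 by (intro mult_left_mono) auto
    finally show ?thesis .
  qed (use M0 in \<open>auto simp: compactify_def\<close>)
  show ?thesis
    unfolding ncont_def
  proof (intro ballI conjI m)
    fix s0 :: real assume s0: "s0 \<in> {0..1}"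
    show "((\<lambda>s. nrm X (compactify \<phi> s - compactify \<phi> s0)) \<longlongrightarrow> 0) (at s0 within {0..1})"
    proof (cases "0 < s0 \<and> s0 < 1")
      case True
      have "ncont X {0<..<1} (\<lambda>s. of_real (pi * (1 + (line_param s)\<^sup>2)) *\<^sub>C \<phi> (line_param s))"
        by (intro ncont_scale ncont_compose[OF c] continuous_intros line_param_continuous) auto
      hence "((\<lambda>s. nrm X (of_real (pi * (1 + (line_param s)\<^sup>2)) *\<^sub>C \<phi> (line_param s) - compactify \<phi> s0)) \<longlongrightarrow> 0) (at s0 within {0<..<1})"
        using True unfolding ncont_def by (simp add: compactify_def)
      hence l: "((\<lambda>s. nrm X (of_real (pi * (1 + (line_param s)\<^sup>2)) *\<^sub>C \<phi> (line_param s) - compactify \<phi> s0)) \<longlongrightarrow> 0) (at s0)"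
        using True by (simp add: at_within_open[of s0 "{0<..<1}"])
      have "\<forall>\<^sub>F s in at s0. s \<in> {0<..<1}" using True by (intro eventually_at_in_open') auto
      hence "\<forall>\<^sub>F s in at s0. nrm X (of_real (pi * (1 + (line_param s)\<^sup>2)) *\<^sub>C \<phi> (line_param s) - compactify \<phi> s0)
          = nrm X (compactify \<phi> s - compactify \<phi> s0)"
        by eventually_elim (simp add: compactify_def)
      hence "((\<lambda>s. nrm X (compactify \<phi> s - compactify \<phi> s0)) \<longlongrightarrow> 0) (at s0)"
        by (rule Lim_transform_eventually[OF l])
      thus ?thesis by (rule tendsto_within_subset) simp
    next
      case False
      \<comment> \<open>At the end points the decay \<open>pi * M * |sin (pi * s)|\<close> replaces
        the continuity of the composition.\<close>
      hence s0': "s0 = 0 \<or> s0 = 1" using s0 by auto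
      hence z: "compactify \<phi> s0 = 0" "sin (pi * s0) = 0" by (auto simp: compactify_def)
      show ?thesis
      proof (rule Lim_null_comparison)
        show "\<forall>\<^sub>F s in at s0 within {0..1}. norm (nrm X (compactify \<phi> s - compactify \<phi> s0)) \<le> pi * M * \<bar>sin (pi * s)\<bar>"
          using bd nrm_ge0[OF m] by (simp add: z)
        have "((\<lambda>s. pi * M * \<bar>sin (pi * s)\<bar>) \<longlongrightarrow> pi * M * \<bar>sin (pi * s0)\<bar>) (at s0 within {0..1})"
          by (intro tendsto_intros)
        thus "((\<lambda>s. pi * M * \<bar>sin (pi * s)\<bar>) \<longlongrightarrow> 0) (at s0 within {0..1})" using z by simp
      qed
    qed
  qed
qed

context bsp
begin

lemma line_int_mem: "rapid X M \<phi> \<Longrightarrow> line_int X \<phi> \<in> pts X"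
  unfolding line_int_def by (rule interval_int_mem[OF ncont_compactify])

lemma line_int_nrm_le:
  assumes r: "rapid X M \<phi>" and B: "\<And>t. (1 + t\<^sup>2) * nrm X (\<phi> t) \<le> B"
  shows "nrm X (line_int X \<phi>) \<le> pi * B"
  unfolding line_int_def
proof (rule interval_int_nrm_le[OF ncont_compactify[OF r]])
  have pm: "\<phi> t \<in> pts X" for t using r by (simp add: rapid_def ncont_def)
  fix s :: real
  show "nrm X (compactify \<phi> s) \<le> pi * B"
  proof (cases "0 < s \<and> s < 1")
    case True
    have "nrm X (compactify \<phi> s) = pi * ((1 + (line_param s)\<^sup>2) * nrm X (\<phi> (line_param s)))"
      using True by (simp add: compactify_def nrm_scale[OF pm] abs_mult norm_mult del: of_real_mult of_real_add)
    also have "\<dots> \<le> pi * B" by (intro mult_left_mono B) auto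
    finally show ?thesis .
  next
    case False
    have "B \<ge> 0" using B[of 0] nrm_ge0[OF pm[of 0]] by simp
    thus ?thesis using False by (auto simp: compactify_def)
  qed
qed

lemma dual_line_int:
  assumes l: "l \<in> dual_ball X" and r: "rapid X M \<phi>"
  shows "l (line_int X \<phi>) = cline_int (\<lambda>t. l (\<phi> t))"
  unfolding line_int_def cline_int_def dual_interval_int[OF l ncont_compactify[OF r]]
  by (intro integral_cong) (use r in \<open>auto simp: compactify_def dual_0[OF l] dual_scale[OF l] rapid_def ncont_def\<close>)

end

lemma rapid_mono:
  assumes "nsp X" "nsp Y" "pts X \<subseteq> pts Y" "\<And>x. x \<in> pts X \<Longrightarrow> nrm Y x \<le> nrm X x" "rapid X M \<phi>"
  shows "rapid Y M \<phi>"
proof -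
  interpret X: nsp X by fact
  interpret Y: nsp Y by fact
  have c: "ncont X UNIV \<phi>" and w: "\<And>t. weight t * nrm X (\<phi> t) \<le> M" using assms(5) by (auto simp: rapid_def)
  have m: "\<phi> t \<in> pts X" for t using c by (simp add: ncont_def)
  have "ncont Y UNIV \<phi>"
    unfolding ncont_def
  proof (intro ballI conjI)
    fix a show "\<phi> a \<in> pts Y" using m assms(3) by blast
    show "((\<lambda>x. nrm Y (\<phi> x - \<phi> a)) \<longlongrightarrow> 0) (at a)"
    proof (rule Lim_null_comparison)
      have "norm (nrm Y (\<phi> x - \<phi> a)) \<le> nrm X (\<phi> x - \<phi> a)" for x
      proof -
        have d: "\<phi> x - \<phi> a \<in> pts X" using X.diff_mem m by blast
        hence "\<phi> x - \<phi> a \<in> pts Y" using assms(3) by blast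
        thus ?thesis using Y.nrm_ge0 assms(4)[OF d] by simp
      qed
      thus "\<forall>\<^sub>F x in at a. norm (nrm Y (\<phi> x - \<phi> a)) \<le> nrm X (\<phi> x - \<phi> a)" by simp
      show "((\<lambda>x. nrm X (\<phi> x - \<phi> a)) \<longlongrightarrow> 0) (at a)" using c by (simp add: ncont_def)
    qed
  qed
  moreover have "weight t * nrm Y (\<phi> t) \<le> M" for t
    using w[of t] mult_left_mono[OF assms(4)[OF m[of t]], of "weight t"] weight_ge(4)[of t] by linarith
  ultimately show ?thesis by (simp add: rapid_def)
qed

lemma line_int_mono:
  assumes "bsp X" "bsp Y" "pts X \<subseteq> pts Y" "\<And>x. x \<in> pts X \<Longrightarrow> nrm Y x \<le> nrm X x" "rapid X M \<phi>"
  shows "line_int Y \<phi> = line_int X \<phi>"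
proof -
  interpret X: bsp X by fact
  show ?thesis
    unfolding line_int_def
    by (rule interval_int_mono[OF assms(1-3), of 1]) (use assms(4) X.ncont_compactify[OF assms(5)] in auto)
qed

definition crapid :: "real \<Rightarrow> (real \<Rightarrow> complex) \<Rightarrow> bool"
  where "crapid M \<psi> \<longleftrightarrow> continuous_on UNIV \<psi> \<and> (\<forall>t. weight t * cmod (\<psi> t) \<le> M)"

lemma (in nsp) crapid_dual: "l \<in> dual_ball X \<Longrightarrow> rapid X M \<phi> \<Longrightarrow> crapid M (\<lambda>t. l (\<phi> t))"
proof -
  assume l: "l \<in> dual_ball X" and r: "rapid X M \<phi>"
  have "weight t * cmod (l (\<phi> t)) \<le> M" for t
  proof -
    have "\<phi> t \<in> pts X" "weight t * nrm X (\<phi> t) \<le> M" using r by (auto simp: rapid_def ncont_def)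
    thus ?thesis
      using mult_left_mono[OF dual_le[OF l, of "\<phi> t"], of "weight t"] weight_ge(4)[of t] by linarith
  qed
  thus ?thesis using r dual_continuous_on[OF l] by (auto simp: crapid_def rapid_def)
qed

lemma crapid_compactify_continuous:
  assumes "crapid M \<psi>"
  shows "continuous_on {0..1} (\<lambda>s. if 0 < s \<and> s < 1
    then of_real (pi * (1 + (line_param s)\<^sup>2)) * \<psi> (line_param s) else 0)" (is "continuous_on _ ?f")
proof -
  have c: "continuous_on UNIV \<psi>" and w: "\<And>t. weight t * cmod (\<psi> t) \<le> M" using assms by (auto simp: crapid_def)
  have M0: "M \<ge> 0" using w[of 0] weight_ge(4)[of 0] by (smt (verit) mult_nonneg_nonneg norm_ge_zero)
  have bd: "cmod (?f s) \<le> pi * M * \<bar>sin (pi * s)\<bar>" for s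
  proof (cases "0 < s \<and> s < 1")
    case True
    have "cmod (?f s) = pi * (1 + (line_param s)\<^sup>2) * cmod (\<psi> (line_param s))"
      using True by (simp add: norm_mult abs_mult del: of_real_mult of_real_add)
    also have "\<dots> \<le> pi * M * sin (pi * s)" using True by (intro compactify_decay w) auto
    also have "\<dots> \<le> pi * M * \<bar>sin (pi * s)\<bar>" using M0 by (intro mult_left_mono) auto
    finally show ?thesis .
  qed (use M0 in auto)
  show ?thesis
    unfolding continuous_on_def
  proof
    fix s0 :: real assume s0: "s0 \<in> {0..1}"
    show "(?f \<longlongrightarrow> ?f s0) (at s0 within {0..1})"
    proof (cases "0 < s0 \<and> s0 < 1")
      case True
      have "continuous_on {0<..<1} (\<lambda>s. of_real (pi * (1 + (line_param s)\<^sup>2)) * \<psi> (line_param s))"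
        by (intro continuous_intros line_param_continuous continuous_on_compose2[OF c line_param_continuous]) auto
      hence "continuous_on {0<..<1} ?f" by (rule continuous_on_eq) auto
      hence "(?f \<longlongrightarrow> ?f s0) (at s0 within {0<..<1})"
        using True unfolding continuous_on_def by force
      hence "(?f \<longlongrightarrow> ?f s0) (at s0)" using True by (simp add: at_within_open[of s0 "{0<..<1}"])
      thus ?thesis by (rule tendsto_within_subset) simp
    next
      case False
      hence s0': "s0 = 0 \<or> s0 = 1" using s0 by auto
      hence z: "?f s0 = 0" "sin (pi * s0) = 0" by auto
      have "(?f \<longlongrightarrow> 0) (at s0 within {0..1})"
      proof (rule Lim_null_comparison)
        show "\<forall>\<^sub>F s in at s0 within {0..1}. norm (?f s) \<le> pi * M * \<bar>sin (pi * s)\<bar>"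
          using bd by (intro always_eventually) blast
        have "((\<lambda>s. pi * M * \<bar>sin (pi * s)\<bar>) \<longlongrightarrow> pi * M * \<bar>sin (pi * s0)\<bar>) (at s0 within {0..1})"
          by (intro tendsto_intros)
        thus "((\<lambda>s. pi * M * \<bar>sin (pi * s)\<bar>) \<longlongrightarrow> 0) (at s0 within {0..1})" using z by simp
      qed
      thus ?thesis by (simp only: z(1))
    qed
  qed
qed

abbreviation cmpt :: "(real \<Rightarrow> complex) \<Rightarrow> real \<Rightarrow> complex"
  where "cmpt \<psi> \<equiv> \<lambda>s. if 0 < s \<and> s < 1 then of_real (pi * (1 + (line_param s)\<^sup>2)) * \<psi> (line_param s) else 0"

lemma cmpt_integrable: "crapid M \<psi> \<Longrightarrow> cmpt \<psi> integrable_on {0..1}"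
  by (rule integrable_continuous_interval[OF crapid_compactify_continuous])

lemma cline_int_diff:
  assumes "crapid M \<psi>" "crapid M' \<psi>'"
  shows "cline_int (\<lambda>t. \<psi> t - \<psi>' t) = cline_int \<psi> - cline_int \<psi>'"
  unfolding cline_int_def
  by (subst integral_diff[OF cmpt_integrable[OF assms(1)] cmpt_integrable[OF assms(2)], symmetric])
    (auto intro!: integral_cong simp: algebra_simps)

lemma cline_int_cmult: "cline_int (\<lambda>t. c * \<psi> t) = c * cline_int \<psi>"
proof -
  have "cmpt (\<lambda>t. c * \<psi> t) = (\<lambda>s. c * cmpt \<psi> s)" by auto
  thus ?thesis unfolding cline_int_def by (simp only: integral_mult_right)
qed

lemma cmpt_le:
  assumes "\<And>t. (1 + t\<^sup>2) * cmod (\<psi> t) \<le> B"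
  shows "cmod (cmpt \<psi> s) \<le> pi * B"
proof (cases "0 < s \<and> s < 1")
  case True
  have "cmod (cmpt \<psi> s) = pi * ((1 + (line_param s)\<^sup>2) * cmod (\<psi> (line_param s)))"
    using True by (simp add: norm_mult abs_mult del: of_real_mult of_real_add)
  also have "\<dots> \<le> pi * B" by (intro mult_left_mono assms) auto
  finally show ?thesis .
next
  case False
  have "B \<ge> 0" using assms[of 0] by (smt (verit) mult_nonneg_nonneg norm_ge_zero zero_le_power2)
  thus ?thesis using False by auto
qed

lemma cline_int_le:
  assumes r: "crapid M \<psi>" and B: "\<And>t. (1 + t\<^sup>2) * cmod (\<psi> t) \<le> B"
  shows "cmod (cline_int \<psi>) \<le> pi * B"
  using integral_bound[OF zero_le_one crapid_compactify_continuous[OF r] cmpt_le[OF B]]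
  by (simp add: cline_int_def)

text \<open>Substituting back identifies \<open>cline_int\<close> with the limit of symmetrically
  truncated integrals: the truncation removes two end pieces of length \<open>s0 T\<close>, on which
  the integrand is bounded by \<open>pi * M\<close>.\<close>

lemma cline_int_limit:
  assumes r: "crapid M \<psi>"
  shows "((\<lambda>T. integral {-T..T} \<psi>) \<longlongrightarrow> cline_int \<psi>) at_top"
proof -
  have c: "continuous_on UNIV \<psi>" and w: "\<And>t. weight t * cmod (\<psi> t) \<le> M" using r by (auto simp: crapid_def)
  have w2: "(1 + t\<^sup>2) * cmod (\<psi> t) \<le> M" for t
    using mult_right_mono[OF weight_ge(2)[of t], of "cmod (\<psi> t)"] w[of t] by simp
  \<comment> \<open>The parameter of \<open>- T\<close>; that of \<open>T\<close> is
    \<open>1 - s0 T\<close>.\<close>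
  define s0 where "s0 T = 1/2 - arctan T / pi" for T
  let ?g = "cmpt \<psi>"
  have key: "cmod (cline_int \<psi> - integral {-T..T} \<psi>) \<le> 2 * (pi * M) * s0 T" if T: "T > 0" for T
  proof -
    have a: "0 < arctan T" "arctan T < pi/2" using T arctan_ubound by auto
    have s: "0 < s0 T" "s0 T < 1/2"
    proof -
      have "arctan T / pi < (pi/2) / pi" using a(2) by (intro divide_strict_right_mono) auto
      thus "0 < s0 T" by (simp add: s0_def)
      show "s0 T < 1/2" using a(1) by (simp add: s0_def)
    qed
    have e1: "pi * (s0 T - 1/2) = - arctan T" "pi * (1 - s0 T - 1/2) = arctan T"
      by (simp_all add: s0_def algebra_simps)
    have lp: "line_param (s0 T) = - T" "line_param (1 - s0 T) = T"
      unfolding line_param_def e1 by (simp_all add: tan_minus tan_arctan)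
    have "((\<lambda>s. (pi * (1 + (line_param s)\<^sup>2)) *\<^sub>R \<psi> (line_param s)) has_integral
        integral {line_param (s0 T)..line_param (1 - s0 T)} \<psi>) {s0 T..1 - s0 T}"
    proof (rule has_integral_substitution[where c = "-T" and d = T])
      show "s0 T \<le> 1 - s0 T" "line_param (s0 T) \<le> line_param (1 - s0 T)" using s T lp by auto
      show "continuous_on {- T..T} \<psi>" using c continuous_on_subset by blast
      show "(line_param has_real_derivative pi * (1 + (line_param x)\<^sup>2)) (at x within {s0 T..1 - s0 T})"
        if "x \<in> {s0 T..1 - s0 T}" for x using that s by (intro line_param_deriv) auto
      show "line_param ` {s0 T..1 - s0 T} \<subseteq> {- T..T}"
      proof
        fix t assume "t \<in> line_param ` {s0 T..1 - s0 T}"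
        then obtain x where x: "s0 T \<le> x" "x \<le> 1 - s0 T" "t = line_param x" by auto
        have "pi * (s0 T - 1/2) \<le> pi * (x - 1/2)" "pi * (x - 1/2) \<le> pi * (1 - s0 T - 1/2)"
          using x by (auto intro!: mult_left_mono)
        hence x': "- arctan T \<le> pi * (x - 1/2)" "pi * (x - 1/2) \<le> arctan T" unfolding e1 .
        have "tan (- arctan T) \<le> tan (pi * (x - 1/2))" by (rule tan_mono_le) (use x' a in linarith)+
        moreover have "tan (pi * (x - 1/2)) \<le> tan (arctan T)" by (rule tan_mono_le) (use x' a in linarith)+
        ultimately have "tan (- arctan T) \<le> t" "t \<le> tan (arctan T)"
          unfolding x(3) line_param_def by auto
        thus "t \<in> {- T..T}" by (simp add: tan_minus tan_arctan)
      qed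
    qed
    hence "integral {-T..T} \<psi> = integral {s0 T..1 - s0 T} (\<lambda>s. (pi * (1 + (line_param s)\<^sup>2)) *\<^sub>R \<psi> (line_param s))"
      unfolding lp by (rule integral_unique[symmetric])
    also have "\<dots> = integral {s0 T..1 - s0 T} ?g"
      using s by (intro integral_cong) (auto simp: scaleR_conv_of_real)
    finally have i: "integral {-T..T} \<psi> = integral {s0 T..1 - s0 T} ?g" .
    have gi: "?g integrable_on {u..v}" if "0 \<le> u" "v \<le> 1" for u v
      using that by (intro integrable_continuous_interval continuous_on_subset[OF crapid_compactify_continuous[OF r]]) auto
    have split: "integral {0..s0 T} ?g + (integral {s0 T..1 - s0 T} ?g + integral {1 - s0 T..1} ?g) = integral {0..1} ?g"
      using s gi by (subst Henstock_Kurzweil_Integration.integral_combine, auto)+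
    have b: "cmod (integral {u..v} ?g) \<le> pi * M * (v - u)" if "0 \<le> u" "u \<le> v" "v \<le> 1" for u v
      using that cmpt_le[OF w2]
      by (intro integral_bound continuous_on_subset[OF crapid_compactify_continuous[OF r]]) auto
    have "cline_int \<psi> - integral {-T..T} \<psi> = integral {0..s0 T} ?g + integral {1 - s0 T..1} ?g"
      unfolding cline_int_def i split[symmetric] by simp
    also have "cmod \<dots> \<le> pi * M * (s0 T - 0) + pi * M * (1 - (1 - s0 T))"
      using b[of 0 "s0 T"] b[of "1 - s0 T" 1] s by (intro norm_triangle_mono) auto
    finally show ?thesis by (simp add: mult_ac)
  qed
  have "((\<lambda>T. integral {-T..T} \<psi> - cline_int \<psi>) \<longlongrightarrow> 0) at_top"
  proof (rule Lim_null_comparison)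
    show "\<forall>\<^sub>F T in at_top. norm (integral {-T..T} \<psi> - cline_int \<psi>) \<le> 2 * (pi * M) * s0 T"
      using eventually_gt_at_top[of 0] by eventually_elim (use key in \<open>simp add: norm_minus_commute\<close>)
    have "((\<lambda>T. 2 * (pi * M) * s0 T) \<longlongrightarrow> 2 * (pi * M) * (1/2 - (pi/2) / pi)) at_top"
      unfolding s0_def by (intro tendsto_intros tendsto_arctan_at_top) auto
    thus "((\<lambda>T. 2 * (pi * M) * s0 T) \<longlongrightarrow> 0) at_top" by simp
  qed
  thus ?thesis by (rule LIM_zero_cancel)
qed

section \<open>Cauchy's formula on vertical strips and half-planes\<close>

lemma crapid_on_line:
  fixes G :: "complex \<Rightarrow> complex"
  assumes c: "continuous_on {z. a \<le> Re z \<and> Re z \<le> b} G"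
    and M: "\<And>v. a \<le> Re v \<Longrightarrow> Re v \<le> b \<Longrightarrow> weight (Im v) * cmod (G v) \<le> M"
    and x: "a \<le> x" "x \<le> b" "x \<noteq> Re z"
  shows "crapid (M / \<bar>x - Re z\<bar>) (\<lambda>t. G (Complex x t) / (Complex x t - z))"
  unfolding crapid_def
proof (intro conjI allI)
  have nz: "Complex x t - z \<noteq> 0" for t using x by (auto simp: complex_eq_iff)
  show "continuous_on UNIV (\<lambda>t. G (Complex x t) / (Complex x t - z))"
    using x nz by (intro continuous_intros continuous_on_compose2[OF c]) (auto simp: Complex_eq intro!: continuous_intros)
  fix t
  have "\<bar>x - Re z\<bar> \<le> cmod (Complex x t - z)" using abs_Re_le_cmod[of "Complex x t - z"] by simp
  moreover have "weight t * cmod (G (Complex x t)) \<le> M" using M[of "Complex x t"] x by simp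
  moreover have "0 \<le> weight t * cmod (G (Complex x t))" using weight_ge(4)[of t] by simp
  ultimately have "weight t * cmod (G (Complex x t)) / cmod (Complex x t - z) \<le> M / \<bar>x - Re z\<bar>"
    using x(3) by (intro frac_le) auto
  thus "weight t * cmod (G (Complex x t) / (Complex x t - z)) \<le> M / \<bar>x - Re z\<bar>"
    by (simp add: norm_divide)
qed

text \<open>Cauchy's formula on rectangles whose height tends to infinity. On vertical sides
  \<open>dw = i dt\<close>, so the factor \<open>i\<close> cancels and \<open>2 * pi\<close> is
  left; \<open>G\<close> is only required to be continuous on the closed strip, so the weak form of
  the formula is used.\<close>

lemma Cauchy_strip:
  fixes G :: "complex \<Rightarrow> complex"
  assumes ab: "a < b" and c: "continuous_on {z. a \<le> Re z \<and> Re z \<le> b} G" and h: "G holomorphic_on strip a b"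
    and M: "\<And>v. a \<le> Re v \<Longrightarrow> Re v \<le> b \<Longrightarrow> weight (Im v) * cmod (G v) \<le> M" and z: "z \<in> strip a b"
  shows "cline_int (\<lambda>t. G (Complex b t) / (Complex b t - z)) -
    cline_int (\<lambda>t. G (Complex a t) / (Complex a t - z)) = 2 * pi * G z"
proof -
  have zr: "a < Re z" "Re z < b" using z by (auto simp: strip_def)
  define f where "f w = G w / (w - z)" for w
  have GM: "cmod (G v) \<le> M" if "a \<le> Re v" "Re v \<le> b" for v
    using mult_right_mono[OF weight_ge(1)[of "Im v"], of "cmod (G v)"] M[OF that] by simp
  have M0: "M \<ge> 0" using GM[of z] zr norm_ge_zero order_trans less_imp_le by metis
  let ?I = "\<lambda>x T. integral {-T..T} (\<lambda>t. f (Complex x t))"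
  \<comment> \<open>The vertical sides are the truncated line integrals; each horizontal side has
    length \<open>b - a\<close> and distance at least \<open>T - |Im z|\<close> from the
    pole.\<close>
  have key: "cmod (?I b T - ?I a T - 2 * pi * G z) \<le> 2 * (M * (b - a)) / (T - \<bar>Im z\<bar>)" if T: "T > \<bar>Im z\<bar>" for T
  proof -
    have T0: "T > 0" using T by linarith
    let ?p1 = "Complex a (-T)" and ?p2 = "Complex b (-T)" and ?p3 = "Complex b T" and ?p4 = "Complex a T"
    let ?R = "cbox ?p1 ?p3"
    have R: "w \<in> ?R \<longleftrightarrow> a \<le> Re w \<and> Re w \<le> b \<and> - T \<le> Im w \<and> Im w \<le> T" for w
      by (auto simp: in_cbox_complex_iff)
    have iR: "w \<in> interior ?R \<longleftrightarrow> a < Re w \<and> Re w < b \<and> - T < Im w \<and> Im w < T" for w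
      by (auto simp: interior_cbox in_box_complex_iff)
    have zb: "z \<in> box ?p1 ?p3" using zr T by (auto simp: in_box_complex_iff)
    have pi_sub: "path_image (rectpath ?p1 ?p3) \<subseteq> ?R - {z}"
      using path_image_rectpath_subset_cbox[of ?p1 ?p3] path_image_rectpath_inter_box[of ?p1 ?p3] zb ab T0 by auto
    have "(f has_contour_integral (2 * pi * \<i> * winding_number (rectpath ?p1 ?p3) z * G z)) (rectpath ?p1 ?p3)"
      unfolding f_def
    proof (rule Cauchy_integral_formula_weak[where S = ?R and k = "{}" and f = G])
      show "continuous_on ?R G" using R by (intro continuous_on_subset[OF c]) auto
      show "G field_differentiable at x" if "x \<in> interior ?R - {}" for x
        using holomorphic_on_imp_differentiable_at[OF h open_strip] that iR by (auto simp: strip_def)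
      show "z \<in> interior ?R - {}" using zb by (simp add: interior_cbox)
    qed (use pi_sub in \<open>auto simp: convex_box\<close>)
    moreover have "winding_number (rectpath ?p1 ?p3) z = 1"
      by (rule winding_number_rectpath[OF zb])
    ultimately have tot: "(f has_contour_integral (2 * pi * \<i> * G z)) (rectpath ?p1 ?p3)" by simp
    have fc: "continuous_on S f" if "S \<subseteq> ?R - {z}" for S
      unfolding f_def using that R by (intro continuous_intros continuous_on_subset[OF c]) auto
    have seg: "closed_segment ?p1 ?p2 \<subseteq> ?R - {z}" "closed_segment ?p2 ?p3 \<subseteq> ?R - {z}"
      "closed_segment ?p3 ?p4 \<subseteq> ?R - {z}" "closed_segment ?p4 ?p1 \<subseteq> ?R - {z}"
      using pi_sub unfolding rectpath_def Let_def by (auto simp: path_image_join)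
    note ci = contour_integrable_continuous_linepath[OF fc[OF seg(1)]] contour_integrable_continuous_linepath[OF fc[OF seg(2)]]
      contour_integrable_continuous_linepath[OF fc[OF seg(3)]] contour_integrable_continuous_linepath[OF fc[OF seg(4)]]
    have "contour_integral (rectpath ?p1 ?p3) f = contour_integral (linepath ?p1 ?p2) f +
      (contour_integral (linepath ?p2 ?p3) f + (contour_integral (linepath ?p3 ?p4) f + contour_integral (linepath ?p4 ?p1) f))"
      using ci unfolding rectpath_def Let_def by (simp add: contour_integral_join)
    hence sum: "2 * pi * \<i> * G z = contour_integral (linepath ?p1 ?p2) f +
      (contour_integral (linepath ?p2 ?p3) f + (contour_integral (linepath ?p3 ?p4) f + contour_integral (linepath ?p4 ?p1) f))"
      using contour_integral_unique[OF tot] by simp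
    have vert: "contour_integral (linepath (Complex x (-T)) (Complex x T)) f = \<i> * ?I x T"
      if "f contour_integrable_on linepath (Complex x (-T)) (Complex x T)" for x
    proof -
      have "((\<lambda>t. f (Complex x t)) has_integral (- \<i> * contour_integral (linepath (Complex x (-T)) (Complex x T)) f)) {-T..T}"
        using has_contour_integral_integral[OF that] T0
        by (subst (asm) has_contour_integral_linepath_same_Re_iff[of _ x _ "-T" T]) auto
      hence "?I x T = - \<i> * contour_integral (linepath (Complex x (-T)) (Complex x T)) f" by (rule integral_unique)
      thus ?thesis by simp
    qed
    have v2: "contour_integral (linepath ?p2 ?p3) f = \<i> * ?I b T" by (rule vert[OF ci(2)])
    have v4: "contour_integral (linepath ?p4 ?p1) f = - (\<i> * ?I a T)"
    proof -
      have "f contour_integrable_on linepath ?p1 ?p4"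
        using contour_integrable_continuous_linepath[OF fc[OF seg(4)[unfolded closed_segment_commute[of ?p4 ?p1]]]] .
      thus ?thesis using vert[of a] contour_integral_reverse_linepath[OF fc[OF seg(4)]] by simp
    qed
    have hor: "cmod (contour_integral (linepath u v) f) \<le> M / (T - \<bar>Im z\<bar>) * (b - a)"
      if s: "closed_segment u v \<subseteq> ?R - {z}" and uv: "\<bar>Im u\<bar> = T" "Im v = Im u" "cmod (v - u) = b - a" for u v
    proof -
      have "cmod (contour_integral (linepath u v) f) \<le> M / (T - \<bar>Im z\<bar>) * cmod (v - u)"
      proof (rule contour_integral_bound_linepath)
        show "f contour_integrable_on linepath u v" by (rule contour_integrable_continuous_linepath[OF fc[OF s]])
        show "0 \<le> M / (T - \<bar>Im z\<bar>)" using M0 T by simp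
        fix w assume w: "w \<in> closed_segment u v"
        then obtain s where "w = (1 - s) *\<^sub>R u + s *\<^sub>R v" unfolding closed_segment_def by blast
        hence "Im w = Im u" using uv(2) by (simp add: left_diff_distrib)
        hence "T - \<bar>Im z\<bar> \<le> \<bar>Im (w - z)\<bar>" using uv(1) by simp
        also have "\<dots> \<le> cmod (w - z)" by (rule abs_Im_le_cmod)
        finally have "T - \<bar>Im z\<bar> \<le> cmod (w - z)" .
        moreover have "cmod (G w) \<le> M" using GM[of w] w s R by blast
        ultimately show "cmod (f w) \<le> M / (T - \<bar>Im z\<bar>)"
          unfolding f_def norm_divide using T M0 by (intro frac_le) auto
      qed
      thus ?thesis using uv(3) by simp
    qed
    have cb: "cmod (?p2 - ?p1) = b - a" "cmod (?p4 - ?p3) = b - a" using ab by (auto simp: cmod_def)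
    have h1: "cmod (contour_integral (linepath ?p1 ?p2) f) \<le> M / (T - \<bar>Im z\<bar>) * (b - a)"
      by (rule hor[OF seg(1)]) (use T0 cb in auto)
    have h3: "cmod (contour_integral (linepath ?p3 ?p4) f) \<le> M / (T - \<bar>Im z\<bar>) * (b - a)"
      by (rule hor[OF seg(3)]) (use T0 cb in auto)
    have "\<i> * (?I b T - ?I a T - 2 * pi * G z) =
        - (contour_integral (linepath ?p1 ?p2) f + contour_integral (linepath ?p3 ?p4) f)"
      using sum unfolding v2 v4 by (simp add: algebra_simps)
    hence "cmod (?I b T - ?I a T - 2 * pi * G z) = cmod (contour_integral (linepath ?p1 ?p2) f + contour_integral (linepath ?p3 ?p4) f)"
      by (metis norm_minus_cancel norm_mult norm_ii mult_1)
    also have "\<dots> \<le> M / (T - \<bar>Im z\<bar>) * (b - a) + M / (T - \<bar>Im z\<bar>) * (b - a)"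
      using h1 h3 by (rule norm_triangle_mono)
    finally show ?thesis by simp
  qed
  have r: "crapid (M / \<bar>x - Re z\<bar>) (\<lambda>t. f (Complex x t))" if "x = a \<or> x = b" for x
    unfolding f_def by (rule crapid_on_line[OF c M]) (use that ab zr in auto)
  have "((\<lambda>T. ?I b T - ?I a T - 2 * pi * G z) \<longlongrightarrow> cline_int (\<lambda>t. f (Complex b t)) - cline_int (\<lambda>t. f (Complex a t)) - 2 * pi * G z) at_top"
    by (intro tendsto_intros cline_int_limit[OF r]) auto
  moreover have "((\<lambda>T. ?I b T - ?I a T - 2 * pi * G z) \<longlongrightarrow> 0) at_top"
  proof (rule Lim_null_comparison)
    show "\<forall>\<^sub>F T in at_top. norm (?I b T - ?I a T - 2 * pi * G z) \<le> 2 * (M * (b - a)) / (T - \<bar>Im z\<bar>)"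
      using eventually_gt_at_top[of "\<bar>Im z\<bar>"] by eventually_elim (rule key)
    show "((\<lambda>T. 2 * (M * (b - a)) / (T - \<bar>Im z\<bar>)) \<longlongrightarrow> 0) at_top"
      by real_asymp
  qed
  ultimately have "cline_int (\<lambda>t. f (Complex b t)) - cline_int (\<lambda>t. f (Complex a t)) - 2 * pi * G z = 0"
    by (rule tendsto_unique[OF trivial_limit_at_top_linorder])
  thus ?thesis unfolding f_def by simp
qed

text \<open>The strip formula with the right edge moved to infinity, where the decay
  \<open>M / (b - Re z)\<close> removes its contribution.\<close>

lemma Cauchy_half_plane:
  fixes G :: "complex \<Rightarrow> complex"
  assumes c: "continuous_on {z. a \<le> Re z} G" and h: "G holomorphic_on {z. a < Re z}"
    and M: "\<And>v. a \<le> Re v \<Longrightarrow> weight (Im v) * cmod (G v) \<le> M" and z: "a < Re z"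
  shows "- cline_int (\<lambda>t. G (Complex a t) / (Complex a t - z)) = 2 * pi * G z"
proof -
  let ?J = "\<lambda>b. cline_int (\<lambda>t. G (Complex b t) / (Complex b t - z))"
  have eq: "?J b - ?J a = 2 * pi * G z" if b: "b > Re z" for b
  proof (rule Cauchy_strip[where G = G])
    show "continuous_on {z. a \<le> Re z \<and> Re z \<le> b} G" by (rule continuous_on_subset[OF c]) auto
    show "G holomorphic_on strip a b" by (rule holomorphic_on_subset[OF h]) (auto simp: strip_def)
  qed (use M z b in \<open>auto simp: strip_def\<close>)
  have le: "cmod (?J b) \<le> pi * (M / (b - Re z))" if b: "b > Re z" for b
  proof -
    have r: "crapid (M / \<bar>b - Re z\<bar>) (\<lambda>t. G (Complex b t) / (Complex b t - z))"
    proof (rule crapid_on_line[where a = a and b = b and G = G])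
      show "continuous_on {z. a \<le> Re z \<and> Re z \<le> b} G" by (rule continuous_on_subset[OF c]) auto
    qed (use M z b in auto)
    show ?thesis
    proof (rule cline_int_le[OF r])
      fix t
      have "(1 + t\<^sup>2) * cmod (G (Complex b t) / (Complex b t - z)) \<le> weight t * cmod (G (Complex b t) / (Complex b t - z))"
        by (intro mult_right_mono weight_ge) auto
      also have "\<dots> \<le> M / (b - Re z)" using r b by (auto simp: crapid_def)
      finally show "(1 + t\<^sup>2) * cmod (G (Complex b t) / (Complex b t - z)) \<le> M / (b - Re z)" .
    qed
  qed
  have "(?J \<longlongrightarrow> 0) at_top"
  proof (rule Lim_null_comparison)
    show "\<forall>\<^sub>F b in at_top. norm (?J b) \<le> pi * (M / (b - Re z))"
      using eventually_gt_at_top[of "Re z"] by eventually_elim (rule le)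
    show "((\<lambda>b. pi * (M / (b - Re z))) \<longlongrightarrow> 0) at_top" by real_asymp
  qed
  moreover have "(?J \<longlongrightarrow> ?J a + 2 * pi * G z) at_top"
  proof (rule tendsto_eventually)
    show "\<forall>\<^sub>F b in at_top. ?J b = ?J a + 2 * pi * G z"
      using eventually_gt_at_top[of "Re z"] by eventually_elim (use eq in \<open>simp add: algebra_simps\<close>)
  qed
  ultimately have "?J a + 2 * pi * G z = 0"
    using tendsto_unique[OF trivial_limit_at_top_linorder] by blast
  thus ?thesis by (metis add.commute add_eq_0_iff)
qed

section \<open>Continuous dependence of line integrals on parameters\<close>

text \<open>Far out the weight \<open>w\<close> is small while \<open>N\<close> stays bounded; on
  the remaining compact interval finitely many neighbourhoods, on each of which \<open>N\<close> is
  small for \<open>q\<close> near \<open>q0\<close>, suffice.\<close>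

lemma uniformly_small:
  fixes N :: "'q::metric_space \<Rightarrow> real \<Rightarrow> real"
  assumes joint: "\<And>\<tau> e. e > 0 \<Longrightarrow> \<exists>d>0. \<forall>q\<in>Q. \<forall>\<sigma>. dist q q0 < d \<longrightarrow> \<bar>\<sigma> - \<tau>\<bar> < d \<longrightarrow> N q \<sigma> \<le> e"
    and N0: "\<And>q \<sigma>. q \<in> Q \<Longrightarrow> 0 \<le> N q \<sigma>" and NM: "\<And>q \<sigma>. q \<in> Q \<Longrightarrow> N q \<sigma> \<le> M"
    and w0: "\<And>\<sigma>. 0 \<le> w \<sigma>" and w1: "\<And>\<sigma>. w \<sigma> \<le> K"
    and winf: "\<And>e. e > 0 \<Longrightarrow> \<exists>R. \<forall>\<sigma>. \<bar>\<sigma>\<bar> > R \<longrightarrow> w \<sigma> \<le> e" and e: "e > 0"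
  shows "\<exists>d>0. \<forall>q\<in>Q. dist q q0 < d \<longrightarrow> (\<forall>\<sigma>. w \<sigma> * N q \<sigma> \<le> e)"
proof -
  define M' where "M' = max M 1"
  have M': "M' > 0" by (simp add: M'_def)
  define K' where "K' = max K 1"
  have K': "K' > 0" by (simp add: K'_def)
  obtain R where R: "\<And>\<sigma>. \<bar>\<sigma>\<bar> > R \<Longrightarrow> w \<sigma> \<le> e / M'" using winf[of "e / M'"] e M' by auto
  obtain d where d: "\<And>\<tau>. d \<tau> > 0" "\<And>\<tau> q \<sigma>. q \<in> Q \<Longrightarrow> dist q q0 < d \<tau> \<Longrightarrow> \<bar>\<sigma> - \<tau>\<bar> < d \<tau> \<Longrightarrow> N q \<sigma> \<le> e / K'"
    using joint[of "e / K'"] e K' by (metis divide_pos_pos)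
  obtain C where C: "C \<subseteq> {-R..R}" "finite C" "{-R..R} \<subseteq> (\<Union>\<tau>\<in>C. ball \<tau> (d \<tau>))"
    by (rule compactE_image[of "{-R..R}" "{-R..R}" "\<lambda>\<tau>. ball \<tau> (d \<tau>)"]) (use d(1) in auto)
  \<comment> \<open>The inserted 1 keeps the minimum defined when the interval, and hence the cover,
    is empty.\<close>
  define \<delta> where "\<delta> = Min (insert 1 (d ` C))"
  have \<delta>: "\<delta> > 0" "\<And>\<tau>. \<tau> \<in> C \<Longrightarrow> \<delta> \<le> d \<tau>" using C(2) d(1) by (auto simp: \<delta>_def)
  have "w \<sigma> * N q \<sigma> \<le> e" if q: "q \<in> Q" "dist q q0 < \<delta>" for q \<sigma>
  proof (cases "\<bar>\<sigma>\<bar> > R")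
    case True
    have "w \<sigma> * N q \<sigma> \<le> (e / M') * M'"
      using R[OF True] NM[OF q(1), of \<sigma>] N0[OF q(1)] e M' by (intro mult_mono) (auto simp: M'_def)
    thus ?thesis using M' by simp
  next
    case False
    hence "\<sigma> \<in> {-R..R}" by auto
    then obtain \<tau> where \<tau>: "\<tau> \<in> C" "\<sigma> \<in> ball \<tau> (d \<tau>)" using C(3) by blast
    have "N q \<sigma> \<le> e / K'"
      using d(2)[OF q(1), of \<tau> \<sigma>] q(2) \<delta>(2)[OF \<tau>(1)] \<tau>(2) by (simp add: dist_real_def abs_minus_commute)
    hence "w \<sigma> * N q \<sigma> \<le> K' * (e / K')"
      using w0 w1[of \<sigma>] N0[OF q(1)] K' by (intro mult_mono) (auto simp: K'_def)
    thus ?thesis using K' by simp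
  qed
  thus ?thesis using \<delta>(1) by blast
qed

text \<open>Both values are compared with the common value at \<open>(q0, \<tau>)\<close>, so joint
  continuity at a single point suffices.\<close>

lemma (in nsp) joint_small:
  fixes Q :: "'q::metric_space set"
  assumes c: "ncont X (Q \<times> (UNIV::real set)) (\<lambda>p. \<phi> (fst p) (snd p))" and q0: "q0 \<in> Q" and e: "e > 0"
  shows "\<exists>d>0. \<forall>q\<in>Q. \<forall>\<sigma>. dist q q0 < d \<longrightarrow> \<bar>\<sigma> - \<tau>\<bar> < d \<longrightarrow> nrm X (\<phi> q \<sigma> - \<phi> q0 \<sigma>) \<le> e"
proof -
  have m: "\<phi> q \<sigma> \<in> pts X" if "q \<in> Q" for q \<sigma> using ncont_mem[OF c, of "(q, \<sigma>)"] that by simp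
  have "((\<lambda>p. nrm X (\<phi> (fst p) (snd p) - \<phi> q0 \<tau>)) \<longlongrightarrow> 0) (at (q0, \<tau>) within Q \<times> UNIV)"
    using c q0 unfolding ncont_def by fastforce
  hence "\<forall>\<^sub>F p in at (q0, \<tau>) within Q \<times> UNIV. dist (nrm X (\<phi> (fst p) (snd p) - \<phi> q0 \<tau>)) 0 < e/2"
    using e unfolding tendsto_iff by (meson half_gt_zero)
  then obtain d where d: "d > 0" "\<And>p. p \<in> Q \<times> UNIV \<Longrightarrow> p \<noteq> (q0, \<tau>) \<Longrightarrow> dist p (q0, \<tau>) < d \<Longrightarrow>
      dist (nrm X (\<phi> (fst p) (snd p) - \<phi> q0 \<tau>)) 0 < e/2"
    unfolding eventually_at by blast
  have d2: "nrm X (\<phi> q \<sigma> - \<phi> q0 \<tau>) \<le> e/2" if "q \<in> Q" "dist (q, \<sigma>) (q0, \<tau>) < d" for q \<sigma>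
    using d(2)[of "(q, \<sigma>)"] that e by (cases "(q, \<sigma>) = (q0, \<tau>)") (auto simp: dist_real_def)
  have "nrm X (\<phi> q \<sigma> - \<phi> q0 \<sigma>) \<le> e" if q: "q \<in> Q" and ds: "dist q q0 < d/2" "\<bar>\<sigma> - \<tau>\<bar> < d/2" for q \<sigma>
  proof -
    have "dist (q, \<sigma>) (q0, \<tau>) \<le> dist q q0 + dist \<sigma> \<tau>"
      unfolding dist_Pair_Pair by (rule sqrt_sum_squares_le_sum) auto
    hence 1: "dist (q, \<sigma>) (q0, \<tau>) < d" using ds by (simp add: dist_real_def)
    have 2: "dist (q0, \<sigma>) (q0, \<tau>) < d" using ds(2) d(1) by (simp add: dist_Pair_Pair dist_real_def)
    have "nrm X (\<phi> q \<sigma> - \<phi> q0 \<sigma>) \<le> nrm X (\<phi> q \<sigma> - \<phi> q0 \<tau>) + nrm X (\<phi> q0 \<tau> - \<phi> q0 \<sigma>)"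
      using nrm_tri m q q0 by blast
    thus ?thesis using d2[OF q 1] d2[OF q0 2] nrm_commute[OF m[OF q0] m[OF q0], of \<tau> \<sigma>] by simp
  qed
  thus ?thesis using d(1) half_gt_zero by blast
qed

text \<open>The full weight ensures that the integrals exist; the distance is controlled with the
  weaker factor \<open>1 + t^2\<close> alone, which leaves \<open>1 + |t|\<close> to spare.\<close>

lemma (in bsp) line_int_dist:
  assumes r: "rapid X M \<phi>" "rapid X M' \<psi>" and B: "\<And>t. (1 + t\<^sup>2) * nrm X (\<phi> t - \<psi> t) \<le> B"
  shows "nrm X (line_int X \<phi> - line_int X \<psi>) \<le> pi * B"
proof (rule nrm_le_dual)
  show "line_int X \<phi> - line_int X \<psi> \<in> pts X" using line_int_mem r diff_mem by blast
  fix l assume l: "l \<in> dual_ball X"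
  have m: "\<phi> t \<in> pts X" "\<psi> t \<in> pts X" for t using r by (auto simp: rapid_def ncont_def)
  have c: "crapid M (\<lambda>t. l (\<phi> t))" "crapid M' (\<lambda>t. l (\<psi> t))" using crapid_dual[OF l] r by auto
  have eq: "l (line_int X \<phi> - line_int X \<psi>) = cline_int (\<lambda>t. l (\<phi> t) - l (\<psi> t))"
    using dual_diff[OF l line_int_mem[OF r(1)] line_int_mem[OF r(2)]]
    by (simp add: dual_line_int[OF l r(1)] dual_line_int[OF l r(2)] cline_int_diff[OF c])
  have "crapid (M + M') (\<lambda>t. l (\<phi> t) - l (\<psi> t))"
    unfolding crapid_def
  proof (intro conjI allI)
    show "continuous_on UNIV (\<lambda>t. l (\<phi> t) - l (\<psi> t))" using c by (auto simp: crapid_def intro!: continuous_intros)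
    fix t
    have "weight t * cmod (l (\<phi> t) - l (\<psi> t)) \<le> weight t * (cmod (l (\<phi> t)) + cmod (l (\<psi> t)))"
      using weight_ge(4)[of t] norm_triangle_ineq4 by (intro mult_left_mono) auto
    also have "\<dots> \<le> M + M'" using c by (auto simp: crapid_def distrib_left intro!: add_mono)
    finally show "weight t * cmod (l (\<phi> t) - l (\<psi> t)) \<le> M + M'" .
  qed
  moreover have "(1 + t\<^sup>2) * cmod (l (\<phi> t) - l (\<psi> t)) \<le> B" for t
  proof -
    have "cmod (l (\<phi> t) - l (\<psi> t)) \<le> nrm X (\<phi> t - \<psi> t)"
      using dual_le[OF l diff_mem[OF m]] dual_diff[OF l m] by metis
    hence "(1 + t\<^sup>2) * cmod (l (\<phi> t) - l (\<psi> t)) \<le> (1 + t\<^sup>2) * nrm X (\<phi> t - \<psi> t)"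
      by (intro mult_left_mono) auto
    thus ?thesis using B[of t] by linarith
  qed
  ultimately have "cmod (cline_int (\<lambda>t. l (\<phi> t) - l (\<psi> t))) \<le> pi * B"
    by (intro cline_int_le)
  thus "cmod (l (line_int X \<phi> - line_int X \<psi>)) \<le> pi * B"
    using eq by (simp only:)
qed

text \<open>A dominated-convergence argument: the weighted integrand \<open>\<psi>\<close> is
  jointly continuous and bounded, and the spare factor \<open>1 / (1 + |t|)\<close> is the weight
  for \<open>uniformly_small\<close>.\<close>

lemma (in bsp) ncont_line_int:
  fixes Q :: "'q::metric_space set"
  assumes c: "ncont X (Q \<times> (UNIV::real set)) (\<lambda>p. \<phi> (fst p) (snd p))"
    and M: "\<And>q t. q \<in> Q \<Longrightarrow> weight t * nrm X (\<phi> q t) \<le> M"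
  shows "ncont X Q (\<lambda>q. line_int X (\<phi> q))" and "\<And>q. q \<in> Q \<Longrightarrow> rapid X M (\<phi> q)"
proof -
  have m: "\<phi> q t \<in> pts X" if "q \<in> Q" for q t using ncont_mem[OF c, of "(q, t)"] that by simp
  show r: "rapid X M (\<phi> q)" if q: "q \<in> Q" for q
  proof -
    have "ncont X UNIV (\<lambda>t. \<phi> (fst (q, t)) (snd (q, t)))"
      using q by (intro ncont_compose[OF c] continuous_intros) auto
    thus ?thesis using M[OF q] by (simp add: rapid_def)
  qed
  define \<psi> where "\<psi> q t = of_real (weight t) *\<^sub>C \<phi> q t" for q t
  have \<psi>c: "ncont X (Q \<times> (UNIV::real set)) (\<lambda>p. \<psi> (fst p) (snd p))"
    unfolding \<psi>_def weight_def by (intro ncont_scale c continuous_intros)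
  have n\<psi>: "nrm X (\<psi> q t - \<psi> q' t) = weight t * nrm X (\<phi> q t - \<phi> q' t)" if "q \<in> Q" "q' \<in> Q" for q q' t
    using nrm_scale[OF diff_mem[OF m[OF that(1)] m[OF that(2)]], of "of_real (weight t)" t t] weight_ge(4)[of t]
    by (simp add: \<psi>_def scaleC.scale_right_diff_distrib)
  show "ncont X Q (\<lambda>q. line_int X (\<phi> q))"
    unfolding ncont_def
  proof (intro ballI conjI)
    fix q0 assume q0: "q0 \<in> Q"
    show "line_int X (\<phi> q0) \<in> pts X" by (rule line_int_mem[OF r[OF q0]])
    show "((\<lambda>q. nrm X (line_int X (\<phi> q) - line_int X (\<phi> q0))) \<longlongrightarrow> 0) (at q0 within Q)"
    proof (rule tendstoI)
      fix e :: real assume e: "e > 0"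
      have "\<exists>d>0. \<forall>q\<in>Q. dist q q0 < d \<longrightarrow> (\<forall>\<sigma>. 1 / (1 + \<bar>\<sigma>\<bar>) * nrm X (\<psi> q \<sigma> - \<psi> q0 \<sigma>) \<le> e / (2 * pi))"
      proof (rule uniformly_small[where K = 1 and M = "2 * M"])
        show "0 \<le> nrm X (\<psi> q \<sigma> - \<psi> q0 \<sigma>)" if "q \<in> Q" for q \<sigma>
          using n\<psi>[OF that q0] nrm_ge0[OF diff_mem[OF m[OF that] m[OF q0]]] weight_ge(4) by (simp add: less_imp_le)
        show "nrm X (\<psi> q \<sigma> - \<psi> q0 \<sigma>) \<le> 2 * M" if "q \<in> Q" for q \<sigma>
        proof -
          have "weight \<sigma> * nrm X (\<phi> q \<sigma> - \<phi> q0 \<sigma>) \<le> weight \<sigma> * (nrm X (\<phi> q \<sigma>) + nrm X (\<phi> q0 \<sigma>))"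
            using nrm_diff[OF m[OF that] m[OF q0]] weight_ge(4)[of \<sigma>] by (intro mult_left_mono) auto
          thus ?thesis unfolding n\<psi>[OF that q0] using M[OF that, of \<sigma>] M[OF q0, of \<sigma>] by (simp add: distrib_left)
        qed
        show "\<exists>R. \<forall>\<sigma>. R < \<bar>\<sigma>\<bar> \<longrightarrow> 1 / (1 + \<bar>\<sigma>\<bar>) \<le> e" if e: "e > 0" for e :: real
        proof (intro exI[of _ "1/e"] allI impI)
          fix \<sigma> :: real assume s: "1/e < \<bar>\<sigma>\<bar>"
          have "0 < 1/e" using e by simp
          hence "1 / (1 + \<bar>\<sigma>\<bar>) \<le> 1 / (1/e)" using s by (intro divide_left_mono) auto
          thus "1 / (1 + \<bar>\<sigma>\<bar>) \<le> e" by simp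
        qed
        show "\<exists>d>0. \<forall>q\<in>Q. \<forall>\<sigma>. dist q q0 < d \<longrightarrow> \<bar>\<sigma> - \<tau>\<bar> < d \<longrightarrow> nrm X (\<psi> q \<sigma> - \<psi> q0 \<sigma>) \<le> e" if "e > 0" for \<tau> e
          by (rule joint_small[OF \<psi>c q0 that])
      qed (use e in auto)
      then obtain d where d: "d > 0" "\<And>q \<sigma>. q \<in> Q \<Longrightarrow> dist q q0 < d \<Longrightarrow> 1 / (1 + \<bar>\<sigma>\<bar>) * nrm X (\<psi> q \<sigma> - \<psi> q0 \<sigma>) \<le> e / (2 * pi)"
        by meson
      have "dist (nrm X (line_int X (\<phi> q) - line_int X (\<phi> q0))) 0 < e" if q: "q \<in> Q" "dist q q0 < d" for q
      proof -
        have "(1 + t\<^sup>2) * nrm X (\<phi> q t - \<phi> q0 t) \<le> e / (2 * pi)" for t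
        proof -
          have "1 / (1 + \<bar>t\<bar>) * nrm X (\<psi> q t - \<psi> q0 t) = (1 + t\<^sup>2) * nrm X (\<phi> q t - \<phi> q0 t)"
            unfolding n\<psi>[OF q(1) q0] weight_def by (simp add: add_pos_nonneg add_nonneg_eq_0_iff)
          thus ?thesis using d(2)[OF q, of t] by simp
        qed
        hence "nrm X (line_int X (\<phi> q) - line_int X (\<phi> q0)) \<le> pi * (e / (2 * pi))"
          by (rule line_int_dist[OF r[OF q(1)] r[OF q0]])
        thus ?thesis
          using e nrm_ge0[OF diff_mem[OF line_int_mem[OF r[OF q(1)]] line_int_mem[OF r[OF q0]]]] by simp
      qed
      thus "\<forall>\<^sub>F q in at q0 within Q. dist (nrm X (line_int X (\<phi> q) - line_int X (\<phi> q0))) 0 < e"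
        unfolding eventually_at using d(1) by blast
    qed
  qed
qed

section \<open>Continuous liftings through a quotient map\<close>

context quotient_map
begin

lemma nsp_Q: "nsp Q"
  by unfold_locales (rule normed_Q)

lemma T_ncont: "ncont F A \<Psi> \<Longrightarrow> ncont Q A (\<lambda>s. T (\<Psi> s))"
  unfolding ncont_def
proof (intro ballI conjI)
  interpret Q: nsp Q by (rule nsp_Q)
  fix a assume c: "\<forall>a\<in>A. \<Psi> a \<in> pts F \<and> ((\<lambda>x. nrm F (\<Psi> x - \<Psi> a)) \<longlongrightarrow> 0) (at a within A)" and a: "a \<in> A"
  thus "T (\<Psi> a) \<in> pts Q" by (auto simp: Q_pts)
  show "((\<lambda>x. nrm Q (T (\<Psi> x) - T (\<Psi> a))) \<longlongrightarrow> 0) (at a within A)"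
  proof (rule Lim_null_comparison)
    show "((\<lambda>x. nrm F (\<Psi> x - \<Psi> a)) \<longlongrightarrow> 0) (at a within A)" using c a by blast
    have "norm (nrm Q (T (\<Psi> x) - T (\<Psi> a))) \<le> nrm F (\<Psi> x - \<Psi> a)" if x: "x \<in> A" for x
    proof -
      have d: "\<Psi> x - \<Psi> a \<in> pts F" using c a x F.diff_mem by blast
      hence "T (\<Psi> x - \<Psi> a) \<in> pts Q" by (auto simp: Q_pts)
      thus ?thesis using Q_nrm_le[OF d] T_diff[of "\<Psi> x" "\<Psi> a"] Q.nrm_ge0 c a x by simp
    qed
    thus "\<forall>\<^sub>F x in at a within A. norm (nrm Q (T (\<Psi> x) - T (\<Psi> a))) \<le> nrm F (\<Psi> x - \<Psi> a)"
      unfolding eventually_at_filter by simp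
  qed
qed

lemma T_sum: "(\<And>i. i \<in> I \<Longrightarrow> f i \<in> pts F) \<Longrightarrow> T (\<Sum>i\<in>I. f i) = (\<Sum>i\<in>I. T (f i))"
proof (induction I rule: infinite_finite_induct)
  case (insert i I)
  thus ?case using T_add[of "f i" "\<Sum>i\<in>I. f i"] F.sum_mem[of I f] by simp
qed (auto simp: T_0)

text \<open>Values at equally spaced nodes are lifted with norm below \<open>2 * B\<close> and
  joined by a partition of unity. Only nodes at which \<open>\<psi>\<close> is within
  \<open>B / 2\<close> of \<open>\<psi> s\<close> contribute, and convexity preserves both
  bounds.\<close>

lemma approx_lift:
  assumes \<psi>: "ncont Q {0..1::real} \<psi>" and B: "B > 0" "\<And>s. s \<in> {0..1} \<Longrightarrow> nrm Q (\<psi> s) \<le> B"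
  shows "\<exists>\<Psi>. ncont F {0..1} \<Psi> \<and> (\<forall>s\<in>{0..1}. nrm F (\<Psi> s) \<le> 2 * B \<and> nrm Q (\<psi> s - T (\<Psi> s)) \<le> B / 2)"
proof -
  interpret Q: nsp Q by (rule nsp_Q)
  have \<psi>m: "\<psi> s \<in> pts Q" if "s \<in> {0..1}" for s using ncont_def \<psi> that by blast
  obtain d where d: "d > 0" "\<And>x y. x \<in> {0..1} \<Longrightarrow> y \<in> {0..1} \<Longrightarrow> dist x y < d \<Longrightarrow> nrm Q (\<psi> x - \<psi> y) < B/2"
    using Q.ncont_uniform[OF \<psi> compact_Icc, of "B/2"] B(1) by (metis half_gt_zero)
  obtain n :: nat where n: "1 / real (Suc n) < d" using d(1) nat_approx_posE by blast
  define N where "N = Suc n"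
  have N: "N > 0" "1 / real N < d" using n by (auto simp: N_def)
  define p where "p i = real i / real N" for i
  have p: "p i \<in> {0..1}" if "i \<le> N" for i using that N by (auto simp: p_def)
  have "\<exists>x\<in>pts F. T x = \<psi> (p i) \<and> nrm F x < 2 * B" if "i \<le> N" for i
    using Q_lift[OF \<psi>m[OF p[OF that]], of "2 * B"] B(2)[OF p[OF that]] B(1) by simp
  then obtain x where x: "\<And>i. i \<le> N \<Longrightarrow> x i \<in> pts F" "\<And>i. i \<le> N \<Longrightarrow> T (x i) = \<psi> (p i)" "\<And>i. i \<le> N \<Longrightarrow> nrm F (x i) < 2 * B"
    by metis
  \<comment> \<open>Tent functions of radius \<open>d\<close>; the mesh \<open>1 / N\<close> is
    smaller than \<open>d\<close>, so their sum \<open>H\<close> is positive on the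
    interval.\<close>
  define h where "h i s = max 0 (d - \<bar>s - p i\<bar>)" for i and s :: real
  define H where "H s = (\<Sum>i\<le>N. h i s)" for s
  have h0: "h i s \<ge> 0" for i s by (simp add: h_def)
  have H: "H s > 0" if s: "s \<in> {0..1}" for s
  proof -
    define i where "i = nat \<lfloor>real N * s\<rfloor>"
    have i: "real i \<le> real N * s" "real N * s < real i + 1"
      using s by (auto simp: i_def of_nat_nat)
    have "real i \<le> real N" using i(1) s N by (smt (verit) atLeastAtMost_iff mult_left_le of_nat_0_le_iff)
    hence iN: "i \<le> N" by simp
    have "\<bar>s - p i\<bar> = (real N * s - real i) / real N" using i N by (simp add: p_def field_simps)
    also have "\<dots> < 1 / real N" using i(2) N by (intro divide_strict_right_mono) auto
    finally have "h i s > 0" using N by (simp add: h_def)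
    thus ?thesis unfolding H_def using iN h0 by (intro sum_pos2[of _ i]) auto
  qed
  define wt where "wt i s = h i s / H s" for i s
  have l0: "wt i s \<ge> 0" if "s \<in> {0..1}" for i s using H[OF that] h0 by (simp add: wt_def)
  have l1: "(\<Sum>i\<le>N. wt i s) = 1" if "s \<in> {0..1}" for s
    using H[OF that] by (simp add: wt_def H_def flip: sum_divide_distrib)
  have lc: "continuous_on {0..1} (\<lambda>s. complex_of_real (wt i s))" for i
    unfolding wt_def h_def H_def
    by (intro continuous_intros ballI) (use H in \<open>force simp: H_def h_def\<close>)
  define \<Psi> where "\<Psi> s = (\<Sum>i\<le>N. of_real (wt i s) *\<^sub>C x i)" for s
  have xl: "of_real (wt i s) *\<^sub>C x i \<in> pts F" if "i \<le> N" for i s using x(1)[OF that] F.scale_mem by blast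
  have "ncont F {0..1} \<Psi>"
    unfolding \<Psi>_def by (intro F.ncont_sum F.ncont_scale lc F.ncont_const x) auto
  moreover have "nrm F (\<Psi> s) \<le> 2 * B" if s: "s \<in> {0..1}" for s
  proof -
    have "nrm F (\<Psi> s) \<le> (\<Sum>i\<le>N. nrm F (of_real (wt i s) *\<^sub>C x i))"
      unfolding \<Psi>_def by (rule F.nrm_sum) (use xl in auto)
    also have "\<dots> \<le> (\<Sum>i\<le>N. wt i s * (2 * B))"
      using l0[OF s] x(1) less_imp_le[OF x(3)] by (intro sum_mono) (auto simp: F.nrm_scale intro!: mult_left_mono)
    also have "\<dots> = 2 * B" using l1[OF s] by (simp flip: sum_distrib_right)
    finally show ?thesis .
  qed
  moreover have "nrm Q (\<psi> s - T (\<Psi> s)) \<le> B / 2" if s: "s \<in> {0..1}" for s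
  proof -
    have "T (\<Psi> s) = (\<Sum>i\<le>N. of_real (wt i s) *\<^sub>C \<psi> (p i))"
      unfolding \<Psi>_def by (subst T_sum) (use xl x in \<open>auto simp: T_scale intro!: sum.cong\<close>)
    moreover have "\<psi> s = (\<Sum>i\<le>N. of_real (wt i s) *\<^sub>C \<psi> s)"
      using l1[OF s] by (simp flip: scaleC.scale_sum_left of_real_sum)
    ultimately have e: "\<psi> s - T (\<Psi> s) = (\<Sum>i\<le>N. of_real (wt i s) *\<^sub>C (\<psi> s - \<psi> (p i)))"
      by (simp add: scaleC.scale_right_diff_distrib sum_subtractf)
    have dm: "\<psi> s - \<psi> (p i) \<in> pts Q" if "i \<le> N" for i using \<psi>m[OF s] \<psi>m[OF p[OF that]] Q.diff_mem by blast
    have "nrm Q (\<psi> s - T (\<Psi> s)) \<le> (\<Sum>i\<le>N. nrm Q (of_real (wt i s) *\<^sub>C (\<psi> s - \<psi> (p i))))"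
      unfolding e by (rule Q.nrm_sum) (use dm in \<open>auto intro: Q.scale_mem\<close>)
    also have "\<dots> \<le> (\<Sum>i\<le>N. wt i s * (B / 2))"
    proof (rule sum_mono)
      fix i assume "i \<in> {..N}"
      hence i: "i \<le> N" by simp
      have "wt i s * nrm Q (\<psi> s - \<psi> (p i)) \<le> wt i s * (B / 2)"
      proof (cases "dist s (p i) < d")
        case True
        thus ?thesis using d(2)[OF s p[OF i]] l0[OF s] by (intro mult_left_mono) auto
      next
        case False
        \<comment> \<open>Outside its tent a node has weight 0, so distant values of
          \<open>\<psi>\<close> do not matter.\<close>
        hence "wt i s = 0" by (simp add: wt_def h_def dist_real_def)
        thus ?thesis by simp
      qed
      thus "nrm Q (of_real (wt i s) *\<^sub>C (\<psi> s - \<psi> (p i))) \<le> wt i s * (B / 2)"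
        using Q.nrm_scale[OF dm[OF i]] l0[OF s, of i] by simp
    qed
    also have "\<dots> = (\<Sum>i\<le>N. wt i s) * (B / 2)" by (simp only: sum_distrib_right)
    also have "\<dots> = B / 2" using l1[OF s] by simp
    finally show ?thesis .
  qed
  ultimately show ?thesis by blast
qed

text \<open>A Bartle--Graves selection over an interval, by iterating the approximate lifting.\<close>

lemma continuous_lift:
  assumes \<psi>: "ncont Q {0..1::real} \<psi>" and B: "B > 0" "\<And>s. s \<in> {0..1} \<Longrightarrow> nrm Q (\<psi> s) \<le> B"
  shows "\<exists>\<Psi>. ncont F {0..1} \<Psi> \<and> (\<forall>s\<in>{0..1}. T (\<Psi> s) = \<psi> s \<and> nrm F (\<Psi> s) \<le> 4 * B)"
proof -
  interpret Q: nsp Q by (rule nsp_Q)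
  let ?P = "\<lambda>k \<psi>. ncont Q {0..1::real} \<psi> \<and> (\<forall>s\<in>{0..1}. nrm Q (\<psi> s) \<le> B * (1/2) ^ k)"
  let ?R = "\<lambda>k \<psi> \<Psi>. ncont F {0..1::real} \<Psi> \<and> (\<forall>s\<in>{0..1}. nrm F (\<Psi> s) \<le> 2 * (B * (1/2) ^ k) \<and>
      nrm Q (\<psi> s - T (\<Psi> s)) \<le> B * (1/2) ^ k / 2)"
  have ex: "\<exists>\<Psi>. ?R k \<psi> \<Psi>" if "?P k \<psi>" for k \<psi>
    using approx_lift[of \<psi> "B * (1/2) ^ k"] that B(1) by simp
  define L where "L k \<psi> = (SOME \<Psi>. ?R k \<psi> \<Psi>)" for k \<psi>
  have L: "?R k \<psi> (L k \<psi>)" if "?P k \<psi>" for k \<psi>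
    unfolding L_def by (rule someI_ex[OF ex[OF that]])
  \<comment> \<open>The residuals left by successive approximate liftings. Each step halves the
    bound, so the lifts have norms at most \<open>2 * B * (1/2)^k\<close> and sum to at most
    \<open>4 * B\<close>.\<close>
  define r where "r = rec_nat \<psi> (\<lambda>k \<psi>' s. \<psi>' s - T (L k \<psi>' s))"
  have r0: "r 0 = \<psi>" and rS: "r (Suc k) = (\<lambda>s. r k s - T (L k (r k) s))" for k by (simp_all add: r_def)
  have P: "?P k (r k)" for k
  proof (induction k)
    case 0 thus ?case using \<psi> B r0 by simp
  next
    case (Suc k)
    thus ?case unfolding rS using L[OF Suc] by (auto intro!: Q.ncont_diff T_ncont)
  qed
  note LP = L[OF P]
  define u where "u k s = (\<Sum>j<k. L j (r j) s)" for k s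
  have Lm: "L j (r j) s \<in> pts F" if "s \<in> {0..1}" for j s using LP[of j] that by (auto simp: ncont_def)
  have um: "u k s \<in> pts F" if "s \<in> {0..1}" for k s unfolding u_def using Lm[OF that] by (intro F.sum_mem)
  have uc: "ncont F {0..1} (u k)" for k unfolding u_def using LP by (intro F.ncont_sum) auto
  have ustep: "nrm F (u (Suc k) s - u k s) \<le> (2 * B) * (1/2) ^ k" if "s \<in> {0..1}" for k s
    using LP[of k] that by (simp add: u_def mult.assoc)
  have Tu: "\<psi> s - T (u k s) = r k s" if s: "s \<in> {0..1}" for k s
  proof (induction k)
    case 0 thus ?case by (simp add: u_def r0 T_0)
  next
    case (Suc k)
    have "u (Suc k) s = u k s + L k (r k) s" by (simp add: u_def)
    thus ?case using Suc T_add[OF um[OF s] Lm[OF s], of k k] by (simp add: rS algebra_simps)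
  qed
  have "\<exists>x. nlim F (\<lambda>k. u k s) x \<and> nrm F (x - u 0 s) \<le> 2 * (2 * B)" if s: "s \<in> {0..1}" for s
    using F.fast_limit[of "\<lambda>k. u k s", OF um[OF s] ustep[OF s]] by metis
  then obtain \<Psi> where \<Psi>: "\<And>s. s \<in> {0..1} \<Longrightarrow> nlim F (\<lambda>k. u k s) (\<Psi> s)" "\<And>s. s \<in> {0..1} \<Longrightarrow> nrm F (\<Psi> s - u 0 s) \<le> 2 * (2 * B)"
    by metis
  have \<Psi>m: "\<Psi> s \<in> pts F" if "s \<in> {0..1}" for s using \<Psi>(1)[OF that] by (simp add: nlim_def)
  \<comment> \<open>The tail bound is uniform in \<open>s\<close>, so continuity passes to the
    limit.\<close>
  have tail: "nrm F (\<Psi> s - u k s) \<le> 4 * B * (1/2) ^ k" if s: "s \<in> {0..1}" for k s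
  proof -
    have "nlim F (\<lambda>j. u (j + k) s) (\<Psi> s)"
      using \<Psi>(1)[OF s] LIMSEQ_ignore_initial_segment[of "\<lambda>j. nrm F (u j s - \<Psi> s)" 0 k] by (simp add: nlim_def)
    moreover have "nrm F (u (Suc j + k) s - u (j + k) s) \<le> (2 * B * (1/2) ^ k) * (1/2) ^ j" for j
      using ustep[OF s, of "j + k"] by (simp add: power_add mult_ac)
    from F.fast_limit[of "\<lambda>j. u (j + k) s", OF um[OF s] this]
    obtain y where "nlim F (\<lambda>j. u (j + k) s) y" "nrm F (y - u (0 + k) s) \<le> 2 * (2 * B * (1/2) ^ k)" by blast
    ultimately show ?thesis using F.nlim_unique by fastforce
  qed
  have geo: "(\<lambda>k. C * (1/2::real) ^ k) \<longlonglongrightarrow> 0" for C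
    using tendsto_mult_right_zero[OF LIMSEQ_power_zero[of "1/2::real"]] by simp
  have "ncont F {0..1} \<Psi>"
  proof (rule F.ncont_uniform_limit[OF \<Psi>m])
    fix e :: real assume e: "e > 0"
    have "\<forall>\<^sub>F k in sequentially. 4 * B * (1/2::real) ^ k < e" using order_tendstoD(2)[OF geo e] .
    then obtain k where "4 * B * (1/2::real) ^ k < e" using eventually_happens'[OF sequentially_bot] by blast
    thus "\<exists>g. ncont F {0..1} g \<and> (\<forall>x\<in>{0..1}. nrm F (\<Psi> x - g x) \<le> e)"
      using uc[of k] tail by (intro exI[of _ "u k"]) (meson less_imp_le order_trans)
  qed
  moreover have "T (\<Psi> s) = \<psi> s" if s: "s \<in> {0..1}" for s
  proof -
    have \<psi>m: "\<psi> s \<in> pts Q" using \<psi> s by (auto simp: ncont_def)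
    have Tm: "T (\<Psi> s) \<in> pts Q" "T (u k s) \<in> pts Q" for k using \<Psi>m[OF s] um[OF s] by (auto simp: Q_pts)
    have "nrm Q (T (\<Psi> s) - \<psi> s) \<le> 5 * B * (1/2) ^ k" for k
    proof -
      have "nrm Q (T (\<Psi> s) - \<psi> s) \<le> nrm Q (T (\<Psi> s) - T (u k s)) + nrm Q (T (u k s) - \<psi> s)"
        by (rule Q.nrm_tri[OF Tm(1) Tm(2) \<psi>m])
      moreover have "nrm Q (T (\<Psi> s) - T (u k s)) \<le> 4 * B * (1/2) ^ k"
        using Q_nrm_le[OF F.diff_mem[OF \<Psi>m[OF s] um[OF s]]] T_diff[OF \<Psi>m[OF s] um[OF s]] tail[OF s, of k]
        by (metis order_trans)
      moreover have "nrm Q (T (u k s) - \<psi> s) \<le> B * (1/2) ^ k"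
        using Q.nrm_commute[OF Tm(2) \<psi>m, of k] Tu[OF s, of k] P[of k] s by simp
      ultimately show ?thesis by simp
    qed
    hence "nrm Q (T (\<Psi> s) - \<psi> s) \<le> 0" by (intro LIMSEQ_le_const[OF geo[of "5 * B"]]) auto
    thus ?thesis using Q.nrm_eq0[OF Q.diff_mem[OF Tm(1) \<psi>m]] Q.nrm_ge0[OF Q.diff_mem[OF Tm(1) \<psi>m]] by simp
  qed
  moreover have "nrm F (\<Psi> s) \<le> 4 * B" if "s \<in> {0..1}" for s using \<Psi>(2)[OF that] by (simp add: u_def)
  ultimately show ?thesis by blast
qed

end

section \<open>Cutoffs and vertical translations\<close>

lemma (in nsp) ncont_local:
  fixes A :: "'a::t2_space set"
  assumes "\<And>a. a \<in> A \<Longrightarrow> \<exists>U. open U \<and> a \<in> U \<and> ncont X (A \<inter> U) f"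
  shows "ncont X A f"
  unfolding ncont_def
proof (intro ballI)
  fix a assume a: "a \<in> A"
  obtain U where U: "open U" "a \<in> U" "ncont X (A \<inter> U) f" using assms[OF a] by blast
  have "at a within A \<inter> U = at a within A" by (rule at_within_nhd[OF U(2,1)]) auto
  thus "f a \<in> pts X \<and> ((\<lambda>x. nrm X (f x - f a)) \<longlongrightarrow> 0) (at a within A)"
    using U(3) a U(2) unfolding ncont_def by (metis IntI)
qed

lemma ncont_cong: "(\<And>x. x \<in> A \<Longrightarrow> f x = g x) \<Longrightarrow> ncont X A f \<Longrightarrow> ncont X A g"
proof -
  assume e: "\<And>x. x \<in> A \<Longrightarrow> f x = g x" and f: "ncont X A f"
  show ?thesis
    unfolding ncont_def
  proof (intro ballI conjI)
    fix a assume a: "a \<in> A"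
    show "g a \<in> pts X" using f a unfolding e[OF a, symmetric] by (simp add: ncont_def)
    have "((\<lambda>x. nrm X (f x - f a)) \<longlongrightarrow> 0) (at a within A)" using f a by (simp add: ncont_def)
    thus "((\<lambda>x. nrm X (g x - g a)) \<longlongrightarrow> 0) (at a within A)"
      by (rule Lim_transform_eventually) (use e a in \<open>auto simp: eventually_at_filter\<close>)
  qed
qed

text \<open>An entire function that decays like a Gaussian along vertical lines and equals 1 to
  order \<open>n\<close> at \<open>c\<close>: multiplication by it restores boundedness and leaves
  Taylor arrays at \<open>c\<close> unchanged.\<close>

definition cutoff :: "nat \<Rightarrow> real \<Rightarrow> complex \<Rightarrow> complex"
  where "cutoff n c z = 1 - (1 - exp ((z - of_real c)\<^sup>2)) ^ n"

lemma cutoff_holomorphic: "cutoff n c holomorphic_on A"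
  unfolding cutoff_def by (intro holomorphic_intros)

lemma cutoff_continuous: "continuous_on A (cutoff n c)"
  unfolding cutoff_def by (intro continuous_intros)

text \<open>With \<open>h = exp ((z - c)^2)\<close> the cutoff factors as \<open>h\<close> times the
  geometric sum of the powers of \<open>1 - h\<close>; on the strip
  \<open>|h| \<le> e * exp (- (Im z)^2)\<close> and the sum is bounded.\<close>

lemma cutoff_bound:
  assumes c: "0 \<le> c" "c \<le> 1"
  obtains K where "K > 0" "\<And>z. 0 \<le> Re z \<Longrightarrow> Re z \<le> 1 \<Longrightarrow> cmod (cutoff n c z) \<le> K * exp (- (Im z)\<^sup>2)"
proof
  \<comment> \<open>The summand 1 keeps \<open>K\<close> positive also for
    \<open>n = 0\<close>.\<close>
  define K where "K = exp 1 * (real n * (1 + exp 1) ^ n) + 1"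
  show "K > 0" unfolding K_def by (intro add_nonneg_pos mult_nonneg_nonneg) auto
  fix z assume z: "0 \<le> Re z" "Re z \<le> 1"
  let ?h = "exp ((z - of_real c)\<^sup>2)"
  have "(Re z - c)\<^sup>2 \<le> 1\<^sup>2" using z c by (intro power2_le_iff_abs_le[THEN iffD2]) auto
  hence "cmod ?h \<le> exp (1 - (Im z)\<^sup>2)" by (simp add: power2_eq_square)
  hence h: "cmod ?h \<le> exp 1 * exp (- (Im z)\<^sup>2)" by (simp flip: exp_add)
  also have "\<dots> \<le> exp 1 * 1" by (intro mult_left_mono) auto
  finally have "cmod ?h \<le> exp 1" by simp
  hence h1: "cmod (1 - ?h) \<le> 1 + exp 1"
    using norm_triangle_ineq4[of 1 ?h] unfolding norm_one by linarith
  have "cutoff n c z = ?h * (\<Sum>i<n. (1 - ?h) ^ i)"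
    unfolding cutoff_def by (subst one_diff_power_eq) simp
  hence "cmod (cutoff n c z) = cmod ?h * cmod (\<Sum>i<n. (1 - ?h) ^ i)" by (simp only: norm_mult)
  also have "cmod (\<Sum>i<n. (1 - ?h) ^ i) \<le> (\<Sum>i<n. (1 + exp 1) ^ n)"
  proof (rule sum_norm_le)
    fix i assume "i \<in> {..<n}"
    have "cmod ((1 - ?h) ^ i) \<le> (1 + exp 1) ^ i" unfolding norm_power by (intro power_mono h1) simp
    also have "\<dots> \<le> (1 + exp 1) ^ n" using \<open>i \<in> {..<n}\<close> by (intro power_increasing) auto
    finally show "cmod ((1 - ?h) ^ i) \<le> (1 + exp 1) ^ n" .
  qed
  also have "cmod ?h * (\<Sum>i<n. (1 + exp 1) ^ n) \<le> (exp 1 * exp (- (Im z)\<^sup>2)) * (\<Sum>i<n. (1 + exp 1) ^ n)"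
    by (intro mult_right_mono h) (auto intro!: sum_nonneg)
  also have "\<dots> \<le> K * exp (- (Im z)\<^sup>2)" by (simp add: K_def algebra_simps)
  finally show "cmod (cutoff n c z) \<le> K * exp (- (Im z)\<^sup>2)" by (simp add: mult_left_mono)
qed

text \<open>\<open>exp (w^2) - 1\<close> has derivative 0 at the origin, so its modulus is at most
  that of \<open>w\<close> nearby; then take \<open>n\<close>-th powers.\<close>

lemma cutoff_order:
  obtains r where "r > 0" "\<And>z. z \<in> ball (complex_of_real c) r \<Longrightarrow> cmod (cutoff n c z - 1) \<le> cmod (z - of_real c) ^ n"
proof -
  have "((\<lambda>w::complex. exp (w\<^sup>2)) has_field_derivative 0) (at 0)"
    by (auto intro!: derivative_eq_intros)
  hence "((\<lambda>w::complex. (exp (w\<^sup>2) - 1) / w) \<longlongrightarrow> 0) (at 0)"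
    by (simp add: has_field_derivative_iff)
  hence "\<forall>\<^sub>F w in at (0::complex). dist ((exp (w\<^sup>2) - 1) / w) 0 < 1" using tendstoD zero_less_one by blast
  then obtain r where r: "r > 0" "\<And>w::complex. w \<noteq> 0 \<Longrightarrow> dist w 0 < r \<Longrightarrow> dist ((exp (w\<^sup>2) - 1) / w) 0 < 1"
    unfolding eventually_at by blast
  have e: "cmod (1 - exp (w\<^sup>2)) \<le> cmod w" if "dist w 0 < r" for w :: complex
  proof (cases "w = 0")
    case False
    thus ?thesis using r(2)[OF False that] by (simp add: norm_divide norm_minus_commute)
  qed simp
  show ?thesis
  proof (rule that[OF r(1)])
    fix z assume "z \<in> ball (complex_of_real c) r"
    hence "cmod (1 - exp ((z - of_real c)\<^sup>2)) \<le> cmod (z - of_real c)"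
      by (intro e) (simp add: dist_norm norm_minus_commute)
    thus "cmod (cutoff n c z - 1) \<le> cmod (z - of_real c) ^ n"
      by (simp add: cutoff_def norm_power power_mono)
  qed
qed

context couple
begin

text \<open>Functions agreeing to order \<open>n\<close> at \<open>z\<close> share the same weak
  expansion, and the expansion determines the array.\<close>

lemma taylor_array_cong_order:
  assumes U: "open U" "z \<in> U" and f: "analytic_into \<Sigma> f U" and g: "analytic_into \<Sigma> g U"
    and r: "r > 0" "\<And>w. w \<in> ball z r \<Longrightarrow> w \<in> U \<Longrightarrow> nrm \<Sigma> (g w - f w) \<le> C * cmod (w - z) ^ n"
  shows "\<T> n z g = \<T> n z f"
proof (rule S.taylor_array_eqI[OF U(1) g U(2)])
  show "\<T> n z f i \<in> pts \<Sigma>" for i by (rule S.taylor_array_mem[OF U(1) f U(2)])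
  show "\<T> n z f i = 0" if "i \<ge> n" for i using that by (simp add: taylor_array_def)
  obtain r' where r': "r' > 0" "ball z r' \<subseteq> U" using U open_contains_ball by blast
  show "S.jet n z g (\<T> n z f)"
    unfolding S.jet_def
  proof
    fix l assume l: "l \<in> \<D>"
    let ?p = "\<lambda>w. \<Sum>i<n. l (\<T> n z f i) * (w - z) ^ (n - 1 - i)"
    obtain C' s where s: "s > 0" "\<And>w. w \<in> ball z s \<Longrightarrow> cmod (l (f w) - ?p w) \<le> C' * cmod (w - z) ^ n"
      using S.taylor_array_jet[OF U(1) f U(2), of n] l unfolding S.jet_def by meson
    have "cmod (l (g w) - ?p w) \<le> (C + C') * cmod (w - z) ^ n" if w: "w \<in> ball z (min r' (min r s))" for w
    proof -
      have wU: "w \<in> U" using w r' by auto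
      note m = S.analytic_mem[OF g wU] S.analytic_mem[OF f wU]
      have "cmod (l (g w) - l (f w)) \<le> C * cmod (w - z) ^ n"
        using S.dual_le[OF l S.diff_mem[OF m]] S.dual_diff[OF l m] r(2)[of w] w wU by simp
      moreover have "cmod (l (f w) - ?p w) \<le> C' * cmod (w - z) ^ n" using s(2) w by simp
      ultimately show ?thesis
        using norm_triangle_ineq[of "l (g w) - l (f w)" "l (f w) - ?p w"] by (simp add: distrib_right)
    qed
    thus "\<exists>C. \<exists>r>0. \<forall>w\<in>ball z r. cmod (l (g w) - ?p w) \<le> C * cmod (w - z) ^ n"
      using r' r(1) s(1) by (intro exI[of _ "C + C'"] exI[of _ "min r' (min r s)"]) auto
  qed
qed

lemma cutoff_taylor:
  assumes f: "analytic_into \<Sigma> f \<S>" and g: "analytic_into \<Sigma> (\<lambda>z. cutoff n c z *\<^sub>C f z) \<S>"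
    and c: "0 < c" "c < 1"
  shows "\<T> n (of_real c) (\<lambda>z. cutoff n c z *\<^sub>C f z) = \<T> n (of_real c) f"
proof -
  have cs: "complex_of_real c \<in> \<S>" using c by (simp add: strip_def)
  obtain r B where r: "r > 0" "ball (of_real c) r \<subseteq> \<S>" "\<And>w. w \<in> ball (of_real c) r \<Longrightarrow> nrm \<Sigma> (f w) \<le> B"
    using S.analytic_locally_bounded[OF open_strip f cs] by blast
  obtain s where s: "s > 0" "\<And>z. z \<in> ball (of_real c) s \<Longrightarrow> cmod (cutoff n c z - 1) \<le> cmod (z - of_real c) ^ n"
    by (rule cutoff_order[of c n]) (rule that)
  show ?thesis
  proof (rule taylor_array_cong_order[OF open_strip cs f g, of "min r s" B])
    fix w assume w: "w \<in> ball (of_real c) (min r s)" "w \<in> \<S>"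
    have m: "f w \<in> pts \<Sigma>" by (rule S.analytic_mem[OF f w(2)])
    have "cutoff n c w *\<^sub>C f w - f w = (cutoff n c w - 1) *\<^sub>C f w" by (simp add: scaleC.scale_left_diff_distrib)
    hence "nrm \<Sigma> (cutoff n c w *\<^sub>C f w - f w) = cmod (cutoff n c w - 1) * nrm \<Sigma> (f w)" by (simp only: S.nrm_scale[OF m])
    also have "\<dots> \<le> cmod (w - of_real c) ^ n * B"
      using s(2)[of w] r(3)[of w] w S.nrm_ge0[OF m] by (intro mult_mono) auto
    finally show "nrm \<Sigma> (cutoff n c w *\<^sub>C f w - f w) \<le> B * cmod (w - of_real c) ^ n" by (simp add: mult.commute)
  qed (use r s in auto)
qed

definition shift :: "real \<Rightarrow> (complex \<Rightarrow> 'v) \<Rightarrow> complex \<Rightarrow> 'v"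
  where "shift t f z = f (z + \<i> * of_real t)"

lemma Complex_shift: "Complex x s + \<i> * of_real t = Complex x (s + t)"
  by (simp add: complex_eq_iff)

lemma shift_F:
  assumes f: "f \<in> pts F"
  shows "shift t f \<in> pts F \<and> nrm F (shift t f) \<le> nrm F f"
proof (rule F_I[where K = "nrm F f"])
  have s: "(\<lambda>z. z + \<i> * of_real t) ` \<S> \<subseteq> \<S>" by (auto simp: strip_def)
  show "(\<lambda>z. l (shift t f z)) holomorphic_on \<S>" if "l \<in> \<D>" for l
    unfolding shift_def
    using holomorphic_on_compose_gen[OF _ F_holomorphic[OF f that] s] by (simp add: o_def holomorphic_intros)
  show "nrm \<Sigma> (shift t f z) \<le> nrm F f" if "z \<in> cstrip" for z
    unfolding shift_def using that by (intro F_\<Sigma>_le f) simp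
  show "ncont \<Sigma> cstrip (shift t f)"
    unfolding shift_def by (intro S.ncont_compose[OF F_D(2)[OF f]] continuous_intros) auto
  show "ncont X0 UNIV (\<lambda>s. shift t f (Complex 0 s))"
    unfolding shift_def Complex_shift by (intro X0.ncont_compose[OF F_D(3)[OF f]] continuous_intros) auto
  show "ncont X1 UNIV (\<lambda>s. shift t f (Complex 1 s))"
    unfolding shift_def Complex_shift by (intro X1.ncont_compose[OF F_D(4)[OF f]] continuous_intros) auto
  show "nrm X0 (shift t f (Complex 0 s)) \<le> nrm F f" "nrm X1 (shift t f (Complex 1 s)) \<le> nrm F f" for s
    unfolding shift_def Complex_shift by (rule F_D[OF f])+
  show "shift t f z = 0" if "z \<notin> cstrip" for z
    unfolding shift_def using that by (intro F_D(7)[OF f]) simp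
qed

lemma taylor_shift:
  assumes f: "f \<in> pts F" and z: "z \<in> \<S>"
  shows "\<T> n z (shift t f) = \<T> n (z + \<i> * of_real t) f"
proof (rule S.taylor_array_eqI[OF open_strip F_D(1) z])
  let ?z = "z + \<i> * of_real t"
  have z': "?z \<in> \<S>" using z by (simp add: strip_def)
  show "shift t f \<in> pts F" using shift_F[OF f] by blast
  show "\<T> n ?z f i \<in> pts \<Sigma>" for i by (rule S.taylor_array_mem[OF open_strip F_D(1)[OF f] z'])
  show "\<T> n ?z f i = 0" if "i \<ge> n" for i using that by (simp add: taylor_array_def)
  show "S.jet n z (shift t f) (\<T> n ?z f)"
    unfolding S.jet_def
  proof
    fix l assume "l \<in> \<D>"
    then obtain C r where r: "r > 0" "\<And>w. w \<in> ball ?z r \<Longrightarrow>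
        cmod (l (f w) - (\<Sum>i<n. l (\<T> n ?z f i) * (w - ?z) ^ (n - 1 - i))) \<le> C * cmod (w - ?z) ^ n"
      using S.taylor_array_jet[OF open_strip F_D(1)[OF f] z', of n] unfolding S.jet_def by meson
    have "cmod (l (shift t f w) - (\<Sum>i<n. l (\<T> n ?z f i) * (w - z) ^ (n - 1 - i))) \<le> C * cmod (w - z) ^ n"
      if "w \<in> ball z r" for w
      using r(2)[of "w + \<i> * of_real t"] that by (simp add: shift_def dist_norm)
    thus "\<exists>C. \<exists>r>0. \<forall>w\<in>ball z r.
        cmod (l (shift t f w) - (\<Sum>i<n. l (\<T> n ?z f i) * (w - z) ^ (n - 1 - i))) \<le> C * cmod (w - z) ^ n"
      using r(1) by blast
  qed
qed

definition cutoff_shift :: "nat \<Rightarrow> real \<Rightarrow> (complex \<Rightarrow> 'v) \<Rightarrow> real \<Rightarrow> complex \<Rightarrow> 'v"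
  where "cutoff_shift n c f t z = cutoff n c z *\<^sub>C shift t f z"

lemma exp_neg_square_small: "e > 0 \<Longrightarrow> \<exists>R. \<forall>\<sigma>. \<bar>\<sigma>\<bar> > R \<longrightarrow> K * exp (- \<sigma>\<^sup>2) \<le> (e::real)"
proof -
  assume e: "e > 0"
  have "((\<lambda>x::real. K * exp (- x\<^sup>2)) \<longlongrightarrow> 0) at_top" by real_asymp
  hence "\<forall>\<^sub>F x in at_top. K * exp (- x\<^sup>2) < e" using e order_tendstoD(2) by blast
  then obtain R where R: "\<And>x. x \<ge> R \<Longrightarrow> K * exp (- x\<^sup>2) < e" unfolding eventually_at_top_linorder by blast
  have "K * exp (- \<sigma>\<^sup>2) \<le> e" if "\<bar>\<sigma>\<bar> > R" for \<sigma> using R[of "\<bar>\<sigma>\<bar>"] that by simp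
  thus ?thesis by blast
qed

text \<open>
  Translation is not continuous on \<^term>\<open>F\<close>; damping by a cutoff restores continuity without changing the
  Taylor array at \<open>c\<close>.
\<close>

lemma cutoff_shift_F:
  assumes f: "f \<in> pts F" and c: "0 < c" "c < 1"
  shows "cutoff_shift n c f t \<in> pts F" and "ncont F UNIV (cutoff_shift n c f)"
    and "\<T> n (of_real c) (cutoff_shift n c f t) = \<T> n (Complex c t) f"
    and "\<exists>B. \<forall>t. nrm F (cutoff_shift n c f t) \<le> B"
proof -
  obtain K where K: "K > 0" "\<And>z. 0 \<le> Re z \<Longrightarrow> Re z \<le> 1 \<Longrightarrow> cmod (cutoff n c z) \<le> K * exp (- (Im z)\<^sup>2)"
    using cutoff_bound[of c n] c by auto
  have K1: "cmod (cutoff n c z) \<le> K" if "z \<in> cstrip" for z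
  proof -
    have "K * exp (- (Im z)\<^sup>2) \<le> K * 1" using K(1) by (intro mult_left_mono) auto
    thus ?thesis using K(2)[of z] that by simp
  qed
  have mult: "(\<lambda>z. cutoff n c z *\<^sub>C g z) \<in> pts F \<and> nrm F (\<lambda>z. cutoff n c z *\<^sub>C g z) \<le> B"
    if g: "g \<in> pts F" and B: "\<And>s. K * exp (- s\<^sup>2) * nrm X0 (g (Complex 0 s)) \<le> B" "\<And>s. K * exp (- s\<^sup>2) * nrm X1 (g (Complex 1 s)) \<le> B" for g B
  proof (rule F_mult[OF g cutoff_holomorphic cutoff_continuous K1])
    show "cmod (cutoff n c (Complex 0 s)) * nrm X0 (g (Complex 0 s)) \<le> B" for s
      using mult_right_mono[OF K(2)[of "Complex 0 s"] X0.nrm_ge0[OF F_D(5)[OF g, of s]]] B(1)[of s] by simp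
    show "cmod (cutoff n c (Complex 1 s)) * nrm X1 (g (Complex 1 s)) \<le> B" for s
      using mult_right_mono[OF K(2)[of "Complex 1 s"] X1.nrm_ge0[OF F_D(6)[OF g, of s]]] B(2)[of s] by simp
  qed
  have sh: "shift t f \<in> pts F" for t using shift_F[OF f] by blast
  have bd: "K * exp (- s\<^sup>2) * x \<le> K * N" if "0 \<le> x" "x \<le> N" for s x N :: real
    using that K(1) mult_mono[of "K * exp (- s\<^sup>2)" "K * 1" x N] by (simp add: mult_left_mono)
  have mB: "cutoff_shift n c f t \<in> pts F \<and> nrm F (cutoff_shift n c f t) \<le> K * nrm F (shift t f)" for t
    unfolding cutoff_shift_def
    using mult[OF sh, of t "K * nrm F (shift t f)"] F_D(9,10)[OF sh] X0.nrm_ge0[OF F_D(5)[OF sh]] X1.nrm_ge0[OF F_D(6)[OF sh]] bd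
    by blast
  thus m: "cutoff_shift n c f t \<in> pts F" for t by blast
  have "nrm F (cutoff_shift n c f t) \<le> K * nrm F f" for t
    using mB[of t] shift_F[OF f, of t] K(1) mult_left_mono[of "nrm F (shift t f)" "nrm F f" K] by linarith
  thus "\<exists>B. \<forall>t. nrm F (cutoff_shift n c f t) \<le> B" by blast
  have "\<T> n (of_real c) (cutoff_shift n c f t) = \<T> n (of_real c) (shift t f)"
    unfolding cutoff_shift_def
    by (rule cutoff_taylor[OF F_D(1)[OF sh] F_D(1)[OF m[unfolded cutoff_shift_def]] c])
  also have "\<dots> = \<T> n (of_real c + \<i> * of_real t) f"
    using c by (intro taylor_shift f) (simp add: strip_def)
  finally show "\<T> n (of_real c) (cutoff_shift n c f t) = \<T> n (Complex c t) f"
    by (simp add: Complex_eq)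
  show "ncont F UNIV (cutoff_shift n c f)"
    unfolding ncont_def
  proof (intro ballI conjI m)
    fix t0 :: real
    \<comment> \<open>Translates of \<open>f\<close> need not be uniformly close on a whole line;
      the Gaussian factor of the cutoff reduces the comparison to a compact interval.\<close>
    have small: "\<exists>d>0. \<forall>t\<in>UNIV. dist t t0 < d \<longrightarrow> (\<forall>\<sigma>. K * exp (- \<sigma>\<^sup>2) * nrm X (f (Complex j (\<sigma> + t)) - f (Complex j (\<sigma> + t0))) \<le> e)"
      if X: "nsp X" and cX: "ncont X UNIV (\<lambda>s. f (Complex j s))" and bX: "\<And>s. nrm X (f (Complex j s)) \<le> nrm F f" and e: "e > 0" for X j e
    proof (rule uniformly_small[where K = K and M = "2 * nrm F f"])
      interpret X: nsp X by fact
      have mX: "f (Complex j s) \<in> pts X" for s using cX by (simp add: ncont_def)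
      show "0 \<le> nrm X (f (Complex j (\<sigma> + t)) - f (Complex j (\<sigma> + t0)))" for \<sigma> t using X.nrm_ge0 X.diff_mem mX by blast
      show "nrm X (f (Complex j (\<sigma> + t)) - f (Complex j (\<sigma> + t0))) \<le> 2 * nrm F f" for \<sigma> t
        using X.nrm_diff[OF mX mX, of "\<sigma> + t" "\<sigma> + t0"] bX[of "\<sigma> + t"] bX[of "\<sigma> + t0"] by simp
      show "\<exists>R. \<forall>\<sigma>. R < \<bar>\<sigma>\<bar> \<longrightarrow> K * exp (- \<sigma>\<^sup>2) \<le> e" if "e > 0" for e by (rule exp_neg_square_small[OF that])
      have "ncont X (UNIV \<times> UNIV) (\<lambda>p. f (Complex j (snd p + fst p)))"
        by (intro X.ncont_compose[OF cX] continuous_intros) auto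
      from X.joint_small[of UNIV "\<lambda>t \<sigma>. f (Complex j (\<sigma> + t))", OF this]
      show "\<exists>d>0. \<forall>t\<in>UNIV. \<forall>\<sigma>. dist t t0 < d \<longrightarrow> \<bar>\<sigma> - \<tau>\<bar> < d \<longrightarrow> nrm X (f (Complex j (\<sigma> + t)) - f (Complex j (\<sigma> + t0))) \<le> e"
        if "e > 0" for \<tau> e using that by simp
    qed (use e K(1) in \<open>auto simp: mult_le_cancel_left1\<close>)
    show "((\<lambda>t. nrm F (cutoff_shift n c f t - cutoff_shift n c f t0)) \<longlongrightarrow> 0) (at t0)"
    proof (rule tendstoI)
      fix e :: real assume e: "e > 0"
      obtain d0 where d0: "d0 > 0" "\<And>t \<sigma>. dist t t0 < d0 \<Longrightarrow> K * exp (- \<sigma>\<^sup>2) * nrm X0 (f (Complex 0 (\<sigma> + t)) - f (Complex 0 (\<sigma> + t0))) \<le> e/2"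
        using small[OF X0.nsp_axioms F_D(3)[OF f] F_D(9)[OF f], of "e/2"] e by (metis UNIV_I half_gt_zero)
      obtain d1 where d1: "d1 > 0" "\<And>t \<sigma>. dist t t0 < d1 \<Longrightarrow> K * exp (- \<sigma>\<^sup>2) * nrm X1 (f (Complex 1 (\<sigma> + t)) - f (Complex 1 (\<sigma> + t0))) \<le> e/2"
        using small[OF X1.nsp_axioms F_D(4)[OF f] F_D(10)[OF f], of "e/2"] e by (metis UNIV_I half_gt_zero)
      have "dist (nrm F (cutoff_shift n c f t - cutoff_shift n c f t0)) 0 < e" if t: "dist t t0 < min d0 d1" for t
      proof -
        have eq: "cutoff_shift n c f t - cutoff_shift n c f t0 = (\<lambda>z. cutoff n c z *\<^sub>C (shift t f - shift t0 f) z)"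
          by (rule ext) (simp add: cutoff_shift_def scaleC.scale_right_diff_distrib)
        have "nrm F (cutoff_shift n c f t - cutoff_shift n c f t0) \<le> e/2"
          unfolding eq
        proof (rule conjunct2[OF mult])
          show "shift t f - shift t0 f \<in> pts F" using F.diff_mem sh by blast
          show "K * exp (- s\<^sup>2) * nrm X0 ((shift t f - shift t0 f) (Complex 0 s)) \<le> e/2" for s
            using d0(2)[of t s] t by (simp add: shift_def Complex_shift)
          show "K * exp (- s\<^sup>2) * nrm X1 ((shift t f - shift t0 f) (Complex 1 s)) \<le> e/2" for s
            using d1(2)[of t s] t by (simp add: shift_def Complex_shift)
        qed
        thus ?thesis using e F_nrm_ge0[OF F.diff_mem[OF m m]] by (simp add: dist_real_def)
      qed
      thus "\<forall>\<^sub>F t in at t0. dist (nrm F (cutoff_shift n c f t - cutoff_shift n c f t0)) 0 < e"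
        unfolding eventually_at using d0(1) d1(1) by (intro exI[of _ "min d0 d1"]) auto
    qed
  qed
qed

section \<open>The array function of a single \<open>f\<close>: the norm-decreasing
  inclusion\<close>

lemma dual_power_space:
  assumes n: "n \<ge> 1" and L: "L \<in> dual_ball (\<P> n)"
  obtains l where "\<And>i. i < n \<Longrightarrow> l i \<in> \<D>" "\<And>x. x \<in> pts (\<P> n) \<Longrightarrow> L x = (\<Sum>i<n. l i (x i))"
proof
  let ?P = "\<P> n"
  interpret P: nsp ?P by unfold_locales (rule normed_power_space[OF S.normed n])
  define e where "e i x = (\<lambda>j. if j = i then x else (0::'v))" for i :: nat and x
  have em: "e i x \<in> pts ?P" if "i < n" "x \<in> pts \<Sigma>" for i x using that by (auto simp: power_space_pts e_def)
  have en: "nrm ?P (e i x) \<le> nrm \<Sigma> x" if "i < n" "x \<in> pts \<Sigma>" for i x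
    by (rule nsp_powerspace_nrm(2)[OF n]) (use that S.nrm_ge0 in \<open>auto simp: e_def\<close>)
  have "e i (x + y) = e i x + e i y" "e i (c *\<^sub>C x) = c *\<^sub>C e i x" for i x y c
    by (auto simp: e_def fun_eq_iff scaleC_fun_def)
  thus "(\<lambda>x. L (e i x)) \<in> \<D>" if "i < n" for i
    using that em en P.dual_add[OF L] P.dual_scale[OF L] order_trans[OF P.dual_le[OF L]]
    unfolding dual_ball_def by auto
  fix x assume x: "x \<in> pts ?P"
  have "x = (\<Sum>i<n. e i (x i))"
  proof
    fix j
    have "(\<Sum>i<n. e i (x i)) j = (\<Sum>i<n. e i (x i) j)" by (induction n) auto
    also have "\<dots> = (\<Sum>i<n. if j = i then x j else 0)" by (rule sum.cong) (auto simp: e_def)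
    also have "\<dots> = x j" using x by (simp add: power_space_pts)
    finally show "x j = (\<Sum>i<n. e i (x i)) j" by simp
  qed
  thus "L x = (\<Sum>i<n. L (e i (x i)))"
    using P.dual_sum[OF L, of "{..<n}" "\<lambda>i. e i (x i)"] em x by (simp add: power_space_pts)
qed

text \<open>Inside the strip the array function is weakly holomorphic by holomorphy of derivatives.
  On a vertical line the array at \<open>c + it\<close> is the array at \<open>c\<close> of a
  translate of \<open>f\<close>, which gives the bound by the norm of \<open>f\<close>.\<close>

lemma taylor_in_calderon:
  assumes f: "f \<in> pts F" and ab: "0 < a" "a < b" "b < 1" and n: "n \<ge> 1"
  defines "g \<equiv> \<lambda>z. if a \<le> Re z \<and> Re z \<le> b then \<T> n z f else 0"
  defines "C \<equiv> calderon_space (\<P> n) (\<R> n a) (\<R> n b) a b"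
  shows "g \<in> pts C" and "nrm C g \<le> nrm F f"
proof -
  let ?P = "\<P> n"
  let ?T = "\<lambda>z. \<T> n z f"
  interpret P: bsp ?P by unfold_locales (rule banach_power_space[OF banach_\<Sigma> n])
  have fa: "analytic_into \<Sigma> f \<S>" by (rule F_D(1)[OF f])
  have Tm: "?T z \<in> pts ?P" if "z \<in> \<S>" for z
  proof -
    have "?T z i = 0" if "i \<ge> n" for i using that by (simp add: taylor_array_def)
    thus ?thesis using S.taylor_array_mem[OF open_strip fa that] by (simp add: power_space_pts)
  qed
  have Tn: "nrm ?P (?T z) \<le> (2 / r) ^ n * nrm F f" if "ball z r \<subseteq> \<S>" "0 < r" "r \<le> 1" for z r
    by (rule taylor_bound[OF f that n])
  have hol: "(\<lambda>z. L (?T z)) holomorphic_on \<S>" if L: "L \<in> dual_ball ?P" for L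
  proof -
    obtain l where l: "\<And>i. i < n \<Longrightarrow> l i \<in> \<D>" "\<And>x. x \<in> pts ?P \<Longrightarrow> L x = (\<Sum>i<n. l i (x i))"
      using dual_power_space[OF n L] by blast
    have "(\<lambda>z. \<Sum>i<n. (deriv ^^ (n - 1 - i)) (\<lambda>z. l i (f z)) z / fact (n - 1 - i)) holomorphic_on \<S>"
      by (intro holomorphic_intros holomorphic_higher_deriv F_holomorphic f l open_strip) auto
    thus ?thesis
      by (rule holomorphic_transform)
        (use l Tm S.dual_taylor_array[OF open_strip fa] in \<open>auto intro!: sum.cong\<close>)
  qed
  have Ta: "analytic_into ?P ?T \<S>"
  proof (rule P.weakly_analytic[OF open_strip _ hol])
    show "?T ` \<S> \<subseteq> pts ?P" using Tm by blast
    fix z assume "z \<in> \<S>"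
    then obtain r where r: "r > 0" "ball z r \<subseteq> \<S>" using open_strip open_contains_ball by metis
    define s where "s = min (r/2) 1"
    have "nrm ?P (?T w) \<le> (2 / s) ^ n * nrm F f" if w: "w \<in> ball z s" for w
    proof (rule Tn)
      have "ball w s \<subseteq> ball z r"
      proof
        fix x assume "x \<in> ball w s"
        thus "x \<in> ball z r" using w dist_triangle[of z x w] by (simp add: s_def)
      qed
      thus "ball w s \<subseteq> \<S>" using r by blast
    qed (use r in \<open>auto simp: s_def\<close>)
    thus "\<exists>r>0. \<exists>B. \<forall>w\<in>ball z r \<inter> \<S>. nrm ?P (?T w) \<le> B"
      using r by (intro exI[of _ s] conjI exI[of _ "(2 / s) ^ n * nrm F f"]) (auto simp: s_def)
  qed
  have sub: "closure (strip a b) \<subseteq> \<S>" unfolding closure_strip[OF ab(2)] using ab by (auto simp: strip_def)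
  have sub2: "strip a b \<subseteq> closure (strip a b)" by (rule closure_subset)
  have gT: "g z = ?T z" if "z \<in> closure (strip a b)" for z
    using that ab by (simp add: g_def closure_strip)
  have rb: "nrm ?P (g z) \<le> (2 / min a (1 - b)) ^ n * nrm F f" if "z \<in> strip a b" for z
  proof -
    have "ball z (min a (1 - b)) \<subseteq> \<S>"
    proof
      fix w assume "w \<in> ball z (min a (1 - b))"
      hence "\<bar>Re (z - w)\<bar> < min a (1 - b)" using abs_Re_le_cmod[of "z - w"] by (simp add: dist_norm)
      thus "w \<in> \<S>" using that by (auto simp: strip_def)
    qed
    thus ?thesis using Tn[of z "min a (1 - b)"] gT[of z] that sub2 ab by auto
  qed
  have line: "nsp (\<R> n c) \<and> ncont (\<R> n c) UNIV (\<lambda>t. g (Complex c t)) \<and>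
      (\<forall>t. nrm (\<R> n c) (g (Complex c t)) \<le> nrm F f)" if c: "a \<le> c" "c \<le> b" for c
  proof -
    have c01: "0 < c" "c < 1" using c ab by auto
    hence cs: "complex_of_real c \<in> \<S>" by (simp add: strip_def)
    obtain D where "quotient_map F ?P (\<T> n (of_real c)) D" using taylor_F[OF cs n] by blast
    then interpret Q: quotient_map F ?P "\<T> n (of_real c)" D .
    \<comment> \<open>Two liftings of the same array: the damped translate depends continuously on
      \<open>t\<close>, while the plain translate has norm at most that of \<open>f\<close>.\<close>
    have g: "g (Complex c t) = \<T> n (of_real c) (cutoff_shift n c f t)"
      "g (Complex c t) = \<T> n (of_real c) (shift t f)" for t
      using cutoff_shift_F(3)[OF f c01, of n t] taylor_shift[OF f cs, of n t] c by (simp_all add: g_def Complex_eq)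
    have "nrm Q.Q (g (Complex c t)) \<le> nrm F f" for t
      using Q.Q_nrm_le[of "shift t f"] shift_F[OF f, of t] by (simp add: g(2))
    thus ?thesis
      unfolding rochberg_space_def using Q.nsp_Q Q.T_ncont[OF cutoff_shift_F(2)[OF f c01]] by (simp add: g(1))
  qed
  have "analytic_into ?P g (strip a b)"
    by (rule P.analytic_into_cong[OF open_strip analytic_into_subset[OF Ta]]) (use sub sub2 gT in auto)
  moreover have "bounded_into ?P g (strip a b)"
    unfolding bounded_into_def using rb gT Tm sub sub2 by (auto simp: subset_iff)
  moreover have "ncont ?P (closure (strip a b)) g"
    by (rule ncont_cong[OF _ P.ncont_mono[OF P.analytic_ncont[OF open_strip Ta] sub]]) (simp add: gT)
  moreover have "g z = 0" if "z \<notin> closure (strip a b)" for z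
    using that ab by (auto simp: g_def closure_strip)
  ultimately show "g \<in> pts C"
    unfolding C_def using line[of a] line[of b] ab
    by (subst calderon_mem[OF P.nsp_axioms]) (auto simp: bounded_into_def ncont_def)
  show "nrm C g \<le> nrm F f"
    unfolding C_def by (rule calderon_nrm_le) (use line ab in auto)
qed

end

section \<open>Holomorphic dependence on parameters\<close>

lemma weight_le: "weight t \<le> (1 + \<bar>t\<bar>) ^ 3"
proof -
  have "1 + t\<^sup>2 \<le> (1 + \<bar>t\<bar>)\<^sup>2" by (simp add: power2_sum)
  hence "(1 + t\<^sup>2) * (1 + \<bar>t\<bar>) \<le> (1 + \<bar>t\<bar>)\<^sup>2 * (1 + \<bar>t\<bar>)" by (intro mult_right_mono) auto
  thus ?thesis by (simp add: weight_def power2_eq_square power3_eq_cube)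
qed

text \<open>The dyadic sums are holomorphic in \<open>z\<close> and locally bounded, so Montel's
  theorem gives a holomorphic limit of a subsequence. Wherever the integrand is continuous in
  \<open>t\<close> the limit is the integral; elsewhere it continues the integral
  holomorphically.\<close>

lemma cline_int_extension:
  assumes U: "open U" and G: "\<And>t. G t holomorphic_on U"
    and M: "\<And>t z. z \<in> U \<Longrightarrow> (1 + t\<^sup>2) * cmod (G t z) \<le> M z"
    and loc: "\<And>L. compact L \<Longrightarrow> L \<subseteq> U \<Longrightarrow> \<exists>B. \<forall>z\<in>L. M z \<le> B"
  shows "\<exists>g. g holomorphic_on U \<and> (\<forall>z\<in>U. cmod (g z) \<le> pi * M z) \<and>
    (\<forall>z\<in>U. \<forall>M'. crapid M' (\<lambda>t. G t z) \<longrightarrow> g z = cline_int (\<lambda>t. G t z))"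
proof -
  define A where "A N z = of_real (1 / 2 ^ N) * (\<Sum>j<2 ^ N. cmpt (\<lambda>t. G t z) (real j / 2 ^ N))" for N z
  have bd: "cmod (A N z) \<le> pi * M z" if z: "z \<in> U" for N z
  proof -
    have b: "cmod (cmpt (\<lambda>t. G t z) s) \<le> pi * M z" for s by (rule cmpt_le[OF M[OF z]])
    have "cmod (\<Sum>j<2 ^ N. cmpt (\<lambda>t. G t z) (real j / 2 ^ N)) \<le> (\<Sum>j<(2::nat) ^ N. pi * M z)"
      by (rule sum_norm_le) (rule b)
    thus ?thesis by (simp add: A_def norm_mult norm_divide norm_power field_simps)
  qed
  have Ah: "A N holomorphic_on U" for N
  proof -
    have "(\<lambda>z. cmpt (\<lambda>t. G t z) s) holomorphic_on U" for s
      by (cases "0 < s \<and> s < 1") (auto intro!: holomorphic_intros G)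
    thus ?thesis unfolding A_def by (intro holomorphic_intros)
  qed
  obtain g \<rho> where g: "g holomorphic_on U" "strict_mono (\<rho> :: nat \<Rightarrow> nat)"
    "\<And>z. z \<in> U \<Longrightarrow> (\<lambda>N. A (\<rho> N) z) \<longlonglongrightarrow> g z"
  proof (rule Montel[OF U, of "range A" A])
    show "f holomorphic_on U" if "f \<in> range A" for f using that Ah by blast
    fix L assume L: "compact L" "L \<subseteq> U"
    obtain B where B: "\<And>z. z \<in> L \<Longrightarrow> M z \<le> B" using loc[OF L] by blast
    have "cmod (A N z) \<le> pi * B" if "z \<in> L" for N z
      by (rule order_trans[OF bd[OF subsetD[OF L(2) that]] mult_left_mono[OF B[OF that] pi_ge_zero]])
    thus "\<exists>B. \<forall>f\<in>range A. \<forall>z\<in>L. cmod (f z) \<le> B" by blast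
  qed (auto intro: that)
  have "g z = cline_int (\<lambda>t. G t z)" if z: "z \<in> U" and cr: "crapid M' (\<lambda>t. G t z)" for z M'
  proof -
    have "(\<lambda>N. A N z) \<longlonglongrightarrow> integral {0..1} (cmpt (\<lambda>t. G t z))"
      unfolding A_def by (rule continuous_dyadic_sum_limit[OF crapid_compactify_continuous[OF cr]])
    from LIMSEQ_subseq_LIMSEQ[OF this g(2)] show ?thesis
      using g(3)[OF z] LIMSEQ_unique by (auto simp: o_def cline_int_def)
  qed
  moreover have "cmod (g z) \<le> pi * M z" if "z \<in> U" for z
    by (rule LIMSEQ_le_const2[OF tendsto_norm[OF g(3)[OF that]]]) (use bd[OF that] in auto)
  ultimately show ?thesis using g(1) by blast
qed

context couple
begin

text \<open>Evaluation is continuous jointly in the function and the point, because the norm of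
  \<open>F\<close> dominates each evaluation.\<close>

lemma ncont_eval:
  fixes e :: "'q::metric_space \<Rightarrow> 'e::metric_space"
  assumes Y: "nsp Y" and ev: "\<And>f. f \<in> pts F \<Longrightarrow> ncont Y E (\<lambda>x. f (j x))"
      "\<And>f x. f \<in> pts F \<Longrightarrow> x \<in> E \<Longrightarrow> nrm Y (f (j x)) \<le> nrm F f"
    and \<Phi>: "ncont F A \<Phi>" and e: "continuous_on A e" "e ` A \<subseteq> E"
  shows "ncont Y A (\<lambda>x. \<Phi> x (j (e x)))"
  unfolding ncont_def
proof (intro ballI conjI)
  interpret Y: nsp Y by fact
  have \<Phi>m: "\<Phi> x \<in> pts F" if "x \<in> A" for x using \<Phi> that by (simp add: ncont_def)
  have ym: "f (j (e x)) \<in> pts Y" if "f \<in> pts F" "x \<in> A" for f x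
    using ev(1)[OF that(1)] e(2) that(2) by (auto simp: ncont_def)
  fix a assume a: "a \<in> A"
  show "\<Phi> a (j (e a)) \<in> pts Y" by (rule ym[OF \<Phi>m[OF a] a])
  show "((\<lambda>x. nrm Y (\<Phi> x (j (e x)) - \<Phi> a (j (e a)))) \<longlongrightarrow> 0) (at a within A)"
  proof (rule Lim_null_comparison)
    have "norm (nrm Y (\<Phi> x (j (e x)) - \<Phi> a (j (e a)))) \<le> nrm F (\<Phi> x - \<Phi> a) + nrm Y (\<Phi> a (j (e x)) - \<Phi> a (j (e a)))"
      if x: "x \<in> A" for x
    proof -
      note m = ym[OF \<Phi>m[OF x] x] ym[OF \<Phi>m[OF a] x] ym[OF \<Phi>m[OF a] a]
      have "nrm Y (\<Phi> x (j (e x)) - \<Phi> a (j (e x))) \<le> nrm F (\<Phi> x - \<Phi> a)"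
        using ev(2)[OF F.diff_mem[OF \<Phi>m[OF x] \<Phi>m[OF a]], of "e x"] e(2) x by auto
      thus ?thesis using Y.nrm_tri[OF m] Y.nrm_ge0[OF Y.diff_mem[OF m(1,3)]] by simp
    qed
    thus "\<forall>\<^sub>F x in at a within A. norm (nrm Y (\<Phi> x (j (e x)) - \<Phi> a (j (e a)))) \<le>
        nrm F (\<Phi> x - \<Phi> a) + nrm Y (\<Phi> a (j (e x)) - \<Phi> a (j (e a)))"
      unfolding eventually_at_filter by simp
    have "((\<lambda>x. nrm F (\<Phi> x - \<Phi> a)) \<longlongrightarrow> 0) (at a within A)" using \<Phi> a by (simp add: ncont_def)
    moreover have "((\<lambda>x. nrm Y (\<Phi> a (j (e x)) - \<Phi> a (j (e a)))) \<longlongrightarrow> 0) (at a within A)"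
      using Y.ncont_compose[OF ev(1)[OF \<Phi>m[OF a]] e] a by (simp add: ncont_def)
    ultimately show "((\<lambda>x. nrm F (\<Phi> x - \<Phi> a) + nrm Y (\<Phi> a (j (e x)) - \<Phi> a (j (e a)))) \<longlongrightarrow> 0) (at a within A)"
      using tendsto_add by fastforce
  qed
qed

end

section \<open>The integral operator attached to one vertical line\<close>

text \<open>
  A lifting \<open>\<Phi> t\<close> of an array at \<open>\<alpha> + it\<close>, together with the Taylor polynomial \<open>p t\<close> of its translate \<open>h t\<close>,
  gives the integrand
  \<open>H z t = k t (p t z + ((z - c) / (z - v t))\<^sup>n (h t z - p t z))\<close>.
  It is regular at \<open>z = v t\<close>, agrees with \<open>k t (p t z)\<close> to order \<open>n\<close> at \<open>c\<close>, and on the boundary of the strip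
  only its \<open>h\<close>-part takes values in \<open>X0\<close> and \<open>X1\<close>; the \<open>p\<close>-part is disposed of by Cauchy's theorem.
\<close>

locale line_operator = couple W X0 X1 for W X0 X1 :: "'v::complex_vector nspace" +
  fixes n :: nat and \<alpha> c :: real and k :: "real \<Rightarrow> complex" and K B :: real and \<Phi> :: "real \<Rightarrow> complex \<Rightarrow> 'v"
  assumes n: "n \<ge> 1" and \<alpha>: "0 < \<alpha>" "\<alpha> < 1" and c: "0 < c" "c < 1" "c \<noteq> \<alpha>"
    and k_cont: "continuous_on UNIV k" and k_le: "\<And>t. weight t * (1 + \<bar>t\<bar>) ^ n * cmod (k t) \<le> K"
    and \<Phi>_cont: "ncont F UNIV \<Phi>" and \<Phi>_le: "\<And>t. nrm F (\<Phi> t) \<le> B"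
begin

definition v :: "real \<Rightarrow> complex" where "v t = Complex \<alpha> t"
definition h :: "real \<Rightarrow> complex \<Rightarrow> 'v" where "h t z = \<Phi> t (z - \<i> * of_real t)"
definition q :: "real \<Rightarrow> nat \<Rightarrow> 'v" where "q t = \<T> n (of_real \<alpha>) (\<Phi> t)"
definition p :: "real \<Rightarrow> complex \<Rightarrow> 'v" where "p t z = (\<Sum>i<n. (z - v t) ^ (n - 1 - i) *\<^sub>C q t i)"
definition m :: "real \<Rightarrow> complex \<Rightarrow> complex" where "m t z = ((z - of_real c) / (z - v t)) ^ n"
definition H :: "complex \<Rightarrow> real \<Rightarrow> 'v" where "H z t = k t *\<^sub>C (p t z + m t z *\<^sub>C (h t z - p t z))"
definition P :: "complex \<Rightarrow> real \<Rightarrow> 'v" where "P z t = k t *\<^sub>C p t z"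
text \<open>\<open>r\<close> is the distance from \<open>\<alpha>\<close> to the boundary of the
  unit strip. \<open>C1\<close> controls the polynomials \<open>p\<close>, \<open>K1\<close> the
  differences \<open>h - p\<close>, and \<open>KH\<close> the whole integrand.\<close>

definition r :: real where "r = min \<alpha> (1 - \<alpha>)"
definition C1 :: real where "C1 = real n * (2 / r) ^ n"
definition K1 :: real where "K1 = 3 * (2 / r) ^ n + C1 * (1 + 2 / r) ^ n"
definition KH :: real where "KH = K * (C1 + K1) * B"

lemma r: "0 < r" "r \<le> 1" "ball (of_real \<alpha>) r \<subseteq> \<S>"
proof -
  show "0 < r" "r \<le> 1" using \<alpha> by (auto simp: r_def)
  show "ball (of_real \<alpha>) r \<subseteq> \<S>"
  proof
    fix w assume "w \<in> ball (complex_of_real \<alpha>) r"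
    hence "\<bar>\<alpha> - Re w\<bar> < r" using abs_Re_le_cmod[of "of_real \<alpha> - w"] by (simp add: dist_norm)
    thus "w \<in> \<S>" by (auto simp: strip_def r_def)
  qed
qed

lemma \<alpha>_strip: "of_real \<alpha> \<in> \<S>"
  using \<alpha> by (simp add: strip_def)

lemma C1: "C1 \<ge> 0" and K1: "K1 \<ge> 0" and C1_pow: "(2 / r) ^ n \<le> C1"
proof -
  show "C1 \<ge> 0" using r by (simp add: C1_def)
  thus "K1 \<ge> 0" using r by (simp add: K1_def)
  show "(2 / r) ^ n \<le> C1" unfolding C1_def using n r mult_right_mono[of 1 "real n" "(2 / r) ^ n"] by simp
qed

lemma \<Phi>_mem: "\<Phi> t \<in> pts F"
  using \<Phi>_cont by (simp add: ncont_def)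

lemma B: "B \<ge> 0"
  using \<Phi>_le[of 0] F_nrm_ge0[OF \<Phi>_mem[of 0]] by simp

lemma K: "K \<ge> 0"
proof -
  have "0 \<le> weight 0 * (1 + \<bar>0\<bar>) ^ n * cmod (k 0)" using weight_ge(4)[of 0] by simp
  thus ?thesis using k_le[of 0] by linarith
qed

lemma h_mem: "z \<in> cstrip \<Longrightarrow> h t z \<in> pts \<Sigma>"
  unfolding h_def by (rule F_D(8)[OF \<Phi>_mem]) simp

lemma h_le: "z \<in> cstrip \<Longrightarrow> nrm \<Sigma> (h t z) \<le> B"
  unfolding h_def by (rule order_trans[OF F_\<Sigma>_le[OF \<Phi>_mem] \<Phi>_le]) simp

lemma q_mem: "q t i \<in> pts \<Sigma>"
  unfolding q_def by (rule S.taylor_array_mem[OF open_strip F_D(1)[OF \<Phi>_mem] \<alpha>_strip])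

lemma q_le: "i < n \<Longrightarrow> nrm \<Sigma> (q t i) \<le> (2 / r) ^ n * B"
proof -
  assume i: "i < n"
  have "nrm \<Sigma> (q t i) \<le> nrm (\<P> n) (q t)" by (rule nsp_powerspace_nrm(1)[OF n i])
  also have "\<dots> \<le> (2 / r) ^ n * nrm F (\<Phi> t)"
    unfolding q_def by (rule taylor_bound[OF \<Phi>_mem r(3,1,2) n])
  also have "\<dots> \<le> (2 / r) ^ n * B" using r \<Phi>_le by (intro mult_left_mono) auto
  finally show ?thesis .
qed

lemma p_mem: "p t z \<in> pts \<Sigma>"
  unfolding p_def by (intro S.sum_mem S.scale_mem q_mem)

lemma dual_p: "l \<in> \<D> \<Longrightarrow> l (p t z) = (\<Sum>i<n. l (q t i) * (z - v t) ^ (n - 1 - i))"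
  unfolding p_def by (subst S.dual_sum) (auto simp: S.scale_mem q_mem S.dual_scale mult.commute)

lemma p_le: "nrm \<Sigma> (p t z) \<le> C1 * B * (1 + cmod (z - v t)) ^ n"
proof -
  have "nrm \<Sigma> (p t z) \<le> (\<Sum>i<n. nrm \<Sigma> ((z - v t) ^ (n - 1 - i) *\<^sub>C q t i))"
    unfolding p_def by (intro S.nrm_sum S.scale_mem q_mem)
  also have "\<dots> \<le> (\<Sum>i<n. (1 + cmod (z - v t)) ^ n * ((2 / r) ^ n * B))"
  proof (rule sum_mono)
    fix i assume i: "i \<in> {..<n}"
    have "cmod ((z - v t) ^ (n - 1 - i)) \<le> (1 + cmod (z - v t)) ^ (n - 1 - i)"
      unfolding norm_power by (intro power_mono) auto
    also have "\<dots> \<le> (1 + cmod (z - v t)) ^ n" by (intro power_increasing) auto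
    finally show "nrm \<Sigma> ((z - v t) ^ (n - 1 - i) *\<^sub>C q t i) \<le> (1 + cmod (z - v t)) ^ n * ((2 / r) ^ n * B)"
      unfolding S.nrm_scale[OF q_mem] using q_le[of i t] i S.nrm_ge0[OF q_mem] by (intro mult_mono) auto
  qed
  also have "\<dots> = C1 * B * (1 + cmod (z - v t)) ^ n" by (simp add: C1_def)
  finally show ?thesis .
qed

text \<open>The remainder has order \<open>n\<close> at \<open>v t\<close> with a constant uniform
  on the closed strip: near \<open>v t\<close> by the Taylor estimate, and at distance at least
  \<open>r / 2\<close> because \<open>h\<close> is bounded and \<open>p\<close> grows at most like
  the \<open>n\<close>-th power of the distance.\<close>

lemma d_le:
  assumes z: "z \<in> cstrip"
  shows "nrm \<Sigma> (h t z - p t z) \<le> K1 * B * cmod (z - v t) ^ n"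
proof -
  let ?x = "cmod (z - v t)"
  have vt: "z - \<i> * of_real t - of_real \<alpha> = z - v t" by (simp add: v_def Complex_eq)
  show ?thesis
  proof (cases "?x < r / 2")
    case True
    show ?thesis
    proof (rule S.nrm_le_dual[OF S.diff_mem[OF h_mem[OF z] p_mem]])
      fix l assume l: "l \<in> \<D>"
      have fa: "analytic_into \<Sigma> (\<Phi> t) (ball (of_real \<alpha>) r)"
        by (rule analytic_into_subset[OF F_D(1)[OF \<Phi>_mem] r(3)])
      have "cmod (l (\<Phi> t (z - \<i> * of_real t)) - (\<Sum>i<n. l (\<T> n (of_real \<alpha>) (\<Phi> t) i) *
          (z - \<i> * of_real t - of_real \<alpha>) ^ (n - 1 - i))) \<le> 3 * B * (2 * cmod (z - \<i> * of_real t - of_real \<alpha>) / r) ^ n"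
      proof (rule S.taylor_array_remainder[OF fa l])
        show "nrm \<Sigma> (\<Phi> t w) \<le> B" if "w \<in> ball (of_real \<alpha>) r" for w
          by (rule order_trans[OF F_\<Sigma>_le[OF \<Phi>_mem] \<Phi>_le]) (use that r(3) in \<open>auto simp: strip_def subset_iff less_imp_le\<close>)
        have "dist (of_real \<alpha>) (z - \<i> * of_real t) = ?x"
          by (subst dist_commute) (simp only: dist_norm vt)
        thus "z - \<i> * of_real t \<in> ball (of_real \<alpha>) (r / 2)" using True by simp
      qed
      hence "cmod (l (h t z) - l (p t z)) \<le> 3 * B * (2 * ?x / r) ^ n"
        unfolding vt dual_p[OF l] q_def h_def .
      also have "\<dots> = 3 * (2 / r) ^ n * B * ?x ^ n" by (simp add: power_mult_distrib power_divide)
      also have "\<dots> \<le> K1 * B * ?x ^ n"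
        unfolding K1_def using C1 B r by (intro mult_right_mono) auto
      finally show "cmod (l (h t z - p t z)) \<le> K1 * B * ?x ^ n"
        by (simp add: S.dual_diff[OF l h_mem[OF z] p_mem])
    qed
  next
    case False
    hence x: "1 \<le> 2 * ?x / r" using r by simp
    hence "1 \<le> (2 * ?x / r) ^ n" by simp
    hence b1: "B \<le> (2 / r) ^ n * B * ?x ^ n"
      using mult_right_mono[of 1 "(2 * ?x / r) ^ n" B] B by (simp add: power_mult_distrib power_divide mult_ac)
    have "1 + ?x \<le> (1 + 2 / r) * ?x" using x by (simp add: field_simps)
    hence "(1 + ?x) ^ n \<le> ((1 + 2 / r) * ?x) ^ n" by (intro power_mono) auto
    hence b2: "C1 * B * (1 + ?x) ^ n \<le> C1 * (1 + 2 / r) ^ n * B * ?x ^ n"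
      using mult_left_mono[of "(1 + ?x) ^ n" "((1 + 2 / r) * ?x) ^ n" "C1 * B"] C1 B by (simp add: power_mult_distrib mult_ac)
    have "nrm \<Sigma> (h t z - p t z) \<le> B + C1 * B * (1 + ?x) ^ n"
      using S.nrm_diff[OF h_mem[OF z] p_mem, of t t z] h_le[OF z, of t] p_le[of t z] by simp
    also have "\<dots> \<le> (2 / r) ^ n * B * ?x ^ n + C1 * (1 + 2 / r) ^ n * B * ?x ^ n" using b1 b2 by simp
    also have "\<dots> \<le> K1 * B * ?x ^ n"
      unfolding K1_def distrib_right using B r by simp
    finally show ?thesis .
  qed
qed

text \<open>The power of \<open>z - v t\<close> in the denominator of \<open>m\<close> is absorbed
  by \<open>d_le\<close>, leaving the power of \<open>z - c\<close>. This gives both regularity at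
  \<open>v t\<close> and agreement to order \<open>n\<close> at \<open>c\<close>.\<close>

lemma md_le:
  assumes z: "z \<in> cstrip"
  shows "nrm \<Sigma> (m t z *\<^sub>C (h t z - p t z)) \<le> K1 * B * cmod (z - of_real c) ^ n"
proof -
  note dm = S.diff_mem[OF h_mem[OF z] p_mem, of t t z]
  show ?thesis
  proof (cases "z = v t")
    case True
    \<comment> \<open>Division by zero yields 0 and \<open>n\<close> is positive.\<close>
    hence "m t z = 0" using n by (simp add: m_def)
    thus ?thesis using K1 B by simp
  next
    case False
    have "nrm \<Sigma> (m t z *\<^sub>C (h t z - p t z)) = cmod (z - of_real c) ^ n / cmod (z - v t) ^ n * nrm \<Sigma> (h t z - p t z)"
      unfolding S.nrm_scale[OF dm] by (simp add: m_def norm_power norm_divide power_divide)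
    also have "\<dots> \<le> cmod (z - of_real c) ^ n / cmod (z - v t) ^ n * (K1 * B * cmod (z - v t) ^ n)"
      by (intro mult_left_mono d_le z) auto
    also have "\<dots> = K1 * B * cmod (z - of_real c) ^ n" using False by simp
    finally show ?thesis .
  qed
qed

lemma v_growth: "(1 + cmod (z - v t)) ^ n \<le> (2 + cmod z) ^ n * (1 + \<bar>t\<bar>) ^ n"
proof -
  have "cmod (v t) \<le> 1 + \<bar>t\<bar>" using cmod_le[of "v t"] \<alpha> by (simp add: v_def)
  hence "1 + cmod (z - v t) \<le> 2 + cmod z + \<bar>t\<bar>" using norm_triangle_ineq4[of z "v t"] by simp
  also have "\<dots> \<le> (2 + cmod z) * (1 + \<bar>t\<bar>)" by (simp add: algebra_simps)
  finally show ?thesis unfolding power_mult_distrib[symmetric] by (intro power_mono) auto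
qed

lemma c_growth: "cmod (z - of_real c) ^ n \<le> (2 + cmod z) ^ n"
proof -
  have "cmod (z - of_real c) \<le> 2 + cmod z" using norm_triangle_ineq4[of z "of_real c"] c by simp
  thus ?thesis by (intro power_mono) auto
qed

text \<open>The bound common to \<^term>\<open>H\<close>, \<^term>\<open>P\<close> and the scalar functions that extend \<^term>\<open>H\<close> to \<open>z = v t\<close>.\<close>

lemma KH_bound:
  assumes "0 \<le> x" "x \<le> C1 * B * (1 + cmod (z - v t)) ^ n + K1 * B * cmod (z - of_real c) ^ n"
  shows "weight t * (cmod (k t) * x) \<le> KH * (2 + cmod z) ^ n"
proof -
  have "C1 * B * (1 + cmod (z - v t)) ^ n \<le> C1 * B * ((2 + cmod z) ^ n * (1 + \<bar>t\<bar>) ^ n)"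
    by (intro mult_left_mono v_growth) (use C1 B in auto)
  moreover have "K1 * B * cmod (z - of_real c) ^ n \<le> K1 * B * ((2 + cmod z) ^ n * (1 + \<bar>t\<bar>) ^ n)"
  proof (intro mult_left_mono)
    have "(2 + cmod z) ^ n * 1 \<le> (2 + cmod z) ^ n * (1 + \<bar>t\<bar>) ^ n" by (intro mult_left_mono) auto
    thus "cmod (z - of_real c) ^ n \<le> (2 + cmod z) ^ n * (1 + \<bar>t\<bar>) ^ n" using c_growth[of z] by simp
  qed (use K1 B in auto)
  ultimately have "x \<le> (C1 + K1) * B * (2 + cmod z) ^ n * (1 + \<bar>t\<bar>) ^ n"
    using assms(2) by (simp add: algebra_simps)
  hence "weight t * (cmod (k t) * x) \<le> weight t * (cmod (k t) * ((C1 + K1) * B * (2 + cmod z) ^ n * (1 + \<bar>t\<bar>) ^ n))"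
    using weight_ge(4)[of t] by (intro mult_left_mono) auto
  also have "\<dots> = (weight t * (1 + \<bar>t\<bar>) ^ n * cmod (k t)) * ((C1 + K1) * B * (2 + cmod z) ^ n)" by (simp add: mult_ac)
  also have "\<dots> \<le> K * ((C1 + K1) * B * (2 + cmod z) ^ n)"
    by (intro mult_right_mono k_le) (use C1 K1 B in auto)
  finally show ?thesis by (simp add: KH_def mult_ac)
qed

lemma H_mem: "z \<in> cstrip \<Longrightarrow> H z t \<in> pts \<Sigma>"
  unfolding H_def by (intro S.scale_mem S.add_mem S.diff_mem h_mem p_mem)

lemma H_le:
  assumes z: "z \<in> cstrip"
  shows "weight t * nrm \<Sigma> (H z t) \<le> KH * (2 + cmod z) ^ n"
proof -
  have dm: "m t z *\<^sub>C (h t z - p t z) \<in> pts \<Sigma>" by (intro S.scale_mem S.diff_mem h_mem p_mem z)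
  have "nrm \<Sigma> (p t z + m t z *\<^sub>C (h t z - p t z)) \<le> C1 * B * (1 + cmod (z - v t)) ^ n + K1 * B * cmod (z - of_real c) ^ n"
    using S.nrm_add[OF p_mem dm] p_le[of t z] md_le[OF z, of t] by (meson add_mono order_trans)
  from KH_bound[OF S.nrm_ge0[OF S.add_mem[OF p_mem dm]] this] show ?thesis
    unfolding H_def S.nrm_scale[OF S.add_mem[OF p_mem dm]] .
qed

lemma P_le: "weight t * nrm \<Sigma> (P z t) \<le> KH * (2 + cmod z) ^ n"
proof -
  have "nrm \<Sigma> (p t z) \<le> C1 * B * (1 + cmod (z - v t)) ^ n + K1 * B * cmod (z - of_real c) ^ n"
    using p_le[of t z] K1 B by (simp add: add_increasing2)
  from KH_bound[OF S.nrm_ge0[OF p_mem] this] show ?thesis unfolding P_def S.nrm_scale[OF p_mem] .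
qed

text \<open>The closed strip without the line of integration: here no \<open>v t\<close> is met, so
  the integral of \<open>H z\<close> is formed directly. Both boundary lines of the unit strip
  belong to it.\<close>

definition D :: "complex set" where "D = {z \<in> cstrip. Re z \<noteq> \<alpha>}"

lemma D: "z \<in> D \<Longrightarrow> z \<in> cstrip" "z \<in> D \<Longrightarrow> z \<noteq> v t"
  by (auto simp: D_def v_def)

lemma \<Phi>_cont2:
  fixes A :: "'q::metric_space set"
  shows "ncont F (A \<times> UNIV) (\<lambda>x. \<Phi> (snd x))"
  by (rule F.ncont_compose[OF \<Phi>_cont]) (auto intro!: continuous_intros)

lemma v_cont: "continuous_on A (\<lambda>x. v (snd x))"
  unfolding v_def Complex_eq by (intro continuous_intros)

lemma q_cont: "i < n \<Longrightarrow> ncont \<Sigma> UNIV (\<lambda>t. q t i)"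
proof -
  assume i: "i < n"
  obtain C where "quotient_map F (\<P> n) (\<T> n (of_real \<alpha>)) C"
    using taylor_F[OF \<alpha>_strip n] by blast
  then interpret Q: quotient_map F "\<P> n" "\<T> n (of_real \<alpha>)" C .
  show ?thesis
    unfolding ncont_def
  proof (intro ballI conjI q_mem)
    fix a
    show "((\<lambda>t. nrm \<Sigma> (q t i - q a i)) \<longlongrightarrow> 0) (at a)"
    proof (rule Lim_null_comparison)
      have "norm (nrm \<Sigma> (q t i - q a i)) \<le> C * nrm F (\<Phi> t - \<Phi> a)" for t
      proof -
        have "nrm \<Sigma> ((q t - q a) i) \<le> nrm (\<P> n) (q t - q a)"
          by (rule nsp_powerspace_nrm(1)[OF n i])
        also have "\<dots> \<le> C * nrm F (\<Phi> t - \<Phi> a)"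
          using Q.T_le[OF F.diff_mem[OF \<Phi>_mem \<Phi>_mem]] Q.T_diff[OF \<Phi>_mem \<Phi>_mem] by (simp add: q_def)
        finally show ?thesis using S.nrm_ge0[OF S.diff_mem[OF q_mem q_mem]] by simp
      qed
      thus "\<forall>\<^sub>F t in at a. norm (nrm \<Sigma> (q t i - q a i)) \<le> C * nrm F (\<Phi> t - \<Phi> a)" by simp
      have "((\<lambda>t. nrm F (\<Phi> t - \<Phi> a)) \<longlongrightarrow> 0) (at a)" using \<Phi>_cont by (simp add: ncont_def)
      from tendsto_mult_right_zero[OF this]
      show "((\<lambda>t. C * nrm F (\<Phi> t - \<Phi> a)) \<longlongrightarrow> 0) (at a)" .
    qed
  qed
qed

lemma p_cont: "ncont \<Sigma> (A \<times> UNIV) (\<lambda>x. p (snd x) (fst x))"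
  unfolding p_def
  by (intro S.ncont_sum S.ncont_scale S.ncont_compose[OF q_cont] continuous_intros v_cont) auto

lemma k_cont2: "continuous_on (A \<times> UNIV) (\<lambda>x. k (snd x))"
  by (rule continuous_on_compose2[OF k_cont]) (auto intro!: continuous_intros)

lemma m_cont: "A \<subseteq> D \<Longrightarrow> continuous_on (A \<times> UNIV) (\<lambda>x. m (snd x) (fst x))"
  unfolding m_def by (intro continuous_intros v_cont) (use D(2) in auto)

lemma H_cont: "ncont \<Sigma> (D \<times> UNIV) (\<lambda>x. H (fst x) (snd x))"
proof -
  have "ncont \<Sigma> (D \<times> UNIV) (\<lambda>x. \<Phi> (snd x) (fst x - \<i> * of_real (snd x)))"
    by (rule ncont_eval[OF S.nsp_axioms, where E = cstrip and j = "\<lambda>z. z"])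
      (use F_D(2) F_\<Sigma>_le D(1) in \<open>auto intro!: \<Phi>_cont2 continuous_intros\<close>)
  hence "ncont \<Sigma> (D \<times> UNIV) (\<lambda>x. h (snd x) (fst x))" unfolding h_def .
  thus ?thesis
    unfolding H_def by (intro S.ncont_scale S.ncont_add S.ncont_diff k_cont2 p_cont m_cont order_refl)
qed

lemma P_cont: "ncont \<Sigma> (A \<times> UNIV) (\<lambda>x. P (fst x) (snd x))"
  unfolding P_def by (intro S.ncont_scale k_cont2 p_cont)

lemma H_rapid: "z \<in> D \<Longrightarrow> rapid \<Sigma> (KH * (2 + cmod z) ^ n) (H z)"
  by (rule S.ncont_line_int(2)[where Q = "{z}"])
    (use H_le D(1) in \<open>auto intro!: S.ncont_mono[OF H_cont]\<close>)

lemma P_rapid: "rapid \<Sigma> (KH * (2 + cmod z) ^ n) (P z)"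
  by (rule S.ncont_line_int(2)[where Q = "{z}"]) (use P_le in \<open>auto intro!: P_cont\<close>)

lemma KH: "KH \<ge> 0"
  unfolding KH_def using K C1 K1 B by simp

text \<open>The bound on \<open>H\<close> grows with \<open>z\<close>, so continuity in the
  parameter is applied on unit balls.\<close>

lemma I_cont: "ncont \<Sigma> D (\<lambda>z. line_int \<Sigma> (H z))"
proof (rule S.ncont_local)
  fix z0 assume z0: "z0 \<in> D"
  have "ncont \<Sigma> (D \<inter> ball z0 1) (\<lambda>z. line_int \<Sigma> (H z))"
  proof (rule S.ncont_line_int(1)[where M = "KH * (3 + cmod z0) ^ n"])
    show "ncont \<Sigma> ((D \<inter> ball z0 1) \<times> UNIV) (\<lambda>p. H (fst p) (snd p))" by (rule S.ncont_mono[OF H_cont]) auto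
    fix z t assume z: "z \<in> D \<inter> ball z0 1"
    hence "cmod z \<le> 1 + cmod z0" using norm_triangle_ineq2[of z z0] by (simp add: dist_norm norm_minus_commute)
    hence "(2 + cmod z) ^ n \<le> (3 + cmod z0) ^ n" by (intro power_mono) auto
    hence "KH * (2 + cmod z) ^ n \<le> KH * (3 + cmod z0) ^ n" using KH by (rule mult_left_mono)
    thus "weight t * nrm \<Sigma> (H z t) \<le> KH * (3 + cmod z0) ^ n" using H_le[of z t] z D(1) by fastforce
  qed
  thus "\<exists>U. open U \<and> z0 \<in> U \<and> ncont \<Sigma> (D \<inter> U) (\<lambda>z. line_int \<Sigma> (H z))"
    by (intro exI[of _ "ball z0 1"]) auto
qed

text \<open>After applying \<open>l\<close>, the quotient of \<open>h - p\<close> by the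
  \<open>n\<close>-th power of \<open>z - v t\<close> is bounded by \<open>K1 * B\<close>, so its
  singularity at \<open>v t\<close> is removable.\<close>

lemma scalar_extension:
  assumes l: "l \<in> \<D>"
  shows "\<exists>g. g holomorphic_on \<S> \<and> (\<forall>z\<in>\<S>. z \<noteq> v t \<longrightarrow> g z = l (H z t)) \<and>
    (\<forall>z\<in>\<S>. weight t * cmod (g z) \<le> KH * (2 + cmod z) ^ n)"
proof -
  have cs: "z \<in> cstrip" if "z \<in> \<S>" for z using that by (simp add: strip_def)
  define s where "s z = (l (h t z) - l (p t z)) / (z - v t) ^ n" for z
  have "shift (- t) (\<Phi> t) \<in> pts F" using shift_F[OF \<Phi>_mem] by blast
  hence "(\<lambda>z. l (shift (- t) (\<Phi> t) z)) holomorphic_on \<S>" by (rule F_holomorphic[OF _ l])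
  hence hh: "(\<lambda>z. l (h t z)) holomorphic_on \<S>" by (simp add: shift_def h_def)
  have "s holomorphic_on \<S> - {v t}"
    unfolding s_def dual_p[OF l]
    by (intro holomorphic_intros holomorphic_on_subset[OF hh]) auto
  have sb: "cmod (s z) \<le> K1 * B" if "z \<in> \<S>" for z
  proof (cases "z = v t")
    case True
    thus ?thesis using n K1 B by (simp add: s_def power_0_left)
  next
    case False
    have "cmod (l (h t z) - l (p t z)) \<le> K1 * B * cmod (z - v t) ^ n"
      using order_trans[OF S.dual_le[OF l S.diff_mem[OF h_mem p_mem]] d_le] S.dual_diff[OF l h_mem p_mem] cs[OF that] by metis
    thus ?thesis using False by (simp add: s_def norm_divide norm_power divide_le_eq)
  qed
  have vs: "v t \<in> \<S>" using \<alpha> by (simp add: v_def strip_def)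
  have "\<forall>\<^sub>F z in at (v t). z \<in> \<S>" using vs open_strip eventually_at_in_open' by blast
  hence "\<forall>\<^sub>F z in at (v t). cmod (s z) \<le> K1 * B" by eventually_elim (rule sb)
  moreover have "v t \<in> interior \<S>" using vs by (simp add: interior_open[OF open_strip])
  ultimately obtain g where g: "g holomorphic_on \<S>" "\<And>z. z \<in> \<S> - {v t} \<Longrightarrow> g z = s z"
    using holomorphic_on_extend_bounded[OF \<open>s holomorphic_on \<S> - {v t}\<close>] by blast
  have gb: "cmod (g z) \<le> K1 * B" if "z \<in> \<S>" for z
  proof (cases "z = v t")
    \<comment> \<open>At the removed singularity the bound is inherited by continuity.\<close>
    case True
    have "continuous_on \<S> g" by (rule holomorphic_on_imp_continuous_on[OF g(1)])
    hence "(g \<longlongrightarrow> g (v t)) (at (v t))"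
      using vs open_strip by (simp add: continuous_on_eq_continuous_at continuous_at)
    hence "((\<lambda>z. cmod (g z)) \<longlongrightarrow> cmod (g (v t))) (at (v t))" by (rule tendsto_norm)
    moreover have "\<forall>\<^sub>F z in at (v t). cmod (g z) \<le> K1 * B"
      using \<open>\<forall>\<^sub>F z in at (v t). z \<in> \<S>\<close> eventually_neq_at_within[of "v t" "v t" UNIV]
      by eventually_elim (use g(2) sb in simp)
    ultimately show ?thesis unfolding True by (rule tendsto_upperbound) simp
  qed (use g(2) sb that in simp)
  define G where "G z = k t * (l (p t z) + (z - of_real c) ^ n * g z)" for z
  have "G holomorphic_on \<S>"
    unfolding G_def dual_p[OF l] by (intro holomorphic_intros g(1))
  moreover have "G z = l (H z t)" if z: "z \<in> \<S>" "z \<noteq> v t" for z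
  proof -
    note zc = cs[OF z(1)]
    have "l (H z t) = k t * (l (p t z) + m t z * (l (h t z) - l (p t z)))"
      unfolding H_def
      by (simp only: S.dual_scale[OF l] S.dual_add[OF l] S.dual_diff[OF l] S.add_mem S.scale_mem S.diff_mem h_mem[OF zc] p_mem)
    thus ?thesis using z g(2)[of z] by (simp add: G_def m_def s_def power_divide)
  qed
  moreover have "weight t * cmod (G z) \<le> KH * (2 + cmod z) ^ n" if z: "z \<in> \<S>" for z
  proof -
    have "cmod ((z - of_real c) ^ n * g z) = cmod (g z) * cmod (z - of_real c) ^ n"
      by (simp add: norm_mult norm_power)
    also have "\<dots> \<le> K1 * B * cmod (z - of_real c) ^ n" by (intro mult_right_mono gb z) simp
    finally have "cmod ((z - of_real c) ^ n * g z) \<le> K1 * B * cmod (z - of_real c) ^ n" .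
    moreover have "cmod (l (p t z)) \<le> C1 * B * (1 + cmod (z - v t)) ^ n"
      using S.dual_le[OF l p_mem] p_le by (meson order_trans)
    ultimately have "cmod (l (p t z) + (z - of_real c) ^ n * g z) \<le>
        C1 * B * (1 + cmod (z - v t)) ^ n + K1 * B * cmod (z - of_real c) ^ n"
      by (intro norm_triangle_mono)
    from KH_bound[OF norm_ge_zero this] show ?thesis by (simp add: G_def norm_mult)
  qed
  ultimately show ?thesis by blast
qed

text \<open>For \<open>z\<close> on the line the parameter \<open>t\<close> with
  \<open>v t = z\<close> breaks the formula for \<open>H\<close>; \<open>cline_int_extension\<close>
  applied to the scalar extensions carries the integral across the line.\<close>

lemma scalar_integral_extension:
  assumes l: "l \<in> \<D>"
  shows "\<exists>g. g holomorphic_on \<S> \<and> (\<forall>z\<in>\<S> \<inter> D. g z = l (line_int \<Sigma> (H z))) \<and>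
    (\<forall>z\<in>\<S>. cmod (g z) \<le> pi * (KH * (2 + cmod z) ^ n))"
proof -
  obtain G where G: "\<And>t. G t holomorphic_on \<S>"
    "\<And>t z. z \<in> \<S> \<Longrightarrow> z \<noteq> v t \<Longrightarrow> G t z = l (H z t)"
    "\<And>t z. z \<in> \<S> \<Longrightarrow> weight t * cmod (G t z) \<le> KH * (2 + cmod z) ^ n"
    using scalar_extension[OF l] by metis
  have "\<exists>g. g holomorphic_on \<S> \<and> (\<forall>z\<in>\<S>. cmod (g z) \<le> pi * (KH * (2 + cmod z) ^ n)) \<and>
    (\<forall>z\<in>\<S>. \<forall>M'. crapid M' (\<lambda>t. G t z) \<longrightarrow> g z = cline_int (\<lambda>t. G t z))"
  proof (rule cline_int_extension[OF open_strip G(1)])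
    show "(1 + t\<^sup>2) * cmod (G t z) \<le> KH * (2 + cmod z) ^ n" if "z \<in> \<S>" for t z
      using mult_right_mono[OF weight_ge(2)[of t] norm_ge_zero[of "G t z"]] G(3)[OF that, of t] by simp
    fix L assume L: "compact L" "L \<subseteq> \<S>"
    obtain R where R: "\<And>z. z \<in> L \<Longrightarrow> cmod z \<le> R" using compact_imp_bounded[OF L(1)] unfolding bounded_iff by blast
    have "KH * (2 + cmod z) ^ n \<le> KH * (2 + \<bar>R\<bar>) ^ n" if "z \<in> L" for z
      using R[OF that] by (intro mult_left_mono power_mono KH) auto
    thus "\<exists>B. \<forall>z\<in>L. KH * (2 + cmod z) ^ n \<le> B" by blast
  qed
  then obtain g where g: "g holomorphic_on \<S>" "\<And>z. z \<in> \<S> \<Longrightarrow> cmod (g z) \<le> pi * (KH * (2 + cmod z) ^ n)"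
    "\<And>z M'. z \<in> \<S> \<Longrightarrow> crapid M' (\<lambda>t. G t z) \<Longrightarrow> g z = cline_int (\<lambda>t. G t z)" by blast
  have "g z = l (line_int \<Sigma> (H z))" if z: "z \<in> \<S> \<inter> D" for z
  proof -
    have e: "(\<lambda>t. G t z) = (\<lambda>t. l (H z t))" using G(2) D(2) z by auto
    have "crapid (KH * (2 + cmod z) ^ n) (\<lambda>t. l (H z t))" by (rule S.crapid_dual[OF l H_rapid]) (use z in simp)
    thus ?thesis
      using g(3)[of z] z S.dual_line_int[OF l H_rapid, of z] unfolding e by simp
  qed
  thus ?thesis using g(1,2) by blast
qed

text \<open>The scalar extensions agree with the vector-valued integral off the line, which is dense
  in the open strip, and are bounded uniformly over the dual ball; \<open>weak_extension\<close>
  assembles them into one analytic function.\<close>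

lemma extension:
  obtains J where "analytic_into \<Sigma> J \<S>" "ncont \<Sigma> cstrip J"
    "\<And>z. z \<in> D \<Longrightarrow> J z = line_int \<Sigma> (H z)"
    "\<And>z. z \<in> cstrip \<Longrightarrow> nrm \<Sigma> (J z) \<le> pi * (KH * (2 + cmod z) ^ n)"
proof -
  let ?I = "\<lambda>z. line_int \<Sigma> (H z)"
  obtain G where G: "\<And>l. l \<in> \<D> \<Longrightarrow> G l holomorphic_on \<S>"
    "\<And>l z. l \<in> \<D> \<Longrightarrow> z \<in> \<S> \<inter> D \<Longrightarrow> G l z = l (?I z)"
    "\<And>l z. l \<in> \<D> \<Longrightarrow> z \<in> \<S> \<Longrightarrow> cmod (G l z) \<le> pi * (KH * (2 + cmod z) ^ n)"
    using scalar_integral_extension by metis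
  have "\<exists>g. analytic_into \<Sigma> g \<S> \<and> (\<forall>z\<in>\<S> \<inter> D. g z = ?I z) \<and>
      (\<forall>l\<in>\<D>. \<forall>z\<in>\<S>. l (g z) = G l z)"
  proof (rule S.weak_extension[OF open_strip _ _ _ G(1,2)])
    show "\<S> \<subseteq> closure (\<S> \<inter> D)"
    proof
      fix z assume z: "z \<in> \<S>"
      show "z \<in> closure (\<S> \<inter> D)"
      proof (cases "Re z = \<alpha>")
        case False
        hence "z \<in> \<S> \<inter> D" using z by (auto simp: D_def strip_def)
        thus ?thesis by (rule subsetD[OF closure_subset])
      next
        case True
        show ?thesis
          unfolding closure_approachable
        proof (intro allI impI)
          fix e :: real assume e: "e > 0"
          let ?y = "z + of_real (min (e/2) ((1 - \<alpha>) / 2))"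
          have "?y \<in> \<S> \<inter> D" using True \<alpha> e by (auto simp: strip_def D_def min_def field_simps)
          moreover have "dist ?y z < e" using e \<alpha> by (simp add: dist_norm del: of_real_divide)
          ultimately show "\<exists>y\<in>\<S> \<inter> D. dist y z < e" by blast
        qed
      qed
    qed
    show "?I ` (\<S> \<inter> D) \<subseteq> pts \<Sigma>" using S.line_int_mem[OF H_rapid] by auto
    show "\<exists>r>0. \<exists>B. \<forall>l\<in>\<D>. \<forall>w\<in>ball z r \<inter> \<S>. cmod (G l w) \<le> B" for z
      using growth_locally_bounded[of "\<S>" "\<lambda>w. pi * (KH * (2 + cmod w) ^ n)" "pi * KH" n z] KH order_trans[OF G(3)]
      by (simp add: mult.assoc) blast
  qed auto
  then obtain g where g: "analytic_into \<Sigma> g \<S>" "\<And>z. z \<in> \<S> \<inter> D \<Longrightarrow> g z = ?I z"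
    "\<And>l z. l \<in> \<D> \<Longrightarrow> z \<in> \<S> \<Longrightarrow> l (g z) = G l z" by blast
  \<comment> \<open>The extension is used inside the strip, the integral itself on the two boundary
    lines.\<close>
  define J where "J z = (if z \<in> \<S> then g z else ?I z)" for z
  have JD: "J z = ?I z" if "z \<in> D" for z using g(2) that by (simp add: J_def)
  have Jg: "J z = g z" if "z \<in> \<S>" for z using that by (simp add: J_def)
  have bd: "z \<in> D" if "z \<in> cstrip" "z \<notin> \<S>" for z
    using that \<alpha> by (auto simp: D_def strip_def)
  have Jm: "J z \<in> pts \<Sigma>" if "z \<in> cstrip" for z
    using S.analytic_mem[OF g(1), of z] S.line_int_mem[OF H_rapid, of z] bd[OF that] by (cases "z \<in> \<S>") (auto simp: J_def)
  show ?thesis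
  proof (rule that[of J])
    have "ncont \<Sigma> \<S> g" by (rule S.analytic_ncont[OF open_strip g(1)])
    hence cs: "ncont \<Sigma> \<S> J" by (rule ncont_cong[rotated]) (simp add: Jg)
    have cD: "ncont \<Sigma> D J" by (rule ncont_cong[OF _ I_cont]) (simp add: JD)
    show "ncont \<Sigma> cstrip J"
    proof (rule S.ncont_local)
      fix z assume z: "z \<in> cstrip"
      show "\<exists>U. open U \<and> z \<in> U \<and> ncont \<Sigma> (cstrip \<inter> U) J"
      proof (cases "z \<in> \<S>")
        case True
        thus ?thesis using open_strip S.ncont_mono[OF cs, of "cstrip \<inter> \<S>"] by blast
      next
        case False
        have "open {w::complex. Re w \<noteq> \<alpha>}" by (intro open_Collect_neq continuous_intros)
        moreover have "ncont \<Sigma> (cstrip \<inter> {w::complex. Re w \<noteq> \<alpha>}) J" by (rule S.ncont_mono[OF cD]) (auto simp: D_def)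
        ultimately show ?thesis using bd[OF z False] by (intro exI[of _ "{w::complex. Re w \<noteq> \<alpha>}"]) (auto simp: D_def)
      qed
    qed
    show "J z = ?I z" if "z \<in> D" for z by (rule JD[OF that])
    show bound: "nrm \<Sigma> (J z) \<le> pi * (KH * (2 + cmod z) ^ n)" if z: "z \<in> cstrip" for z
    proof (cases "z \<in> \<S>")
      case True
      thus ?thesis using G(3) g(3) Jg by (intro S.nrm_le_dual Jm[OF z]) auto
    next
      case False
      show ?thesis unfolding JD[OF bd[OF z False]]
      proof (rule S.line_int_nrm_le[OF H_rapid[OF bd[OF z False]]])
        fix t show "(1 + t\<^sup>2) * nrm \<Sigma> (H z t) \<le> KH * (2 + cmod z) ^ n"
          using mult_right_mono[OF weight_ge(2)[of t] S.nrm_ge0[OF H_mem[OF z, of t]]] H_le[OF z, of t] by simp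
      qed
    qed
    show "analytic_into \<Sigma> J \<S>" by (rule S.analytic_into_cong[OF open_strip g(1) Jg])
  qed
qed

text \<open>\<open>H\<close> and \<open>P\<close> differ by \<open>k * m * (h - p)\<close>, of order
  \<open>n\<close> at \<open>c\<close> uniformly in \<open>t\<close>; hence the array at
  \<open>c\<close> can be computed from the integral of the polynomials.\<close>

lemma order_at_c:
  assumes z: "z \<in> D"
  shows "nrm \<Sigma> (line_int \<Sigma> (H z) - line_int \<Sigma> (P z)) \<le> pi * (K * K1 * B * cmod (z - of_real c) ^ n)"
proof (rule S.line_int_dist[OF H_rapid[OF z] P_rapid])
  fix t
  note zc = D(1)[OF z]
  note dm = S.scale_mem[OF S.diff_mem[OF h_mem[OF zc] p_mem], of "m t z" t t z]
  have "H z t - P z t = k t *\<^sub>C (m t z *\<^sub>C (h t z - p t z))"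
    unfolding H_def P_def by (simp add: scaleC.scale_right_distrib scaleC.scale_right_diff_distrib)
  hence "nrm \<Sigma> (H z t - P z t) = cmod (k t) * nrm \<Sigma> (m t z *\<^sub>C (h t z - p t z))"
    by (simp only: S.nrm_scale[OF dm])
  also have "\<dots> \<le> cmod (k t) * (K1 * B * cmod (z - of_real c) ^ n)"
    by (intro mult_left_mono md_le zc) auto
  finally have "(1 + t\<^sup>2) * nrm \<Sigma> (H z t - P z t) \<le> ((1 + t\<^sup>2) * cmod (k t)) * (K1 * B * cmod (z - of_real c) ^ n)"
    using mult_left_mono[of _ _ "1 + t\<^sup>2"] by (simp add: mult.assoc)
  also have "(1 + t\<^sup>2) * cmod (k t) \<le> K"
  proof -
    have "(1 + t\<^sup>2) * 1 \<le> weight t * (1 + \<bar>t\<bar>) ^ n" by (intro mult_mono weight_ge) (use weight_ge(4)[of t] in auto)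
    hence "(1 + t\<^sup>2) * cmod (k t) \<le> weight t * (1 + \<bar>t\<bar>) ^ n * cmod (k t)" by (intro mult_right_mono) auto
    thus ?thesis using k_le[of t] by linarith
  qed
  hence "((1 + t\<^sup>2) * cmod (k t)) * (K1 * B * cmod (z - of_real c) ^ n) \<le> K * (K1 * B * cmod (z - of_real c) ^ n)"
    by (rule mult_right_mono) (use K1 B in auto)
  finally show "(1 + t\<^sup>2) * nrm \<Sigma> (H z t - P z t) \<le> K * K1 * B * cmod (z - of_real c) ^ n" by (simp add: mult.assoc)
qed

text \<open>On the boundary of the unit strip \<open>v t\<close> is at distance at least
  \<open>r\<close>, so \<open>m\<close> grows at most like the \<open>n\<close>-th power of
  \<open>1 + |t|\<close>; the assumption \<open>k_le\<close> pays for this growth.\<close>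

lemma m_le:
  assumes "\<bar>Re z - \<alpha>\<bar> \<ge> r"
  shows "cmod (m t z) \<le> (1 + 2 / r) ^ n * (1 + \<bar>t\<bar>) ^ n"
proof -
  have zv: "cmod (z - v t) \<ge> r" using abs_Re_le_cmod[of "z - v t"] assms by (simp add: v_def)
  hence zvp: "cmod (z - v t) > 0" using r(1) by linarith
  hence zv0: "z \<noteq> v t" by auto
  have "cmod (z - of_real c) \<le> cmod (z - v t) + cmod (v t - of_real c)"
    using norm_triangle_ineq[of "z - v t" "v t - of_real c"] by simp
  also have "cmod (v t - of_real c) \<le> 2 * (1 + \<bar>t\<bar>)"
    using cmod_le[of "v t - of_real c"] \<alpha> c by (simp add: v_def)
  finally have "cmod (z - of_real c) / cmod (z - v t) \<le> (cmod (z - v t) + 2 * (1 + \<bar>t\<bar>)) / cmod (z - v t)"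
    by (intro divide_right_mono) auto
  also have "\<dots> = 1 + 2 * (1 + \<bar>t\<bar>) / cmod (z - v t)" using zv0 by (simp add: add_divide_distrib)
  also have "\<dots> \<le> 1 + 2 * (1 + \<bar>t\<bar>) / r" using zv mult_pos_pos[OF zvp r(1)] by (intro add_left_mono divide_left_mono) auto
  also have "\<dots> \<le> (1 + 2 / r) * (1 + \<bar>t\<bar>)" using r(1) by (simp add: field_simps)
  finally show ?thesis
    unfolding m_def norm_power norm_divide power_mult_distrib[symmetric] by (intro power_mono) auto
qed

text \<open>On \<open>Re z = j\<close> the integrand splits as \<open>k m h + k (1 - m) p\<close>.
  The first part takes values in \<open>X\<close> and integrates to \<open>A\<close>; the second
  lies only in \<open>\<Sigma>\<close> and is kept as a scalar integral, to cancel between two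
  lines.\<close>

lemma boundary:
  assumes X: "bsp X" "pts X \<subseteq> pts \<Sigma>" "\<And>x. x \<in> pts X \<Longrightarrow> nrm \<Sigma> x \<le> nrm X x"
    and FX: "\<And>f. f \<in> pts F \<Longrightarrow> ncont X UNIV (\<lambda>t. f (Complex j t))"
      "\<And>f t. f \<in> pts F \<Longrightarrow> nrm X (f (Complex j t)) \<le> nrm F f"
    and j: "j = 0 \<or> j = 1"
  obtains A where "ncont X UNIV A" "\<And>y. nrm X (A y) \<le> pi * (K * (1 + 2 / r) ^ n * B)"
    "\<And>l y. l \<in> \<D> \<Longrightarrow> l (line_int \<Sigma> (H (Complex j y))) =
      l (A y) + cline_int (\<lambda>t. k t * (1 - m t (Complex j y)) * l (p t (Complex j y)))"
proof -
  interpret X: bsp X by fact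
  define E where "E y t = (k t * m t (Complex j y)) *\<^sub>C h t (Complex j y)" for y t
  have jD: "Complex j y \<in> D" for y using j \<alpha> by (auto simp: D_def)
  have jr: "\<bar>Re (Complex j y) - \<alpha>\<bar> \<ge> r" for y using j by (auto simp: r_def)
  have hE: "h t (Complex j y) = \<Phi> t (Complex j (y - t))" for t y
    unfolding h_def by (rule arg_cong[of _ _ "\<Phi> t"]) (simp add: complex_eq_iff)
  have hX: "h t (Complex j y) \<in> pts X" "nrm X (h t (Complex j y)) \<le> B" for t y
    unfolding hE using FX(1)[OF \<Phi>_mem] order_trans[OF FX(2)[OF \<Phi>_mem] \<Phi>_le] by (auto simp: ncont_def)
  have km: "weight t * (cmod (k t) * cmod (m t (Complex j y))) \<le> K * (1 + 2 / r) ^ n" for t y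
  proof -
    have "weight t * (cmod (k t) * cmod (m t (Complex j y))) \<le> weight t * (cmod (k t) * ((1 + 2 / r) ^ n * (1 + \<bar>t\<bar>) ^ n))"
      using m_le[OF jr] weight_ge(4)[of t] by (intro mult_left_mono) auto
    also have "\<dots> = weight t * (1 + \<bar>t\<bar>) ^ n * cmod (k t) * (1 + 2 / r) ^ n" by (simp add: mult_ac)
    also have "\<dots> \<le> K * (1 + 2 / r) ^ n" using r(1) by (intro mult_right_mono k_le) auto
    finally show ?thesis .
  qed
  have E_le: "weight t * nrm X (E y t) \<le> K * (1 + 2 / r) ^ n * B" for y t
  proof -
    have "weight t * nrm X (E y t) = weight t * (cmod (k t) * cmod (m t (Complex j y))) * nrm X (h t (Complex j y))"
      unfolding E_def X.nrm_scale[OF hX(1)] by (simp add: norm_mult mult.assoc)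
    also have "\<dots> \<le> K * (1 + 2 / r) ^ n * B"
      by (rule mult_mono[OF km hX(2) _ X.nrm_ge0[OF hX(1)]]) (use K r(1) in simp)
    finally show ?thesis .
  qed
  have Ec: "ncont X (UNIV \<times> UNIV) (\<lambda>x. E (fst x) (snd x))"
  proof -
    have "ncont X (UNIV \<times> UNIV) (\<lambda>x. \<Phi> (snd x) (Complex j (fst x - snd x)))"
    proof (rule ncont_eval[OF X.nsp_axioms, where E = UNIV and j = "Complex j"])
      show "ncont F ((UNIV :: real set) \<times> UNIV) (\<lambda>x. \<Phi> (snd x))" by (rule \<Phi>_cont2)
      show "continuous_on (UNIV \<times> UNIV) (\<lambda>x. fst x - snd x :: real)" by (intro continuous_intros)
    qed (use FX in auto)
    hence "ncont X (UNIV \<times> UNIV) (\<lambda>x. h (snd x) (Complex j (fst x)))" unfolding hE .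
    moreover have "continuous_on (UNIV \<times> UNIV) (\<lambda>x. m (snd x) (Complex j (fst x)))"
    proof -
      have "continuous_on (UNIV \<times> UNIV) (\<lambda>x. m (snd (Complex j (fst x), snd x)) (fst (Complex j (fst x), snd x)))"
        by (rule continuous_on_compose2[OF m_cont[OF order_refl]])
          (use jD in \<open>auto simp: image_subset_iff intro!: continuous_intros simp: Complex_eq\<close>)
      thus ?thesis by simp
    qed
    ultimately show ?thesis unfolding E_def by (intro X.ncont_scale continuous_on_mult k_cont2)
  qed
  have Er: "rapid X (K * (1 + 2 / r) ^ n * B) (E y)" for y
    using X.ncont_line_int(2)[OF Ec, of "K * (1 + 2 / r) ^ n * B"] E_le by blast
  have E\<Sigma>: "rapid \<Sigma> (K * (1 + 2 / r) ^ n * B) (E y)" "line_int \<Sigma> (E y) = line_int X (E y)" for y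
    using rapid_mono[OF X.nsp_axioms S.nsp_axioms X(2,3) Er] line_int_mono[OF X(1) S.bsp_axioms X(2,3) Er] by auto
  show ?thesis
  proof (rule that[of "\<lambda>y. line_int X (E y)"])
    show "ncont X UNIV (\<lambda>y. line_int X (E y))"
      using X.ncont_line_int(1)[OF Ec, of "K * (1 + 2 / r) ^ n * B"] E_le by blast
    show "nrm X (line_int X (E y)) \<le> pi * (K * (1 + 2 / r) ^ n * B)" for y
    proof (rule X.line_int_nrm_le[OF Er])
      fix t
      have "E y t \<in> pts X" unfolding E_def by (rule X.scale_mem[OF hX(1)])
      thus "(1 + t\<^sup>2) * nrm X (E y t) \<le> K * (1 + 2 / r) ^ n * B"
        using mult_right_mono[OF weight_ge(2)[of t] X.nrm_ge0] E_le[of t y] by force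
    qed
    fix l y assume l: "l \<in> \<D>"
    let ?z = "Complex j y"
    note zc = D(1)[OF jD[of y]]
    have s: "l (H ?z t) - l (E y t) = k t * (1 - m t ?z) * l (p t ?z)" for t
    proof -
      have "l (H ?z t) = k t * (l (p t ?z) + m t ?z * (l (h t ?z) - l (p t ?z)))"
        unfolding H_def
        by (simp only: S.dual_scale[OF l] S.dual_add[OF l] S.dual_diff[OF l] S.add_mem S.scale_mem S.diff_mem h_mem[OF zc] p_mem)
      moreover have "l (E y t) = k t * m t ?z * l (h t ?z)" unfolding E_def by (rule S.dual_scale[OF l h_mem[OF zc]])
      ultimately show ?thesis by (simp add: algebra_simps)
    qed
    have "cline_int (\<lambda>t. k t * (1 - m t ?z) * l (p t ?z)) = l (line_int \<Sigma> (H ?z)) - l (line_int \<Sigma> (E y))"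
      unfolding s[symmetric] S.dual_line_int[OF l H_rapid[OF jD]] S.dual_line_int[OF l E\<Sigma>(1)]
      by (rule cline_int_diff[OF S.crapid_dual[OF l H_rapid[OF jD]] S.crapid_dual[OF l E\<Sigma>(1)]])
    thus "l (line_int \<Sigma> (H ?z)) = l (line_int X (E y)) + cline_int (\<lambda>t. k t * (1 - m t ?z) * l (p t ?z))"
      by (simp add: E\<Sigma>(2))
  qed
qed

end

section \<open>Damped Cauchy kernels\<close>

text \<open>A damping factor of order \<open>j\<close> with value 1 at \<open>c\<close> and no pole
  in the closed right half-plane; unlike a Gaussian it serves the half-plane argument as
  well.\<close>

definition kap :: "real \<Rightarrow> nat \<Rightarrow> complex \<Rightarrow> complex"
  where "kap c j w = ((1 + of_real c) / (1 + w)) ^ j"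

text \<open>The Cauchy kernel at \<open>c\<close> on the line \<open>Re = \<alpha>\<close>. The
  exponent provides 3 powers for \<open>weight\<close>, \<open>n\<close> for the Taylor polynomial
  and \<open>n\<close> for the multiplier; the liftings carry a further factor of order 3.\<close>

definition kline :: "nat \<Rightarrow> real \<Rightarrow> real \<Rightarrow> real \<Rightarrow> complex"
  where "kline n c \<alpha> t = kap c (2 * n + 3) (Complex \<alpha> t) / (Complex \<alpha> t - of_real c) / (2 * pi)"

lemma kap_nonzero: "0 \<le> Re w \<Longrightarrow> 1 + w \<noteq> 0"
  by (metis add_eq_0_iff complex_Re_le_cmod minus_complex.sel(1) not_one_le_zero one_complex.sel(1) order_trans
      uminus_complex.sel(1) zero_le_one le_minus_one_simps(3) neg_0_le_iff_le)

text \<open>In the right half-plane \<open>|1 + w|\<close> dominates both 1 and \<open>|w|\<close>,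
  so \<open>1 + |w| \<le> 2 |1 + w|\<close>; the numerator contributes another 2.\<close>

lemma kap_le:
  assumes w: "0 \<le> Re w" and c: "0 \<le> c" "c \<le> 1"
  shows "cmod (kap c j w) * (1 + cmod w) ^ j \<le> 4 ^ j"
proof -
  have 1: "1 \<le> cmod (1 + w)" using complex_Re_le_cmod[of "1 + w"] w by simp
  have "(cmod w)\<^sup>2 \<le> (cmod (1 + w))\<^sup>2" using w unfolding cmod_power2 by (simp add: power2_eq_square algebra_simps)
  hence "cmod w \<le> cmod (1 + w)" by (rule power2_le_imp_le) simp
  hence 2: "1 + cmod w \<le> 2 * cmod (1 + w)" using 1 by simp
  have "cmod (1 + of_real c) \<le> 2" using c norm_triangle_ineq[of 1 "complex_of_real c"] by simp
  hence "cmod (1 + of_real c) * (1 + cmod w) \<le> 2 * (2 * cmod (1 + w))" using 2 by (intro mult_mono) auto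
  hence "cmod (1 + of_real c) * (1 + cmod w) / cmod (1 + w) \<le> 4"
    using 1 by (subst pos_divide_le_eq) auto
  hence "cmod ((1 + of_real c) / (1 + w)) * (1 + cmod w) \<le> 4"
    by (simp only: norm_divide times_divide_eq_left)
  hence "(cmod ((1 + of_real c) / (1 + w)) * (1 + cmod w)) ^ j \<le> 4 ^ j" by (intro power_mono) auto
  thus ?thesis by (simp add: kap_def norm_power power_mult_distrib)
qed

lemma kap_c: "0 \<le> c \<Longrightarrow> kap c j (of_real c) = 1"
  using kap_nonzero[of "of_real c"] by (simp add: kap_def)

lemma kap_add: "kap c i w * kap c j w = kap c (i + j) w"
  by (simp add: kap_def power_add)

lemma kap_holomorphic: "(\<And>w. w \<in> A \<Longrightarrow> 0 \<le> Re w) \<Longrightarrow> kap c j holomorphic_on A"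
  unfolding kap_def using kap_nonzero by (intro holomorphic_intros) auto

lemma kap_continuous: "(\<And>w. w \<in> A \<Longrightarrow> 0 \<le> Re w) \<Longrightarrow> continuous_on A (kap c j)"
  by (rule holomorphic_on_imp_continuous_on[OF kap_holomorphic])

lemma kap_line_continuous: "0 \<le> \<alpha> \<Longrightarrow> continuous_on A (\<lambda>t. kap c j (Complex \<alpha> t))"
  by (rule continuous_on_compose2[OF kap_continuous[of "{w. 0 \<le> Re w}"]])
    (auto simp: Complex_eq intro!: continuous_intros)

lemma kap_line_le:
  assumes "0 \<le> \<alpha>" "0 \<le> c" "c \<le> 1"
  shows "cmod (kap c j (Complex \<alpha> t)) * (1 + \<bar>t\<bar>) ^ j \<le> 4 ^ j"
proof -
  have "(1 + \<bar>t\<bar>) ^ j \<le> (1 + cmod (Complex \<alpha> t)) ^ j"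
    using abs_Im_le_cmod[of "Complex \<alpha> t"] by (intro power_mono) auto
  hence "cmod (kap c j (Complex \<alpha> t)) * (1 + \<bar>t\<bar>) ^ j \<le> cmod (kap c j (Complex \<alpha> t)) * (1 + cmod (Complex \<alpha> t)) ^ j"
    by (intro mult_left_mono) auto
  also have "\<dots> \<le> 4 ^ j" by (rule kap_le) (use assms in auto)
  finally show ?thesis .
qed

lemma kline_continuous: "0 \<le> \<alpha> \<Longrightarrow> \<alpha> \<noteq> c \<Longrightarrow> continuous_on A (kline n c \<alpha>)"
  unfolding kline_def
  by (intro continuous_intros kap_line_continuous) (auto simp: Complex_eq complex_eq_iff intro!: continuous_intros)

lemma kline_le:
  assumes a: "0 \<le> \<alpha>" "\<alpha> \<noteq> c" and c: "0 \<le> c" "c \<le> 1"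
  shows "weight t * (1 + \<bar>t\<bar>) ^ n * cmod (kline n c \<alpha> t) \<le> 4 ^ (2 * n + 3) / \<bar>\<alpha> - c\<bar>"
proof -
  have "weight t * (1 + \<bar>t\<bar>) ^ n \<le> (1 + \<bar>t\<bar>) ^ 3 * (1 + \<bar>t\<bar>) ^ n" by (intro mult_right_mono weight_le) auto
  also have "\<dots> \<le> (1 + \<bar>t\<bar>) ^ (2 * n + 3)" unfolding power_add[symmetric] by (intro power_increasing) auto
  finally have "weight t * (1 + \<bar>t\<bar>) ^ n * cmod (kap c (2 * n + 3) (Complex \<alpha> t)) \<le> (1 + \<bar>t\<bar>) ^ (2 * n + 3) * cmod (kap c (2 * n + 3) (Complex \<alpha> t))"
    by (intro mult_right_mono) auto
  also have "\<dots> \<le> 4 ^ (2 * n + 3)" using kap_line_le[OF a(1) c, of "2 * n + 3" t] by (simp add: mult.commute)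
  finally have 1: "weight t * (1 + \<bar>t\<bar>) ^ n * cmod (kap c (2 * n + 3) (Complex \<alpha> t)) \<le> 4 ^ (2 * n + 3)" .
  have d: "\<bar>\<alpha> - c\<bar> \<le> cmod (Complex \<alpha> t - of_real c)" using abs_Re_le_cmod[of "Complex \<alpha> t - of_real c"] by simp
  have "\<bar>\<alpha> - c\<bar> * 1 \<le> cmod (Complex \<alpha> t - of_real c) * (2 * pi)"
    using d pi_gt3 by (intro mult_mono) auto
  hence 2: "\<bar>\<alpha> - c\<bar> \<le> cmod (Complex \<alpha> t - of_real c) * (2 * pi)" by simp
  have "weight t * (1 + \<bar>t\<bar>) ^ n * cmod (kline n c \<alpha> t) =
      weight t * (1 + \<bar>t\<bar>) ^ n * cmod (kap c (2 * n + 3) (Complex \<alpha> t)) / (cmod (Complex \<alpha> t - of_real c) * (2 * pi))"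
    by (simp add: kline_def norm_divide norm_mult)
  also have "\<dots> \<le> 4 ^ (2 * n + 3) / \<bar>\<alpha> - c\<bar>"
    by (rule frac_le[OF _ 1 _ 2]) (use a in auto)
  finally show ?thesis .
qed

text \<open>The decay required by \<open>Cauchy_strip\<close> and \<open>Cauchy_half_plane\<close>, for a Taylor polynomial times a factor \<open>e\<close>.\<close>

lemma jet_decay:
  assumes w: "0 \<le> Re w" and c: "0 \<le> c" "c \<le> 1" and y: "\<And>i. i < n \<Longrightarrow> cmod (y i) \<le> Y" "Y \<ge> 0"
    and e: "cmod e \<le> E * (1 + cmod w) ^ n" and E: "E \<ge> 0"
  shows "weight (Im w) * cmod (kap c (2 * n + 6) w * (\<Sum>i<n. y i * (z - w) ^ (n - 1 - i)) * e)
    \<le> 4 ^ (2 * n + 6) * (real n * Y * (2 + cmod z) ^ n * E)"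
proof -
  let ?W = "1 + cmod w"
  have W: "?W \<ge> 1" by simp
  have "weight (Im w) \<le> (1 + \<bar>Im w\<bar>) ^ 3" by (rule weight_le)
  also have "\<dots> \<le> ?W ^ 3" using abs_Im_le_cmod by (intro power_mono) auto
  finally have 1: "weight (Im w) \<le> ?W ^ 3" .
  have "cmod (\<Sum>i<n. y i * (z - w) ^ (n - 1 - i)) \<le> (\<Sum>i<n. Y * ((2 + cmod z) * ?W) ^ n)"
  proof (rule sum_norm_le)
    fix i assume i: "i \<in> {..<n}"
    have "0 \<le> cmod z * cmod w" by simp
    hence "cmod (z - w) \<le> (2 + cmod z) * ?W"
      unfolding distrib_left distrib_right using norm_triangle_ineq4[of z w] norm_ge_zero[of w] by linarith
    hence "cmod (z - w) ^ (n - 1 - i) \<le> ((2 + cmod z) * ?W) ^ (n - 1 - i)" by (intro power_mono) auto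
    also have "\<dots> \<le> ((2 + cmod z) * ?W) ^ n"
      using mult_mono[of 1 "2 + cmod z" 1 ?W] by (intro power_increasing) auto
    finally show "cmod (y i * (z - w) ^ (n - 1 - i)) \<le> Y * ((2 + cmod z) * ?W) ^ n"
      unfolding norm_mult norm_power using y i by (intro mult_mono) auto
  qed
  hence 2: "cmod (\<Sum>i<n. y i * (z - w) ^ (n - 1 - i)) \<le> real n * Y * (2 + cmod z) ^ n * ?W ^ n"
    by (simp add: power_mult_distrib mult_ac)
  have "weight (Im w) * (cmod (\<Sum>i<n. y i * (z - w) ^ (n - 1 - i)) * cmod e) \<le>
      ?W ^ 3 * ((real n * Y * (2 + cmod z) ^ n * ?W ^ n) * (E * ?W ^ n))"
    using 1 2 e y(2) E weight_ge(4)[of "Im w"] by (intro mult_mono) auto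
  also have "\<dots> = (real n * Y * (2 + cmod z) ^ n * E) * ?W ^ (2 * n + 3)"
    unfolding mult_2 power_add by (simp only: mult_ac)
  also have "\<dots> \<le> (real n * Y * (2 + cmod z) ^ n * E) * ?W ^ (2 * n + 6)"
    using y(2) E by (intro mult_left_mono power_increasing) auto
  finally have "cmod (kap c (2 * n + 6) w) * (weight (Im w) * (cmod (\<Sum>i<n. y i * (z - w) ^ (n - 1 - i)) * cmod e)) \<le>
      cmod (kap c (2 * n + 6) w) * ((real n * Y * (2 + cmod z) ^ n * E) * ?W ^ (2 * n + 6))"
    by (intro mult_left_mono) auto
  also have "\<dots> = (cmod (kap c (2 * n + 6) w) * ?W ^ (2 * n + 6)) * (real n * Y * (2 + cmod z) ^ n * E)" by (simp add: mult_ac)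
  also have "\<dots> \<le> 4 ^ (2 * n + 6) * (real n * Y * (2 + cmod z) ^ n * E)"
    by (intro mult_right_mono kap_le w c) (use y(2) E in auto)
  finally show ?thesis by (simp add: norm_mult mult_ac)
qed

lemma multiplier_growth:
  assumes d: "d > 0" "d \<le> cmod (z - w)" and c: "0 \<le> c" "c \<le> 1"
  shows "cmod (1 - ((z - of_real c) / (z - w)) ^ n) \<le> (1 + (1 + 1 / d) ^ n) * (1 + cmod w) ^ n"
proof -
  have zw: "cmod (z - w) > 0" using d by linarith
  have "cmod (z - of_real c) \<le> cmod (z - w) + cmod (w - of_real c)"
    using norm_triangle_ineq[of "z - w" "w - of_real c"] by simp
  also have "cmod (w - of_real c) \<le> 1 + cmod w" using norm_triangle_ineq4[of w "of_real c"] c by simp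
  finally have "cmod (z - of_real c) / cmod (z - w) \<le> (cmod (z - w) + (1 + cmod w)) / cmod (z - w)"
    by (intro divide_right_mono) auto
  also have "\<dots> = 1 + (1 + cmod w) / cmod (z - w)" using d by (subst add_divide_distrib) auto
  also have "\<dots> \<le> 1 + (1 + cmod w) / d" using d mult_pos_pos[OF zw d(1)] by (intro add_left_mono divide_left_mono) auto
  also have "\<dots> \<le> (1 + 1 / d) * (1 + cmod w)" using d by (simp add: field_simps)
  finally have "(cmod (z - of_real c) / cmod (z - w)) ^ n \<le> ((1 + 1 / d) * (1 + cmod w)) ^ n" by (intro power_mono) auto
  hence "cmod (((z - of_real c) / (z - w)) ^ n) \<le> (1 + 1 / d) ^ n * (1 + cmod w) ^ n"
    by (simp add: norm_power norm_divide power_mult_distrib)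
  moreover have "1 \<le> (1 + cmod w) ^ n" by (rule one_le_power) simp
  ultimately show ?thesis
    using norm_triangle_ineq4[of 1 "((z - of_real c) / (z - w)) ^ n"] unfolding distrib_right norm_one mult_1 by linarith
qed

text \<open>Bound \<open>3 + |y|\<close> by \<open>exp (2 + |y|)\<close> and complete the square in
  the exponent.\<close>

lemma polynomial_gaussian_bounded: "(3 + \<bar>y\<bar>) ^ n * exp (- y\<^sup>2) \<le> exp (2 * real n + (real n)\<^sup>2)"
proof -
  have "3 + \<bar>y\<bar> \<le> exp (2 + \<bar>y\<bar>)" using exp_ge_add_one_self[of "2 + \<bar>y\<bar>"] by simp
  hence "(3 + \<bar>y\<bar>) ^ n \<le> exp (2 + \<bar>y\<bar>) ^ n" by (intro power_mono) auto
  also have "\<dots> = exp (real n * (2 + \<bar>y\<bar>))" by (simp add: exp_of_nat_mult)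
  finally have "(3 + \<bar>y\<bar>) ^ n * exp (- y\<^sup>2) \<le> exp (real n * (2 + \<bar>y\<bar>)) * exp (- y\<^sup>2)" by (intro mult_right_mono) auto
  also have "\<dots> = exp (2 * real n + (real n * \<bar>y\<bar> - y\<^sup>2))" by (simp add: algebra_simps flip: exp_add)
  also have "\<dots> \<le> exp (2 * real n + (real n)\<^sup>2)"
  proof -
    have "0 \<le> (\<bar>y\<bar> - real n)\<^sup>2 + real n * \<bar>y\<bar>" by (intro add_nonneg_nonneg mult_nonneg_nonneg) auto
    hence "real n * \<bar>y\<bar> - y\<^sup>2 \<le> (real n)\<^sup>2" by (simp add: power2_diff mult.commute)
    thus ?thesis by simp
  qed
  finally show ?thesis .
qed

section \<open>From two line integrals to an element of the Calderon space\<close>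

context couple
begin

text \<open>What is known of \<open>J\<close> before damping: polynomial growth in place of
  boundedness, the expansion at \<open>c\<close> with constants uniform over the dual ball, and no
  information yet about \<open>X0\<close> and \<open>X1\<close>.\<close>

definition jet_function :: "nat \<Rightarrow> real \<Rightarrow> (complex \<Rightarrow> 'v) \<Rightarrow> (nat \<Rightarrow> 'v) \<Rightarrow> bool"
  where "jet_function n c J x \<longleftrightarrow> analytic_into \<Sigma> J \<S> \<and> ncont \<Sigma> cstrip J \<and>
    (\<exists>C. \<forall>z\<in>cstrip. nrm \<Sigma> (J z) \<le> C * (2 + cmod z) ^ n) \<and> x \<in> pts (\<P> n) \<and>
    (\<exists>R. \<exists>\<rho>>0. \<forall>l\<in>\<D>. \<forall>w\<in>ball (of_real c) \<rho>.
      cmod (l (J w) - (\<Sum>i<n. l (x i) * (w - of_real c) ^ (n - 1 - i))) \<le> R * cmod (w - of_real c) ^ n)"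

text \<open>Damping turns a function of polynomial growth with the right Taylor expansion into an element of \<^term>\<open>F\<close>.\<close>

lemma glue:
  assumes n: "n \<ge> 1" and c: "0 < c" "c < 1"
  obtains Kc where "Kc > 0"
    "\<And>J x N. \<lbrakk>jet_function n c J x;
      ncont X0 UNIV (\<lambda>y. J (Complex 0 y)); \<And>y. nrm X0 (J (Complex 0 y)) \<le> N * (3 + \<bar>y\<bar>) ^ n;
      ncont X1 UNIV (\<lambda>y. J (Complex 1 y)); \<And>y. nrm X1 (J (Complex 1 y)) \<le> N * (3 + \<bar>y\<bar>) ^ n\<rbrakk>
      \<Longrightarrow> \<exists>f\<in>pts F. \<T> n (of_real c) f = x \<and> nrm F f \<le> Kc * N"
proof -
  obtain K where K: "K > 0" "\<And>z. 0 \<le> Re z \<Longrightarrow> Re z \<le> 1 \<Longrightarrow> cmod (cutoff n c z) \<le> K * exp (- (Im z)\<^sup>2)"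
    using cutoff_bound[of c n] c by auto
  define M where "M = exp (2 * real n + (real n)\<^sup>2)"
  have cs: "complex_of_real c \<in> \<S>" using c by (simp add: strip_def)
  have cut: "cmod (cutoff n c z) * y \<le> K * M * N" if z: "0 \<le> Re z" "Re z \<le> 1" and y: "0 \<le> y" "y \<le> N * (3 + \<bar>Im z\<bar>) ^ n" for z y N
  proof -
    have N: "N \<ge> 0"
    proof (rule ccontr)
      assume "\<not> N \<ge> 0"
      hence "N * (3 + \<bar>Im z\<bar>) ^ n < 0" by (intro mult_neg_pos) auto
      thus False using y by linarith
    qed
    have "cmod (cutoff n c z) * y \<le> (K * exp (- (Im z)\<^sup>2)) * (N * (3 + \<bar>Im z\<bar>) ^ n)"
      using K(2)[OF z] y by (intro mult_mono) (use K(1) in auto)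
    also have "\<dots> = K * N * ((3 + \<bar>Im z\<bar>) ^ n * exp (- (Im z)\<^sup>2))" by (simp add: mult_ac)
    also have "\<dots> \<le> K * N * M" unfolding M_def
      by (intro mult_left_mono polynomial_gaussian_bounded) (use K(1) N in auto)
    finally show ?thesis by (simp add: mult_ac)
  qed
  show ?thesis
  proof (rule that[of "K * M"])
    show "0 < K * M" using K(1) by (simp add: M_def)
    fix J x N
    assume J: "jet_function n c J x"
      and c0: "ncont X0 UNIV (\<lambda>y. J (Complex 0 y))" and N0: "\<And>y. nrm X0 (J (Complex 0 y)) \<le> N * (3 + \<bar>y\<bar>) ^ n"
      and c1: "ncont X1 UNIV (\<lambda>y. J (Complex 1 y))" and N1: "\<And>y. nrm X1 (J (Complex 1 y)) \<le> N * (3 + \<bar>y\<bar>) ^ n"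
    have an: "analytic_into \<Sigma> J \<S>" and co: "ncont \<Sigma> cstrip J" and x: "x \<in> pts (\<P> n)"
      using J by (auto simp: jet_function_def)
    obtain C where CJ: "\<And>z. z \<in> cstrip \<Longrightarrow> nrm \<Sigma> (J z) \<le> C * (2 + cmod z) ^ n"
      using J unfolding jet_function_def by blast
    obtain R \<rho> where \<rho>: "\<rho> > 0" and jet: "\<And>l w. l \<in> \<D> \<Longrightarrow> w \<in> ball (of_real c) \<rho> \<Longrightarrow>
        cmod (l (J w) - (\<Sum>i<n. l (x i) * (w - of_real c) ^ (n - 1 - i))) \<le> R * cmod (w - of_real c) ^ n"
      using J unfolding jet_function_def by blast
    have Jm: "J z \<in> pts \<Sigma>" if "z \<in> cstrip" for z using co that by (simp add: ncont_def)
    have m0: "J (Complex 0 y) \<in> pts X0" "J (Complex 1 y) \<in> pts X1" for y using c0 c1 by (auto simp: ncont_def)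
    define f where "f z = (if z \<in> cstrip then cutoff n c z *\<^sub>C J z else 0)" for z
    have fJ: "f z = cutoff n c z *\<^sub>C J z" if "z \<in> cstrip" for z unfolding f_def using that by (rule if_P)
    have cutc: "continuous_on UNIV (\<lambda>y. cutoff n c (Complex j y))" for j
      by (rule continuous_on_compose2[OF cutoff_continuous[of UNIV]]) (auto simp: Complex_eq intro!: continuous_intros)
    have sub: "z \<in> cstrip" if "z \<in> \<S>" for z using that by (simp add: strip_def)
    have f: "f \<in> pts F \<and> nrm F f \<le> K * M * N"
    proof (rule F_I[where K = "K * M * C"])
      fix l assume l: "l \<in> \<D>"
      have "(\<lambda>z. cutoff n c z * l (J z)) holomorphic_on \<S>"
        by (intro holomorphic_on_mult cutoff_holomorphic S.analytic_dual(1)[OF open_strip an l])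
      thus "(\<lambda>z. l (f z)) holomorphic_on \<S>"
        by (rule holomorphic_transform) (simp only: fJ sub S.dual_scale[OF l] Jm)
    next
      fix z assume z: "z \<in> cstrip"
      have "cmod z \<le> 1 + \<bar>Im z\<bar>" using cmod_le[of z] z by simp
      hence "(2 + cmod z) ^ n \<le> (3 + \<bar>Im z\<bar>) ^ n" by (intro power_mono) auto
      moreover have "C \<ge> 0"
      proof (rule ccontr)
        assume "\<not> C \<ge> 0"
        hence "C * (2 + cmod z) ^ n < 0" by (intro mult_neg_pos) (auto intro!: zero_less_power add_pos_nonneg)
        thus False using CJ[OF z] S.nrm_ge0[OF Jm[OF z]] by linarith
      qed
      ultimately have "nrm \<Sigma> (J z) \<le> C * (3 + \<bar>Im z\<bar>) ^ n" using CJ[OF z] by (meson mult_left_mono order_trans)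
      thus "nrm \<Sigma> (f z) \<le> K * M * C"
        unfolding fJ[OF z] S.nrm_scale[OF Jm[OF z]] using z S.nrm_ge0[OF Jm[OF z]] by (intro cut) auto
    next
      show "ncont \<Sigma> cstrip f"
        by (rule ncont_cong[OF _ S.ncont_scale[OF cutoff_continuous co]]) (simp only: fJ)
      show "ncont X0 UNIV (\<lambda>y. f (Complex 0 y))"
        by (rule ncont_cong[OF _ X0.ncont_scale[OF cutc[of 0] c0]]) (simp add: f_def)
      show "ncont X1 UNIV (\<lambda>y. f (Complex 1 y))"
        by (rule ncont_cong[OF _ X1.ncont_scale[OF cutc[of 1] c1]]) (simp add: f_def)
      show "nrm X0 (f (Complex 0 y)) \<le> K * M * N" for y
        using cut[of "Complex 0 y" "nrm X0 (J (Complex 0 y))" N] N0[of y] X0.nrm_ge0[OF m0(1)]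
        by (simp add: f_def X0.nrm_scale[OF m0(1)])
      show "nrm X1 (f (Complex 1 y)) \<le> K * M * N" for y
        using cut[of "Complex 1 y" "nrm X1 (J (Complex 1 y))" N] N1[of y] X1.nrm_ge0[OF m0(2)]
        by (simp add: f_def X1.nrm_scale[OF m0(2)])
      show "f z = 0" if "z \<notin> cstrip" for z unfolding f_def using that by (rule if_not_P)
    qed
    have fa: "analytic_into \<Sigma> f \<S>" using F_D(1) f by blast
    have "\<T> n (of_real c) f = x"
    proof (rule S.taylor_array_eqI[OF open_strip fa cs])
      show "x i \<in> pts \<Sigma>" if "i < n" for i using x that by (simp add: power_space_pts)
      show "x i = 0" if "i \<ge> n" for i using x that by (simp add: power_space_pts)
      obtain r B where r: "r > 0" "ball (of_real c) r \<subseteq> \<S>" "\<And>w. w \<in> ball (of_real c) r \<Longrightarrow> nrm \<Sigma> (J w) \<le> B"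
        using S.analytic_locally_bounded[OF open_strip an cs] by blast
      obtain s where s: "s > 0" "\<And>z. z \<in> ball (complex_of_real c) s \<Longrightarrow> cmod (cutoff n c z - 1) \<le> cmod (z - of_real c) ^ n"
        by (rule cutoff_order[of c n]) (rule that)
      show "S.jet n (of_real c) f x"
        unfolding S.jet_def
      proof
        fix l assume l: "l \<in> \<D>"
        let ?p = "\<lambda>w. \<Sum>i<n. l (x i) * (w - of_real c) ^ (n - 1 - i)"
        have "cmod (l (f w) - ?p w) \<le> (B + R) * cmod (w - of_real c) ^ n" if w: "w \<in> ball (of_real c) (min \<rho> (min r s))" for w
        proof -
          have ws: "w \<in> cstrip" using sub r(2) w by (simp add: subset_iff)
          have "l (f w) - ?p w = (cutoff n c w - 1) * l (J w) + (l (J w) - ?p w)"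
            unfolding fJ[OF ws] S.dual_scale[OF l Jm[OF ws]] by (simp add: algebra_simps)
          moreover have "cmod ((cutoff n c w - 1) * l (J w)) \<le> cmod (w - of_real c) ^ n * B"
            unfolding norm_mult using s(2)[of w] r(3)[of w] w S.dual_le[OF l Jm[OF ws]] by (intro mult_mono) auto
          moreover have "cmod (l (J w) - ?p w) \<le> R * cmod (w - of_real c) ^ n" using jet[OF l, of w] w by simp
          ultimately have "cmod (l (f w) - ?p w) \<le> cmod (w - of_real c) ^ n * B + R * cmod (w - of_real c) ^ n"
            by (simp only: norm_triangle_mono)
          thus ?thesis by (simp add: distrib_right mult.commute)
        qed
        thus "\<exists>C. \<exists>r>0. \<forall>w\<in>ball (of_real c) r. cmod (l (f w) - ?p w) \<le> C * cmod (w - of_real c) ^ n"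
          using \<rho> r(1) s(1) by (intro exI[of _ "B + R"] exI[of _ "min \<rho> (min r s)"]) auto
      qed
    qed
    thus "\<exists>f\<in>pts F. \<T> n (of_real c) f = x \<and> nrm F f \<le> K * M * N" using f by blast
  qed
qed

text \<open>Factor \<open>kap c 3\<close> gives the decay for which the compactified boundary
  function is continuous on the closed interval; it is lifted there and carried back to the line
  with the Jacobian divided out. The constant is \<open>256 = 4 * 4^3\<close>: lifting costs 4 and
  the damping \<open>4^3\<close>.\<close>

lemma lift_line:
  assumes Q: "quotient_map F Y T C" and c: "0 \<le> c" "c \<le> 1" and \<alpha>: "0 \<le> \<alpha>"
    and G: "ncont (quotient_space T F) UNIV G" "\<And>t. nrm (quotient_space T F) (G t) \<le> N" and N: "N > 0"
  obtains \<Phi> where "ncont F UNIV \<Phi>" "\<And>t. nrm F (\<Phi> t) \<le> 256 * N" "\<And>t. T (\<Phi> t) = kap c 3 (Complex \<alpha> t) *\<^sub>C G t"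
proof -
  interpret Q: quotient_map F Y T C by fact
  interpret QQ: nsp Q.Q by (rule Q.nsp_Q)
  have Gm: "G t \<in> pts Q.Q" for t using G(1) by (simp add: ncont_def)
  define \<phi> where "\<phi> t = kap c 3 (Complex \<alpha> t) *\<^sub>C G t" for t
  have w: "weight t * nrm Q.Q (\<phi> t) \<le> 64 * N" for t
  proof -
    have "weight t * nrm Q.Q (\<phi> t) \<le> (1 + \<bar>t\<bar>) ^ 3 * (cmod (kap c 3 (Complex \<alpha> t)) * nrm Q.Q (G t))"
      unfolding \<phi>_def QQ.nrm_scale[OF Gm] using QQ.nrm_ge0[OF Gm] by (intro mult_right_mono weight_le) auto
    also have "\<dots> = (cmod (kap c 3 (Complex \<alpha> t)) * (1 + \<bar>t\<bar>) ^ 3) * nrm Q.Q (G t)" by (simp add: mult_ac)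
    also have "\<dots> \<le> 4 ^ 3 * N" by (intro mult_mono kap_line_le G(2) \<alpha> c QQ.nrm_ge0 Gm) auto
    finally show ?thesis by simp
  qed
  have r: "rapid Q.Q (64 * N) \<phi>"
    unfolding rapid_def
  proof (intro conjI allI w)
    show "ncont Q.Q UNIV \<phi>"
      by (rule ncont_cong[OF _ QQ.ncont_scale[OF kap_line_continuous[OF \<alpha>, of UNIV c 3] G(1)]]) (simp add: \<phi>_def)
  qed
  have \<phi>m: "\<phi> t \<in> pts Q.Q" for t unfolding \<phi>_def by (rule QQ.scale_mem[OF Gm])
  have "nrm Q.Q (compactify \<phi> s) \<le> 64 * pi * N" for s
  proof (cases "0 < s \<and> s < 1")
    case True
    have "nrm Q.Q (compactify \<phi> s) = pi * ((1 + (line_param s)\<^sup>2) * nrm Q.Q (\<phi> (line_param s)))"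
      using True by (simp add: compactify_def QQ.nrm_scale[OF \<phi>m] norm_mult abs_mult del: of_real_mult of_real_add)
    also have "\<dots> \<le> pi * (64 * N)"
      using w[of "line_param s"] mult_right_mono[OF weight_ge(2)[of "line_param s"] QQ.nrm_ge0[OF \<phi>m[of "line_param s"]]]
      by (intro mult_left_mono) (linarith, simp)
    finally show ?thesis by simp
  qed (use N in \<open>auto simp: compactify_def\<close>)
  then obtain \<Psi> where \<Psi>: "ncont F {0..1} \<Psi>" "\<And>s. s \<in> {0..1} \<Longrightarrow> T (\<Psi> s) = compactify \<phi> s"
    "\<And>s. s \<in> {0..1} \<Longrightarrow> nrm F (\<Psi> s) \<le> 4 * (64 * pi * N)"
    using Q.continuous_lift[OF QQ.ncont_compactify[OF r], of "64 * pi * N"] N by auto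
  \<comment> \<open>The inverse of \<open>line_param\<close>.\<close>
  define \<sigma> where "\<sigma> t = 1/2 + arctan t / pi" for t
  have \<sigma>: "0 < \<sigma> t" "\<sigma> t < 1" for t
  proof -
    have "- (pi/2) / pi < arctan t / pi" "arctan t / pi < (pi/2) / pi"
      using arctan_lbound arctan_ubound by (intro divide_strict_right_mono; simp)+
    moreover have "- (pi/2) / pi = - (1/2)" "(pi/2) / pi = 1/2" by simp_all
    ultimately show "0 < \<sigma> t" "\<sigma> t < 1" unfolding \<sigma>_def by linarith+
  qed
  have lp: "line_param (\<sigma> t) = t" for t
    by (simp add: line_param_def \<sigma>_def tan_arctan)
  define \<Phi> where "\<Phi> t = of_real (1 / (pi * (1 + t\<^sup>2))) *\<^sub>C \<Psi> (\<sigma> t)" for t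
  have \<Psi>m: "\<Psi> (\<sigma> t) \<in> pts F" for t using \<Psi>(1) \<sigma>[of t] by (simp add: ncont_def)
  have p1: "1 + t\<^sup>2 > 0" for t :: real by (simp add: add_pos_nonneg)
  show ?thesis
  proof (rule that[of \<Phi>])
    have "continuous_on UNIV (\<lambda>t. complex_of_real (1 / (pi * (1 + t\<^sup>2))))"
      using p1 by (intro continuous_intros ballI) (metis less_irrefl mult_pos_pos pi_gt_zero)
    moreover have "ncont F UNIV (\<lambda>t. \<Psi> (\<sigma> t))"
    proof (rule F.ncont_compose[OF \<Psi>(1)])
      show "continuous_on UNIV \<sigma>" unfolding \<sigma>_def by (intro continuous_intros) auto
      show "range \<sigma> \<subseteq> {0..1}" using less_imp_le[OF \<sigma>(1)] less_imp_le[OF \<sigma>(2)] by auto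
    qed
    ultimately show "ncont F UNIV \<Phi>" unfolding \<Phi>_def by (rule F.ncont_scale)
    fix t
    have "nrm F (\<Phi> t) = 1 / (pi * (1 + t\<^sup>2)) * nrm F (\<Psi> (\<sigma> t))"
      unfolding \<Phi>_def F.nrm_scale[OF \<Psi>m] norm_of_real using p1[of t] by simp
    also have "\<dots> \<le> 1 / pi * (4 * (64 * pi * N))"
    proof (rule mult_mono)
      show "1 / (pi * (1 + t\<^sup>2)) \<le> 1 / pi" by (intro divide_left_mono) (auto intro!: mult_pos_pos p1)
      show "nrm F (\<Psi> (\<sigma> t)) \<le> 4 * (64 * pi * N)" using \<Psi>(3)[of "\<sigma> t"] \<sigma>[of t] by simp
    qed (use F.nrm_ge0[OF \<Psi>m] in auto)
    finally show "nrm F (\<Phi> t) \<le> 256 * N" by simp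
    have "T (\<Phi> t) = of_real (1 / (pi * (1 + t\<^sup>2))) *\<^sub>C of_real (pi * (1 + t\<^sup>2)) *\<^sub>C \<phi> t"
    proof -
      have "compactify \<phi> (\<sigma> t) = of_real (pi * (1 + t\<^sup>2)) *\<^sub>C \<phi> t"
        using \<sigma>[of t] unfolding compactify_def lp by (simp del: of_real_mult of_real_add)
      moreover have "T (\<Psi> (\<sigma> t)) = compactify \<phi> (\<sigma> t)" using \<Psi>(2) \<sigma>[of t] by simp
      ultimately show ?thesis unfolding \<Phi>_def Q.T_scale[OF \<Psi>m] by simp
    qed
    also have "\<dots> = \<phi> t"
    proof -
      have "complex_of_real (1 / (pi * (1 + t\<^sup>2))) * of_real (pi * (1 + t\<^sup>2)) = 1"
        using p1[of t] by (simp flip: of_real_mult del: of_real_divide)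
      thus ?thesis by (simp only: scaleC.scale_scale scaleC.scale_one)
    qed
    finally show "T (\<Phi> t) = kap c 3 (Complex \<alpha> t) *\<^sub>C G t" unfolding \<phi>_def .
  qed
qed

text \<open>Reduces an element of the inner Calderon space to its scalar components
  \<open>l (g w i)\<close>, for which the classical Cauchy formulas are available; a component of an
  array followed by \<open>l\<close> is a functional in the dual ball of the power space.\<close>

lemma calderon_rochberg_D:
  assumes ab: "0 < a" "a < b" "b < 1" and n: "n \<ge> 1"
    and g: "g \<in> pts (calderon_space (\<P> n) (\<R> n a) (\<R> n b) a b)"
  shows "ncont (\<R> n a) UNIV (\<lambda>t. g (Complex a t))"
    and "ncont (\<R> n b) UNIV (\<lambda>t. g (Complex b t))"
    and "\<And>w. a \<le> Re w \<Longrightarrow> Re w \<le> b \<Longrightarrow> g w \<in> pts (\<P> n)"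
    and "\<And>l i. l \<in> \<D> \<Longrightarrow> i < n \<Longrightarrow> continuous_on {w. a \<le> Re w \<and> Re w \<le> b} (\<lambda>w. l (g w i))"
    and "\<And>l i. l \<in> \<D> \<Longrightarrow> i < n \<Longrightarrow> (\<lambda>w. l (g w i)) holomorphic_on strip a b"
    and "\<exists>Y\<ge>0. \<forall>l\<in>\<D>. \<forall>i<n. \<forall>w. a \<le> Re w \<longrightarrow> Re w \<le> b \<longrightarrow> cmod (l (g w i)) \<le> Y"
    and "0 \<le> nrm (calderon_space (\<P> n) (\<R> n a) (\<R> n b) a b) g"
proof -
  let ?P = "\<P> n"
  interpret P: bsp ?P by unfold_locales (rule banach_power_space[OF banach_\<Sigma> n])
  have R: "nsp (\<R> n x)" if "0 < x" "x < 1" for x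
    using rochberg_compatible[OF n, of "of_real x" "of_real x"] that
    by (auto simp: compatible_couple_def nsp_banach strip_def)
  have Ra: "nsp (\<R> n a)" and Rb: "nsp (\<R> n b)"
    using R ab by auto
  note G = g[unfolded calderon_mem[OF P.nsp_axioms Ra Rb] closure_strip[OF ab(2)]]
  show ca: "ncont (\<R> n a) UNIV (\<lambda>t. g (Complex a t))"
    and cb: "ncont (\<R> n b) UNIV (\<lambda>t. g (Complex b t))" using G by auto
  have c: "ncont ?P {w. a \<le> Re w \<and> Re w \<le> b} g" and an: "analytic_into ?P g (strip a b)" using G by auto
  show gm: "g w \<in> pts ?P" if "a \<le> Re w" "Re w \<le> b" for w using c that by (auto simp: ncont_def)
  have comp: "(\<lambda>x. l (x i)) \<in> dual_ball ?P" if l: "l \<in> \<D>" and i: "i < n" for l i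
    unfolding dual_ball_def
  proof (intro CollectI conjI ballI allI)
    fix x y assume x: "x \<in> pts ?P" and y: "y \<in> pts ?P"
    hence m: "x i \<in> pts \<Sigma>" "y i \<in> pts \<Sigma>" using i by (auto simp: power_space_pts)
    show "l ((x + y) i) = l (x i) + l (y i)" using S.dual_add[OF l m] by simp
    show "l ((d *\<^sub>C x) i) = d * l (x i)" for d using S.dual_scale[OF l m(1)] by (simp add: scaleC_fun_def)
    show "cmod (l (x i)) \<le> nrm ?P x" using S.dual_le[OF l m(1)] nsp_powerspace_nrm(1)[OF n i, of \<Sigma> x] by simp
  qed
  show "continuous_on {w. a \<le> Re w \<and> Re w \<le> b} (\<lambda>w. l (g w i))" if "l \<in> \<D>" "i < n" for l i
    by (rule P.dual_continuous_on[OF comp[OF that] c])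
  show "(\<lambda>w. l (g w i)) holomorphic_on strip a b" if "l \<in> \<D>" "i < n" for l i
    by (rule P.analytic_dual(1)[OF open_strip an comp[OF that]])
  have "bounded_into ?P g (strip a b)" using G by blast
  then obtain Y where Y: "\<And>w. w \<in> strip a b \<Longrightarrow> nrm ?P (g w) \<le> Y" by (auto simp: bounded_into_def)
  have cn: "continuous_on (closure (strip a b)) (\<lambda>w. nrm ?P (g w))"
    unfolding closure_strip[OF ab(2)] by (rule P.ncont_continuous_nrm[OF c])
  \<comment> \<open>The bound on the open strip passes to its closure by continuity.\<close>
  have Yc: "nrm ?P (g w) \<le> Y" if "a \<le> Re w" "Re w \<le> b" for w
    by (rule continuous_le_on_closure[OF cn _ Y]) (use that closure_strip[OF ab(2)] in auto)
  have "cmod (l (g w i)) \<le> \<bar>Y\<bar>" if "l \<in> \<D>" "i < n" "a \<le> Re w" "Re w \<le> b" for l i w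
    using P.dual_le[OF comp[OF that(1,2)] gm[OF that(3,4)]] Yc[OF that(3,4)] by simp
  thus "\<exists>Y\<ge>0. \<forall>l\<in>\<D>. \<forall>i<n. \<forall>w. a \<le> Re w \<longrightarrow> Re w \<le> b \<longrightarrow> cmod (l (g w i)) \<le> Y"
    by (intro exI[of _ "\<bar>Y\<bar>"]) auto
  show "0 \<le> nrm (calderon_space (\<P> n) (\<R> n a) (\<R> n b) a b) g"
    using calderon_le_nrm(1)[OF g, of 0] nsp.nrm_ge0[OF Ra, of "g (Complex a 0)"] ca by (auto simp: ncont_def)
qed

text \<open>
  Cauchy's formula over two lines reproduces \<open>g c\<close> from the \<open>P\<close>-parts, while the \<open>p\<close>-parts of the boundary
  values cancel. The factor \<open>s\<close> is 1, or 0 if there is only one line.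
\<close>

lemma two_lines:
  assumes La: "line_operator W X0 X1 n a c (kline n c a) Ka B \<Phi>a"
    and Lb: "line_operator W X0 X1 n b c (kline n c b) Kb B \<Phi>b"
    and \<Omega>: "\<And>t. Complex a t \<in> \<Omega>" "\<And>t. Complex b t \<in> \<Omega>" "of_real c \<in> \<Omega>" "\<And>w. w \<in> \<Omega> \<Longrightarrow> 0 \<le> Re w" "U \<subseteq> \<Omega>"
    and gm: "\<And>w. w \<in> \<Omega> \<Longrightarrow> g w \<in> pts (\<P> n)"
    and gc: "\<And>l i. l \<in> \<D> \<Longrightarrow> i < n \<Longrightarrow> continuous_on \<Omega> (\<lambda>w. l (g w i))"
    and gh: "\<And>l i. l \<in> \<D> \<Longrightarrow> i < n \<Longrightarrow> (\<lambda>w. l (g w i)) holomorphic_on U"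
    and Y: "Y \<ge> 0" "\<And>l i w. l \<in> \<D> \<Longrightarrow> i < n \<Longrightarrow> w \<in> \<Omega> \<Longrightarrow> cmod (l (g w i)) \<le> Y"
    and Ta: "\<And>t. \<T> n (of_real a) (\<Phi>a t) = kap c 3 (Complex a t) *\<^sub>C g (Complex a t)"
    and Tb: "\<And>t. \<T> n (of_real b) (\<Phi>b t) = s *\<^sub>C kap c 3 (Complex b t) *\<^sub>C g (Complex b t)"
    and Cauchy: "\<And>(G :: complex \<Rightarrow> complex) M. continuous_on \<Omega> G \<Longrightarrow> G holomorphic_on U \<Longrightarrow> (\<And>v. v \<in> \<Omega> \<Longrightarrow> weight (Im v) * cmod (G v) \<le> M) \<Longrightarrow>
      s * cline_int (\<lambda>t. G (Complex b t) / (Complex b t - of_real c)) -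
        cline_int (\<lambda>t. G (Complex a t) / (Complex a t - of_real c)) = 2 * pi * G (of_real c)"
  obtains J where "jet_function n c J (g (of_real c))"
    "\<And>z. z \<in> cstrip \<Longrightarrow> nrm \<Sigma> (J z) \<le> (pi * line_operator.KH n b Kb B + pi * line_operator.KH n a Ka B) * (2 + cmod z) ^ n"
    "\<And>X j d. \<lbrakk>bsp X; pts X \<subseteq> pts \<Sigma>; \<And>x. x \<in> pts X \<Longrightarrow> nrm \<Sigma> x \<le> nrm X x;
      \<And>f. f \<in> pts F \<Longrightarrow> ncont X UNIV (\<lambda>t. f (Complex j t)); \<And>f t. f \<in> pts F \<Longrightarrow> nrm X (f (Complex j t)) \<le> nrm F f;
      j = 0 \<or> j = 1; d > 0; \<And>w. w \<in> \<Omega> \<Longrightarrow> d \<le> \<bar>j - Re w\<bar>\<rbrakk> \<Longrightarrow>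
      ncont X UNIV (\<lambda>y. J (Complex j y)) \<and> (\<forall>y. nrm X (J (Complex j y)) \<le>
        pi * (Kb * (1 + 2 / min b (1 - b)) ^ n * B) + pi * (Ka * (1 + 2 / min a (1 - a)) ^ n * B))"
proof -
  interpret La: line_operator W X0 X1 n a c "kline n c a" Ka B \<Phi>a by (rule La)
  interpret Lb: line_operator W X0 X1 n b c "kline n c b" Kb B \<Phi>b by (rule Lb)
  obtain Ja where Ja: "analytic_into \<Sigma> Ja \<S>" "ncont \<Sigma> cstrip Ja"
    "\<And>z. z \<in> La.D \<Longrightarrow> Ja z = line_int \<Sigma> (La.H z)"
    "\<And>z. z \<in> cstrip \<Longrightarrow> nrm \<Sigma> (Ja z) \<le> pi * (La.KH * (2 + cmod z) ^ n)" by (rule La.extension) blast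
  obtain Jb where Jb: "analytic_into \<Sigma> Jb \<S>" "ncont \<Sigma> cstrip Jb"
    "\<And>z. z \<in> Lb.D \<Longrightarrow> Jb z = line_int \<Sigma> (Lb.H z)"
    "\<And>z. z \<in> cstrip \<Longrightarrow> nrm \<Sigma> (Jb z) \<le> pi * (Lb.KH * (2 + cmod z) ^ n)" by (rule Lb.extension) blast
  have Jm: "Ja z \<in> pts \<Sigma>" "Jb z \<in> pts \<Sigma>" if "z \<in> cstrip" for z using Ja(2) Jb(2) that by (auto simp: ncont_def)
  define J where "J z = Jb z - Ja z" for z
  define p where "p l z w = (\<Sum>i<n. l (g w i) * (z - w) ^ (n - 1 - i))" for l and z w :: complex
  have gmi: "g w i \<in> pts \<Sigma>" if "w \<in> \<Omega>" "i < n" for w i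
    using gm[OF that(1)] that(2) by (simp add: power_space_pts)
  \<comment> \<open>The coefficients of the lifted polynomials are the damped entries of
    \<open>g\<close>, so the \<open>p\<close>-parts on both lines come from the same function of
    \<open>w\<close>.\<close>
  have lp: "l (La.p t z) = kap c 3 (Complex a t) * p l z (Complex a t)"
    "l (Lb.p t z) = s * (kap c 3 (Complex b t) * p l z (Complex b t))" if l: "l \<in> \<D>" for l t z
    unfolding La.dual_p[OF l] Lb.dual_p[OF l] La.q_def La.v_def Lb.q_def Lb.v_def Ta Tb p_def sum_distrib_left
    using \<Omega> gmi S.dual_scale[OF l] by (auto simp: scaleC_fun_def mult.assoc intro!: sum.cong)
  \<comment> \<open>One Cauchy formula with a free factor \<open>e\<close>: with
    \<open>e = 1\<close> it computes the expansion at \<open>c\<close>, with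
    \<open>e = 1 - ((z - c)/(z - w))^n\<close> it cancels the boundary terms.\<close>
  have cauchy: "cline_int (\<lambda>t. kline n c b t * e (Complex b t) * l (Lb.p t z)) - cline_int (\<lambda>t. kline n c a t * e (Complex a t) * l (La.p t z))
      = e (of_real c) * p l z (of_real c)"
    if l: "l \<in> \<D>" and e: "continuous_on \<Omega> e" "e holomorphic_on U"
      "\<And>w. w \<in> \<Omega> \<Longrightarrow> cmod (e w) \<le> E * (1 + cmod w) ^ n" "E \<ge> 0" for l z e E
  proof -
    define G where "G w = kap c (2 * n + 6) w * p l z w * e w" for w
    have "s * cline_int (\<lambda>t. G (Complex b t) / (Complex b t - of_real c)) - cline_int (\<lambda>t. G (Complex a t) / (Complex a t - of_real c)) = 2 * pi * G (of_real c)"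
    proof (rule Cauchy)
      show "continuous_on \<Omega> G"
        unfolding G_def p_def using \<Omega> by (intro continuous_intros kap_continuous gc l e(1)) auto
      show "G holomorphic_on U"
        unfolding G_def p_def using \<Omega> by (intro holomorphic_intros kap_holomorphic gh l e(2)) auto
      fix w assume w: "w \<in> \<Omega>"
      show "weight (Im w) * cmod (G w) \<le> 4 ^ (2 * n + 6) * (real n * Y * (2 + cmod z) ^ n * E)"
        unfolding G_def p_def by (rule jet_decay) (use w \<Omega> La.c Y l e in auto)
    qed
    moreover have kb: "kline n c b t * e (Complex b t) * l (Lb.p t z) = s / (2 * pi) * (G (Complex b t) / (Complex b t - of_real c))"
      and ka: "kline n c a t * e (Complex a t) * l (La.p t z) = 1 / (2 * pi) * (G (Complex a t) / (Complex a t - of_real c))" for t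
      using kap_add[of c "2 * n + 3" _ 3, symmetric] unfolding lp[OF l] by (simp_all add: G_def kline_def mult_ac add.commute[of 6])
    ultimately have "cline_int (\<lambda>t. kline n c b t * e (Complex b t) * l (Lb.p t z)) - cline_int (\<lambda>t. kline n c a t * e (Complex a t) * l (La.p t z))
        = 1 / (2 * pi) * (2 * pi * G (of_real c))"
      unfolding kb ka cline_int_cmult by (simp add: diff_divide_distrib[symmetric])
    also have "\<dots> = G (of_real c)" by simp
    finally show ?thesis
      using kap_c[of c "2 * n + 6"] La.c by (simp add: G_def)
  qed
  have bnd: "ncont X UNIV (\<lambda>y. J (Complex j y)) \<and> (\<forall>y. nrm X (J (Complex j y)) \<le>
      pi * (Kb * (1 + 2 / min b (1 - b)) ^ n * B) + pi * (Ka * (1 + 2 / min a (1 - a)) ^ n * B))"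
    if X: "bsp X" "pts X \<subseteq> pts \<Sigma>" "\<And>x. x \<in> pts X \<Longrightarrow> nrm \<Sigma> x \<le> nrm X x"
      and FX: "\<And>f. f \<in> pts F \<Longrightarrow> ncont X UNIV (\<lambda>t. f (Complex j t))" "\<And>f t. f \<in> pts F \<Longrightarrow> nrm X (f (Complex j t)) \<le> nrm F f"
      and j: "j = 0 \<or> j = 1" and d: "d > 0" "\<And>w. w \<in> \<Omega> \<Longrightarrow> d \<le> \<bar>j - Re w\<bar>" for X j d
  proof -
    interpret X: bsp X by fact
    obtain Aa where Aa: "ncont X UNIV Aa" "\<And>y. nrm X (Aa y) \<le> pi * (Ka * (1 + 2 / La.r) ^ n * B)"
      "\<And>l y. l \<in> \<D> \<Longrightarrow> l (line_int \<Sigma> (La.H (Complex j y))) =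
        l (Aa y) + cline_int (\<lambda>t. kline n c a t * (1 - La.m t (Complex j y)) * l (La.p t (Complex j y)))"
      by (rule La.boundary[OF X FX j]) blast+
    obtain Ab where Ab: "ncont X UNIV Ab" "\<And>y. nrm X (Ab y) \<le> pi * (Kb * (1 + 2 / Lb.r) ^ n * B)"
      "\<And>l y. l \<in> \<D> \<Longrightarrow> l (line_int \<Sigma> (Lb.H (Complex j y))) =
        l (Ab y) + cline_int (\<lambda>t. kline n c b t * (1 - Lb.m t (Complex j y)) * l (Lb.p t (Complex j y)))"
      by (rule Lb.boundary[OF X FX j]) blast+
    have Am: "Aa y \<in> pts X" "Ab y \<in> pts X" for y using Aa(1) Ab(1) by (auto simp: ncont_def)
    have eq: "J (Complex j y) = Ab y - Aa y" for y
    proof (rule S.dual_eqI)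
      let ?z = "Complex j y"
      have zc: "?z \<in> cstrip" "?z \<in> La.D" "?z \<in> Lb.D" using j La.\<alpha> Lb.\<alpha> by (auto simp: La.D_def Lb.D_def)
      show "J ?z \<in> pts \<Sigma>" unfolding J_def by (intro S.diff_mem Jm zc)
      show "Ab y - Aa y \<in> pts \<Sigma>" using X.diff_mem[OF Am(2,1)] X(2) by blast
      fix l assume l: "l \<in> \<D>"
      define e where "e w = 1 - ((?z - of_real c) / (?z - w)) ^ n" for w
      have dz: "d \<le> cmod (?z - w)" if "w \<in> \<Omega>" for w
        using abs_Re_le_cmod[of "?z - w"] d(2)[OF that] by simp
      have zw: "?z - w \<noteq> 0" if "w \<in> \<Omega>" for w using dz[OF that] d by auto
      \<comment> \<open>At \<open>w = c\<close> the multiplier is 1; hence the Cauchy integral of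
        the \<open>p\<close>-parts vanishes and only the values \<open>Ab y - Aa y\<close> in
        \<open>X\<close> remain.\<close>
      have "e (of_real c) = 0" using zw[OF \<Omega>(3)] by (simp add: e_def)
      moreover have "cline_int (\<lambda>t. kline n c b t * e (Complex b t) * l (Lb.p t ?z)) - cline_int (\<lambda>t. kline n c a t * e (Complex a t) * l (La.p t ?z))
          = e (of_real c) * p l ?z (of_real c)"
      proof (rule cauchy[OF l])
        show "continuous_on \<Omega> e"
          unfolding e_def using zw by (intro continuous_intros) auto
        show "e holomorphic_on U"
          unfolding e_def using zw \<Omega>(5) by (intro holomorphic_intros) auto
        show "cmod (e w) \<le> (1 + (1 + 1 / d) ^ n) * (1 + cmod w) ^ n" if "w \<in> \<Omega>" for w
          unfolding e_def by (rule multiplier_growth[OF d(1) dz[OF that]]) (use La.c in auto)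
        show "0 \<le> 1 + (1 + 1 / d) ^ n" using d by simp
      qed
      moreover have "1 - La.m t ?z = e (Complex a t)" "1 - Lb.m t ?z = e (Complex b t)" for t
        by (auto simp: e_def La.m_def Lb.m_def La.v_def Lb.v_def)
      ultimately have "l (Jb ?z) - l (Ja ?z) = l (Ab y) - l (Aa y)"
        unfolding Ja(3)[OF zc(2)] Jb(3)[OF zc(3)] Aa(3)[OF l] Ab(3)[OF l] by simp
      thus "l (J ?z) = l (Ab y - Aa y)"
        unfolding J_def S.dual_diff[OF l Jm(2)[OF zc(1)] Jm(1)[OF zc(1)]]
        using S.dual_diff[OF l, of "Ab y" "Aa y"] Am X(2) by (simp add: subset_iff)
    qed
    have "nrm X (Ab y - Aa y) \<le> pi * (Kb * (1 + 2 / Lb.r) ^ n * B) + pi * (Ka * (1 + 2 / La.r) ^ n * B)" for y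
      using X.nrm_diff[OF Am(2,1), of y y] Aa(2)[of y] Ab(2)[of y] by simp
    thus ?thesis unfolding eq using X.ncont_diff[OF Ab(1) Aa(1)] unfolding La.r_def Lb.r_def by blast
  qed
  have growth: "nrm \<Sigma> (J z) \<le> (pi * Lb.KH + pi * La.KH) * (2 + cmod z) ^ n" if z: "z \<in> cstrip" for z
    using S.nrm_diff[OF Jm(2)[OF z] Jm(1)[OF z]] Ja(4)[OF z] Jb(4)[OF z] unfolding J_def by (simp add: distrib_right mult.assoc)
  have "analytic_into \<Sigma> J \<S>"
  proof (rule S.weakly_analytic[OF open_strip])
    have sub: "z \<in> cstrip" if "z \<in> \<S>" for z using that by (simp add: strip_def)
    show "J ` \<S> \<subseteq> pts \<Sigma>" unfolding J_def using Jm sub S.diff_mem by blast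
    show "(\<lambda>z. l (J z)) holomorphic_on \<S>" if l: "l \<in> \<D>" for l
      by (rule holomorphic_transform[OF holomorphic_on_diff[OF S.analytic_dual(1)[OF open_strip Jb(1) l] S.analytic_dual(1)[OF open_strip Ja(1) l]]])
        (simp only: J_def S.dual_diff[OF l Jm(2,1)] sub)
    show "\<exists>r>0. \<exists>B. \<forall>w\<in>ball z r \<inter> \<S>. nrm \<Sigma> (J w) \<le> B" for z
      by (rule growth_locally_bounded[OF growth[OF sub]]) (use La.KH Lb.KH in auto)
  qed
  moreover have "ncont \<Sigma> cstrip J" unfolding J_def by (rule S.ncont_diff[OF Jb(2) Ja(2)])
  moreover have "\<exists>R. \<exists>\<rho>>0. \<forall>l\<in>\<D>. \<forall>w\<in>ball (of_real c) \<rho>.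
      cmod (l (J w) - (\<Sum>i<n. l (g (of_real c) i) * (w - of_real c) ^ (n - 1 - i))) \<le> R * cmod (w - of_real c) ^ n"
  proof (intro exI conjI ballI)
    let ?\<rho> = "min (min c (1 - c)) (min \<bar>c - a\<bar> \<bar>c - b\<bar>)"
    show "?\<rho> > 0" using La.c Lb.c by simp
    fix l w assume l: "l \<in> \<D>" and w: "w \<in> ball (complex_of_real c) ?\<rho>"
    have "\<bar>c - Re w\<bar> < ?\<rho>" using abs_Re_le_cmod[of "of_real c - w"] w by (simp add: dist_norm)
    hence wD: "w \<in> cstrip" "w \<in> La.D" "w \<in> Lb.D"
      by (auto simp: La.D_def Lb.D_def abs_less_iff)
    have "l (La.P w t) = kline n c a t * 1 * l (La.p t w)" "l (Lb.P w t) = kline n c b t * 1 * l (Lb.p t w)" for t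
      unfolding La.P_def Lb.P_def by (simp_all add: S.dual_scale[OF l] La.p_mem Lb.p_mem)
    \<comment> \<open>The two \<open>P\<close>-integrals combine to the polynomial with coefficients
      \<open>g c\<close>, so the error of the expansion is the sum of two differences
      \<open>H - P\<close>, each of order \<open>n\<close>.\<close>
    hence "l (line_int \<Sigma> (Lb.P w)) - l (line_int \<Sigma> (La.P w)) = 1 * p l w (of_real c)"
      unfolding S.dual_line_int[OF l La.P_rapid] S.dual_line_int[OF l Lb.P_rapid]
      using cauchy[OF l, of "\<lambda>_. 1" 1 w] by simp
    hence e: "l (J w) - (\<Sum>i<n. l (g (of_real c) i) * (w - of_real c) ^ (n - 1 - i)) =
        (l (line_int \<Sigma> (Lb.H w)) - l (line_int \<Sigma> (Lb.P w))) - (l (line_int \<Sigma> (La.H w)) - l (line_int \<Sigma> (La.P w)))"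
      unfolding J_def S.dual_diff[OF l Jm(2)[OF wD(1)] Jm(1)[OF wD(1)]] unfolding Ja(3)[OF wD(2)] Jb(3)[OF wD(3)] p_def by (simp, metis minus_diff_eq)
    note mem = S.line_int_mem[OF La.H_rapid[OF wD(2)]] S.line_int_mem[OF La.P_rapid]
      S.line_int_mem[OF Lb.H_rapid[OF wD(3)]] S.line_int_mem[OF Lb.P_rapid]
    have "cmod (l (line_int \<Sigma> (La.H w)) - l (line_int \<Sigma> (La.P w))) \<le> pi * (Ka * La.K1 * B * cmod (w - of_real c) ^ n)"
      unfolding S.dual_diff[OF l mem(1,2), symmetric]
      by (rule order_trans[OF S.dual_le[OF l S.diff_mem[OF mem(1,2)]] La.order_at_c[OF wD(2)]])
    moreover have "cmod (l (line_int \<Sigma> (Lb.H w)) - l (line_int \<Sigma> (Lb.P w))) \<le> pi * (Kb * Lb.K1 * B * cmod (w - of_real c) ^ n)"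
      unfolding S.dual_diff[OF l mem(3,4), symmetric]
      by (rule order_trans[OF S.dual_le[OF l S.diff_mem[OF mem(3,4)]] Lb.order_at_c[OF wD(3)]])
    ultimately show "cmod (l (J w) - (\<Sum>i<n. l (g (of_real c) i) * (w - of_real c) ^ (n - 1 - i)))
        \<le> (pi * (Ka * La.K1 * B) + pi * (Kb * Lb.K1 * B)) * cmod (w - of_real c) ^ n"
      unfolding e
      using norm_triangle_ineq4[of "l (line_int \<Sigma> (Lb.H w)) - l (line_int \<Sigma> (Lb.P w))" "l (line_int \<Sigma> (La.H w)) - l (line_int \<Sigma> (La.P w))"]
      by (simp add: distrib_right mult.assoc)
  qed
  ultimately have "jet_function n c J (g (of_real c))" unfolding jet_function_def using growth gm[OF \<Omega>(3)] by blast
  thus ?thesis by (rule that) (use growth bnd in auto)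
qed

section \<open>The converse inclusion\<close>

text \<open>The boundary functions of \<open>g\<close> are lifted on both lines,
  \<open>two_lines\<close> builds \<open>J\<close> with boundary values bounded by
  \<open>K0 * N\<close>, and \<open>glue\<close> damps it. A strict bound \<open>N\<close> is used
  because the liftings need a positive one, also for \<open>g = 0\<close>.\<close>

lemma reiteration_upper:
  assumes ab: "0 < a" "a < c" "c < b" "b < 1" and n: "n \<ge> 1"
  defines "C \<equiv> calderon_space (\<P> n) (\<R> n a) (\<R> n b) a b"
  shows "\<exists>K>0. \<forall>g\<in>pts C. \<forall>N>nrm C g. \<exists>f\<in>pts F. \<T> n (of_real c) f = g (of_real c) \<and> nrm F f \<le> K * N"
proof -
  have c01: "0 < c" "c < 1" using ab by auto
  have ab': "a < b" using ab by simp
  have as: "complex_of_real a \<in> \<S>" "complex_of_real b \<in> \<S>" using ab by (auto simp: strip_def)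
  obtain Kc where Kc: "Kc > 0"
    "\<And>J x N. \<lbrakk>jet_function n c J x;
      ncont X0 UNIV (\<lambda>y. J (Complex 0 y)); \<And>y. nrm X0 (J (Complex 0 y)) \<le> N * (3 + \<bar>y\<bar>) ^ n;
      ncont X1 UNIV (\<lambda>y. J (Complex 1 y)); \<And>y. nrm X1 (J (Complex 1 y)) \<le> N * (3 + \<bar>y\<bar>) ^ n\<rbrakk>
      \<Longrightarrow> \<exists>f\<in>pts F. \<T> n (of_real c) f = x \<and> nrm F f \<le> Kc * N"
    by (rule glue[OF n c01]) blast
  define Ka where "Ka = 4 ^ (2 * n + 3) / \<bar>a - c\<bar>"
  define Kb where "Kb = 4 ^ (2 * n + 3) / \<bar>b - c\<bar>"
  define K0 where "K0 = pi * (Kb * (1 + 2 / min b (1 - b)) ^ n * 256) + pi * (Ka * (1 + 2 / min a (1 - a)) ^ n * 256)"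
  have K0: "K0 > 0" unfolding K0_def Ka_def Kb_def
    using ab by (intro add_pos_pos mult_pos_pos zero_less_power divide_pos_pos) auto
  show ?thesis
  proof (intro exI[of _ "Kc * K0"] conjI ballI allI impI)
    show "0 < Kc * K0" using Kc(1) K0 by simp
    fix g N assume g: "g \<in> pts C" and N: "nrm C g < N"
    note gD = calderon_rochberg_D[OF ab(1) ab' ab(4) n g[unfolded C_def]]
    have N0: "N > 0" using gD(7) N unfolding C_def by linarith
    obtain Ca Cb where Q: "quotient_map F (\<P> n) (\<T> n (of_real a)) Ca"
      "quotient_map F (\<P> n) (\<T> n (of_real b)) Cb"
      using taylor_F[OF as(1) n] taylor_F[OF as(2) n] by blast
    have na: "nrm (\<R> n a) (g (Complex a t)) \<le> N"
      and nb: "nrm (\<R> n b) (g (Complex b t)) \<le> N" for t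
      using calderon_le_nrm[OF g[unfolded C_def], of t] N unfolding C_def by linarith+
    obtain \<Phi>a where \<Phi>a: "ncont F UNIV \<Phi>a" "\<And>t. nrm F (\<Phi>a t) \<le> 256 * N"
      "\<And>t. \<T> n (of_real a) (\<Phi>a t) = kap c 3 (Complex a t) *\<^sub>C g (Complex a t)"
      by (rule lift_line[OF Q(1), of c a "\<lambda>t. g (Complex a t)" N])
        (use gD(1) na N0 ab in \<open>auto simp: rochberg_space_def\<close>)
    obtain \<Phi>b where \<Phi>b: "ncont F UNIV \<Phi>b" "\<And>t. nrm F (\<Phi>b t) \<le> 256 * N"
      "\<And>t. \<T> n (of_real b) (\<Phi>b t) = kap c 3 (Complex b t) *\<^sub>C g (Complex b t)"
      by (rule lift_line[OF Q(2), of c b "\<lambda>t. g (Complex b t)" N])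
        (use gD(2) nb N0 ab in \<open>auto simp: rochberg_space_def\<close>)
    obtain Y where Y: "Y \<ge> 0" "\<And>l i w. l \<in> \<D> \<Longrightarrow> i < n \<Longrightarrow> w \<in> {w. a \<le> Re w \<and> Re w \<le> b} \<Longrightarrow> cmod (l (g w i)) \<le> Y"
      using gD(6) by blast
    have La: "line_operator W X0 X1 n a c (kline n c a) Ka (256 * N) \<Phi>a"
      by unfold_locales (use n ab \<Phi>a kline_le[of a c] in \<open>auto intro!: kline_continuous simp: Ka_def\<close>)
    have Lb: "line_operator W X0 X1 n b c (kline n c b) Kb (256 * N) \<Phi>b"
      by unfold_locales (use n ab \<Phi>b kline_le[of b c] in \<open>auto intro!: kline_continuous simp: Kb_def\<close>)
    obtain J where J: "jet_function n c J (g (of_real c))"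
      "\<And>X j d. \<lbrakk>bsp X; pts X \<subseteq> pts \<Sigma>; \<And>x. x \<in> pts X \<Longrightarrow> nrm \<Sigma> x \<le> nrm X x;
        \<And>f. f \<in> pts F \<Longrightarrow> ncont X UNIV (\<lambda>t. f (Complex j t)); \<And>f t. f \<in> pts F \<Longrightarrow> nrm X (f (Complex j t)) \<le> nrm F f;
        j = 0 \<or> j = 1; d > 0; \<And>w. w \<in> {w. a \<le> Re w \<and> Re w \<le> b} \<Longrightarrow> d \<le> \<bar>j - Re w\<bar>\<rbrakk> \<Longrightarrow>
        ncont X UNIV (\<lambda>y. J (Complex j y)) \<and> (\<forall>y. nrm X (J (Complex j y)) \<le> K0 * N)"
    proof (rule two_lines[OF La Lb, where \<Omega> = "{w. a \<le> Re w \<and> Re w \<le> b}" and U = "strip a b" and g = g and s = 1 and Y = Y])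
      show "strip a b \<subseteq> {w. a \<le> Re w \<and> Re w \<le> b}" by (auto simp: strip_def)
      show "cmod (l (g w i)) \<le> Y" if "l \<in> \<D>" "i < n" "w \<in> {w. a \<le> Re w \<and> Re w \<le> b}" for l i w
        by (rule Y(2)[OF that])
      show "g w \<in> pts (\<P> n)" if "w \<in> {w. a \<le> Re w \<and> Re w \<le> b}" for w using gD(3) that by simp
      fix G M assume G: "continuous_on {w. a \<le> Re w \<and> Re w \<le> b} G" "G holomorphic_on strip a b"
        "\<And>v. v \<in> {w. a \<le> Re w \<and> Re w \<le> b} \<Longrightarrow> weight (Im v) * cmod (G v) \<le> M"
      show "1 * cline_int (\<lambda>t. G (Complex b t) / (Complex b t - of_real c)) -
        cline_int (\<lambda>t. G (Complex a t) / (Complex a t - of_real c)) = 2 * pi * G (of_real c)"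
        unfolding mult_1 by (rule Cauchy_strip[OF ab' G(1,2)]) (use G(3) ab in \<open>auto simp: strip_def\<close>)
    qed (use ab gD(4,5) Y(1) \<Phi>a(3) \<Phi>b(3) in \<open>auto simp: K0_def distrib_right mult.assoc\<close>)
    have pw: "K0 * N \<le> K0 * N * (3 + \<bar>y\<bar>) ^ n" for y
      using mult_left_mono[of 1 "(3 + \<bar>y\<bar>) ^ n" "K0 * N"] K0 N0 by simp
    \<comment> \<open>The inner closed strip keeps distance \<open>a\<close> from
      \<open>Re z = 0\<close> and \<open>1 - b\<close> from \<open>Re z = 1\<close>.\<close>
    note J0 = J(2)[OF X0.bsp_axioms \<Sigma>_sub(1) \<Sigma>_le(1) F_D(3,9) disjI1[OF refl], of a]
      and J1 = J(2)[OF X1.bsp_axioms \<Sigma>_sub(2) \<Sigma>_le(2) F_D(4,10) disjI2[OF refl], of "1 - b"]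
    have "\<exists>f\<in>pts F. \<T> n (of_real c) f = g (of_real c) \<and> nrm F f \<le> Kc * (K0 * N)"
      by (rule Kc(2)[OF J(1)]) (use J0 J1 ab order_trans[OF _ pw] in auto)
    thus "\<exists>f\<in>pts F. \<T> n (of_real c) f = g (of_real c) \<and> nrm F f \<le> Kc * K0 * N" by (simp add: mult.assoc)
  qed
qed

end

section \<open>The case of nested spaces\<close>

text \<open>The open mapping theorem for the identity. By Baire the \<open>Y\<close>-closure of some
  \<open>X\<close>-ball contains a \<open>Y\<close>-ball; hence each \<open>y\<close> is
  approximated by a \<open>u\<close> with controlled \<open>X\<close>-norm up to half its
  \<open>Y\<close>-norm, and iteration gives the bound.\<close>

lemma equivalent_norms:
  assumes "bsp X" "bsp Y" and p: "pts X = pts Y" and le: "\<And>x. x \<in> pts X \<Longrightarrow> nrm Y x \<le> nrm X x"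
  obtains C where "C > 0" "\<And>x. x \<in> pts X \<Longrightarrow> nrm X x \<le> C * nrm Y x"
proof -
  interpret X: bsp X by fact
  interpret Y: bsp Y by fact
  define A where "A k = {x \<in> pts X. nrm X x \<le> real k}" for k :: nat
  have "\<exists>k. ntop Y interior_of (ntop Y closure_of A k) \<noteq> {}"
  proof (rule ccontr)
    assume "\<not> ?thesis"
    hence "ntop Y interior_of \<Union>(range (\<lambda>k. ntop Y closure_of A k)) = {}"
      unfolding Y.mtop(2)
      by (intro Metric_space.metric_Baire_category_alt[OF Y.mtop(1)])
        (use Y.banach in \<open>auto simp: banach_space_def mcomplete_of_def nmetric_def mspace_def mdist_def metric_inverse Y.mtop(1)\<close>)
    moreover have "pts Y \<subseteq> \<Union>(range (\<lambda>k. ntop Y closure_of A k))"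
    proof
      fix x assume x: "x \<in> pts Y"
      obtain k :: nat where "nrm X x \<le> real k" using real_arch_simple by blast
      hence "x \<in> ntop Y closure_of A k" using x p by (auto simp: A_def Y.closure_iff intro!: bexI[of _ x])
      thus "x \<in> \<Union>(range (\<lambda>k. ntop Y closure_of A k))" by blast
    qed
    hence "pts Y \<subseteq> ntop Y interior_of \<Union>(range (\<lambda>k. ntop Y closure_of A k))"
      using Y.topspace openin_topspace interior_of_maximal by metis
    ultimately show False using Y.zero_mem by blast
  qed
  then obtain k x0 where "x0 \<in> ntop Y interior_of (ntop Y closure_of A k)" by blast
  then obtain r where x0: "x0 \<in> ntop Y closure_of A k" and r: "r > 0"
    "\<And>y. y \<in> pts Y \<Longrightarrow> nrm Y (x0 - y) < r \<Longrightarrow> y \<in> ntop Y closure_of A k"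
    using openin_interior_of[of "ntop Y" "ntop Y closure_of A k"] interior_of_subset[of "ntop Y" "ntop Y closure_of A k"]
    unfolding Y.openin_iff by (metis subsetD)
  have x0m: "x0 \<in> pts Y" using x0 Y.closure_iff by blast
  define C where "C = 4 * real k / r"
  have C0: "C \<ge> 0" using r(1) by (simp add: C_def)
  have approx: "\<exists>u\<in>pts X. nrm X u \<le> C * M \<and> nrm Y (y - u) \<le> M / 2" if y: "y \<in> pts Y" "nrm Y y \<le> M" and M: "M > 0" for y M
  proof -
    \<comment> \<open>The scale that brings \<open>s y\<close> within \<open>r / 2\<close> of the
      origin. Both \<open>x0\<close> and \<open>x0 + s y\<close> lie in the closure of
      \<open>A k\<close>; the difference of approximants, divided by \<open>s\<close>, approximates
      \<open>y\<close>.\<close>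
    define s where "s = r / (2 * M)"
    have s: "s > 0" using r(1) M by (simp add: s_def)
    have sy: "of_real s *\<^sub>C y \<in> pts Y" by (rule Y.scale_mem[OF y(1)])
    have "nrm Y (of_real s *\<^sub>C y) \<le> s * M" using s y by (simp add: Y.nrm_scale)
    also have "\<dots> < r" using r(1) M by (simp add: s_def)
    finally have "nrm Y (x0 - (x0 + of_real s *\<^sub>C y)) < r" using Y.nrm_minus[OF sy] by simp
    hence "x0 + of_real s *\<^sub>C y \<in> ntop Y closure_of A k" using r(2) Y.add_mem[OF x0m sy] by blast
    moreover have e: "s * M / 4 > 0" using s M by simp
    ultimately obtain p where p1: "p \<in> A k" "p \<in> pts Y" "nrm Y (x0 + of_real s *\<^sub>C y - p) < s * M / 4"
      unfolding Y.closure_iff by blast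
    obtain q where q: "q \<in> A k" "q \<in> pts Y" "nrm Y (x0 - q) < s * M / 4"
      using x0 e unfolding Y.closure_iff by blast
    define u where "u = of_real (1 / s) *\<^sub>C (p - q)"
    have pq: "p \<in> pts X" "q \<in> pts X" "nrm X (p - q) \<le> 2 * real k"
      using p1(1) q(1) X.nrm_diff[of p q] by (auto simp: A_def)
    have "of_real s *\<^sub>C (y - u) = of_real s *\<^sub>C y - (of_real s * of_real (1 / s)) *\<^sub>C (p - q)"
      by (simp add: u_def scaleC.scale_right_diff_distrib)
    also have "\<dots> = (x0 + of_real s *\<^sub>C y - p) - (x0 - q)" using s by simp
    finally have eq: "of_real s *\<^sub>C (y - u) = (x0 + of_real s *\<^sub>C y - p) - (x0 - q)" .
    have "nrm Y (of_real s *\<^sub>C (y - u)) \<le> s * M / 4 + s * M / 4"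
      unfolding eq using Y.nrm_diff[OF Y.diff_mem[OF Y.add_mem[OF x0m sy] p1(2)] Y.diff_mem[OF x0m q(2)]] p1(3) q(3) by linarith
    moreover have um: "u \<in> pts X" unfolding u_def by (intro X.scale_mem X.diff_mem pq)
    ultimately have "s * nrm Y (y - u) \<le> s * (M / 2)"
      using s Y.nrm_scale[OF Y.diff_mem, of y u "of_real s"] y(1) p by simp
    hence "nrm Y (y - u) \<le> M / 2" using s by simp
    moreover have "nrm X u \<le> C * M"
    proof -
      have "nrm X u = 1 / s * nrm X (p - q)" unfolding u_def using s pq X.diff_mem by (simp add: X.nrm_scale norm_divide)
      also have "\<dots> \<le> 1 / s * (2 * real k)" using s pq by (intro mult_left_mono) auto
      finally show ?thesis by (simp add: C_def s_def mult_ac)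
    qed
    ultimately show ?thesis using um by blast
  qed
  show ?thesis
  proof (rule that[of "4 * C + 1"])
    show "4 * C + 1 > 0" using C0 by simp
    fix y assume y: "y \<in> pts X"
    show "nrm X y \<le> (4 * C + 1) * nrm Y y"
    proof (cases "y = 0")
      case False
      define M where "M = nrm Y y"
      have M: "M > 0" using False y p Y.nrm_eq0[of y] Y.nrm_ge0[of y] by (simp add: M_def)
      \<comment> \<open>Partial sums of successive approximants, each chosen for the residual
        \<open>y - s\<close>, whose \<open>Y\<close>-norm is halved every time.\<close>
      define S where "S = rec_nat 0 (\<lambda>k s. s + (SOME u. u \<in> pts X \<and> nrm X u \<le> C * (M * (1/2) ^ k) \<and> nrm Y (y - s - u) \<le> M * (1/2) ^ k / 2))"
      have step: "S (Suc k) - S k \<in> pts X \<and> nrm X (S (Suc k) - S k) \<le> C * (M * (1/2) ^ k) \<and> nrm Y (y - S (Suc k)) \<le> M * (1/2) ^ k / 2"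
        if "S k \<in> pts X" "nrm Y (y - S k) \<le> M * (1/2) ^ k" for k
      proof -
        have "\<exists>u\<in>pts X. nrm X u \<le> C * (M * (1/2) ^ k) \<and> nrm Y (y - S k - u) \<le> M * (1/2) ^ k / 2"
          using approx[of "y - S k" "M * (1/2) ^ k"] that y p M Y.diff_mem by auto
        from someI_ex[OF this[unfolded Bex_def]] show ?thesis by (simp add: S_def diff_diff_add)
      qed
      have inv: "S k \<in> pts X \<and> nrm Y (y - S k) \<le> M * (1/2) ^ k" for k
      proof (induction k)
        case (Suc k)
        thus ?case using step[of k] X.add_mem[of "S (Suc k) - S k" "S k"] by simp
      qed (simp add: S_def M_def)
      obtain x where x: "nlim X S x" "nrm X (x - S 0) \<le> 2 * (C * M)"
        by (rule X.fast_limit[of S "C * M"]) (use inv step in \<open>auto simp: mult.assoc\<close>)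
      have "nlim Y S x" by (rule nlim_mono[OF X.nsp_axioms Y.nsp_axioms _ _ x(1), of 1]) (use p le in auto)
      moreover have "nlim Y S y"
        unfolding nlim_def
      proof (intro conjI allI)
        have "(\<lambda>k. M * (1/2) ^ k) \<longlonglongrightarrow> 0" by (intro tendsto_mult_right_zero LIMSEQ_power_zero) simp
        thus "(\<lambda>k. nrm Y (S k - y)) \<longlonglongrightarrow> 0"
          by (rule Lim_null_comparison[rotated])
            (use inv y p Y.nrm_commute Y.nrm_ge0[OF Y.diff_mem] in \<open>auto intro!: always_eventually\<close>)
      qed (use inv y p in auto)
      ultimately have "x = y" by (rule Y.nlim_unique)
      hence "nrm X y \<le> 2 * (C * M)" using x(2) by (simp add: S_def)
      also have "\<dots> \<le> (4 * C + 1) * M" using C0 M by (simp add: distrib_right)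
      finally show ?thesis by (simp add: M_def)
    qed simp
  qed
qed

context couple
begin

text \<open>
  For \<open>X0 \<subseteq> X1\<close> only the left boundary matters, so Cauchy's formula for the half-plane to the right of \<open>a\<close>,
  applied with constant array, transports arrays from \<open>a\<close> to \<open>b\<close>.
\<close>

lemma rochberg_mono:
  assumes ab: "0 < a" "a < b" "b < 1" and n: "n \<ge> 1" and sub: "pts X0 \<subseteq> pts X1"
  obtains K where "K > 0" "\<And>f N. f \<in> pts F \<Longrightarrow> nrm F f < N \<Longrightarrow>
    \<exists>h\<in>pts F. \<T> n (of_real b) h = \<T> n (of_real a) f \<and> nrm F h \<le> K * N"
proof -
  have b01: "0 < b" "b < 1" using ab by auto
  have as: "complex_of_real a \<in> \<S>" using ab by (simp add: strip_def)
  \<comment> \<open>Here \<open>X1\<close> is all of \<open>\<Sigma>\<close>, so the open mapping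
    theorem makes the two norms equivalent and estimates in \<open>\<Sigma>\<close> suffice on the
    right boundary.\<close>
  have ps: "pts X1 = pts \<Sigma>" using \<Sigma>_sub(2) sub by (auto simp: \<Sigma>_pts intro!: X1.add_mem)
  obtain CE where CE: "CE > 0" "\<And>x. x \<in> pts X1 \<Longrightarrow> nrm X1 x \<le> CE * nrm \<Sigma> x"
    by (rule equivalent_norms[OF X1.bsp_axioms S.bsp_axioms ps \<Sigma>_le(2)]) auto
  obtain Kc where Kc: "Kc > 0"
    "\<And>J x N. \<lbrakk>jet_function n b J x;
      ncont X0 UNIV (\<lambda>y. J (Complex 0 y)); \<And>y. nrm X0 (J (Complex 0 y)) \<le> N * (3 + \<bar>y\<bar>) ^ n;
      ncont X1 UNIV (\<lambda>y. J (Complex 1 y)); \<And>y. nrm X1 (J (Complex 1 y)) \<le> N * (3 + \<bar>y\<bar>) ^ n\<rbrakk>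
      \<Longrightarrow> \<exists>f\<in>pts F. \<T> n (of_real b) f = x \<and> nrm F f \<le> Kc * N"
    by (rule glue[OF n b01]) blast
  obtain Ca where "quotient_map F (\<P> n) (\<T> n (of_real a)) Ca"
    using taylor_F[OF as n] by blast
  then interpret Qa: quotient_map F "\<P> n" "\<T> n (of_real a)" Ca .
  define r where "r = min a (1 - a)"
  define C1 where "C1 = real n * (2 / r) ^ n"
  define K1 where "K1 = 3 * (2 / r) ^ n + C1 * (1 + 2 / r) ^ n"
  define Ka where "Ka = 4 ^ (2 * n + 3) / \<bar>a - b\<bar>"
  \<comment> \<open>\<open>A0\<close> bounds the values on \<open>Re z = 0\<close>, where the
    polynomial terms cancel; \<open>A1\<close> comes from the growth in \<open>\<Sigma>\<close> on
    \<open>Re z = 1\<close>, which the half-plane contains.\<close>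
  define A0 where "A0 = 2 * (pi * (Ka * (1 + 2 / r) ^ n * 64))"
  define A1 where "A1 = CE * (2 * (pi * (Ka * (C1 + K1) * 64)))"
  have "A0 > 0" unfolding A0_def Ka_def r_def
    using ab by (intro mult_pos_pos zero_less_power divide_pos_pos add_pos_pos) auto
  moreover have "A1 \<ge> 0" using ab CE(1) by (simp add: A1_def Ka_def C1_def K1_def r_def)
  ultimately have A: "A0 > 0" "A1 \<ge> 0" .
  show ?thesis
  proof (rule that[of "Kc * (A0 + A1)"])
    show "0 < Kc * (A0 + A1)" using Kc(1) A by simp
    fix f N assume f: "f \<in> pts F" and "nrm F f < N"
    hence N: "nrm F f \<le> N" "N > 0" using F_nrm_ge0[OF f] by auto
    define x where "x = \<T> n (of_real a) f"
    have xm: "x \<in> pts (\<P> n)" unfolding x_def by (rule Qa.T_mem[OF f])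
    \<comment> \<open>The array is constant along the line, so a damped multiple of the one function
      \<open>f\<close> is already a continuous lifting.\<close>
    define \<Phi> where "\<Phi> t = kap b 3 (Complex a t) *\<^sub>C f" for t
    have \<Phi>_le: "nrm F (\<Phi> t) \<le> 64 * N" for t
    proof -
      have "cmod (kap b 3 (Complex a t)) * 1 \<le> cmod (kap b 3 (Complex a t)) * (1 + \<bar>t\<bar>) ^ 3"
        by (intro mult_left_mono one_le_power) auto
      also have "\<dots> \<le> 4 ^ 3" by (rule kap_line_le) (use ab in auto)
      finally have "cmod (kap b 3 (Complex a t)) * nrm F f \<le> 64 * N"
        using N F_nrm_ge0[OF f] by (intro mult_mono) auto
      thus ?thesis by (simp add: \<Phi>_def F.nrm_scale[OF f])
    qed
    have \<Phi>_c: "ncont F UNIV \<Phi>" unfolding \<Phi>_def by (intro F.ncont_scale kap_line_continuous F.ncont_const f) (use ab in auto)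
    have L: "line_operator W X0 X1 n a b (kline n b a) Ka (64 * N) \<Phi>"
      by unfold_locales (use n ab \<Phi>_le \<Phi>_c kline_le[of a b] in \<open>auto intro!: kline_continuous simp: Ka_def\<close>)
    \<comment> \<open>The second line carries the zero lifting and the factor \<open>s = 0\<close>;
      it only brings the half-plane into the form required by \<open>two_lines\<close>.\<close>
    have L0: "line_operator W X0 X1 n a b (kline n b a) Ka (64 * N) (\<lambda>_. 0)"
      by unfold_locales (use n ab N F.ncont_const[OF F.zero_mem] kline_le[of a b] in \<open>auto intro!: kline_continuous simp: Ka_def\<close>)
    obtain J where J: "jet_function n b J x"
      "\<And>z. z \<in> cstrip \<Longrightarrow> nrm \<Sigma> (J z) \<le> (pi * line_operator.KH n a Ka (64 * N) + pi * line_operator.KH n a Ka (64 * N)) * (2 + cmod z) ^ n"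
      "\<And>X j d. \<lbrakk>bsp X; pts X \<subseteq> pts \<Sigma>; \<And>x. x \<in> pts X \<Longrightarrow> nrm \<Sigma> x \<le> nrm X x;
        \<And>f. f \<in> pts F \<Longrightarrow> ncont X UNIV (\<lambda>t. f (Complex j t)); \<And>f t. f \<in> pts F \<Longrightarrow> nrm X (f (Complex j t)) \<le> nrm F f;
        j = 0 \<or> j = 1; d > 0; \<And>w. w \<in> {w. a \<le> Re w} \<Longrightarrow> d \<le> \<bar>j - Re w\<bar>\<rbrakk> \<Longrightarrow>
        ncont X UNIV (\<lambda>y. J (Complex j y)) \<and> (\<forall>y. nrm X (J (Complex j y)) \<le>
          pi * (Ka * (1 + 2 / min a (1 - a)) ^ n * (64 * N)) + pi * (Ka * (1 + 2 / min a (1 - a)) ^ n * (64 * N)))"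
    proof (rule two_lines[OF L L0, where \<Omega> = "{w. a \<le> Re w}" and U = "{w. a < Re w}" and g = "\<lambda>_. x" and s = 0
        and Y = "nrm (\<P> n) x"])
      show "cmod (l (x i)) \<le> nrm (\<P> n) x" if "l \<in> \<D>" "i < n" for l i
        using S.dual_le[OF that(1), of "x i"] xm that(2) nsp_powerspace_nrm(1)[OF n that(2), of \<Sigma> x] by (simp add: power_space_pts)
      show "\<T> n (of_real a) (\<Phi> t) = kap b 3 (Complex a t) *\<^sub>C x" for t
        unfolding \<Phi>_def Qa.T_scale[OF f] x_def ..
      show "\<T> n (of_real a) 0 = 0 *\<^sub>C kap b 3 (Complex a t) *\<^sub>C x" for t
        using Qa.T_0 by simp
      fix G M assume G: "continuous_on {w. a \<le> Re w} G" "G holomorphic_on {w. a < Re w}"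
        "\<And>v. v \<in> {w. a \<le> Re w} \<Longrightarrow> weight (Im v) * cmod (G v) \<le> M"
      show "0 * cline_int (\<lambda>t. G (Complex a t) / (Complex a t - of_real b)) -
        cline_int (\<lambda>t. G (Complex a t) / (Complex a t - of_real b)) = 2 * pi * G (of_real b)"
        using Cauchy_half_plane[OF G(1,2), of M "of_real b"] G(3) ab by simp
    qed ((rule that; blast) | use ab xm Qa.Y.nrm_ge0 in auto)+
    have KH: "pi * line_operator.KH n a Ka (64 * N) + pi * line_operator.KH n a Ka (64 * N) = 2 * (pi * (Ka * (C1 + K1) * 64)) * N"
      unfolding line_operator.KH_def[OF L] line_operator.C1_def[OF L] line_operator.K1_def[OF L] line_operator.r_def[OF L] C1_def K1_def r_def
      by (simp add: algebra_simps)
    have A0N: "pi * (Ka * (1 + 2 / min a (1 - a)) ^ n * (64 * N)) + pi * (Ka * (1 + 2 / min a (1 - a)) ^ n * (64 * N)) = A0 * N"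
      by (simp add: A0_def r_def)
    have grow: "y \<le> A0 * N \<Longrightarrow> y \<le> (A0 + A1) * N * (3 + \<bar>t\<bar>) ^ n" for y t :: real
    proof -
      have "A0 * N * 1 \<le> (A0 + A1) * N * (3 + \<bar>t\<bar>) ^ n"
        using A N by (intro mult_mono mult_right_mono one_le_power) auto
      thus "y \<le> A0 * N \<Longrightarrow> y \<le> (A0 + A1) * N * (3 + \<bar>t\<bar>) ^ n" by linarith
    qed
    have "\<exists>f\<in>pts F. \<T> n (of_real b) f = x \<and> nrm F f \<le> Kc * ((A0 + A1) * N)"
    proof (rule Kc(2)[OF J(1)])
      note J0 = J(3)[OF X0.bsp_axioms \<Sigma>_sub(1) \<Sigma>_le(1) F_D(3,9) disjI1[OF refl], of a, unfolded A0N]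
      show "ncont X0 UNIV (\<lambda>y. J (Complex 0 y))" "nrm X0 (J (Complex 0 y)) \<le> (A0 + A1) * N * (3 + \<bar>y\<bar>) ^ n" for y
        using J0 ab grow by auto
      have Jm: "J (Complex 1 y) \<in> pts \<Sigma>" for y using J(1) by (simp add: jet_function_def ncont_def)
      have Je: "ncont \<Sigma> UNIV (\<lambda>y. J (Complex 1 y))"
        by (rule S.ncont_compose[of cstrip J]) (use J(1) in \<open>auto simp: jet_function_def Complex_eq intro!: continuous_intros\<close>)
      thus "ncont X1 UNIV (\<lambda>y. J (Complex 1 y))"
        unfolding ncont_def
      proof (intro ballI conjI)
        fix y
        show "J (Complex 1 y) \<in> pts X1" unfolding ps by (rule Jm)
        have "((\<lambda>x. CE * nrm \<Sigma> (J (Complex 1 x) - J (Complex 1 y))) \<longlongrightarrow> 0) (at y)"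
          using Je by (intro tendsto_mult_right_zero) (auto simp: ncont_def)
        thus "((\<lambda>x. nrm X1 (J (Complex 1 x) - J (Complex 1 y))) \<longlongrightarrow> 0) (at y)"
          by (rule Lim_null_comparison[rotated])
            (use CE(2) X1.nrm_ge0[OF X1.diff_mem] Jm ps in \<open>auto intro!: always_eventually CE(2)[unfolded ps] S.diff_mem\<close>)
      qed
      fix y
      have "cmod (Complex 1 y) \<le> 1 + \<bar>y\<bar>" using cmod_le[of "Complex 1 y"] by simp
      hence y3: "(2 + cmod (Complex 1 y)) ^ n \<le> (3 + \<bar>y\<bar>) ^ n" by (intro power_mono) auto
      have "nrm X1 (J (Complex 1 y)) \<le> CE * nrm \<Sigma> (J (Complex 1 y))" using CE(2) Jm ps by blast
      also have "\<dots> \<le> CE * ((2 * (pi * (Ka * (C1 + K1) * 64)) * N) * (2 + cmod (Complex 1 y)) ^ n)"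
        using CE(1) J(2)[of "Complex 1 y"] unfolding KH by (intro mult_left_mono) auto
      also have "\<dots> = A1 * N * (2 + cmod (Complex 1 y)) ^ n" by (simp add: A1_def mult_ac)
      also have "\<dots> \<le> (A0 + A1) * N * (3 + \<bar>y\<bar>) ^ n"
        using A N y3 by (intro mult_mono) auto
      finally show "nrm X1 (J (Complex 1 y)) \<le> (A0 + A1) * N * (3 + \<bar>y\<bar>) ^ n" .
    qed
    thus "\<exists>h\<in>pts F. \<T> n (of_real b) h = \<T> n (of_real a) f \<and> nrm F h \<le> Kc * (A0 + A1) * N"
      by (simp add: x_def mult.assoc)
  qed
qed

text \<open>An array with entries in both spaces is the exact expansion of a polynomial with such
  coefficients; the polynomial has polynomial growth on the strip and \<open>glue\<close> applies to
  it.\<close>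

lemma inter_power_subset:
  assumes n: "n \<ge> 1" and c: "0 < c" "c < 1" and x: "x \<in> pts (power_space n (inter_space X0 X1))"
  shows "x \<in> pts (\<R> n c)"
proof -
  define J where "J z = (\<Sum>i<n. ((z - of_real c) ^ (n - 1 - i)) *\<^sub>C x i)" for z :: complex
  have x0: "i < n \<Longrightarrow> x i \<in> pts X0" and x1: "i < n \<Longrightarrow> x i \<in> pts X1" and xn: "i \<ge> n \<Longrightarrow> x i = 0" for i
    using x by (auto simp: power_space_pts inter_space_def)
  have xS: "i < n \<Longrightarrow> x i \<in> pts \<Sigma>" for i using x0 \<Sigma>_sub by blast
  have Jm: "J z \<in> pts X" if "nsp X" "\<And>i. i < n \<Longrightarrow> x i \<in> pts X" for X z
    unfolding J_def using that by (auto intro!: nsp.sum_mem nsp.scale_mem)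
  have Jc: "ncont X A (\<lambda>y. J (g y))" if "nsp X" "\<And>i. i < n \<Longrightarrow> x i \<in> pts X" "continuous_on A g" for X and A :: "'b::t2_space set" and g
    unfolding J_def
    by (intro nsp.ncont_sum[OF that(1)] nsp.ncont_scale[OF that(1)] nsp.ncont_const[OF that(1)] continuous_intros)
      (use that in auto)
  have Jle: "nrm X (J z) \<le> (\<Sum>i<n. nrm X (x i)) * (2 + cmod z) ^ n" if X: "nsp X" "\<And>i. i < n \<Longrightarrow> x i \<in> pts X" for X z
  proof -
    interpret X: nsp X by fact
    have "nrm X (J z) \<le> (\<Sum>i<n. nrm X ((z - of_real c) ^ (n - 1 - i) *\<^sub>C x i))"
      unfolding J_def using X by (intro X.nrm_sum X.scale_mem) auto
    also have "\<dots> \<le> (\<Sum>i<n. nrm X (x i) * (2 + cmod z) ^ n)"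
    proof (rule sum_mono)
      fix i assume i: "i \<in> {..<n}"
      have "cmod (z - of_real c) \<le> 2 + cmod z" using norm_triangle_ineq4[of z "of_real c"] c by simp
      hence "cmod (z - of_real c) ^ (n - 1 - i) \<le> (2 + cmod z) ^ (n - 1 - i)" by (intro power_mono) auto
      also have "\<dots> \<le> (2 + cmod z) ^ n"
        using norm_ge_zero[of z] by (intro power_increasing) (simp, linarith)
      finally show "nrm X ((z - of_real c) ^ (n - 1 - i) *\<^sub>C x i) \<le> nrm X (x i) * (2 + cmod z) ^ n"
        using i X X.nrm_ge0 by (simp add: X.nrm_scale norm_power mult.commute mult_left_mono)
    qed
    finally show ?thesis by (simp add: sum_distrib_right)
  qed
  define N where "N = (\<Sum>i<n. nrm X0 (x i)) + (\<Sum>i<n. nrm X1 (x i))"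
  have N: "(\<Sum>i<n. nrm X0 (x i)) \<le> N" "(\<Sum>i<n. nrm X1 (x i)) \<le> N" "N \<ge> 0"
    unfolding N_def using x0 x1 by (auto intro!: sum_nonneg add_nonneg_nonneg X0.nrm_ge0 X1.nrm_ge0)
  have NJ: "nrm X (J (Complex j y)) \<le> N * (3 + \<bar>y\<bar>) ^ n"
    if "nsp X" "\<And>i. i < n \<Longrightarrow> x i \<in> pts X" "(\<Sum>i<n. nrm X (x i)) \<le> N" "\<bar>j\<bar> \<le> 1" for X y j
  proof -
    have "cmod (Complex j y) \<le> 1 + \<bar>y\<bar>" using cmod_le[of "Complex j y"] that(4) by simp
    thus ?thesis using N(3)
      by (intro order_trans[OF Jle[OF that(1,2)]] mult_mono that(3) power_mono) auto
  qed
  have c1: "continuous_on UNIV (\<lambda>y. Complex j y)" for j by (auto simp: Complex_eq intro!: continuous_intros)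
  have lJ: "l (J z) = (\<Sum>i<n. l (x i) * (z - of_real c) ^ (n - 1 - i))" if "l \<in> \<D>" for l z
    unfolding J_def
    by (subst S.dual_sum[OF that]) (auto simp: S.dual_scale[OF that] xS S.scale_mem mult.commute intro!: sum.cong)
  have J: "jet_function n c J x"
    unfolding jet_function_def
  proof (intro conjI exI ballI)
    show "analytic_into \<Sigma> J \<S>"
    proof (rule S.weakly_analytic[OF open_strip])
      show "J ` \<S> \<subseteq> pts \<Sigma>" using Jm[OF S.nsp_axioms xS] by blast
      show "(\<lambda>z. l (J z)) holomorphic_on \<S>" if "l \<in> \<D>" for l
        unfolding lJ[OF that] by (intro holomorphic_intros)
      show "\<exists>r>0. \<exists>B. \<forall>w\<in>ball z r \<inter> \<S>. nrm \<Sigma> (J w) \<le> B" for z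
        by (rule growth_locally_bounded[OF Jle[OF S.nsp_axioms xS]]) (auto intro!: sum_nonneg S.nrm_ge0 xS)
    qed
    show "ncont \<Sigma> cstrip J" by (rule Jc[OF S.nsp_axioms xS continuous_on_id])
    show "x \<in> pts (\<P> n)" using xS xn by (simp add: power_space_pts)
    show "(1::real) > 0" by simp
    show "nrm \<Sigma> (J z) \<le> (\<Sum>i<n. nrm \<Sigma> (x i)) * (2 + cmod z) ^ n" for z by (rule Jle[OF S.nsp_axioms xS])
    show "cmod (l (J w) - (\<Sum>i<n. l (x i) * (w - of_real c) ^ (n - 1 - i))) \<le> 0 * cmod (w - of_real c) ^ n"
      if "l \<in> \<D>" for l w unfolding lJ[OF that] by simp
  qed
  have bX: "ncont X0 UNIV (\<lambda>y. J (Complex 0 y))" "nrm X0 (J (Complex 0 y)) \<le> N * (3 + \<bar>y\<bar>) ^ n"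
    "ncont X1 UNIV (\<lambda>y. J (Complex 1 y))" "nrm X1 (J (Complex 1 y)) \<le> N * (3 + \<bar>y\<bar>) ^ n" for y
    by (auto intro!: Jc NJ X0.nsp_axioms X1.nsp_axioms x0 x1 N c1)
  have "\<exists>f\<in>pts F. \<T> n (of_real c) f = x"
    by (rule glue[OF n c]) (use J bX in blast)
  thus ?thesis by (force simp: rochberg_space_def quotient_space_def)
qed

end

section \<open>Gaussian averages and approximation by arrays with entries in
  \<open>X0\<close>\<close>

lemma weight_gaussian:
  "weight t * (1 + \<bar>t\<bar>) ^ k * exp (- (t - s)\<^sup>2) \<le> (1 + \<bar>s\<bar>) ^ (3 + k) * exp (2 * real (3 + k) + (real (3 + k))\<^sup>2)"
proof -
  have "\<bar>t\<bar> \<le> \<bar>t - s\<bar> + \<bar>s\<bar>" "0 \<le> \<bar>s\<bar> * \<bar>t - s\<bar>" by simp_all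
  hence "1 + \<bar>t\<bar> \<le> 3 + \<bar>t - s\<bar> + 3 * \<bar>s\<bar> + \<bar>s\<bar> * \<bar>t - s\<bar>" by linarith
  hence "1 + \<bar>t\<bar> \<le> (1 + \<bar>s\<bar>) * (3 + \<bar>t - s\<bar>)" by (simp add: algebra_simps)
  hence "(1 + \<bar>t\<bar>) ^ (3 + k) \<le> ((1 + \<bar>s\<bar>) * (3 + \<bar>t - s\<bar>)) ^ (3 + k)" by (intro power_mono) auto
  moreover have "weight t * (1 + \<bar>t\<bar>) ^ k \<le> (1 + \<bar>t\<bar>) ^ (3 + k)"
    unfolding power_add by (intro mult_right_mono weight_le) auto
  ultimately have "weight t * (1 + \<bar>t\<bar>) ^ k \<le> (1 + \<bar>s\<bar>) ^ (3 + k) * (3 + \<bar>t - s\<bar>) ^ (3 + k)"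
    unfolding power_mult_distrib by linarith
  hence "weight t * (1 + \<bar>t\<bar>) ^ k * exp (- (t - s)\<^sup>2) \<le> (1 + \<bar>s\<bar>) ^ (3 + k) * ((3 + \<bar>t - s\<bar>) ^ (3 + k) * exp (- (t - s)\<^sup>2))"
    unfolding mult.assoc[symmetric, of "(1 + \<bar>s\<bar>) ^ (3 + k)"] by (intro mult_right_mono) auto
  also have "\<dots> \<le> (1 + \<bar>s\<bar>) ^ (3 + k) * exp (2 * real (3 + k) + (real (3 + k))\<^sup>2)"
    by (intro mult_left_mono polynomial_gaussian_bounded) auto
  finally show ?thesis .
qed

text \<open>The compactified integrand is continuous and nonnegative, and at \<open>s = 1/2\<close>
  it equals \<open>pi\<close>.\<close>

lemma gaussian_integral_nonzero: "cline_int (\<lambda>t. of_real (exp (- t\<^sup>2))) \<noteq> 0"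
proof
  let ?\<psi> = "\<lambda>t. complex_of_real (exp (- t\<^sup>2))"
  assume 0: "cline_int ?\<psi> = 0"
  have r: "crapid (exp 15) ?\<psi>"
    unfolding crapid_def using weight_gaussian[of _ 0 0] by (auto intro!: continuous_intros)
  define h where "h s = Re (cmpt ?\<psi> s)" for s
  have "(cmpt ?\<psi> has_integral 0) {0..1}"
    using integrable_integral[OF cmpt_integrable[OF r]] 0 by (simp add: cline_int_def)
  from has_integral_Re[OF this] have "integral {0..1} h = 0" unfolding h_def by (simp add: integral_unique)
  moreover have "continuous_on {0..1} h"
    unfolding h_def by (intro continuous_intros crapid_compactify_continuous[OF r])
  moreover have "h s \<ge> 0" for s by (auto simp: h_def intro!: mult_nonneg_nonneg simp flip: of_real_power of_real_add of_real_mult)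
  ultimately have "h (1/2) = 0" using integral_eq_0_iff[of 0 1 h] by simp
  thus False by (simp add: h_def line_param_def)
qed

context couple
begin

text \<open>
  Gaussian averages along vertical lines. Moving the contour to the line \<open>Re v = 0\<close>, the average of \<open>f\<close> is given
  by an integral over boundary values in \<open>X0\<close> that is entire in \<open>z\<close>.
\<close>

lemma gaussian_average:
  assumes f: "f \<in> pts F" and \<eta>: "\<eta> > 0"
  obtains V where "analytic_into X0 V UNIV"
    "\<And>l x. l \<in> \<D> \<Longrightarrow> 0 < x \<Longrightarrow> x < 1 \<Longrightarrow>
      cline_int (\<lambda>t. of_real (exp (- t\<^sup>2)) * l (f (Complex x (\<eta> * t)))) = l (V (of_real x))"
proof -
  \<comment> \<open>The Gaussian seen from the line \<open>Re = 0\<close> in the rescaled variable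
    \<open>v / \<eta>\<close>; as a function of \<open>z\<close> it is entire, which is why the
    average continues to the whole plane.\<close>
  define E where "E z t = exp ((\<i> * of_real t - z / of_real \<eta>)\<^sup>2)" for z t
  define V where "V z = line_int X0 (\<lambda>t. E z t *\<^sub>C f (Complex 0 (\<eta> * t)))" for z
  define m where "m z = exp ((Re z / \<eta>)\<^sup>2) * ((1 + \<bar>Im z / \<eta>\<bar>) ^ 3 * exp 15)" for z
  define N where "N = nrm F f"
  have N: "N \<ge> 0" unfolding N_def by (rule F_nrm_ge0[OF f])
  have m0: "m z \<ge> 0" for z by (simp add: m_def)
  have E_norm: "cmod (E z t) = exp ((Re z / \<eta>)\<^sup>2) * exp (- (t - Im z / \<eta>)\<^sup>2)" for z t
  proof -
    have "Re ((\<i> * of_real t - w)\<^sup>2) = (Re w)\<^sup>2 - (t - Im w)\<^sup>2" for w by (simp add: power2_eq_square algebra_simps)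
    thus ?thesis unfolding E_def norm_exp_eq_Re by (simp flip: exp_add)
  qed
  have E_le: "weight t * cmod (E z t) \<le> m z" for z t
    using mult_left_mono[OF weight_gaussian[of t 0 "Im z / \<eta>"], of "exp ((Re z / \<eta>)\<^sup>2)"]
    by (simp add: E_norm m_def mult_ac)
  have fm: "f (Complex 0 t) \<in> pts X0" for t by (rule F_D(5)[OF f])
  have fle: "nrm X0 (f (Complex 0 t)) \<le> N" for t unfolding N_def by (rule F_D(9)[OF f])
  have fc: "ncont X0 UNIV (\<lambda>t. f (Complex 0 (\<eta> * t)))"
    by (rule X0.ncont_compose[OF F_D(3)[OF f]]) (auto intro!: continuous_intros)
  have wE: "weight t * nrm X0 (E z t *\<^sub>C f (Complex 0 (\<eta> * t))) \<le> m z * N" for z t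
    unfolding X0.nrm_scale[OF fm] mult.assoc[symmetric]
    using E_le fle N m0 X0.nrm_ge0[OF fm] weight_ge(4)[of t] by (intro mult_mono) auto
  have rap: "rapid X0 (m z * N) (\<lambda>t. E z t *\<^sub>C f (Complex 0 (\<eta> * t)))" for z
    unfolding rapid_def using wE by (auto simp: E_def intro!: X0.ncont_scale fc continuous_intros)
  have mloc: "\<exists>B. \<forall>z\<in>L. m z * N \<le> B" if "compact L" for L
  proof -
    have "continuous_on L (\<lambda>z. m z * N)" unfolding m_def using \<eta> by (intro continuous_intros) auto
    from compact_imp_bounded[OF compact_continuous_image[OF this that]] show ?thesis
      by (auto simp: bounded_iff dest: order_trans[OF abs_ge_self])
  qed
  have wV: "(\<lambda>z. l (V z)) holomorphic_on UNIV" if l: "l \<in> dual_ball X0" for l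
  proof -
    have "\<exists>g. g holomorphic_on UNIV \<and> (\<forall>z\<in>UNIV. cmod (g z) \<le> pi * (m z * N)) \<and>
      (\<forall>z\<in>UNIV. \<forall>M'. crapid M' (\<lambda>t. l (E z t *\<^sub>C f (Complex 0 (\<eta> * t)))) \<longrightarrow> g z = cline_int (\<lambda>t. l (E z t *\<^sub>C f (Complex 0 (\<eta> * t)))))"
    proof (rule cline_int_extension[OF open_UNIV])
      show "(\<lambda>z. l (E z t *\<^sub>C f (Complex 0 (\<eta> * t)))) holomorphic_on UNIV" for t
        unfolding X0.dual_scale[OF l fm] E_def using \<eta> by (intro holomorphic_intros) auto
      show "(1 + t\<^sup>2) * cmod (l (E z t *\<^sub>C f (Complex 0 (\<eta> * t)))) \<le> m z * N" for t z
        using mult_mono[OF weight_ge(2)[of t] X0.dual_le[OF l X0.scale_mem[OF fm, of "E z t" "\<eta> * t"]]] wE[of t z] weight_ge(4)[of t]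
        by force
    qed (use mloc in auto)
    then obtain g where "g holomorphic_on UNIV" "\<And>z. g z = cline_int (\<lambda>t. l (E z t *\<^sub>C f (Complex 0 (\<eta> * t))))"
      using X0.crapid_dual[OF l rap] by blast
    thus ?thesis unfolding V_def X0.dual_line_int[OF l rap] by (metis (no_types, lifting) holomorphic_transform)
  qed
  have "analytic_into X0 V UNIV"
  proof (rule X0.weakly_analytic[OF open_UNIV _ wV])
    show "range V \<subseteq> pts X0" unfolding V_def using X0.line_int_mem[OF rap] by blast
    fix z
    obtain B where B: "\<And>w. w \<in> cball z 1 \<Longrightarrow> m w * N \<le> B" using mloc[OF compact_cball, of z 1] by blast
    have "nrm X0 (V w) \<le> pi * B" if "w \<in> ball z 1" for w
    proof -
      have "nrm X0 (V w) \<le> pi * (m w * N)" unfolding V_def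
      proof (rule X0.line_int_nrm_le[OF rap])
        show "(1 + t\<^sup>2) * nrm X0 (E w t *\<^sub>C f (Complex 0 (\<eta> * t))) \<le> m w * N" for t
          using mult_right_mono[OF weight_ge(2)[of t] X0.nrm_ge0[OF X0.scale_mem[OF fm, of "E w t" "\<eta> * t"]]] wE[of t w] by linarith
      qed
      also have "\<dots> \<le> pi * B" using B[of w] that by (intro mult_left_mono) auto
      finally show ?thesis .
    qed
    thus "\<exists>r>0. \<exists>B. \<forall>w\<in>ball z r \<inter> UNIV. nrm X0 (V w) \<le> B" by (metis IntD1 zero_less_one)
  qed
  thus ?thesis
  proof (rule that)
    fix l x assume l: "l \<in> \<D>" and x: "0 < x" "x < (1::real)"
    have l0: "l \<in> dual_ball X0"
      using l \<Sigma>_sub(1) \<Sigma>_le(1) unfolding dual_ball_def by (auto simp: subset_iff) (meson order_trans)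
    define b where "b = x / \<eta>"
    define s0 where "s0 = complex_of_real (b / 2)"
    have b: "b > 0" using x \<eta> by (simp add: b_def)
    \<comment> \<open>The extra factor \<open>s - s0\<close> cancels the Cauchy kernel at
      \<open>s0\<close> and makes \<open>G s0 = 0\<close>, so Cauchy's formula becomes equality of
      the two line integrals, that is, a shift of contour.\<close>
    define G where "G s = exp ((s - of_real b)\<^sup>2) * l (f (of_real \<eta> * s)) * (s - s0)" for s
    have sc: "of_real \<eta> * s \<in> cstrip" if "0 \<le> Re s" "Re s \<le> b" for s
      using that \<eta> x mult_left_mono[of "Re s" b \<eta>] by (simp add: b_def)
    have "cline_int (\<lambda>t. G (Complex b t) / (Complex b t - s0)) - cline_int (\<lambda>t. G (Complex 0 t) / (Complex 0 t - s0)) = 2 * pi * G s0"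
    proof (rule Cauchy_strip[OF b])
      show "continuous_on {z. 0 \<le> Re z \<and> Re z \<le> b} G"
        unfolding G_def
        by (intro continuous_intros continuous_on_compose2[OF S.dual_continuous_on[OF l F_D(2)[OF f]]]) (use sc in auto)
      show "G holomorphic_on strip 0 b"
      proof -
        have "((\<lambda>z. l (f z)) \<circ> (\<lambda>s. of_real \<eta> * s)) holomorphic_on strip 0 b"
        proof (rule holomorphic_on_compose_gen[OF _ F_holomorphic[OF f l]])
          show "(*) (complex_of_real \<eta>) ` strip 0 b \<subseteq> \<S>"
            using \<eta> x by (auto simp: strip_def b_def pos_less_divide_eq mult.commute[of \<eta>])
        qed (intro holomorphic_intros)
        thus ?thesis unfolding G_def by (intro holomorphic_intros) (simp add: o_def)
      qed
      show "s0 \<in> strip 0 b" using b by (simp add: s0_def strip_def)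
      fix s assume s: "0 \<le> Re s" "Re s \<le> b"
      have "cmod (exp ((s - of_real b)\<^sup>2)) = exp ((Re s - b)\<^sup>2) * exp (- (Im s - 0)\<^sup>2)"
        unfolding norm_exp_eq_Re by (simp add: power2_eq_square flip: exp_add)
      also have "\<dots> \<le> exp (b\<^sup>2) * exp (- (Im s - 0)\<^sup>2)"
        using s power_mono[of "b - Re s" b 2] by (intro mult_right_mono) (auto simp: power2_commute)
      finally have 1: "cmod (exp ((s - of_real b)\<^sup>2)) \<le> exp (b\<^sup>2) * exp (- (Im s - 0)\<^sup>2)" .
      have 2: "cmod (l (f (of_real \<eta> * s))) \<le> N"
        unfolding N_def using S.dual_le[OF l F_D(8)[OF f sc[OF s]]] F_\<Sigma>_le[OF f sc[OF s]] by simp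
      have "cmod (s - s0) \<le> \<bar>Re s - b / 2\<bar> + \<bar>Im s\<bar>" using cmod_le[of "s - s0"] by (simp add: s0_def)
      also have "\<dots> \<le> (1 + b) * (1 + \<bar>Im s\<bar>)"
        using s b mult_nonneg_nonneg[of b "\<bar>Im s\<bar>"] unfolding distrib_left distrib_right by linarith
      finally have 3: "cmod (s - s0) \<le> (1 + b) * (1 + \<bar>Im s\<bar>)" .
      have "weight (Im s) * cmod (G s) \<le> weight (Im s) * ((exp (b\<^sup>2) * exp (- (Im s - 0)\<^sup>2)) * N * ((1 + b) * (1 + \<bar>Im s\<bar>)))"
        unfolding G_def norm_mult using 1 2 3 N b weight_ge(4)[of "Im s"] by (intro mult_left_mono mult_mono) auto
      also have "\<dots> = (exp (b\<^sup>2) * N * (1 + b)) * (weight (Im s) * (1 + \<bar>Im s\<bar>) ^ 1 * exp (- (Im s - 0)\<^sup>2))" by (simp add: mult_ac)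
      also have "\<dots> \<le> (exp (b\<^sup>2) * N * (1 + b)) * ((1 + \<bar>0\<bar>) ^ (3 + 1) * exp (2 * real (3 + 1) + (real (3 + 1))\<^sup>2))"
        using N b by (intro mult_left_mono weight_gaussian) auto
      finally show "weight (Im s) * cmod (G s) \<le> (exp (b\<^sup>2) * N * (1 + b)) * ((1 + \<bar>0\<bar>) ^ (3 + 1) * exp (2 * real (3 + 1) + (real (3 + 1))\<^sup>2))" .
    qed
    moreover have "G s0 = 0" by (simp add: G_def)
    moreover have "G (Complex b t) / (Complex b t - s0) = of_real (exp (- t\<^sup>2)) * l (f (Complex x (\<eta> * t)))" for t
    proof -
      have "Complex b t - s0 \<noteq> 0" "Complex b t - of_real b = \<i> * of_real t" "of_real \<eta> * Complex b t = Complex x (\<eta> * t)"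
        using b \<eta> by (auto simp: complex_eq_iff s0_def b_def)
      thus ?thesis by (simp add: G_def power_mult_distrib exp_of_real[symmetric])
    qed
    moreover have "G (Complex 0 t) / (Complex 0 t - s0) = l (E (of_real x) t *\<^sub>C f (Complex 0 (\<eta> * t)))" for t
    proof -
      have "Complex 0 t - s0 \<noteq> 0" "Complex 0 t - of_real b = \<i> * of_real t - of_real x / of_real \<eta>" "of_real \<eta> * Complex 0 t = Complex 0 (\<eta> * t)"
        using b \<eta> by (auto simp: complex_eq_iff s0_def b_def)
      thus ?thesis unfolding X0.dual_scale[OF l0 fm] by (simp add: G_def E_def)
    qed
    ultimately show "cline_int (\<lambda>t. of_real (exp (- t\<^sup>2)) * l (f (Complex x (\<eta> * t)))) = l (V (of_real x))"
      unfolding V_def X0.dual_line_int[OF l0 rap] by simp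
  qed
qed

text \<open>Derivatives formed in \<open>X0\<close> are also derivatives in \<open>\<Sigma>\<close>,
  so the array computed in \<open>\<Sigma>\<close> has entries in \<open>X0\<close>.\<close>

lemma analytic_into_X0:
  assumes V: "analytic_into X0 V UNIV"
  shows "analytic_into \<Sigma> V UNIV" and "\<T> n z V = taylor_array X0 n z V"
proof -
  have d: "has_cderiv \<Sigma> g D z" if "has_cderiv X0 g D z" for g D z
    unfolding S.has_cderiv_iff
  proof (intro conjI)
    let ?q = "\<lambda>w. inverse (w - z) *\<^sub>C (g w - g z)"
    have D: "D \<in> pts X0" "\<forall>\<^sub>F w in at z. ?q w \<in> pts X0" and l: "((\<lambda>w. nrm X0 (?q w - D)) \<longlongrightarrow> 0) (at z)"
      using that unfolding X0.has_cderiv_iff by auto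
    show "D \<in> pts \<Sigma>" "\<forall>\<^sub>F w in at z. ?q w \<in> pts \<Sigma>"
      using D \<Sigma>_sub(1) by (auto elim!: eventually_mono)
    have "\<forall>\<^sub>F w in at z. norm (nrm \<Sigma> (?q w - D)) \<le> nrm X0 (?q w - D)"
      using D(2)
    proof (rule eventually_mono)
      fix w assume "?q w \<in> pts X0"
      hence m: "?q w - D \<in> pts X0" using D(1) X0.diff_mem by blast
      thus "norm (nrm \<Sigma> (?q w - D)) \<le> nrm X0 (?q w - D)"
        using \<Sigma>_le(1)[OF m] S.nrm_ge0 \<Sigma>_sub(1) by (simp add: subset_iff)
    qed
    thus "((\<lambda>w. nrm \<Sigma> (?q w - D)) \<longlongrightarrow> 0) (at z)" by (rule Lim_null_comparison[OF _ l])
  qed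
  show "analytic_into \<Sigma> V UNIV" using V d \<Sigma>_sub(1) unfolding analytic_into_def by blast
  have "(cderiv \<Sigma> ^^ k) V = (cderiv X0 ^^ k) V" for k
  proof (induction k)
    case (Suc k)
    have "cderiv \<Sigma> ((cderiv X0 ^^ k) V) z = cderiv X0 ((cderiv X0 ^^ k) V) z" for z
      by (rule S.cderiv_eqI[OF d[OF X0.analytic_has_cderiv[OF X0.analytic_higher_cderiv(1)[OF open_UNIV V] UNIV_I]]])
    thus ?case by (intro ext) (simp add: Suc)
  qed simp
  thus "\<T> n z V = taylor_array X0 n z V" by (simp add: taylor_array_def cong: if_cong)
qed

text \<open>\<open>h\<close> is \<open>f\<close> damped by the cutoff, and \<open>g\<close> the
  normalised Gaussian average of damped translates, close to \<open>h\<close> by norm continuity of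
  \<open>cutoff_shift\<close>. On real points the cutoff leaves the average, so \<open>g\<close> is
  a multiple of \<open>cutoff\<close> times the \<open>X0\<close>-valued \<open>V\<close>, whose
  array at \<open>a\<close> it shares up to that multiple.\<close>

lemma rochberg_approx:
  assumes f: "f \<in> pts F" and a: "0 < a" "a < 1" and n: "n \<ge> 1" and e: "e > 0"
  obtains g h where "g \<in> pts F" "h \<in> pts F" "\<T> n (of_real a) h = \<T> n (of_real a) f"
    "nrm F (h - g) < e" "\<And>i. i < n \<Longrightarrow> \<T> n (of_real a) g i \<in> pts X0"
proof -
  interpret FB: bsp F by unfold_locales (rule banach_F)
  define \<psi> where "\<psi> t = complex_of_real (exp (- t\<^sup>2))" for t
  define c0 where "c0 = cline_int \<psi>"
  have c0: "c0 \<noteq> 0" unfolding c0_def \<psi>_def by (rule gaussian_integral_nonzero)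
  define s where "s = cutoff_shift n a f"
  note sF = cutoff_shift_F[OF f a, of n, folded s_def]
  obtain B where B: "\<And>t. nrm F (s t) \<le> B" using sF(4) by blast
  have B0: "B \<ge> 0" using B[of 0] F_nrm_ge0[OF sF(1)[of 0]] by linarith
  have gauss: "weight t * exp (- t\<^sup>2) \<le> exp 15" for t using weight_gaussian[of t 0 0] by simp
  have rap: "rapid F (exp 15 * B) (\<lambda>t. \<psi> t *\<^sub>C s (\<eta> * t))" for \<eta>
    unfolding rapid_def
  proof (intro conjI allI)
    have "ncont F UNIV (\<lambda>t. s (\<eta> * t))"
      by (rule F.ncont_compose[OF sF(2)]) (auto intro!: continuous_intros)
    thus "ncont F UNIV (\<lambda>t. \<psi> t *\<^sub>C s (\<eta> * t))"
      by (intro F.ncont_scale) (auto simp: \<psi>_def intro!: continuous_intros)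
    show "weight t * nrm F (\<psi> t *\<^sub>C s (\<eta> * t)) \<le> exp 15 * B" for t
      unfolding F.nrm_scale[OF sF(1)] mult.assoc[symmetric]
      using gauss[of t] B F_nrm_ge0[OF sF(1)] by (intro mult_mono) (auto simp: \<psi>_def)
  qed
  define \<delta> where "\<delta> = e * cmod c0 / (2 * pi)"
  have \<delta>: "\<delta> > 0" using e c0 by (simp add: \<delta>_def)
  obtain d where d: "d > 0" "\<And>t. \<bar>t\<bar> < d \<Longrightarrow> nrm F (s t - s 0) \<le> \<delta> / exp 15"
  proof -
    have "((\<lambda>t. nrm F (s t - s 0)) \<longlongrightarrow> 0) (at 0)" using sF(2) by (simp add: ncont_def)
    then obtain d where "d > 0" "\<And>t. t \<noteq> 0 \<Longrightarrow> dist t 0 < d \<Longrightarrow> dist (nrm F (s t - s 0)) 0 < \<delta> / exp 15"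
      using \<delta> unfolding tendsto_iff eventually_at by (metis UNIV_I divide_pos_pos exp_gt_zero)
    hence "nrm F (s t - s 0) \<le> \<delta> / exp 15" if "\<bar>t\<bar> < d" for t
      using \<delta> that by (cases "t = 0") (force simp: dist_real_def)+
    with \<open>d > 0\<close> show ?thesis using that by blast
  qed
  define R where "R = 2 * B * exp 15 / \<delta>"
  have R: "R \<ge> 0" using B0 \<delta> by (simp add: R_def)
  define \<eta> where "\<eta> = d / (R + 1)"
  have \<eta>: "\<eta> > 0" using d R by (simp add: \<eta>_def)
  define g' where "g' = line_int F (\<lambda>t. \<psi> t *\<^sub>C s (\<eta> * t))"
  have g': "g' \<in> pts F" unfolding g'_def by (rule FB.line_int_mem[OF rap])
  \<comment> \<open>With \<open>\<eta> = 0\<close> nothing is averaged, so closeness can be measured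
    as a distance of two line integrals.\<close>
  have const: "line_int F (\<lambda>t. \<psi> t *\<^sub>C s (0 * t)) = c0 *\<^sub>C s 0"
  proof (rule F.dual_eqI[OF FB.line_int_mem[OF rap] F.scale_mem[OF sF(1)]])
    fix l assume l: "l \<in> dual_ball F"
    show "l (line_int F (\<lambda>t. \<psi> t *\<^sub>C s (0 * t))) = l (c0 *\<^sub>C s 0)"
      unfolding F.dual_scale[OF l sF(1)] FB.dual_line_int[OF l rap]
      using cline_int_cmult[of "l (s 0)" \<psi>] by (simp add: c0_def F.dual_scale[OF l sF(1)] mult.commute)
  qed
  have "nrm F (g' - c0 *\<^sub>C s 0) \<le> pi * \<delta>"
    unfolding g'_def const[symmetric]
  proof (rule FB.line_int_dist[OF rap rap])
    fix t
    have m: "s (\<eta> * t) - s (0 * t) \<in> pts F" using sF(1) F.diff_mem by blast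
    have eq: "nrm F (\<psi> t *\<^sub>C s (\<eta> * t) - \<psi> t *\<^sub>C s (0 * t)) = exp (- t\<^sup>2) * nrm F (s (\<eta> * t) - s 0)"
      unfolding scaleC.scale_right_diff_distrib[symmetric] F.nrm_scale[OF m] by (simp add: \<psi>_def)
    have d0: "0 \<le> nrm F (s (\<eta> * t) - s 0)" "nrm F (s (\<eta> * t) - s 0) \<le> 2 * B"
      using F_nrm_ge0[OF m] F.nrm_diff[OF sF(1) sF(1), of "\<eta> * t" 0] B[of "\<eta> * t"] B[of 0] by auto
    have "(1 + t\<^sup>2) * (exp (- t\<^sup>2) * nrm F (s (\<eta> * t) - s 0)) \<le> \<delta>"
    \<comment> \<open>For \<open>|t| \<le> R\<close> the translation \<open>\<eta> * t\<close> is
      below \<open>d\<close> and continuity at 0 is used; beyond \<open>R\<close> the spare factor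
      \<open>1 + |t|\<close> of \<open>weight\<close> makes the trivial bound \<open>2 * B\<close>
      sufficient.\<close>
    proof (cases "\<bar>t\<bar> \<le> R")
      case True
      hence "\<eta> * \<bar>t\<bar> \<le> \<eta> * R" using \<eta> by (intro mult_left_mono) auto
      also have "\<dots> < d" using d R by (simp add: \<eta>_def field_simps)
      finally have "nrm F (s (\<eta> * t) - s 0) \<le> \<delta> / exp 15" using d(2)[of "\<eta> * t"] \<eta> by (simp add: abs_mult)
      moreover have "(1 + t\<^sup>2) * exp (- t\<^sup>2) \<le> exp 15"
        using order_trans[OF mult_right_mono[OF weight_ge(2)[of t]] gauss[of t]] by simp
      ultimately have "((1 + t\<^sup>2) * exp (- t\<^sup>2)) * nrm F (s (\<eta> * t) - s 0) \<le> exp 15 * (\<delta> / exp 15)"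
        using d0 by (intro mult_mono) auto
      thus ?thesis by (simp add: mult.assoc)
    next
      case False
      hence "2 * B * exp 15 \<le> \<delta> * \<bar>t\<bar>" using \<delta> by (simp add: R_def field_simps)
      also have "\<dots> \<le> \<delta> * (1 + \<bar>t\<bar>)" using \<delta> by (intro mult_left_mono) auto
      finally have 1: "2 * B * exp 15 \<le> \<delta> * (1 + \<bar>t\<bar>)" .
      have "(1 + \<bar>t\<bar>) * ((1 + t\<^sup>2) * (exp (- t\<^sup>2) * nrm F (s (\<eta> * t) - s 0))) = (weight t * exp (- t\<^sup>2)) * nrm F (s (\<eta> * t) - s 0)"
        by (simp add: weight_def mult_ac)
      also have "\<dots> \<le> exp 15 * (2 * B)" by (rule mult_mono[OF gauss d0(2)]) (use d0 in auto)
      also have "\<dots> \<le> (1 + \<bar>t\<bar>) * \<delta>" using 1 by (simp add: mult_ac)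
      finally show ?thesis by (rule mult_left_le_imp_le) simp
    qed
    thus "(1 + t\<^sup>2) * nrm F (\<psi> t *\<^sub>C s (\<eta> * t) - \<psi> t *\<^sub>C s (0 * t)) \<le> \<delta>" unfolding eq .
  qed
  moreover have "c0 *\<^sub>C s 0 - g' \<in> pts F" by (intro F.diff_mem F.scale_mem sF(1) g')
  moreover have "s 0 - (1 / c0) *\<^sub>C g' = (1 / c0) *\<^sub>C (c0 *\<^sub>C s 0 - g')"
    using c0 by (simp add: scaleC.scale_right_diff_distrib)
  ultimately have "nrm F (s 0 - (1 / c0) *\<^sub>C g') \<le> pi * \<delta> / cmod c0"
    using F.nrm_commute[OF F.scale_mem[OF sF(1)] g', of c0 0] c0 by (simp add: F.nrm_scale norm_divide divide_right_mono)
  also have "\<dots> < e" using c0 e by (simp add: \<delta>_def)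
  finally have close: "nrm F (s 0 - (1 / c0) *\<^sub>C g') < e" .
  obtain V where V: "analytic_into X0 V UNIV"
    "\<And>l x. l \<in> \<D> \<Longrightarrow> 0 < x \<Longrightarrow> x < 1 \<Longrightarrow>
      cline_int (\<lambda>t. of_real (exp (- t\<^sup>2)) * l (f (Complex x (\<eta> * t)))) = l (V (of_real x))"
    by (rule gaussian_average[OF f \<eta>]) blast
  have VS: "analytic_into \<Sigma> V \<S>"
    by (rule analytic_into_subset[OF analytic_into_X0(1)[OF V(1)]]) simp
  have as: "complex_of_real a \<in> \<S>" using a by (simp add: strip_def)
  have Vm: "V z \<in> pts \<Sigma>" for z using V(1) \<Sigma>_sub(1) by (auto simp: analytic_into_def)
  have g'm: "g' z \<in> pts \<Sigma>" if "z \<in> \<S>" for z using F_D(8)[OF g'] that by (simp add: strip_def)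
  \<comment> \<open>The identity is verified on the real interval, where the averaging formula
    applies, and extended to the strip by the identity theorem.\<close>
  have g'V: "g' z = cutoff n a z *\<^sub>C V z" if z: "z \<in> \<S>" for z
  proof (rule S.dual_eqI[OF g'm[OF z] S.scale_mem[OF Vm]])
    fix l assume l: "l \<in> \<D>"
    have "l (g' z) - cutoff n a z * l (V z) = 0"
    proof (rule analytic_continuation[of "\<lambda>z. l (g' z) - cutoff n a z * l (V z)" "\<S>" "of_real ` {0<..<1}" "of_real a"])
      show "(\<lambda>z. l (g' z) - cutoff n a z * l (V z)) holomorphic_on \<S>"
        by (intro holomorphic_intros F_holomorphic[OF g' l] cutoff_holomorphic S.analytic_dual(1)[OF open_strip VS l])
      show "connected \<S>"
      proof -
        have "\<S> = {z. 0 < Re z} \<inter> {z. Re z < 1}" by (auto simp: strip_def)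
        thus ?thesis by (simp add: convex_connected convex_Int convex_halfspace_Re_gt convex_halfspace_Re_lt)
      qed
      show "complex_of_real a islimpt complex_of_real ` {0<..<1}"
        unfolding islimpt_approachable
      proof (intro allI impI)
        fix e :: real assume e: "e > 0"
        define y where "y = a + min (e / 2) ((1 - a) / 2)"
        have "y \<in> {0<..<1}" "y \<noteq> a" "\<bar>y - a\<bar> < e" using a e by (auto simp: y_def min_def field_simps)
        thus "\<exists>x'\<in>complex_of_real ` {0<..<1}. x' \<noteq> of_real a \<and> dist x' (of_real a) < e"
          by (auto simp: dist_norm simp flip: of_real_diff)
      qed
      fix w assume "w \<in> complex_of_real ` {0<..<1}"
      then obtain x where x: "w = of_real x" "0 < x" "x < 1" by auto
      have wc: "w \<in> cstrip" using x by simp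
      have L: "(\<lambda>h. l (h w)) \<in> dual_ball F"
        unfolding dual_ball_def
        using F_D(8)[OF _ wc] S.dual_add[OF l] S.dual_scale[OF l] order_trans[OF S.dual_le[OF l] F_\<Sigma>_le[OF _ wc]]
        by (auto simp: scaleC_fun_def)
      have "l ((\<psi> t *\<^sub>C s (\<eta> * t)) w) = cutoff n a w * (of_real (exp (- t\<^sup>2)) * l (f (Complex x (\<eta> * t))))" for t
      proof -
        have z: "w + \<i> * of_real (\<eta> * t) = Complex x (\<eta> * t)" "Complex x (\<eta> * t) \<in> cstrip" using x by (auto simp: Complex_eq)
        have "(\<psi> t *\<^sub>C s (\<eta> * t)) w = (\<psi> t * cutoff n a w) *\<^sub>C f (Complex x (\<eta> * t))"
          unfolding s_def scaleC_fun_def cutoff_shift_def shift_def z(1) by simp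
        thus ?thesis using S.dual_scale[OF l F_D(8)[OF f z(2)]] by (simp add: \<psi>_def)
      qed
      thus "l (g' w) - cutoff n a w * l (V w) = 0"
        using FB.dual_line_int[OF L rap, of \<eta>, folded g'_def] V(2)[OF l x(2,3)] x(1) by (simp add: cline_int_cmult)
    qed (use as z open_strip in \<open>auto simp: strip_def\<close>)
    thus "l (g' z) = l (cutoff n a z *\<^sub>C V z)" by (simp add: S.dual_scale[OF l Vm])
  qed
  obtain r where r: "r > 0" "\<And>z. z \<in> ball (complex_of_real a) r \<Longrightarrow> cmod (cutoff n a z - 1) \<le> cmod (z - of_real a) ^ n"
    by (rule cutoff_order[of a n]) (rule that)
  obtain r' B' where r': "r' > 0" "\<And>w. w \<in> ball (of_real a) r' \<Longrightarrow> nrm \<Sigma> (V w) \<le> B'"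
    using S.analytic_locally_bounded[OF open_strip VS as] by blast
  have "\<T> n (of_real a) g' = \<T> n (of_real a) V"
  proof (rule taylor_array_cong_order[OF open_strip as VS F_D(1)[OF g']])
    show "min r r' > 0" using r r' by simp
    fix w assume w: "w \<in> ball (complex_of_real a) (min r r')" "w \<in> \<S>"
    have eq: "g' w - V w = (cutoff n a w - 1) *\<^sub>C V w" using g'V[OF w(2)] by (simp add: scaleC.scale_left_diff_distrib)
    show "nrm \<Sigma> (g' w - V w) \<le> B' * cmod (w - of_real a) ^ n"
      unfolding eq S.nrm_scale[OF Vm] mult.commute[of B'] using r(2)[of w] r'(2)[of w] w S.nrm_ge0[OF Vm]
      by (intro mult_mono) auto
  qed
  hence T: "\<T> n (of_real a) g' i \<in> pts X0" for i
    unfolding analytic_into_X0(2)[OF V(1)] using X0.taylor_array_mem[OF open_UNIV V(1) UNIV_I] by simp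
  obtain C where "quotient_map F (\<P> n) (\<T> n (of_real a)) C" using taylor_F[OF as n] by blast
  then interpret Q: quotient_map F "\<P> n" "\<T> n (of_real a)" C .
  show ?thesis
  proof (rule that[of "(1 / c0) *\<^sub>C g'" "s 0"])
    show "\<T> n (of_real a) (s 0) = \<T> n (of_real a) f"
      using sF(3)[of 0] by (simp add: complex_of_real_def)
    show "\<T> n (of_real a) ((1 / c0) *\<^sub>C g') i \<in> pts X0" for i
      unfolding Q.T_scale[OF g'] by (simp add: scaleC_fun_def[of _ "taylor_array _ _ _ _"] X0.scale_mem[OF T])
  qed (use close sF(1) g' F.scale_mem in auto)
qed

end

section \<open>Conclusion\<close>

lemma normed_inter_space:
  assumes "nsp X" "nsp Y"
  shows "nsp (inter_space X Y)"
proof -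
  interpret X: nsp X by fact
  interpret Y: nsp Y by fact
  have "max (nrm X (x + y)) (nrm Y (x + y)) \<le> max (nrm X x) (nrm Y x) + max (nrm X y) (nrm Y y)"
    if "x \<in> pts X" "x \<in> pts Y" "y \<in> pts X" "y \<in> pts Y" for x y
    using X.nrm_add[of x y] Y.nrm_add[of x y] that by linarith
  moreover have "max (nrm X x) (nrm Y x) = 0 \<longleftrightarrow> x = 0" if "x \<in> pts X" "x \<in> pts Y" for x
    using X.nrm_ge0[OF that(1)] Y.nrm_ge0[OF that(2)] X.nrm_eq0[OF that(1)] Y.nrm_eq0[OF that(2)] by (auto simp: max_def)
  ultimately show ?thesis
    by unfold_locales
      (simp add: normed_space_def inter_space_def X.subspace Y.subspace scaleC.subspace_inter X.nrm_scale Y.nrm_scale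
        max_mult_distrib_left X.nrm_ge0 le_max_iff_disj)
qed

context couple
begin

text \<open>The first bound has constant 1, since passing to array functions does not increase
  norms. In the second, \<open>reiteration_upper\<close> gives an estimate for each \<open>N\<close>
  above the norm of \<open>g\<close>, which passes to the infimum.\<close>

lemma reiteration:
  fixes a b c :: real and n :: nat
  assumes ab: "0 < a" "a < c" "c < b" "b < 1" and n: "n \<ge> 1"
  defines "R \<equiv> \<R> n c"
    and "I \<equiv> interpolation_space (\<P> n) (\<R> n a) (\<R> n b) a b (of_real c)"
  shows "pts I = pts R" and "\<And>x. x \<in> pts R \<Longrightarrow> nrm I x \<le> nrm R x" and "\<exists>K>0. \<forall>x\<in>pts R. nrm R x \<le> K * nrm I x"
proof -
  define C where "C = calderon_space (\<P> n) (\<R> n a) (\<R> n b) a b"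
  have a_b: "a < b" using ab by simp
  have cs: "complex_of_real c \<in> \<S>" using ab by (simp add: strip_def)
  obtain D where "quotient_map F (\<P> n) (\<T> n (of_real c)) D" using taylor_F[OF cs n] by blast
  then interpret Q: quotient_map F "\<P> n" "\<T> n (of_real c)" D .
  have RQ: "R = Q.Q" by (simp add: R_def rochberg_space_def)
  obtain K where K: "K > 0" "\<And>g N. g \<in> pts C \<Longrightarrow> nrm C g < N \<Longrightarrow> \<exists>f\<in>pts F. \<T> n (of_real c) f = g (of_real c) \<and> nrm F f \<le> K * N"
    using reiteration_upper[OF ab n] unfolding C_def by blast
  have C0: "0 \<le> nrm C g" if "g \<in> pts C" for g
    using calderon_rochberg_D(7)[OF ab(1) a_b ab(4) n] that unfolding C_def by blast
  have Ip: "y \<in> pts I \<longleftrightarrow> (\<exists>g\<in>pts C. g (of_real c) = y)" for y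
    unfolding I_def interpolation_space_def quotient_space_def C_def by auto
  have In: "nrm I y = Inf {nrm C g | g. g \<in> pts C \<and> g (of_real c) = y}" for y
    unfolding I_def interpolation_space_def quotient_space_def C_def by simp
  have low: "\<exists>g\<in>pts C. g (of_real c) = \<T> n (of_real c) f \<and> nrm C g \<le> nrm F f" if "f \<in> pts F" for f
    using taylor_in_calderon[OF that ab(1) a_b ab(4) n] ab unfolding C_def by (intro bexI) auto
  show "pts I = pts R"
  proof
    show "pts I \<subseteq> pts R"
      unfolding RQ
    proof
      fix y assume "y \<in> pts I"
      then obtain g where g: "g \<in> pts C" "g (of_real c) = y" unfolding Ip by blast
      thus "y \<in> pts Q.Q" using K(2)[OF g(1), of "nrm C g + 1"] by (force simp: Q.Q_pts)
    qed
    show "pts R \<subseteq> pts I" unfolding RQ using low by (force simp: Ip Q.Q_pts)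
  qed
  show "nrm I x \<le> nrm R x" if "x \<in> pts R" for x
    unfolding RQ
  proof (rule Q.Q_nrm_ge)
    fix f assume f: "f \<in> pts F" "\<T> n (of_real c) f = x"
    obtain g where g: "g \<in> pts C" "g (of_real c) = x" "nrm C g \<le> nrm F f" using low[OF f(1)] f(2) by blast
    have "nrm I x \<le> nrm C g"
      unfolding In by (rule cInf_lower) (use g C0 in \<open>auto intro!: bdd_belowI[of _ 0]\<close>)
    thus "nrm I x \<le> nrm F f" using g(3) by simp
  qed (use that RQ in simp)
  have "nrm R x \<le> K * nrm I x" if x: "x \<in> pts R" for x
  proof -
    have "nrm R x / K \<le> nrm I x"
      unfolding In
    proof (rule cInf_greatest)
      show "{nrm C g | g. g \<in> pts C \<and> g (of_real c) = x} \<noteq> {}"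
        using x Ip \<open>pts I = pts R\<close> by auto
      fix y assume "y \<in> {nrm C g | g. g \<in> pts C \<and> g (of_real c) = x}"
      then obtain g where g: "g \<in> pts C" "g (of_real c) = x" "y = nrm C g" by blast
      show "nrm R x / K \<le> y"
      proof (rule dense_ge)
        fix N assume "y < N"
        then obtain f where "f \<in> pts F" "\<T> n (of_real c) f = x" "nrm F f \<le> K * N" using K(2)[OF g(1)] g by blast
        thus "nrm R x / K \<le> N" using Q.Q_nrm_le[of f] K(1) by (auto simp: RQ field_simps)
      qed
    qed
    thus ?thesis using K(1) by (simp add: field_simps)
  qed
  thus "\<exists>K>0. \<forall>x\<in>pts R. nrm R x \<le> K * nrm I x" using K(1) by blast
qed

text \<open>Since \<open>X0\<close> is contained in \<open>X1\<close>, arrays with entries in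
  \<open>X0\<close> lie in the power of the intersection. They approximate in the norm at
  \<open>a\<close> by \<open>rochberg_approx\<close>, and \<open>rochberg_mono\<close> transfers the
  smallness of the difference to \<open>b\<close>.\<close>

lemma dense_inter_power:
  assumes ab: "0 < a" "a < b" "b < 1" and n: "n \<ge> 1" and sub: "pts X0 \<subseteq> pts X1"
  shows "dense_in (pts (power_space n (inter_space X0 X1)))
    (inter_space (\<R> n a) (\<R> n b))" (is "dense_in ?D (inter_space ?Ra ?Rb)")
proof -
  have as: "complex_of_real a \<in> \<S>" "complex_of_real b \<in> \<S>" using ab by (auto simp: strip_def)
  obtain Ca Cb where Q: "quotient_map F (\<P> n) (\<T> n (of_real a)) Ca"
    "quotient_map F (\<P> n) (\<T> n (of_real b)) Cb"
    using taylor_F[OF as(1) n] taylor_F[OF as(2) n] by blast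
  interpret Qa: quotient_map F "\<P> n" "\<T> n (of_real a)" Ca by (rule Q)
  interpret Qb: quotient_map F "\<P> n" "\<T> n (of_real b)" Cb by (rule Q)
  have R: "?Ra = Qa.Q" "?Rb = Qb.Q" by (simp_all add: rochberg_space_def)
  interpret I: nsp "inter_space ?Ra ?Rb" unfolding R by (rule normed_inter_space[OF Qa.nsp_Q Qb.nsp_Q])
  have D: "?D \<subseteq> pts (inter_space ?Ra ?Rb)"
    using inter_power_subset[OF n, of a] inter_power_subset[OF n, of b] ab by (auto simp: inter_space_def)
  obtain K where K: "K > 0" "\<And>f N. f \<in> pts F \<Longrightarrow> nrm F f < N \<Longrightarrow>
    \<exists>h\<in>pts F. \<T> n (of_real b) h = \<T> n (of_real a) f \<and> nrm F h \<le> K * N"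
    by (rule rochberg_mono[OF ab n sub]) blast
  have "\<exists>y\<in>?D \<inter> pts (inter_space ?Ra ?Rb). nrm (inter_space ?Ra ?Rb) (x - y) < e"
    if x: "x \<in> pts (inter_space ?Ra ?Rb)" and e: "e > 0" for x e
  proof -
    obtain f where f: "f \<in> pts F" "x = \<T> n (of_real a) f"
      using x by (auto simp: inter_space_def R Qa.Q_pts)
    \<comment> \<open>Small enough for the norm at \<open>a\<close> directly and, after
      multiplication by \<open>K\<close>, for the norm at \<open>b\<close>.\<close>
    define d where "d = min e (e / (2 * K))"
    have d: "d > 0" "d \<le> e" "K * d < e" using e K(1) by (auto simp: d_def min_def field_simps)
    obtain g h where gh: "g \<in> pts F" "h \<in> pts F" "\<T> n (of_real a) h = x" "nrm F (h - g) < d"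
      "\<And>i. i < n \<Longrightarrow> \<T> n (of_real a) g i \<in> pts X0"
      by (rule rochberg_approx[OF f(1) ab(1) _ n d(1)]) (use ab f(2) in auto)
    define y where "y = \<T> n (of_real a) g"
    have hg: "h - g \<in> pts F" by (rule F.diff_mem[OF gh(2,1)])
    have y: "y \<in> ?D"
      using gh(5) sub by (auto simp: y_def power_space_pts inter_space_def taylor_array_def)
    have xy: "x - y = \<T> n (of_real a) (h - g)"
      using Qa.T_diff[OF gh(2,1)] gh(3) by (simp add: y_def)
    obtain k where k: "k \<in> pts F" "\<T> n (of_real b) k = x - y" "nrm F k \<le> K * d"
      using K(2)[OF hg gh(4)] unfolding xy by blast
    have "nrm ?Ra (x - y) < e" using Qa.Q_nrm_le[OF hg] gh(4) d(2) unfolding R xy by linarith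
    moreover have "nrm ?Rb (x - y) < e" using Qb.Q_nrm_le[OF k(1)] k(2,3) d(3) unfolding R by simp
    ultimately show ?thesis using y D by (auto simp: inter_space_def)
  qed
  thus ?thesis
    unfolding dense_in_def using D I.closure_iff by blast
qed

end

theorem proposition6p1:
  fixes W X0 X1 :: "'v::complex_vector nspace" and a b :: real and n :: nat
  assumes "compatible_couple W X0 X1"
    and "regular_couple X0 X1"
    and "0 < a" and "a < b" and "b < 1"
    and "n \<ge> 1"
  shows "compatible_couple (power_space n (sum_space X0 X1))
           (rochberg_space X0 X1 n (of_real a)) (rochberg_space X0 X1 n (of_real b)) \<and>
         (\<forall>c. a < c \<and> c < b \<longrightarrow>
           isomorphically_included (rochberg_space X0 X1 n (of_real c))
             (interpolation_space (power_space n (sum_space X0 X1))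
               (rochberg_space X0 X1 n (of_real a)) (rochberg_space X0 X1 n (of_real b))
               a b (of_real c))) \<and>
         (dense_in (pts (power_space n (inter_space X0 X1)))
             (inter_space (rochberg_space X0 X1 n (of_real a)) (rochberg_space X0 X1 n (of_real b))) \<longrightarrow>
           (\<forall>c. a < c \<and> c < b \<longrightarrow>
             equal_with_equivalent_norms
               (interpolation_space (power_space n (sum_space X0 X1))
                 (rochberg_space X0 X1 n (of_real a)) (rochberg_space X0 X1 n (of_real b))
                 a b (of_real c))
               (rochberg_space X0 X1 n (of_real c)))) \<and>
         (pts X0 \<subseteq> pts X1 \<longrightarrow>
           dense_in (pts (power_space n (inter_space X0 X1)))
             (inter_space (rochberg_space X0 X1 n (of_real a)) (rochberg_space X0 X1 n (of_real b))))"
proof -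
  interpret couple W X0 X1 by unfold_locales (rule assms(1))
  have n: "n \<ge> 1" by fact
  have as: "complex_of_real a \<in> strip 0 1" "complex_of_real b \<in> strip 0 1" using assms(3-5) by (auto simp: strip_def)
  have "isomorphically_included (rochberg_space X0 X1 n (of_real c))
      (interpolation_space (power_space n (sum_space X0 X1))
        (rochberg_space X0 X1 n (of_real a)) (rochberg_space X0 X1 n (of_real b)) a b (of_real c)) \<and>
    equal_with_equivalent_norms
      (interpolation_space (power_space n (sum_space X0 X1))
        (rochberg_space X0 X1 n (of_real a)) (rochberg_space X0 X1 n (of_real b)) a b (of_real c))
      (rochberg_space X0 X1 n (of_real c))" (is "isomorphically_included ?R ?I \<and> _") if c: "a < c" "c < b" for c
  proof -
    note r = reiteration[OF assms(3) c assms(5) n]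
    obtain K where K: "K > 0" "\<And>x. x \<in> pts ?R \<Longrightarrow> nrm ?R x \<le> K * nrm ?I x" using r(3) by blast
    have "1 / K * nrm ?R x \<le> nrm ?I x \<and> nrm ?I x \<le> 1 * nrm ?R x" if "x \<in> pts ?R" for x
      using K(2)[OF that] K(1) r(2)[OF that] by (simp add: field_simps)
    moreover have "1 * nrm ?I x \<le> nrm ?R x \<and> nrm ?R x \<le> K * nrm ?I x" if "x \<in> pts ?I" for x
      using that K(2)[of x] r(2)[of x] unfolding r(1) by simp
    moreover have "1 / K > 0" "(1::real) > 0" using K(1) by simp_all
    ultimately show ?thesis
      unfolding isomorphically_included_def equal_with_equivalent_norms_def using r(1) K(1) equalityD2[OF r(1)] by blast
  qed
  thus ?thesis
    using rochberg_compatible[OF n as] dense_inter_power[OF assms(3-5) n] by blast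
qed

end
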